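(* Let $\mathbb G_2$ be the rooted binary tree with $n$-th generation $S_n$, $\#S_n=2^n$, and let $V_n=V_n(\omega)$ ($n\ge0$) be independent random Hermitian $2^n\times2^n$ matrices on a probability space $(\Omega,\mathcal A,\mathbb P)$ with $$\sum_{n=1}^\infty\left(\|\mathbb E(V_n)\|+\mathbb E(\|V_n\|^2+\|V_n\|^4)\right)<\infty .$$ Let $H^{(2)}_\omega=\Delta^{(2)}+\bigoplus_nV_n(\omega)$ on $\ell^2(\mathbb G_2)$ (see context). Then almost surely $H^{(2)}_\omega$ has purely absolutely continuous spectrum in $(-2\sqrt2,2\sqrt2)$, that is, almost surely $$(-2\sqrt2,2\sqrt2)\subset\operatorname{spec}_{ac}(H^{(2)}_\omega),$$ $$\operatorname{spec}_{pp}(H^{(2)}_\omega)\cap(-2\sqrt2,2\sqrt2)=\emptyset,\qquad\operatorname{spec}_{sc}(H^{(2)}_\omega)\cap(-2\sqrt2,2\sqrt2)=\emptyset .$$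
   Context: The rooted binary tree: $\mathbb G_2=\{(n,j):n\in\mathbb N_0,\ j\in\{1,\ldots,2^n\}\}$, $S_n=\{n\}\times\{1,\ldots,2^n\}$, where $(n,j)$ is joined to its two children $(n+1,2j-1)$ and $(n+1,2j)$. For $\psi\in\ell^2(\mathbb G_2)$ write $\psi_n=(\psi_{n,1},\ldots,\psi_{n,2^n})^\top\in\ell^2(S_n)=\mathbb C^{2^n}$. $\Delta^{(2)}$ is the negative adjacency operator, $$(\Delta^{(2)}\psi)_{n,j}=-\psi_{n-1,\lceil j/2\rceil}-\psi_{n+1,2j-1}-\psi_{n+1,2j}$$ (with the first term $0$ for $n=0$), and $(H^{(2)}_\omega\psi)_n=(\Delta^{(2)}\psi)_n+V_n(\omega)\psi_n$. $\|\cdot\|$ is the operator norm of matrices and $\mathbb E$ the expectation. $\operatorname{spec}_{ac},\operatorname{spec}_{pp},\operatorname{spec}_{sc}$ denote the absolutely continuous, pure point and singular continuous spectrum, as closed sets. *)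

theory Defs
  imports "HOL-Probability.Probability"
begin

section \<open>The Hilbert space of square-summable functions on a set\<close>

text \<open>Elements are functions on the whole type that vanish off the index set \<open>S\<close>, so that
  equality of functions is equality of vectors.\<close>

definition ell2 :: "'a set \<Rightarrow> ('a \<Rightarrow> complex) set" where
  "ell2 S = {\<psi>. (\<forall>x. x \<notin> S \<longrightarrow> \<psi> x = 0) \<and> (\<lambda>x. (cmod (\<psi> x))\<^sup>2) summable_on S}"

definition ell2_inner :: "'a set \<Rightarrow> ('a \<Rightarrow> complex) \<Rightarrow> ('a \<Rightarrow> complex) \<Rightarrow> complex" where
  "ell2_inner S \<phi> \<psi> = (\<Sum>\<^sub>\<infinity>x\<in>S. cnj (\<phi> x) * \<psi> x)"

definition ell2_norm :: "'a set \<Rightarrow> ('a \<Rightarrow> complex) \<Rightarrow> real" where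
  "ell2_norm S \<psi> = sqrt (\<Sum>\<^sub>\<infinity>x\<in>S. (cmod (\<psi> x))\<^sup>2)"


section \<open>Spectral theory of self-adjoint operators\<close>

text \<open>A possibly unbounded operator is a pair of its domain and its action; the action is
  irrelevant off the domain.\<close>

type_synonym 'a operator = "('a \<Rightarrow> complex) set \<times> (('a \<Rightarrow> complex) \<Rightarrow> 'a \<Rightarrow> complex)"

definition orthogonal_projection ::
    "'a set \<Rightarrow> (('a \<Rightarrow> complex) \<Rightarrow> 'a \<Rightarrow> complex) \<Rightarrow> bool" where
  "orthogonal_projection S Q \<longleftrightarrow>
     (\<forall>\<psi>\<in>ell2 S. Q \<psi> \<in> ell2 S \<and> Q (Q \<psi>) = Q \<psi>) \<and>
     (\<forall>\<phi>\<in>ell2 S. \<forall>\<psi>\<in>ell2 S. \<forall>a b.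
        Q (\<lambda>x. a * \<phi> x + b * \<psi> x) = (\<lambda>x. a * Q \<phi> x + b * Q \<psi> x)) \<and>
     (\<forall>\<phi>\<in>ell2 S. \<forall>\<psi>\<in>ell2 S. ell2_inner S \<phi> (Q \<psi>) = ell2_inner S (Q \<phi>) \<psi>)"

definition projection_valued_measure ::
    "'a set \<Rightarrow> (real set \<Rightarrow> ('a \<Rightarrow> complex) \<Rightarrow> 'a \<Rightarrow> complex) \<Rightarrow> bool" where
  "projection_valued_measure S P \<longleftrightarrow>
     (\<forall>B\<in>sets borel. orthogonal_projection S (P B)) \<and>
     (\<forall>\<psi>\<in>ell2 S. P UNIV \<psi> = \<psi>) \<and>
     (\<forall>B :: nat \<Rightarrow> real set. range B \<subseteq> sets borel \<longrightarrow> disjoint_family B \<longrightarrow>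
        (\<forall>\<psi>\<in>ell2 S.
          (\<lambda>n. ell2_norm S (\<lambda>x. P (\<Union>i. B i) \<psi> x - (\<Sum>i<n. P (B i) \<psi> x))) \<longlonglongrightarrow> 0))"

definition scalar_measure ::
    "'a set \<Rightarrow> (real set \<Rightarrow> ('a \<Rightarrow> complex) \<Rightarrow> 'a \<Rightarrow> complex) \<Rightarrow> ('a \<Rightarrow> complex) \<Rightarrow> real measure" where
  "scalar_measure S P \<psi> =
     measure_of UNIV (sets borel) (\<lambda>B. ennreal (Re (ell2_inner S \<psi> (P B \<psi>))))"

text \<open>\<open>A = \<integral> t dP(t)\<close>: the domain of \<open>A\<close> consists of the \<open>\<psi>\<close> with
  \<open>\<integral> t\<^sup>2 d\<langle>\<psi>, P(t) \<psi>\<rangle> < \<infinity>\<close>, and there \<open>\<langle>\<psi>, A \<psi>\<rangle> = \<integral> t d\<langle>\<psi>, P(t) \<psi>\<rangle>\<close>; by polarization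
  this determines \<open>A\<close>.\<close>

definition spectral_resolution_of ::
    "'a set \<Rightarrow> 'a operator \<Rightarrow> (real set \<Rightarrow> ('a \<Rightarrow> complex) \<Rightarrow> 'a \<Rightarrow> complex) \<Rightarrow> bool" where
  "spectral_resolution_of S A P \<longleftrightarrow>
     projection_valued_measure S P \<and>
     fst A = {\<psi>\<in>ell2 S. (\<integral>\<^sup>+t. ennreal (t\<^sup>2) \<partial>scalar_measure S P \<psi>) < \<infinity>} \<and>
     (\<forall>\<psi>\<in>fst A. snd A \<psi> \<in> ell2 S \<and>
        ell2_inner S \<psi> (snd A \<psi>) = complex_of_real (\<integral>t. t \<partial>scalar_measure S P \<psi>))"

text \<open>By the spectral theorem, a self-adjoint operator has exactly one resolution, up to the
  irrelevant values on non-Borel sets and on functions outside \<^term>\<open>ell2 S\<close>; hence the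
  choice operator below is harmless, whereas a definite description would be ill-defined.\<close>

definition spectral_measure :: "'a set \<Rightarrow> 'a operator \<Rightarrow> ('a \<Rightarrow> complex) \<Rightarrow> real measure" where
  "spectral_measure S A = scalar_measure S (SOME P. spectral_resolution_of S A P)"

definition ac_subspace :: "'a set \<Rightarrow> 'a operator \<Rightarrow> ('a \<Rightarrow> complex) set" where
  "ac_subspace S A = {\<psi>\<in>ell2 S. absolutely_continuous lborel (spectral_measure S A \<psi>)}"

definition pp_subspace :: "'a set \<Rightarrow> 'a operator \<Rightarrow> ('a \<Rightarrow> complex) set" where
  "pp_subspace S A =
     {\<psi>\<in>ell2 S. \<exists>C. countable C \<and> emeasure (spectral_measure S A \<psi>) (UNIV - C) = 0}"

definition sc_subspace :: "'a set \<Rightarrow> 'a operator \<Rightarrow> ('a \<Rightarrow> complex) set" where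
  "sc_subspace S A =
     {\<psi>\<in>ell2 S. (\<exists>N\<in>null_sets lborel. emeasure (spectral_measure S A \<psi>) (UNIV - N) = 0) \<and>
                 (\<forall>t. emeasure (spectral_measure S A \<psi>) {t} = 0)}"

text \<open>The spectrum of the part of \<open>A\<close> in a reducing closed subspace \<open>M\<close>, regarded as an
  operator in the Hilbert space \<open>M\<close> with domain \<open>D(A) \<inter> M\<close>.\<close>

definition spectrum_in :: "'a set \<Rightarrow> ('a \<Rightarrow> complex) set \<Rightarrow> 'a operator \<Rightarrow> complex set" where
  "spectrum_in S M A =
     {z. \<not> (bij_betw (\<lambda>\<psi> x. snd A \<psi> x - z * \<psi> x) (fst A \<inter> M) M \<and>
            (\<exists>c. \<forall>\<psi>\<in>fst A \<inter> M. ell2_norm S \<psi> \<le> c * ell2_norm S (\<lambda>x. snd A \<psi> x - z * \<psi> x)))}"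

definition spec_ac :: "'a set \<Rightarrow> 'a operator \<Rightarrow> complex set" where
  "spec_ac S A = spectrum_in S (ac_subspace S A) A"

definition spec_pp :: "'a set \<Rightarrow> 'a operator \<Rightarrow> complex set" where
  "spec_pp S A = spectrum_in S (pp_subspace S A) A"

definition spec_sc :: "'a set \<Rightarrow> 'a operator \<Rightarrow> complex set" where
  "spec_sc S A = spectrum_in S (sc_subspace S A) A"


section \<open>Matrices of varying size\<close>

text \<open>An \<open>N \<times> N\<close> matrix is a function of two indices, of which only the values on
  \<open>{1..N} \<times> {1..N}\<close> matter.\<close>

definition hermitian_mat :: "nat \<Rightarrow> (nat \<Rightarrow> nat \<Rightarrow> complex) \<Rightarrow> bool" where
  "hermitian_mat N A \<longleftrightarrow> (\<forall>i\<in>{1..N}. \<forall>j\<in>{1..N}. A i j = cnj (A j i))"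

definition mat_op_norm :: "nat \<Rightarrow> (nat \<Rightarrow> nat \<Rightarrow> complex) \<Rightarrow> real" where
  "mat_op_norm N A =
     Sup {L2_set (\<lambda>i. cmod (\<Sum>j\<in>{1..N}. A i j * u j)) {1..N} | u.
            L2_set (\<lambda>j. cmod (u j)) {1..N} \<le> 1}"


section \<open>The rooted binary tree and its Schroedinger operators\<close>

definition G2 :: "(nat \<times> nat) set" where
  "G2 = {(n, j). j \<in> {1..2 ^ n}}"

text \<open>The parent of \<open>(n, j)\<close> is \<open>(n - 1, \<lceil>j/2\<rceil>)\<close>, and \<open>\<lceil>j/2\<rceil> = (j + 1) div 2\<close>.\<close>

definition Delta2 :: "(nat \<times> nat \<Rightarrow> complex) \<Rightarrow> nat \<times> nat \<Rightarrow> complex" where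
  "Delta2 \<psi> = (\<lambda>(n, j). if (n, j) \<in> G2
     then - (if n = 0 then 0 else \<psi> (n - 1, (j + 1) div 2))
          - \<psi> (n + 1, 2 * j - 1) - \<psi> (n + 1, 2 * j)
     else 0)"

definition potential ::
    "(nat \<Rightarrow> nat \<Rightarrow> nat \<Rightarrow> complex) \<Rightarrow> (nat \<times> nat \<Rightarrow> complex) \<Rightarrow> nat \<times> nat \<Rightarrow> complex" where
  "potential W \<psi> = (\<lambda>(n, j). if (n, j) \<in> G2 then \<Sum>k\<in>{1..2 ^ n}. W n j k * \<psi> (n, k) else 0)"

text \<open>Since \<^const>\<open>Delta2\<close> is bounded, the natural domain is that of the direct sum of the
  matrices \<open>W n\<close>.  With Hermitian \<open>W n\<close> the operator is self-adjoint there; if the \<open>W n\<close> are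
  uniformly bounded, the domain is all of \<^term>\<open>ell2 G2\<close>.\<close>

definition H2 :: "(nat \<Rightarrow> nat \<Rightarrow> nat \<Rightarrow> complex) \<Rightarrow> (nat \<times> nat) operator" where
  "H2 W = ({\<psi>\<in>ell2 G2. potential W \<psi> \<in> ell2 G2}, \<lambda>\<psi> v. Delta2 \<psi> v + potential W \<psi> v)"

end

theory Submission
  imports Defs "HOL-Computational_Algebra.Polynomial"
begin

text \<open>Almost surely the potential is bounded, so the operator \<open>H\<close> is bounded and self-adjoint.
  For a vertex \<open>x\<close> of layer \<open>m\<close> and \<open>\<phi> = (H - c - \<i>/k)\<^bsup>-1\<^esup> \<delta>\<^sub>x\<close>, the number \<open>\<parallel>\<phi>\<parallel>\<^sup>2 / k\<close> is the Poisson
  integral of the spectral measure of \<open>\<delta>\<^sub>x\<close> at \<open>c + \<i>/k\<close>.  Let \<open>g\<close> be a solution of \<open>H g = c g\<close> above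
  layer \<open>m\<close> that takes equal values on siblings; it is produced by a forward recursion in which
  layer \<open>n\<close> of the potential is independent of the previous values.  Green's identity for
  \<open>\<phi>\<close> and \<open>g\<close>, averaged over the \<open>k\<close> layers after \<open>m\<close>, bounds the Poisson integral from above,
  and at the root also from below, by \<open>1/k\<close> times the energy of such \<open>g\<close> in these layers (respectively its inverse).
  For \<open>\<bar>c\<bar> < 2 * sqrt 2\<close> the free recursion conserves a positive definite quadratic form;
  in the expectation of its square the term linear in the potential only contributes through
  \<open>E V\<close>, so the fourth moments of \<open>g\<close> stay bounded, locally uniformly in \<open>c\<close>.
  By Fatou's lemma the Poisson integrals are then almost surely bounded in \<open>L\<^sup>2\<close> along a
  subsequence, which gives absolute continuity, and they do not vanish on any interval.\<close>

section \<open>Symmetric operators and polynomial calculus\<close>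

text \<open>The obstacle is twofold: the layers grow, so a transfer matrix between whole layers is
  not square, and the part of the evolution that is linear in V is summable only in mean. Functions
  that are equal on siblings answer both. The sum over two children is then twice one value, so the
  equation can be solved outwards from a single vertex, and each layer of the potential meets only
  values computed before it. The width 2 * sqrt 2 arises because lifting a layer to its children
  multiplies norms by sqrt 2. The imaginary part 1/k is matched to k layers: over that distance the
  flux of phi and g drifts by at most their overlap divided by k, so averaging costs only a
  constant. Fourth moments of g occur because g enters the Poisson bound quadratically and this
  bound is then squared; bounds in L1 in place of L2 would not exclude a singular limit. Since the
  spectral measure is selected by a choice operator, all spectral facts are derived for an arbitrary
  resolution, starting from its first moment identity. Existence comes from Bernstein weights of an
  operator and the Hausdorff moment problem.\<close>

definition symmetric_op :: "('h::real_inner \<Rightarrow> 'h) \<Rightarrow> bool" where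
  "symmetric_op T \<longleftrightarrow> bounded_linear T \<and> (\<forall>x y. inner x (T y) = inner (T x) y)"

lemma symmetric_opD:
  assumes "symmetric_op T"
  shows "bounded_linear T" "linear T" "inner x (T y) = inner (T x) y"
  using assms by (auto simp: symmetric_op_def bounded_linear.linear)

lemma symmetric_op_scale_add:
  assumes "symmetric_op S" "symmetric_op T"
  shows "symmetric_op (\<lambda>x. a *\<^sub>R S x + b *\<^sub>R T x)"
proof -
  have "bounded_linear (\<lambda>x. a *\<^sub>R S x + b *\<^sub>R T x)"
    using symmetric_opD(1)[OF assms(1)] symmetric_opD(1)[OF assms(2)]
    by (intro bounded_linear_add bounded_linear_const_scaleR)
  then show ?thesis
    using symmetric_opD(3)[OF assms(1)] symmetric_opD(3)[OF assms(2)]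
    by (auto simp: symmetric_op_def inner_add_left inner_add_right)
qed

lemma symmetric_op_id: "symmetric_op (\<lambda>x. x)"
  by (simp add: symmetric_op_def bounded_linear_ident)

text \<open>Positivity of the form, tested at x - S x / q and expanded, bounds the square of
  \<open>norm (S x)\<close>. In this way a bound on a positive form becomes a bound on the
  operator.\<close>

lemma symmetric_op_norm_le:
  assumes S: "symmetric_op S" and pos: "\<And>x. 0 \<le> inner x (S x)"
    and le: "\<And>x. inner x (S x) \<le> q * (norm x)\<^sup>2" and q: "q > 0"
  shows "norm (S x) \<le> q * norm x"
proof -
  interpret S: bounded_linear S using symmetric_opD(1)[OF S] .
  have "0 \<le> inner (x - (1/q) *\<^sub>R S x) (S (x - (1/q) *\<^sub>R S x))" by (rule pos)
  also have "\<dots> = inner x (S x) - 2/q * (norm (S x))\<^sup>2 + (1/q)\<^sup>2 * inner (S x) (S (S x))"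
    using symmetric_opD(3)[OF S, of x "S x"] q
    by (simp add: S.diff S.scaleR inner_diff_left inner_diff_right power2_norm_eq_inner)
       (simp add: power2_eq_square field_simps)
  also have "(1/q)\<^sup>2 * inner (S x) (S (S x)) \<le> (1/q)\<^sup>2 * (q * (norm (S x))\<^sup>2)"
    using le by (intro mult_left_mono) auto
  also have "inner x (S x) \<le> q * (norm x)\<^sup>2" by (rule le)
  also have "q * (norm x)\<^sup>2 - 2/q * (norm (S x))\<^sup>2 + (1/q)\<^sup>2 * (q * (norm (S x))\<^sup>2)
      = q * (norm x)\<^sup>2 - (norm (S x))\<^sup>2 / q"
    using q by (simp add: power2_eq_square)
  finally have "(norm (S x))\<^sup>2 \<le> q * (norm x)\<^sup>2 * q"
    using q by (simp add: pos_divide_le_eq)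
  then have "(norm (S x))\<^sup>2 \<le> (q * norm x)\<^sup>2"
    by (simp add: power2_eq_square mult_ac)
  then show ?thesis
    by (rule power2_le_imp_le) (rule mult_nonneg_nonneg[OF less_imp_le[OF q] norm_ge_zero])
qed

text \<open>Richardson iteration: 1 - C/K is a contraction with factor
  \<open>1 - \<delta>/K\<close>, and a fixed point of x -> y/K + (1 - C/K) x solves
  \<open>C x = y\<close>. All inverses of operators below are obtained from it.\<close>

lemma symmetric_op_surj:
  fixes C :: "'h::{real_inner,complete_space} \<Rightarrow> 'h"
  assumes C: "symmetric_op C" and \<delta>: "\<delta> > 0" and pos: "\<And>x. \<delta> * (norm x)\<^sup>2 \<le> inner x (C x)"
  shows "\<exists>x. C x = y"
proof -
  interpret C: bounded_linear C using symmetric_opD(1)[OF C] .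
  obtain K0 where K0: "\<And>x. norm (C x) \<le> norm x * K0" using C.bounded by blast
  \<comment> \<open>\<open>K\<close> dominates the norm of \<open>C\<close>, which makes
    \<open>S\<close> positive, and also \<open>2 * \<delta>\<close>, which keeps the contraction
    factor positive.\<close>
  define K where "K = max K0 (2*\<delta>)"
  have K: "K \<ge> K0" "K \<ge> 2*\<delta>" "K > 0" using \<delta> by (auto simp: K_def)
  have nC: "norm (C x) \<le> K * norm x" for x
    using K0[of x] mult_right_mono[OF K(1) norm_ge_zero[of x]] by (simp add: mult.commute)
  define S where "S = (\<lambda>x. 1 *\<^sub>R x + (- 1/K) *\<^sub>R C x)"
  have S: "symmetric_op S"
    unfolding S_def by (rule symmetric_op_scale_add[OF symmetric_op_id C])
  interpret S: bounded_linear S using symmetric_opD(1)[OF S] .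
  have inS: "inner x (S x) = (norm x)\<^sup>2 - inner x (C x) / K" for x
    by (simp add: S_def inner_add_right inner_diff_right power2_norm_eq_inner)
  have CK: "inner x (C x) \<le> K * (norm x)\<^sup>2" for x
  proof -
    have "inner x (C x) \<le> norm x * norm (C x)" by (rule norm_cauchy_schwarz)
    also have "\<dots> \<le> norm x * (K * norm x)" by (intro mult_left_mono nC) auto
    finally show ?thesis by (simp add: power2_eq_square ac_simps)
  qed
  have q: "1 - \<delta>/K > 0" "1 - \<delta>/K < 1" using K \<delta> by (auto simp: field_simps)
  have "norm (S x) \<le> (1 - \<delta>/K) * norm x" for x
  proof (rule symmetric_op_norm_le[OF S _ _ q(1)])
    fix x show "0 \<le> inner x (S x)" using CK[of x] K(3) by (simp add: inS field_simps)
    show "inner x (S x) \<le> (1 - \<delta>/K) * (norm x)\<^sup>2"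
      using pos[of x] K(3) by (simp add: inS field_simps)
  qed
  then have "dist ((1/K) *\<^sub>R y + S a) ((1/K) *\<^sub>R y + S b) \<le> (1 - \<delta>/K) * dist a b" for a b
    by (simp add: dist_norm flip: S.diff)
  then have "\<exists>!x. (1/K) *\<^sub>R y + S x = x"
    using q by (intro banach_fix_type[of "1 - \<delta>/K"]) auto
  then obtain x where "(1/K) *\<^sub>R y + S x = x" by blast
  then have "(1/K) *\<^sub>R y = (1/K) *\<^sub>R C x" by (simp add: S_def algebra_simps)
  then have "C x = y" using K by simp
  then show ?thesis ..
qed

text \<open>Expanding the form at x + D x leaves twice the squared norm of \<open>D x\<close>.
  Identities between symmetric operators are thereby reduced to identities between quadratic
  forms.\<close>

lemma symmetric_zero_form:
  assumes "linear D" "\<And>x y. inner x (D y) = inner (D x) y" "\<And>x. inner x (D x) = 0"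
  shows "D x = 0"
proof -
  interpret D: linear D by fact
  have "inner (x + D x) (D (x + D x)) = 0" by (rule assms(3))
  then have "inner x (D (D x)) + inner (D x) (D x) = 0"
    using assms(3)[of x] assms(3)[of "D x"] by (simp add: D.add inner_add_left inner_add_right)
  then show ?thesis using assms(2)[of x "D x"] by simp
qed

definition poly_op :: "('h::real_vector \<Rightarrow> 'h) \<Rightarrow> real poly \<Rightarrow> 'h \<Rightarrow> 'h" where
  "poly_op T p x = (\<Sum>i\<le>degree p. coeff p i *\<^sub>R (T ^^ i) x)"

lemma poly_op_eq:
  assumes "degree p \<le> n"
  shows "poly_op T p x = (\<Sum>i\<le>n. coeff p i *\<^sub>R (T ^^ i) x)"
  unfolding poly_op_def
  using assms by (intro sum.mono_neutral_left) (auto simp: coeff_eq_0)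

lemma poly_op_0 [simp]: "poly_op T 0 x = 0"
  by (simp add: poly_op_def)

lemma poly_op_add: "poly_op T (p + q) x = poly_op T p x + poly_op T q x"
proof -
  let ?n = "max (degree p) (degree q)"
  have "degree (p + q) \<le> ?n" by (rule degree_add_le_max)
  then show ?thesis
    by (simp add: poly_op_eq[of "p+q" ?n] poly_op_eq[of p ?n] poly_op_eq[of q ?n]
        scaleR_add_left sum.distrib)
qed

lemma poly_op_smult: "poly_op T (smult a p) x = a *\<^sub>R poly_op T p x"
  using poly_op_eq[of "smult a p" "degree p" T x] degree_smult_le[of a p]
  by (simp add: poly_op_def scaleR_sum_right)

lemma poly_op_minus: "poly_op T (- p) x = - poly_op T p x"
  using poly_op_smult[of T "-1" p x] by simp

lemma poly_op_diff: "poly_op T (p - q) x = poly_op T p x - poly_op T q x"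
  using poly_op_add[of T p "-q" x] by (simp add: poly_op_minus)

lemma poly_op_sum: "poly_op T (\<Sum>i\<in>I. p i) x = (\<Sum>i\<in>I. poly_op T (p i) x)"
  by (induction I rule: infinite_finite_induct) (simp_all add: poly_op_add)

lemma linear_funpow:
  fixes T :: "'h::real_vector \<Rightarrow> 'h"
  shows "linear T \<Longrightarrow> linear (T ^^ i)"
proof (induction i)
  case 0
  show ?case by (rule linearI) auto
next
  case (Suc i)
  then show ?case using linear_compose[of "T ^^ i" T] by (simp add: o_def)
qed

lemma poly_op_linear: "linear T \<Longrightarrow> linear (poly_op T p)"
  unfolding poly_op_def
  by (intro linear_compose_sum linear_compose_scale_right ballI linear_funpow) auto

lemma poly_op_pCons:
  assumes "linear T"
  shows "poly_op T (pCons a p) x = a *\<^sub>R x + T (poly_op T p x)"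
proof -
  have "degree (pCons a p) \<le> Suc (degree p)" by (rule degree_pCons_le)
  then have "poly_op T (pCons a p) x
     = (\<Sum>i\<le>Suc (degree p). coeff (pCons a p) i *\<^sub>R (T ^^ i) x)" by (rule poly_op_eq)
  also have "\<dots> = a *\<^sub>R x + (\<Sum>i\<le>degree p. coeff p i *\<^sub>R T ((T ^^ i) x))"
    by (subst sum.atMost_Suc_shift) simp
  also have "(\<Sum>i\<le>degree p. coeff p i *\<^sub>R T ((T ^^ i) x)) = T (poly_op T p x)"
    by (simp add: poly_op_def linear_sum[OF assms] linear_scale[OF assms])
  finally show ?thesis .
qed

lemma poly_op_1 [simp]: "poly_op T 1 x = x"
  by (simp add: poly_op_def)

lemma poly_op_commute:
  assumes "linear T" "linear J" "\<And>x. J (T x) = T (J x)"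
  shows "J (poly_op T p x) = poly_op T p (J x)"
proof (induction p arbitrary: x)
  case 0 then show ?case using linear_0[OF assms(2)] by simp
next
  case (pCons a p)
  then show ?case
    by (simp add: poly_op_pCons assms linear_add[OF assms(2)] linear_scale[OF assms(2)])
qed

lemma poly_op_mult:
  assumes "linear T"
  shows "poly_op T (p * q) x = poly_op T p (poly_op T q x)"
proof (induction p)
  case (pCons a p)
  then show ?case
    by (simp add: poly_op_add poly_op_smult poly_op_pCons assms)
qed simp

lemma poly_op_symmetric:
  assumes "linear T" and T: "\<And>x y. inner x (T y) = inner (T x) y"
  shows "inner x (poly_op T p y) = inner (poly_op T p x) y"
proof (induction p arbitrary: x y)
  case (pCons a p)
  show ?case
    by (simp add: poly_op_pCons assms inner_add_left inner_add_right pCons.IH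
        poly_op_commute[of T T])
qed simp

lemma poly_op_square:
  assumes "linear T" and T: "\<And>x y. inner x (T y) = inner (T x) y"
  shows "inner x (poly_op T (p * p) x) = (norm (poly_op T p x))\<^sup>2"
  by (simp add: poly_op_mult assms poly_op_symmetric power2_norm_eq_inner)

lemma poly_op_X [simp]: "linear T \<Longrightarrow> poly_op T [:0, 1:] x = T x"
  by (simp add: poly_op_pCons linear_0)

subsection \<open>Bernstein weights\<close>

text \<open>A formal polynomial, so that it can be evaluated at an operator as well as at a
  number.\<close>

definition bernstein_poly :: "nat \<Rightarrow> nat \<Rightarrow> real poly" where
  "bernstein_poly n k = smult (of_nat (n choose k)) ([:0, 1:] ^ k * [:1, -1:] ^ (n - k))"

lemma poly_bernstein_poly: "poly (bernstein_poly n k) x = Bernstein n k x"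
  by (simp add: bernstein_poly_def Bernstein_def)

text \<open>The factorial moments of the binomial distribution, as an identity of formal
  polynomials: one binomial coefficient is absorbed into the other, and the binomial theorem is
  applied to x + (1 - x) = 1.\<close>

lemma bernstein_poly_falling:
  assumes "j \<le> n"
  shows "(\<Sum>k\<le>n. smult (of_nat (k choose j)) (bernstein_poly n k)) = smult (of_nat (n choose j)) ([:0, 1:] ^ j)"
proof -
  let ?x = "[:0, 1::real:]" and ?y = "[:1, -1::real:]"
  have sm: "smult c p = [:c:] * p" for c :: real and p by simp
  have "(\<Sum>k\<le>n. smult (of_nat (k choose j)) (bernstein_poly n k))
      = (\<Sum>k\<in>{j..n}. smult (of_nat (k choose j)) (bernstein_poly n k))"
    by (rule sum.mono_neutral_right) (auto simp: binomial_eq_0)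
  also have "\<dots> = (\<Sum>k\<in>{j..n}. smult (of_nat (n choose j)) (smult (of_nat ((n - j) choose (k - j))) (?x ^ k * ?y ^ (n - k))))"
  proof (rule sum.cong[OF refl])
    fix k assume "k \<in> {j..n}"
    then have "(n choose k) * (k choose j) = (n choose j) * ((n - j) choose (k - j))"
      by (intro choose_mult) auto
    then have "real (k choose j) * real (n choose k) = real (n choose j) * real ((n - j) choose (k - j))"
      by (metis mult.commute of_nat_mult)
    then show "smult (of_nat (k choose j)) (bernstein_poly n k) = smult (of_nat (n choose j)) (smult (of_nat ((n - j) choose (k - j))) (?x ^ k * ?y ^ (n - k)))"
      by (simp add: bernstein_poly_def)
  qed
  also have "\<dots> = (\<Sum>i\<le>n - j. smult (of_nat (n choose j)) (smult (of_nat ((n - j) choose i)) (?x ^ (i + j) * ?y ^ (n - j - i))))"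
    using assms by (intro sum.reindex_bij_witness[of _ "\<lambda>i. i + j" "\<lambda>k. k - j"]) auto
  also have "\<dots> = smult (of_nat (n choose j)) (?x ^ j * (\<Sum>i\<le>n - j. of_nat ((n - j) choose i) * ?x ^ i * ?y ^ (n - j - i)))"
    by (simp only: sm of_nat_poly sum_distrib_left power_add mult_ac)
  also have "(\<Sum>i\<le>n - j. of_nat ((n - j) choose i) * ?x ^ i * ?y ^ (n - j - i)) = (?x + ?y) ^ (n - j)"
    by (rule binomial_ring[symmetric])
  also have "?x + ?y = 1" by (simp add: one_pCons)
  finally show ?thesis by simp
qed

lemma poly_op_power_X:
  assumes "linear T" shows "poly_op T ([:0, 1:] ^ j) x = (T ^^ j) x"
proof (induction j)
  case (Suc j)
  then show ?case using assms by (simp only: power_Suc poly_op_mult poly_op_X funpow.simps o_apply)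
qed simp

text \<open>An operator between 0 and 1. A general bounded symmetric operator is brought to this
  form by an affine map, which places its moment problem on [0,1].\<close>

locale unit_op =
  fixes T :: "'h::{real_inner,complete_space} \<Rightarrow> 'h"
  assumes sym: "symmetric_op T"
    and pos: "\<And>x. 0 \<le> inner x (T x)" and le1: "\<And>x. inner x (T x) \<le> (norm x)\<^sup>2"
begin

lemma lin: "linear T" and sy: "inner x (T y) = inner (T x) y"
  using symmetric_opD[OF sym] by auto

text \<open>Even powers are squares and can be distributed over both sides of the inner product,
  which leaves exponents 0 or 1. The mixed case follows from x (1 - x) = x^2 (1 - x) + (1 - x)^2
  x.\<close>

lemma poly_op_nonneg:
  "0 \<le> inner x (poly_op T ([:0, 1:] ^ k * [:1, -1:] ^ m) x)"
proof -
  let ?x = "[:0, 1::real:]" and ?y = "[:1, -1::real:]"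
  have sq: "inner z (poly_op T (r * r * p) z) = inner (poly_op T r z) (poly_op T p (poly_op T r z))"
    for r p z
  proof -
    have "r * r * p = r * (p * r)" by (simp only: mult_ac)
    then show ?thesis by (simp only: poly_op_mult[OF lin] poly_op_symmetric[OF lin sy])
  qed
  have y: "poly_op T ?y z = z - T z" for z
    by (simp add: poly_op_pCons[OF lin] linear_0[OF lin] linear_diff[OF lin] linear_neg[OF lin])
  have g: "0 \<le> inner z (poly_op T (?x ^ a * ?y ^ b) z)" if "a \<le> 1" "b \<le> 1" for a b :: nat and z
  proof -
    have 1: "0 \<le> inner z (poly_op T ?y z)"
      using le1[of z] by (simp add: y inner_diff_right power2_norm_eq_inner)
    have xy: "?x * ?y = ?x * ?x * ?y + ?y * ?y * ?x" by simp
    have 2: "0 \<le> inner z (poly_op T (?x * ?y) z)"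
    proof -
      have "inner z (poly_op T (?x * ?y) z)
          = inner z (poly_op T (?x * ?x * ?y) z) + inner z (poly_op T (?y * ?y * ?x) z)"
        by (subst xy) (simp only: poly_op_add inner_add_right)
      also have "\<dots> \<ge> 0"
        unfolding sq poly_op_X[OF lin] y
        using pos[of "z - T z"] le1[of "T z"]
        by (simp add: inner_diff_right power2_norm_eq_inner)
      finally show ?thesis .
    qed
    from that have "a = 0 \<or> a = 1" "b = 0 \<or> b = 1" by auto
    then show ?thesis using 1 2 pos[of z] poly_op_X[OF lin, of z] by (auto simp del: mult_pCons_left mult_pCons_right)
  qed
  have "?x ^ k * ?y ^ m = (?x ^ (k div 2) * ?y ^ (m div 2)) * (?x ^ (k div 2) * ?y ^ (m div 2)) * (?x ^ (k mod 2) * ?y ^ (m mod 2))"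
  proof -
    have "?x ^ k = ?x ^ (k div 2) * ?x ^ (k div 2) * ?x ^ (k mod 2)"
      by (simp only: flip: power_add) (metis add.assoc mult_2 mult_div_mod_eq)
    moreover have "?y ^ m = ?y ^ (m div 2) * ?y ^ (m div 2) * ?y ^ (m mod 2)"
      by (simp only: flip: power_add) (metis add.assoc mult_2 mult_div_mod_eq)
    ultimately show ?thesis by (simp only: mult_ac)
  qed
  then show ?thesis
    by (simp only: sq) (intro g, auto)
qed

text \<open>What the integral of a Bernstein polynomial against the spectral measure of
  \<open>x\<close> has to be. For fixed \<open>n\<close> these numbers serve as masses at the points
  k/n.\<close>

definition weight :: "'h \<Rightarrow> nat \<Rightarrow> nat \<Rightarrow> real" where
  "weight x n k = inner x (poly_op T (bernstein_poly n k) x)"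

lemma weight_nonneg: "0 \<le> weight x n k"
  using poly_op_nonneg by (simp add: weight_def bernstein_poly_def poly_op_smult)

lemma weight_falling:
  assumes "j \<le> n"
  shows "(\<Sum>k\<le>n. real (k choose j) * weight x n k) = real (n choose j) * inner x ((T ^^ j) x)"
proof -
  have "(\<Sum>k\<le>n. real (k choose j) * weight x n k)
      = inner x (poly_op T (\<Sum>k\<le>n. smult (of_nat (k choose j)) (bernstein_poly n k)) x)"
    by (simp add: weight_def poly_op_sum poly_op_smult inner_sum_right)
  also have "\<dots> = real (n choose j) * inner x ((T ^^ j) x)"
    by (simp only: bernstein_poly_falling[OF assms] poly_op_smult poly_op_power_X[OF lin] inner_scaleR_right)
  finally show ?thesis .
qed

lemma weight_sum: "(\<Sum>k\<le>n. weight x n k) = (norm x)\<^sup>2"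
  using weight_falling[of 0 n x] by (simp add: power2_norm_eq_inner)

end

text \<open>Both terms are products of \<open>j\<close> factors, compared one by one. In the limit
  the exact factorial moments of the weights can therefore stand for power moments.\<close>

lemma choose_ratio_approx:
  assumes "2 * j < n" "k \<le> n"
  shows "\<bar>real (k choose j) / real (n choose j) - (real k / real n) ^ j\<bar> \<le> real j * (real j / (real n - real j))"
proof -
  have "real (k choose j) / real (n choose j) = (\<Prod>i<j. (real k - real i) / (real n - real i))"
    by (simp add: binomial_gbinomial gbinomial_prod_rev prod_dividef lessThan_atLeast0)
  moreover have "\<bar>(\<Prod>i<j. (real k - real i) / (real n - real i)) - (\<Prod>i<j. real k / real n)\<bar>
     \<le> (\<Sum>i<j. \<bar>(real k - real i) / (real n - real i) - real k / real n\<bar>)"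
  proof -
    have "norm ((\<Prod>i<j. (real k - real i) / (real n - real i)) - (\<Prod>i<j. real k / real n))
     \<le> (\<Sum>i<j. norm ((real k - real i) / (real n - real i) - real k / real n))"
      \<comment> \<open>\<open>k - i\<close> may be negative, but \<open>2 * j < n\<close> keeps
        every quotient in [-1,1], as the comparison of products requires.\<close>
      using assms by (intro norm_prod_diff) (auto simp: abs_le_iff divide_simps)
    then show ?thesis by simp
  qed
  moreover have "\<dots> \<le> (\<Sum>i<j. real j / (real n - real j))"
  proof (rule sum_mono)
    fix i assume "i \<in> {..<j}"
    then have i: "real i < real j" "real n - real i > 0" "real n > 0" "real n - real j > 0" using assms by auto
    have "(real k - real i) / (real n - real i) - real k / real n = - (real i / (real n - real i) * ((real n - real k) / real n))"
      using i by (simp add: field_simps)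
    moreover have "real i / (real n - real i) * ((real n - real k) / real n) \<le> real j / (real n - real j) * 1"
      using i assms by (intro mult_mono frac_le) auto
    moreover have "0 \<le> real i / (real n - real i) * ((real n - real k) / real n)"
      using i assms by auto
    ultimately show "\<bar>(real k - real i) / (real n - real i) - real k / real n\<bar> \<le> real j / (real n - real j)"
      by (simp only: abs_minus_cancel abs_of_nonneg mult_1_right)
  qed
  ultimately show ?thesis by simp
qed

text \<open>The factorial moments are exact for every \<open>n\<close>; replacing them by powers of
  k/n costs an error of order 1/n for fixed \<open>j\<close>.\<close>

lemma (in unit_op) weight_moments:
  "(\<lambda>n. \<Sum>k\<le>n. (real k / real n) ^ j * weight x n k) \<longlonglongrightarrow> inner x ((T ^^ j) x)"
proof -
  have "(\<lambda>n. (\<Sum>k\<le>n. (real k / real n) ^ j * weight x n k) - inner x ((T ^^ j) x)) \<longlonglongrightarrow> 0"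
  proof (rule Lim_null_comparison)
    show "(\<lambda>n. real j * (real j / (real n - real j)) * (norm x)\<^sup>2) \<longlonglongrightarrow> 0"
    proof -
      have "filterlim (\<lambda>n. real n - real j) at_top sequentially"
        using filterlim_tendsto_add_at_top[OF tendsto_const[of "- real j"] filterlim_real_sequentially]
        by simp
      then have "(\<lambda>n. real j * (real j / (real n - real j)) * (norm x)\<^sup>2) \<longlonglongrightarrow> real j * 0 * (norm x)\<^sup>2"
        by (intro tendsto_intros real_tendsto_divide_at_top[OF tendsto_const])
      then show ?thesis by simp
    qed
    show "\<forall>\<^sub>F n in sequentially. norm ((\<Sum>k\<le>n. (real k / real n) ^ j * weight x n k) - inner x ((T ^^ j) x))
        \<le> real j * (real j / (real n - real j)) * (norm x)\<^sup>2"
      using eventually_gt_at_top[of "2*j"]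
    proof eventually_elim
      case (elim n)
      have "inner x ((T ^^ j) x) = (\<Sum>k\<le>n. real (k choose j) / real (n choose j) * weight x n k)"
        using weight_falling[of j n x] elim by (simp add: sum_divide_distrib[symmetric] field_simps)
      then have "\<bar>(\<Sum>k\<le>n. (real k / real n) ^ j * weight x n k) - inner x ((T ^^ j) x)\<bar>
         = \<bar>\<Sum>k\<le>n. (real (k choose j) / real (n choose j) - (real k / real n) ^ j) * weight x n k\<bar>"
        by (simp add: sum_subtractf left_diff_distrib abs_minus_commute)
      also have "\<dots> \<le> (\<Sum>k\<le>n. \<bar>real (k choose j) / real (n choose j) - (real k / real n) ^ j\<bar> * weight x n k)"
        by (rule sum_abs[THEN order_trans]) (simp add: abs_mult weight_nonneg)
      also have "\<dots> \<le> (\<Sum>k\<le>n. real j * (real j / (real n - real j)) * weight x n k)"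
        using elim by (intro sum_mono mult_right_mono choose_ratio_approx weight_nonneg) auto
      also have "\<dots> = real j * (real j / (real n - real j)) * (norm x)\<^sup>2"
        by (simp only: weight_sum sum_distrib_left[symmetric])
      finally show ?case by simp
    qed
  qed
  then show ?thesis by (simp add: LIM_zero_iff)
qed

subsection \<open>Scalar spectral measures from the Hausdorff moment problem\<close>

context unit_op
begin

text \<open>Hausdorff moment problem by Helly selection: the discrete measures with mass
  \<open>weight x n k\<close> at k/n are tight, and the weak limit of a subsequence has the moments
  of \<open>T\<close>.\<close>

lemma moment_measure_unit:
  assumes x: "norm x = 1"
  shows "\<exists>M. real_distribution M \<and> (AE t in M. t \<in> {0..1}) \<and>
    (\<forall>j. integral\<^sup>L M (\<lambda>t. t ^ j) = inner x ((T ^^ j) x))"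
proof -
  define \<mu> :: "nat \<Rightarrow> real measure" where
    "\<mu> n = distr (point_measure {..n} (\<lambda>k. ennreal (weight x n k))) borel (\<lambda>k. real k / real n)" for n
  have sum1: "(\<Sum>k\<le>n. weight x n k) = 1" for n using x by (simp add: weight_sum)
  have int: "integral\<^sup>L (\<mu> n) f = (\<Sum>k\<le>n. weight x n k * f (real k / real n))"
    if "f \<in> borel_measurable borel" for f :: "real \<Rightarrow> real" and n
    using that by (simp add: \<mu>_def integral_distr lebesgue_integral_point_measure_finite weight_nonneg)
  have rd: "real_distribution (\<mu> n)" for n
  proof -
    have "emeasure (\<mu> n) (space (\<mu> n)) = 1"
      by (simp add: \<mu>_def emeasure_distr space_point_measure emeasure_point_measure_finite
          sum1 weight_nonneg sum_ennreal)
    then have "prob_space (\<mu> n)" by (rule prob_spaceI)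
    then show ?thesis by (simp add: real_distribution_def real_distribution_axioms_def \<mu>_def)
  qed
  have "tight \<mu>"
    unfolding tight_def
  proof (intro conjI allI impI rd)
    fix \<epsilon> :: real assume "\<epsilon> > 0"
    \<comment> \<open>Tightness is phrased with half-open intervals; the left end -1 makes sure that
      a possible atom at 0 is included.\<close>
    have "measure (\<mu> n) {-1<..1} = 1" for n
    proof -
      have "measure (\<mu> n) {-1<..1} = integral\<^sup>L (\<mu> n) (indicator {-1<..1})"
        by (simp add: \<mu>_def)
      also have "\<dots> = (\<Sum>k\<le>n. weight x n k)"
        by (subst int) (auto intro!: sum.cong simp: indicator_def divide_simps less_le_trans[of "-1" 0])
      finally show ?thesis by (simp add: sum1)
    qed
    then show "\<exists>a b. a < b \<and> (\<forall>n. 1 - \<epsilon> < measure (\<mu> n) {a<..b})"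
      using \<open>\<epsilon> > 0\<close> by (intro exI[of _ "-1::real"] exI[of _ "1::real"]) auto
  qed
  from tight_imp_convergent_subsubsequence[OF this strict_mono_id]
  obtain r M where r: "strict_mono (r::nat\<Rightarrow>nat)" and M: "real_distribution M"
    and wc: "weak_conv_m (\<mu> \<circ> id \<circ> r) M" by blast
  interpret M: real_distribution M by fact
  interpret rdi: real_distribution "(\<mu> \<circ> id \<circ> r) n" for n using rd by simp
  have conv: "(\<lambda>n. integral\<^sup>L (\<mu> (r n)) f) \<longlonglongrightarrow> integral\<^sup>L M f"
    if "\<And>t. isCont f t" "\<And>t. norm (f t) \<le> C" for f :: "real \<Rightarrow> real" and C
    using weak_conv_imp_integral_bdd_continuous_conv[OF rdi.real_distribution_axioms M wc, of f C]
      that by simp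
  \<comment> \<open>Clamping to [0,1] makes powers bounded and continuous on the whole line, as weak
    convergence needs, and changes nothing where the measures live.\<close>
  define c :: "real \<Rightarrow> real" where "c t = max 0 (min 1 t)" for t
  have c01: "c t \<in> {0..1}" for t by (auto simp: c_def)
  have cid: "c (real k / real n) = real k / real n" if "k \<le> n" for k n
    using that by (auto simp: c_def min_def divide_simps)
  have cc: "isCont c t" for t
    unfolding c_def by (intro continuous_intros)
  have AE: "AE t in M. t \<in> {0..1}"
  proof -
    \<comment> \<open>A bounded continuous function whose zero set is [0,1]. Its integral is 0 for
      every \<open>\<mu> n\<close>, hence also for the limit.\<close>
    define g where "g t = min 1 \<bar>t - c t\<bar>" for t
    have gc: "isCont g t" for t unfolding g_def by (intro continuous_intros cc)
    have g1: "norm (g t) \<le> 1" for t by (auto simp: g_def)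
    have gm: "g \<in> borel_measurable borel"
      using gc by (intro borel_measurable_continuous_onI continuous_at_imp_continuous_on) auto
    have "integral\<^sup>L (\<mu> (r n)) g = 0" for n
      by (subst int[OF gm]) (auto intro!: sum.neutral simp: g_def cid)
    with conv[OF gc g1] have "integral\<^sup>L M g = 0"
      by (simp add: LIMSEQ_const_iff)
    moreover have "integrable M g"
      using g1 gm by (intro M.integrable_const_bound[where B=1]) auto
    ultimately have "AE t in M. g t = 0"
      by (subst (asm) integral_nonneg_eq_0_iff_AE) (auto simp: g_def)
    then show ?thesis
    proof eventually_elim
      case (elim t)
      then have "t = c t" by (auto simp: g_def min_def split: if_splits)
      then show ?case using c01 by metis
    qed
  qed
  have "integral\<^sup>L M (\<lambda>t. t ^ j) = inner x ((T ^^ j) x)" for j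
  proof -
    have f1: "norm ((c t) ^ j) \<le> 1" for t
      using c01[of t] by (auto simp: power_le_one)
    have fc: "isCont (\<lambda>t. c t ^ j) t" for t by (intro continuous_intros cc)
    have fm: "(\<lambda>t. c t ^ j) \<in> borel_measurable borel"
      using fc by (intro borel_measurable_continuous_onI continuous_at_imp_continuous_on) auto
    have "(\<lambda>n. integral\<^sup>L (\<mu> (r n)) (\<lambda>t. c t ^ j)) \<longlonglongrightarrow> integral\<^sup>L M (\<lambda>t. c t ^ j)"
      by (rule conv[OF fc f1])
    moreover have "integral\<^sup>L (\<mu> n) (\<lambda>t. c t ^ j) = (\<Sum>k\<le>n. (real k / real n) ^ j * weight x n k)" for n
      by (subst int[OF fm]) (auto intro!: sum.cong simp: cid)
    ultimately have "(\<lambda>n. (\<Sum>k\<le>r n. (real k / real (r n)) ^ j * weight x (r n) k)) \<longlonglongrightarrow> integral\<^sup>L M (\<lambda>t. c t ^ j)"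
      by simp
    moreover have "(\<lambda>n. (\<Sum>k\<le>r n. (real k / real (r n)) ^ j * weight x (r n) k)) \<longlonglongrightarrow> inner x ((T ^^ j) x)"
      using LIMSEQ_subseq_LIMSEQ[OF weight_moments[of j x] r] by (simp add: o_def)
    ultimately have "integral\<^sup>L M (\<lambda>t. c t ^ j) = inner x ((T ^^ j) x)"
      by (rule LIMSEQ_unique)
    moreover have "integral\<^sup>L M (\<lambda>t. c t ^ j) = integral\<^sup>L M (\<lambda>t. t ^ j)"
      using AE fm by (intro integral_cong_AE) (auto simp: c_def)
    ultimately show ?thesis by simp
  qed
  with M AE show ?thesis by blast
qed

lemma moment_measure:
  "\<exists>M. finite_measure M \<and> sets M = sets borel \<and> (AE t in M. t \<in> {0..1}) \<and>
    (\<forall>j. integral\<^sup>L M (\<lambda>t. t ^ j) = inner x ((T ^^ j) x))"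
proof (cases "x = 0")
  case True
  have "(T ^^ j) 0 = 0" for j using linear_0[OF linear_funpow[OF lin]] .
  moreover have "finite_measure (null_measure (borel :: real measure))"
    by (rule finite_measureI) simp
  ultimately show ?thesis using True
    by (intro exI[of _ "null_measure borel"]) (auto simp: AE_iff_null null_sets_def)
next
  case False
  define y where "y = (1 / norm x) *\<^sub>R x"
  have "norm y = 1" using False by (simp add: y_def)
  from moment_measure_unit[OF this] obtain M where M: "real_distribution M" "AE t in M. t \<in> {0..1}"
    "\<And>j. integral\<^sup>L M (\<lambda>t. t ^ j) = inner y ((T ^^ j) y)" by blast
  interpret M: real_distribution M by fact
  let ?N = "density M (\<lambda>_. ennreal ((norm x)\<^sup>2))"
  have "finite_measure ?N"
    by (rule finite_measureI) (simp add: emeasure_density ennreal_mult_eq_top_iff nn_integral_cmult)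
  moreover have "AE t in ?N. t \<in> {0..1}"
    using M(2) by (subst AE_density) auto
  moreover have "integral\<^sup>L ?N (\<lambda>t. t ^ j) = inner x ((T ^^ j) x)" for j
  proof -
    have "integral\<^sup>L ?N (\<lambda>t. t ^ j) = (norm x)\<^sup>2 * inner y ((T ^^ j) y)"
      by (subst integral_density) (auto simp: M(3))
    also have "\<dots> = inner x ((T ^^ j) x)"
      using False by (simp add: y_def linear_scale[OF linear_funpow[OF lin]] power2_eq_square)
    finally show ?thesis .
  qed
  ultimately show ?thesis by (intro exI[of _ ?N]) auto
qed

section \<open>Integration against the scalar measures\<close>

definition spm :: "'h \<Rightarrow> real measure" where
  "spm x = (SOME M. finite_measure M \<and> sets M = sets borel \<and> (AE t in M. t \<in> {0..1}) \<and>
    (\<forall>j. integral\<^sup>L M (\<lambda>t. t ^ j) = inner x ((T ^^ j) x)))"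

lemma spm: "finite_measure (spm x)" "sets (spm x) = sets borel" "AE t in spm x. t \<in> {0..1}"
  "integral\<^sup>L (spm x) (\<lambda>t. t ^ j) = inner x ((T ^^ j) x)"
  using someI_ex[OF moment_measure[of x]] unfolding spm_def by auto

sublocale spm: finite_measure "spm x" for x
  by (rule spm)

lemma sets_spm [measurable_cong, simp]: "sets (spm x) = sets borel" by (rule spm)

lemma space_spm [simp]: "space (spm x) = UNIV"
  using sets_eq_imp_space_eq[OF spm(2)] by simp

text \<open>Bounds are asked on [0,1] only, where \<open>spm\<close> is concentrated, so that
  polynomials belong to the class.\<close>

definition bounded_fun :: "(real \<Rightarrow> real) set" where
  "bounded_fun = {f \<in> borel_measurable borel. \<exists>C. \<forall>t\<in>{0..1}. \<bar>f t\<bar> \<le> C}"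

lemma bounded_fun_measurable [measurable_dest]: "f \<in> bounded_fun \<Longrightarrow> f \<in> borel_measurable borel"
  by (simp add: bounded_fun_def)

lemma bounded_fun_integrable: "f \<in> bounded_fun \<Longrightarrow> integrable (spm x) f"
proof -
  assume f: "f \<in> bounded_fun"
  then obtain C where C: "\<forall>t\<in>{0..1}. \<bar>f t\<bar> \<le> C" unfolding bounded_fun_def by blast
  show ?thesis
    using spm(3)[of x] C f by (intro spm.integrable_const_bound[where B=C]) (auto simp: bounded_fun_def)
qed

lemma bounded_fun_continuous: "continuous_on UNIV f \<Longrightarrow> f \<in> bounded_fun"
proof -
  assume f: "continuous_on UNIV f"
  then have "compact (f ` {0..1})"
    by (intro compact_continuous_image) (auto intro: continuous_on_subset)
  then have "bounded (f ` {0..1})" by (rule compact_imp_bounded)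
  then obtain C where "\<forall>t\<in>{0..1}. \<bar>f t\<bar> \<le> C" by (auto simp: bounded_iff)
  with f show ?thesis by (auto simp: bounded_fun_def intro: borel_measurable_continuous_onI)
qed

lemma bounded_fun_poly: "poly p \<in> bounded_fun"
  by (intro bounded_fun_continuous continuous_intros)

lemma bounded_fun_indicator: "B \<in> sets borel \<Longrightarrow> indicator B \<in> bounded_fun"
  by (auto simp: bounded_fun_def indicator_def intro!: exI[of _ 1])

lemma bounded_fun_add: "f \<in> bounded_fun \<Longrightarrow> g \<in> bounded_fun \<Longrightarrow> (\<lambda>t. f t + g t) \<in> bounded_fun"
proof -
  assume "f \<in> bounded_fun" "g \<in> bounded_fun"
  then obtain C D where "\<forall>t\<in>{0..1}. \<bar>f t\<bar> \<le> C" "\<forall>t\<in>{0..1}. \<bar>g t\<bar> \<le> D" by (auto simp: bounded_fun_def)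
  then have "\<forall>t\<in>{0..1}. \<bar>f t + g t\<bar> \<le> C + D" by (meson abs_triangle_ineq add_mono order_trans)
  with \<open>f \<in> bounded_fun\<close> \<open>g \<in> bounded_fun\<close> show ?thesis by (auto simp: bounded_fun_def)
qed

lemma bounded_fun_mult: "f \<in> bounded_fun \<Longrightarrow> g \<in> bounded_fun \<Longrightarrow> (\<lambda>t. f t * g t) \<in> bounded_fun"
proof -
  assume "f \<in> bounded_fun" "g \<in> bounded_fun"
  then obtain C D where "\<forall>t\<in>{0..1}. \<bar>f t\<bar> \<le> C" "\<forall>t\<in>{0..1}. \<bar>g t\<bar> \<le> D" by (auto simp: bounded_fun_def)
  then have "\<forall>t\<in>{0..1}. \<bar>f t * g t\<bar> \<le> C * D"
    by (auto simp: abs_mult intro!: mult_mono intro: order_trans[OF abs_ge_zero])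
  with \<open>f \<in> bounded_fun\<close> \<open>g \<in> bounded_fun\<close> show ?thesis by (auto simp: bounded_fun_def)
qed

lemma bounded_fun_diff: "f \<in> bounded_fun \<Longrightarrow> g \<in> bounded_fun \<Longrightarrow> (\<lambda>t. f t - g t) \<in> bounded_fun"
  using bounded_fun_add[of f "\<lambda>t. -1 * g t"] bounded_fun_mult[of "\<lambda>_. -1" g] bounded_fun_continuous[of "\<lambda>_. -1"]
  by simp

lemma bounded_fun_power2: "f \<in> bounded_fun \<Longrightarrow> (\<lambda>t. (f t)\<^sup>2) \<in> bounded_fun"
  using bounded_fun_mult[of f f] by (simp add: power2_eq_square)

text \<open>The squared distance in L2 of \<open>spm x\<close>. Working with squares costs a factor
  2 in the triangle inequality.\<close>

definition sq_dist :: "'h \<Rightarrow> (real \<Rightarrow> real) \<Rightarrow> (real \<Rightarrow> real) \<Rightarrow> real" where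
  "sq_dist x f g = (\<integral>t. (f t - g t)\<^sup>2 \<partial>spm x)"

lemma sq_dist_nonneg: "0 \<le> sq_dist x f g"
  unfolding sq_dist_def by (rule integral_nonneg_AE) auto

lemma sq_dist_commute: "sq_dist x f g = sq_dist x g f"
  unfolding sq_dist_def by (simp add: power2_commute)

lemma sq_dist_triangle:
  assumes "f \<in> bounded_fun" "g \<in> bounded_fun" "h \<in> bounded_fun"
  shows "sq_dist x f h \<le> 2 * sq_dist x f g + 2 * sq_dist x g h"
proof -
  have "sq_dist x f h \<le> (\<integral>t. 2 * (f t - g t)\<^sup>2 + 2 * (g t - h t)\<^sup>2 \<partial>spm x)"
    unfolding sq_dist_def
  proof (rule integral_mono)
    show "integrable (spm x) (\<lambda>t. (f t - h t)\<^sup>2)"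
      by (intro bounded_fun_integrable bounded_fun_power2 bounded_fun_diff assms)
    show "integrable (spm x) (\<lambda>t. 2 * (f t - g t)\<^sup>2 + 2 * (g t - h t)\<^sup>2)"
      by (intro Bochner_Integration.integrable_add integrable_mult_right bounded_fun_integrable bounded_fun_power2 bounded_fun_diff assms)
    fix t
    have "0 \<le> ((f t - g t) - (g t - h t))\<^sup>2" by simp
    then show "(f t - h t)\<^sup>2 \<le> 2 * (f t - g t)\<^sup>2 + 2 * (g t - h t)\<^sup>2"
      by (simp add: power2_eq_square algebra_simps)
  qed
  also have "\<dots> = 2 * sq_dist x f g + 2 * sq_dist x g h"
    unfolding sq_dist_def
    by (subst Bochner_Integration.integral_add) (auto intro!: integrable_mult_right bounded_fun_integrable bounded_fun_power2 bounded_fun_diff assms)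
  finally show ?thesis .
qed

lemma integral_poly: "integral\<^sup>L (spm x) (poly p) = inner x (poly_op T p x)"
proof -
  have i: "integrable (spm x) (\<lambda>t. t ^ i)" for i
    by (intro bounded_fun_integrable bounded_fun_continuous continuous_intros)
  have "integral\<^sup>L (spm x) (poly p) = (\<integral>t. (\<Sum>i\<le>degree p. coeff p i * t ^ i) \<partial>spm x)"
    by (intro Bochner_Integration.integral_cong) (auto simp: poly_altdef)
  also have "\<dots> = (\<Sum>i\<le>degree p. coeff p i * inner x ((T ^^ i) x))"
    using i by (subst Bochner_Integration.integral_sum) (auto simp: spm(4))
  finally show ?thesis by (simp add: poly_op_def inner_sum_right)
qed

text \<open>The isometry behind the functional calculus: p(T) x depends on p only through its class
  in L2 of \<open>spm x\<close>, and so the calculus extends to L2 limits of polynomials.\<close>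

lemma norm_poly_op_diff: "(norm (poly_op T p x - poly_op T q x))\<^sup>2 = sq_dist x (poly p) (poly q)"
proof -
  have "sq_dist x (poly p) (poly q) = integral\<^sup>L (spm x) (poly ((p - q) * (p - q)))"
    unfolding sq_dist_def by (intro Bochner_Integration.integral_cong) (auto simp: power2_eq_square)
  also have "\<dots> = (norm (poly_op T (p - q) x))\<^sup>2"
    by (simp only: integral_poly poly_op_square[OF lin sy])
  finally show ?thesis by (simp add: poly_op_diff)
qed

lemma measure_spm_UNIV: "measure (spm x) UNIV = (norm x)\<^sup>2"
proof -
  have "poly 1 = (\<lambda>_. 1::real)" by auto
  then show ?thesis using integral_poly[of x 1] by (simp add: power2_norm_eq_inner)
qed

subsection \<open>Polynomial approximation of indicators\<close>

text \<open>One polynomial has to serve all vectors of \<open>F\<close> at once. This provides a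
  common approximating sequence for x, y and x + y, from which linearity and symmetry of the limit
  are read off.\<close>

definition approximable :: "'h set \<Rightarrow> (real \<Rightarrow> real) \<Rightarrow> bool" where
  "approximable F f \<longleftrightarrow> f \<in> bounded_fun \<and> (\<forall>e>0. \<exists>p. \<forall>x\<in>F. sq_dist x (poly p) f < e)"

lemma approximable_close:
  assumes f: "f \<in> bounded_fun" and "\<And>e. e > 0 \<Longrightarrow> \<exists>g. approximable F g \<and> (\<forall>x\<in>F. sq_dist x g f < e)"
  shows "approximable F f"
  unfolding approximable_def
proof (intro conjI allI impI f)
  fix e :: real assume e: "e > 0"
  then obtain g where g: "approximable F g" "\<forall>x\<in>F. sq_dist x g f < e/4"
    using assms(2)[of "e/4"] by auto
  moreover from g(1) e have "e/4 > 0" by simp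
  ultimately obtain p where p: "\<forall>x\<in>F. sq_dist x (poly p) g < e/4" unfolding approximable_def by blast
  have "sq_dist x (poly p) f < e" if "x \<in> F" for x
  proof -
    have "g \<in> bounded_fun" using g by (simp add: approximable_def)
    from sq_dist_triangle[OF bounded_fun_poly this f, of x p]
    have "sq_dist x (poly p) f \<le> 2 * sq_dist x (poly p) g + 2 * sq_dist x g f" .
    moreover have "sq_dist x (poly p) g < e/4" "sq_dist x g f < e/4" using p g that by auto
    ultimately show ?thesis by linarith
  qed
  then show "\<exists>p. \<forall>x\<in>F. sq_dist x (poly p) f < e" by blast
qed

lemma approximable_poly: "approximable F (poly p)"
  unfolding approximable_def using bounded_fun_poly by (auto intro!: exI[of _ p] simp: sq_dist_def)

lemma approximable_add:
  assumes "approximable F f" "approximable F g"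
  shows "approximable F (\<lambda>t. f t + g t)"
  unfolding approximable_def
proof (intro conjI allI impI)
  have fg: "f \<in> bounded_fun" "g \<in> bounded_fun" using assms by (auto simp: approximable_def)
  then show "(\<lambda>t. f t + g t) \<in> bounded_fun" by (rule bounded_fun_add)
  fix e :: real assume e: "e > 0"
  then obtain p q where p: "\<forall>x\<in>F. sq_dist x (poly p) f < e/4" and q: "\<forall>x\<in>F. sq_dist x (poly q) g < e/4"
    using assms unfolding approximable_def by (metis zero_less_divide_iff zero_less_numeral)
  have "sq_dist x (poly (p + q)) (\<lambda>t. f t + g t) < e" if "x \<in> F" for x
  proof -
    have "sq_dist x (poly (p + q)) (\<lambda>t. f t + g t)
        \<le> 2 * sq_dist x (poly (p + q)) (\<lambda>t. f t + poly q t) + 2 * sq_dist x (\<lambda>t. f t + poly q t) (\<lambda>t. f t + g t)"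
      by (intro sq_dist_triangle bounded_fun_add bounded_fun_poly fg)
    also have "sq_dist x (poly (p + q)) (\<lambda>t. f t + poly q t) = sq_dist x (poly p) f"
      unfolding sq_dist_def by (intro Bochner_Integration.integral_cong) auto
    also have "sq_dist x (\<lambda>t. f t + poly q t) (\<lambda>t. f t + g t) = sq_dist x (poly q) g"
      unfolding sq_dist_def by (intro Bochner_Integration.integral_cong) auto
    finally have "sq_dist x (poly (p + q)) (\<lambda>t. f t + g t) \<le> 2 * sq_dist x (poly p) f + 2 * sq_dist x (poly q) g" .
    moreover have "sq_dist x (poly p) f < e/4" "sq_dist x (poly q) g < e/4" using p q that by auto
    ultimately show ?thesis by linarith
  qed
  then show "\<exists>p. \<forall>x\<in>F. sq_dist x (poly p) (\<lambda>t. f t + g t) < e" by blast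
qed

lemma approximable_uminus:
  assumes "approximable F f" shows "approximable F (\<lambda>t. - f t)"
  unfolding approximable_def
proof (intro conjI allI impI)
  have "f \<in> bounded_fun" using assms by (simp add: approximable_def)
  then show "(\<lambda>t. - f t) \<in> bounded_fun" using bounded_fun_diff[OF bounded_fun_poly[of 0]] by simp
  fix e :: real assume "e > 0"
  then obtain p where "\<forall>x\<in>F. sq_dist x (poly p) f < e" using assms unfolding approximable_def by blast
  moreover have "sq_dist x (poly (-p)) (\<lambda>t. - f t) = sq_dist x (poly p) f" for x
    unfolding sq_dist_def
    by (intro Bochner_Integration.integral_cong) (auto simp: power2_commute)
  ultimately show "\<exists>p. \<forall>x\<in>F. sq_dist x (poly p) (\<lambda>t. - f t) < e" by (metis)
qed

lemma approximable_continuous: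
  assumes F: "finite F" and f: "continuous_on UNIV f"
  shows "approximable F f"
  unfolding approximable_def
proof (intro conjI allI impI bounded_fun_continuous[OF f])
  fix e :: real assume e: "e > 0"
  \<comment> \<open>Exceeds the total mass of \<open>spm x\<close> for every x in \<open>F\<close>,
    so that a uniform error \<open>d\<close> on [0,1] gives a squared L2 error below
    \<open>d\<^sup>2 * K\<close>.\<close>
  define K where "K = 1 + (\<Sum>x\<in>F. (norm x)\<^sup>2)"
  have K: "K > 0" "\<And>x. x \<in> F \<Longrightarrow> (norm x)\<^sup>2 < K"
    using F by (auto simp: K_def add_pos_nonneg sum_nonneg intro!: member_le_sum
        intro: le_less_trans[OF member_le_sum[of _ F "\<lambda>x. (norm x)\<^sup>2"]])
  define d where "d = sqrt (e / K)"
  have d: "d > 0" "d\<^sup>2 = e / K" using e K by (auto simp: d_def)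
  have "continuous_on {0..1} f" using f continuous_on_subset by blast
  from Bernstein_Weierstrass[OF this d(1)]
  obtain n where n: "\<And>t. t \<in> {0..1} \<Longrightarrow> \<bar>f t - (\<Sum>k\<le>n. f (k / n) * Bernstein n k t)\<bar> < d"
    by blast
  define p where "p = (\<Sum>k\<le>n. smult (f (k/n)) (bernstein_poly n k))"
  have p: "poly p t = (\<Sum>k\<le>n. f (k / n) * Bernstein n k t)" for t
    by (simp add: p_def poly_sum poly_bernstein_poly)
  have "sq_dist x (poly p) f < e" if "x \<in> F" for x
  proof -
    have "sq_dist x (poly p) f \<le> (\<integral>t. d\<^sup>2 \<partial>spm x)"
      unfolding sq_dist_def
    proof (rule integral_mono_AE)
      show "integrable (spm x) (\<lambda>t. (poly p t - f t)\<^sup>2)"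
        by (intro bounded_fun_integrable bounded_fun_power2 bounded_fun_diff bounded_fun_poly bounded_fun_continuous f)
      show "AE t in spm x. (poly p t - f t)\<^sup>2 \<le> d\<^sup>2"
        using spm(3)[of x]
      proof eventually_elim
        case (elim t)
        have "\<bar>poly p t - f t\<bar> \<le> \<bar>d\<bar>" using n[OF elim] d by (simp add: p abs_minus_commute)
        then show ?case by (simp only: abs_le_square_iff)
      qed
    qed simp
    also have "\<dots> = d\<^sup>2 * (norm x)\<^sup>2" by (simp add: measure_spm_UNIV)
    also have "\<dots> < d\<^sup>2 * K" using d K(2)[OF that] zero_less_power[OF d(1), of 2] by (intro mult_strict_left_mono)
    also have "\<dots> = e" using d K by simp
    finally show ?thesis .
  qed
  then show "\<exists>p. \<forall>x\<in>F. sq_dist x (poly p) f < e" by blast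
qed

lemma approximable_dominated:
  assumes F: "finite F" and f: "f \<in> bounded_fun" and g: "\<And>k. approximable F (g k)"
    and lim: "\<And>t. (\<lambda>k. g k t) \<longlonglongrightarrow> f t" and b: "\<And>k t. \<bar>g k t - f t\<bar> \<le> 1"
  shows "approximable F f"
proof (rule approximable_close[OF f])
  fix e :: real assume e: "e > 0"
  have "(\<lambda>k. sq_dist x (g k) f) \<longlonglongrightarrow> (\<integral>t. 0 \<partial>spm x)" for x
    unfolding sq_dist_def
  proof (rule integral_dominated_convergence[where w="\<lambda>_. 1"])
    show "(\<lambda>t. (g i t - f t)\<^sup>2) \<in> borel_measurable (spm x)" for i
      using g[of i] f by (auto simp: approximable_def bounded_fun_def)
    show "AE t in spm x. (\<lambda>k. (g k t - f t)\<^sup>2) \<longlonglongrightarrow> 0"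
    proof (rule AE_I2)
      fix t
      have "(\<lambda>k. (g k t - f t)\<^sup>2) \<longlonglongrightarrow> (f t - f t)\<^sup>2" by (intro tendsto_intros lim)
      then show "(\<lambda>k. (g k t - f t)\<^sup>2) \<longlonglongrightarrow> 0" by simp
    qed
    show "AE t in spm x. norm ((g i t - f t)\<^sup>2) \<le> 1" for i
    proof (rule AE_I2)
      fix t
      have "\<bar>g i t - f t\<bar> \<le> \<bar>1\<bar>" using b[of i t] by simp
      then have "(g i t - f t)\<^sup>2 \<le> 1\<^sup>2" by (simp only: abs_le_square_iff)
      then show "norm ((g i t - f t)\<^sup>2) \<le> 1" by simp
    qed
  qed auto
  then have "\<forall>x\<in>F. \<forall>\<^sub>F k in sequentially. sq_dist x (g k) f < e"
    using e by (auto dest!: order_tendstoD(2))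
  then have "\<forall>\<^sub>F k in sequentially. \<forall>x\<in>F. sq_dist x (g k) f < e"
    using F by (simp add: eventually_ball_finite)
  then obtain k where "\<forall>x\<in>F. sq_dist x (g k) f < e"
    by (auto dest: eventually_happens)
  with g show "\<exists>g. approximable F g \<and> (\<forall>x\<in>F. sq_dist x g f < e)" by blast
qed

text \<open>Induction over the sigma algebra generated by half lines: a half line is a limit of
  continuous functions, and complements and disjoint unions inherit the property.\<close>

lemma approximable_indicator:
  assumes F: "finite F" and B: "B \<in> sets borel"
  shows "approximable F (indicator B)"
proof -
  have sb: "sets borel = sigma_sets UNIV (range (\<lambda>a::real. {..a}))"
    by (simp add: borel_eq_atMost)
  have "Int_stable (range (\<lambda>a::real. {..a}))"
    by (auto simp: Int_stable_def)
  moreover have "range (\<lambda>a::real. {..a}) \<subseteq> Pow UNIV" by auto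
  moreover have "B \<in> sigma_sets UNIV (range (\<lambda>a::real. {..a}))" using B sb by simp
  ultimately show ?thesis
  proof (induction rule: sigma_sets_induct_disjoint)
    case (basic A)
    then obtain a where A: "A = {..a}" by auto
    \<comment> \<open>For k > 0 a ramp that is 1 up to \<open>a\<close> and falls linearly to 0 at a
      + 1/k.\<close>
    define g where "g k t = max 0 (min 1 (1 - real k * (t - a)))" for k t
    show ?case
    proof (rule approximable_dominated[OF F, of _ g])
      show "indicator A \<in> bounded_fun" using A by (intro bounded_fun_indicator) auto
      show "approximable F (g k)" for k
        unfolding g_def by (intro approximable_continuous F continuous_intros)
      fix t show "\<bar>g k t - indicator A t\<bar> \<le> 1" for k by (auto simp: g_def indicator_def)
      show "(\<lambda>k. g k t) \<longlonglongrightarrow> indicator A t"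
      proof (cases "t \<le> a")
        case True
        then have "g k t = 1" for k by (auto simp: g_def mult_nonneg_nonpos)
        then show ?thesis using True A by simp
      next
        case False
        have "\<forall>\<^sub>F k in sequentially. g k t = 0"
          using eventually_ge_at_top[of "nat \<lceil>1 / (t - a)\<rceil>"]
        proof eventually_elim
          case (elim k)
          then have "1 / (t - a) \<le> real k" by linarith
          then have "1 - real k * (t - a) \<le> 0" using False by (simp add: field_simps)
          then show ?case by (simp add: g_def)
        qed
        then show ?thesis using False A by (simp add: tendsto_eventually)
      qed
    qed
  next
    case empty
    have "indicator {} = poly 0" by (auto simp: fun_eq_iff)
    then show ?case by (metis approximable_poly)
  next
    case (compl A)
    have "indicator (UNIV - A) = (\<lambda>t. poly 1 t + - indicator A t :: real)"
      by (auto simp: fun_eq_iff indicator_def)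
    then show ?case
      using approximable_add[OF approximable_poly approximable_uminus[OF compl.IH], of 1] by simp
  next
    case (union A)
    have fin: "approximable F (\<lambda>t. \<Sum>i<n. indicator (A i) t)" for n
    proof (induction n)
      case 0
      have "(\<lambda>t. \<Sum>i<0. indicator (A i) t) = (poly 0 :: real \<Rightarrow> real)" by auto
      then show ?case using approximable_poly[of F 0] by simp
    next
      case (Suc n) then show ?case using approximable_add[OF Suc.IH union.IH[of n]] by (simp add: add.commute)
    qed
    have eq: "(\<Sum>i<n. indicator (A i) t :: real) = indicator (\<Union>i<n. A i) t" for n t
    proof -
      have "disjoint_family_on A {..<n}" using union(1) by (auto simp: disjoint_family_on_def)
      then show ?thesis by (simp add: indicator_UN_disjoint)
    qed
    show ?case
    proof (rule approximable_dominated[OF F _ fin])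
      show "indicator (\<Union> (range A)) \<in> bounded_fun"
        using union(2) sb by (intro bounded_fun_indicator sets.countable_UN) auto
      fix t
      show "\<bar>(\<Sum>i<n. indicator (A i) t) - indicator (\<Union> (range A)) t\<bar> \<le> (1::real)" for n
      proof -
        have "indicator S t = (0::real) \<or> indicator S t = (1::real)" for S :: "real set"
          by (auto simp: indicator_def)
        from this[of "\<Union>i<n. A i"] this[of "\<Union> (range A)"] show ?thesis
          by (simp only: eq) auto
      qed
      have "(\<lambda>n. indicator (\<Union>i<n. A i) t :: real) \<longlonglongrightarrow> indicator (\<Union>i. A i) t"
        by (rule LIMSEQ_indicator_UN)
      then show "(\<lambda>n. \<Sum>i<n. indicator (A i) t :: real) \<longlonglongrightarrow> indicator (\<Union> (range A)) t"
        unfolding eq .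
    qed
  qed
qed

end

section \<open>Projection-valued measures on real Hilbert spaces\<close>

text \<open>The space is real here; complex linearity is added later as commutation with
  multiplication by i.\<close>

locale real_pvm =
  fixes P :: "real set \<Rightarrow> 'h::real_inner \<Rightarrow> 'h"
  assumes linear_P: "B \<in> sets borel \<Longrightarrow> linear (P B)"
    and idem: "B \<in> sets borel \<Longrightarrow> P B (P B x) = P B x"
    and self_adj: "B \<in> sets borel \<Longrightarrow> inner x (P B y) = inner (P B x) y"
    and P_UNIV: "P UNIV x = x"
    and sums_norm: "range E \<subseteq> sets borel \<Longrightarrow> disjoint_family E \<Longrightarrow>
      (\<lambda>n. norm (P (\<Union>i. E i) x - (\<Sum>i<n. P (E i) x))) \<longlonglongrightarrow> 0"

section \<open>Spectral projections as limits of polynomials in an operator\<close>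

context unit_op
begin

text \<open>Quantifying over all approximating sequences makes the limit independent of the
  sequence; \<open>approx_seq\<close> guarantees that the quantifier is not vacuous.\<close>

definition proj :: "real set \<Rightarrow> 'h \<Rightarrow> 'h" where
  "proj B x = (SOME y. \<forall>p. (\<lambda>n. sq_dist x (poly (p n)) (indicator B)) \<longlonglongrightarrow> 0 \<longrightarrow>
     (\<lambda>n::nat. poly_op T (p n) x) \<longlonglongrightarrow> y)"

lemma approx_seq:
  assumes "finite F" "B \<in> sets borel"
  obtains p where "\<And>x. x \<in> F \<Longrightarrow> (\<lambda>n::nat. sq_dist x (poly (p n)) (indicator B)) \<longlonglongrightarrow> 0"
proof -
  have "\<forall>n. \<exists>p. \<forall>x\<in>F. sq_dist x (poly p) (indicator B) < 1 / real (Suc n)"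
    using approximable_indicator[OF assms] unfolding approximable_def by auto
  then obtain p where p: "\<And>n x. x \<in> F \<Longrightarrow> sq_dist x (poly (p n)) (indicator B) < 1 / real (Suc n)"
    by metis
  have "(\<lambda>n. sq_dist x (poly (p n)) (indicator B)) \<longlonglongrightarrow> 0" if "x \<in> F" for x
  proof (rule tendsto_sandwich[OF _ _ tendsto_const LIMSEQ_Suc[OF lim_1_over_n]])
    show "\<forall>\<^sub>F n in sequentially. sq_dist x (poly (p n)) (indicator B) \<le> 1 / real (Suc n)"
      using p[OF that] by (simp add: less_imp_le)
  qed (simp add: sq_dist_nonneg)
  then show thesis by (rule that)
qed

text \<open>By the isometry, L2 convergence of polynomials makes their vectors a Cauchy sequence. A
  fixed sequence \<open>q\<close> defines the limit, and every other sequence is asymptotic to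
  it.\<close>

lemma proj_lim:
  assumes B: "B \<in> sets borel" and p: "(\<lambda>n. sq_dist x (poly (p n)) (indicator B)) \<longlonglongrightarrow> 0"
  shows "(\<lambda>n. poly_op T (p n) x) \<longlonglongrightarrow> proj B x"
proof -
  have tri: "(norm (poly_op T p x - poly_op T q x))\<^sup>2
     \<le> 2 * sq_dist x (poly p) (indicator B) + 2 * sq_dist x (poly q) (indicator B)" for p q
    using sq_dist_triangle[OF bounded_fun_poly bounded_fun_indicator[OF B] bounded_fun_poly, of x p q]
    by (simp add: norm_poly_op_diff sq_dist_commute[of x "indicator B"])
  obtain q where q: "(\<lambda>n::nat. sq_dist x (poly (q n)) (indicator B)) \<longlonglongrightarrow> 0"
    using approx_seq[of "{x}", OF _ B] by auto
  have "Cauchy (\<lambda>n. poly_op T (q n) x)"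
    unfolding Cauchy_iff
  proof (intro allI impI)
    fix e :: real assume e: "e > 0"
    then have "0 < e\<^sup>2 / 4" by simp
    from order_tendstoD(2)[OF q this] obtain N
      where N: "\<And>n. n \<ge> N \<Longrightarrow> sq_dist x (poly (q n)) (indicator B) < e\<^sup>2 / 4"
      by (auto simp: eventually_sequentially)
    have "norm (poly_op T (q m) x - poly_op T (q n) x) < e" if "m \<ge> N" "n \<ge> N" for m n
    proof (rule power2_less_imp_less)
      show "(norm (poly_op T (q m) x - poly_op T (q n) x))\<^sup>2 < e\<^sup>2"
        using tri[of "q m" "q n"] N[OF that(1)] N[OF that(2)] by linarith
    qed (use e in simp)
    then show "\<exists>M. \<forall>m\<ge>M. \<forall>n\<ge>M. norm (poly_op T (q m) x - poly_op T (q n) x) < e" by blast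
  qed
  then obtain y where y: "(\<lambda>n. poly_op T (q n) x) \<longlonglongrightarrow> y"
    by (auto simp: Cauchy_convergent_iff convergent_def)
  have "(\<lambda>n. poly_op T (p n) x) \<longlonglongrightarrow> y" if p: "(\<lambda>n. sq_dist x (poly (p n)) (indicator B)) \<longlonglongrightarrow> 0" for p
  proof -
    have "(\<lambda>n. (norm (poly_op T (p n) x - poly_op T (q n) x))\<^sup>2) \<longlonglongrightarrow> 0"
    proof (rule tendsto_sandwich[OF _ _ tendsto_const])
      show "\<forall>\<^sub>F n in sequentially. (norm (poly_op T (p n) x - poly_op T (q n) x))\<^sup>2
         \<le> 2 * sq_dist x (poly (p n)) (indicator B) + 2 * sq_dist x (poly (q n)) (indicator B)"
        using tri by simp
      show "(\<lambda>n. 2 * sq_dist x (poly (p n)) (indicator B) + 2 * sq_dist x (poly (q n)) (indicator B)) \<longlonglongrightarrow> 0"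
        using tendsto_add[OF tendsto_mult_right[OF p, of 2] tendsto_mult_right[OF q, of 2]] 
        by (simp add: mult.commute)
    qed simp
    from tendsto_real_sqrt[OF this] have "(\<lambda>n. poly_op T (p n) x - poly_op T (q n) x) \<longlonglongrightarrow> 0"
      by (simp add: tendsto_norm_zero_iff)
    from tendsto_add[OF this y] show ?thesis by simp
  qed
  then have "\<exists>y. \<forall>p. (\<lambda>n. sq_dist x (poly (p n)) (indicator B)) \<longlonglongrightarrow> 0 \<longrightarrow>
     (\<lambda>n::nat. poly_op T (p n) x) \<longlonglongrightarrow> y" by blast
  from someI_ex[OF this] p show ?thesis unfolding proj_def by blast
qed

lemma proj_linear:
  assumes B: "B \<in> sets borel" shows "linear (proj B)"
proof (rule linearI)
  fix x y
  obtain p where p: "\<And>z. z \<in> {x, y, x + y} \<Longrightarrow> (\<lambda>n::nat. sq_dist z (poly (p n)) (indicator B)) \<longlonglongrightarrow> 0"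
    using approx_seq[of "{x, y, x + y}", OF _ B] by auto
  note l = proj_lim[OF B p]
  have "(\<lambda>n. poly_op T (p n) (x + y)) \<longlonglongrightarrow> proj B x + proj B y"
    using tendsto_add[OF l[of x] l[of y]] by (simp add: linear_add[OF poly_op_linear[OF lin]])
  with l[of "x + y"] show "proj B (x + y) = proj B x + proj B y"
    by (auto intro: LIMSEQ_unique)
next
  fix a x
  obtain p where p: "\<And>z. z \<in> {x, a *\<^sub>R x} \<Longrightarrow> (\<lambda>n::nat. sq_dist z (poly (p n)) (indicator B)) \<longlonglongrightarrow> 0"
    using approx_seq[of "{x, a *\<^sub>R x}", OF _ B] by auto
  note l = proj_lim[OF B p]
  have "(\<lambda>n. poly_op T (p n) (a *\<^sub>R x)) \<longlonglongrightarrow> a *\<^sub>R proj B x"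
    using tendsto_scaleR[OF tendsto_const l[of x], of a] by (simp add: linear_scale[OF poly_op_linear[OF lin]])
  with l[of "a *\<^sub>R x"] show "proj B (a *\<^sub>R x) = a *\<^sub>R proj B x"
    by (auto intro: LIMSEQ_unique)
qed

text \<open>Its use is with multiplication by i, which turns the real projections into complex
  linear ones.\<close>

lemma proj_commute:
  assumes B: "B \<in> sets borel" and J: "bounded_linear J" "\<And>x. J (T x) = T (J x)"
  shows "J (proj B x) = proj B (J x)"
proof -
  obtain p where p: "\<And>z. z \<in> {x, J x} \<Longrightarrow> (\<lambda>n::nat. sq_dist z (poly (p n)) (indicator B)) \<longlonglongrightarrow> 0"
    using approx_seq[of "{x, J x}", OF _ B] by auto
  note l = proj_lim[OF B p]
  have "(\<lambda>n. J (poly_op T (p n) x)) \<longlonglongrightarrow> J (proj B x)"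
    using bounded_linear.tendsto[OF J(1) l[of x]] by simp
  then have "(\<lambda>n. poly_op T (p n) (J x)) \<longlonglongrightarrow> J (proj B x)"
    by (simp add: poly_op_commute[OF lin bounded_linear.linear[OF J(1)] J(2)])
  with l[of "J x"] show ?thesis by (auto intro: LIMSEQ_unique)
qed

lemma proj_self_adj:
  assumes B: "B \<in> sets borel"
  shows "inner x (proj B y) = inner (proj B x) y"
proof -
  obtain p where p: "\<And>z. z \<in> {x, y} \<Longrightarrow> (\<lambda>n::nat. sq_dist z (poly (p n)) (indicator B)) \<longlonglongrightarrow> 0"
    using approx_seq[of "{x, y}", OF _ B] by auto
  note l = proj_lim[OF B p]
  have "(\<lambda>n. inner x (poly_op T (p n) y)) \<longlonglongrightarrow> inner x (proj B y)"
    using l[of y] by (intro tendsto_intros) auto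
  moreover have "(\<lambda>n. inner (poly_op T (p n) x) y) \<longlonglongrightarrow> inner (proj B x) y"
    using l[of x] by (intro tendsto_intros) auto
  ultimately show ?thesis
    by (simp add: poly_op_symmetric[OF lin sy] LIMSEQ_unique)
qed

text \<open>The integral formula for polynomials, carried to the indicator by continuity. That the
  form and the squared norm agree is what makes the limit idempotent.\<close>

lemma proj_norm_form:
  assumes B: "B \<in> sets borel"
  shows "inner x (proj B x) = measure (spm x) B" "(norm (proj B x))\<^sup>2 = measure (spm x) B"
proof -
  obtain p where p: "(\<lambda>n::nat. sq_dist x (poly (p n)) (indicator B)) \<longlonglongrightarrow> 0"
    using approx_seq[of "{x}", OF _ B] by auto
  note l = proj_lim[OF B p]
  define I where "I f = integral\<^sup>L (spm x) f" for f :: "real \<Rightarrow> real"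
  have IB: "I (indicator B) = measure (spm x) B" by (simp add: I_def)
  have ib: "integrable (spm x) f" if "f \<in> bounded_fun" for f using bounded_fun_integrable[OF that] .
  define h where "h n t = indicator B t * (poly (p n) t - indicator B t)" for n t
  have hb: "h n \<in> bounded_fun" for n unfolding h_def by (intro bounded_fun_mult bounded_fun_diff bounded_fun_poly bounded_fun_indicator B)
  have "(\<lambda>n. I (h n)) \<longlonglongrightarrow> 0" and f1: "(\<lambda>n. I (\<lambda>t. poly (p n) t - indicator B t)) \<longlonglongrightarrow> 0"
  proof -
    have *: "(\<lambda>n. I (g n)) \<longlonglongrightarrow> 0" if gb: "\<And>n. g n \<in> bounded_fun"
      and ge: "\<And>n t. \<bar>g n t\<bar> \<le> \<bar>poly (p n) t - indicator B t\<bar>" for g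
    proof -
      have bound: "\<bar>I (g n)\<bar> \<le> norm x * sqrt (sq_dist x (poly (p n)) (indicator B))" for n
      proof -
        let ?m = "(norm x)\<^sup>2" and ?d = "sq_dist x (poly (p n)) (indicator B)"
        \<comment> \<open>Cauchy-Schwarz against the constant 1, from the integral of (s - a g)^2
          being nonnegative; a = 1 and a = -1 together give the modulus.\<close>
        have quad: "2 * s * \<bar>I (g n)\<bar> \<le> s\<^sup>2 * ?m + ?d" for s
        proof -
          have "0 \<le> (\<integral>t. (s - a * (g n t))\<^sup>2 \<partial>spm x)" for a by (intro integral_nonneg_AE) auto
          also have "(\<integral>t. (s - a * (g n t))\<^sup>2 \<partial>spm x) = s\<^sup>2 * ?m - 2 * s * a * I (g n) + a\<^sup>2 * I (\<lambda>t. (g n t)\<^sup>2)" for a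
          proof -
            have "(\<integral>t. (s - a * (g n t))\<^sup>2 \<partial>spm x) = (\<integral>t. s\<^sup>2 - 2 * s * a * g n t + a\<^sup>2 * (g n t)\<^sup>2 \<partial>spm x)"
              by (intro Bochner_Integration.integral_cong) (auto simp: power2_eq_square algebra_simps)
            then show ?thesis using ib[OF gb[of n]] ib[OF bounded_fun_power2[OF gb[of n]]]
              by (simp add: I_def measure_spm_UNIV)
          qed
          finally have 1: "2 * s * a * I (g n) \<le> s\<^sup>2 * ?m + a\<^sup>2 * I (\<lambda>t. (g n t)\<^sup>2)" for a
            by (simp add: algebra_simps)
          have 2: "I (\<lambda>t. (g n t)\<^sup>2) \<le> ?d"
            unfolding I_def sq_dist_def
            using ge by (intro integral_mono ib bounded_fun_power2 gb bounded_fun_diff bounded_fun_poly bounded_fun_indicator B)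
              (simp add: abs_le_square_iff)
          show ?thesis using 1[of 1] 1[of "-1"] 2 by (auto simp: abs_if)
        qed
        show ?thesis
        proof (rule ccontr)
          assume n: "\<not> ?thesis"
          have "\<bar>I (g n)\<bar>\<^sup>2 \<le> ?m * ?d"
          \<comment> \<open>The optimal \<open>s\<close> divides by the total mass. Where this is 0
            the inequality is linear in \<open>s\<close>, and a large \<open>s\<close> violates it
            unless the integral vanishes.\<close>
          proof (cases "?m = 0")
            case True
            have "I (g n) = 0"
            proof (rule ccontr)
              assume "I (g n) \<noteq> 0"
              define s where "s = (?d + 1) / \<bar>I (g n)\<bar>"
              have "s * \<bar>I (g n)\<bar> = ?d + 1" using \<open>I (g n) \<noteq> 0\<close> by (simp add: s_def)
              moreover have "s\<^sup>2 * ?m = 0" using True by simp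
              ultimately show False
                using quad[of s] sq_dist_nonneg[of x "poly (p n)" "indicator B"] by linarith
            qed
            then show ?thesis using True by simp
          next
            case False
            then have m: "?m > 0" by simp
            let ?s = "\<bar>I (g n)\<bar> / ?m"
            have "2 * ?s * \<bar>I (g n)\<bar> = 2 * (\<bar>I (g n)\<bar>\<^sup>2 / ?m)" by (simp add: power2_eq_square)
            moreover have "?s\<^sup>2 * ?m = \<bar>I (g n)\<bar>\<^sup>2 / ?m" using m by (simp add: power_divide power2_eq_square)
            ultimately have "\<bar>I (g n)\<bar>\<^sup>2 / ?m \<le> ?d" using quad[of ?s] by linarith
            then show ?thesis using m by (simp add: pos_divide_le_eq mult.commute)
          qed
          then have "\<bar>I (g n)\<bar> \<le> sqrt (?m * ?d)" by (rule real_le_rsqrt)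
          with n show False by (simp add: real_sqrt_mult)
        qed
      qed
      show ?thesis
      proof (rule Lim_null_comparison)
        show "\<forall>\<^sub>F n in sequentially. norm (I (g n)) \<le> norm x * sqrt (sq_dist x (poly (p n)) (indicator B))"
          using bound by simp
        show "(\<lambda>n. norm x * sqrt (sq_dist x (poly (p n)) (indicator B))) \<longlonglongrightarrow> 0"
          using tendsto_mult_right[OF tendsto_real_sqrt[OF p], of "norm x"] by (simp add: mult.commute)
      qed
    qed
    show "(\<lambda>n. I (h n)) \<longlonglongrightarrow> 0"
      by (rule *[OF hb]) (auto simp: h_def indicator_def)
    show "(\<lambda>n. I (\<lambda>t. poly (p n) t - indicator B t)) \<longlonglongrightarrow> 0"
      by (rule *) (auto intro!: bounded_fun_diff bounded_fun_poly bounded_fun_indicator B)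
  qed
  note h0 = this(1)
  have "(\<lambda>n. inner x (poly_op T (p n) x)) \<longlonglongrightarrow> inner x (proj B x)"
    using l by (intro tendsto_intros)
  moreover have "inner x (poly_op T (p n) x) = I (\<lambda>t. poly (p n) t - indicator B t) + measure (spm x) B" for n
    using ib[OF bounded_fun_poly] ib[OF bounded_fun_indicator[OF B]] IB
    by (simp add: I_def integral_poly[symmetric])
  ultimately show "inner x (proj B x) = measure (spm x) B"
    using tendsto_add[OF f1 tendsto_const[of "measure (spm x) B"]] by (auto intro: LIMSEQ_unique)
  have "(\<lambda>n. (norm (poly_op T (p n) x))\<^sup>2) \<longlonglongrightarrow> (norm (proj B x))\<^sup>2"
    using l by (intro tendsto_intros)
  \<comment> \<open>For an indicator f one has p^2 = (p - f)^2 + 2 f (p - f) + f; the integrals of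
    the first two terms tend to 0.\<close>
  moreover have "(norm (poly_op T (p n) x))\<^sup>2 = sq_dist x (poly (p n)) (indicator B) + 2 * I (h n) + measure (spm x) B" for n
  proof -
    have "(norm (poly_op T (p n) x))\<^sup>2 = I (\<lambda>t. (poly (p n) t)\<^sup>2)"
      using norm_poly_op_diff[of "p n" x 0] by (simp add: sq_dist_def I_def)
    also have "\<dots> = I (\<lambda>t. (poly (p n) t - indicator B t)\<^sup>2 + 2 * h n t + indicator B t)"
      unfolding I_def by (intro Bochner_Integration.integral_cong)
        (auto simp: h_def indicator_def power2_eq_square algebra_simps)
    also have "\<dots> = sq_dist x (poly (p n)) (indicator B) + 2 * I (h n) + measure (spm x) B"
      using ib[OF hb[of n]] ib[OF bounded_fun_indicator[OF B]] ib[OF bounded_fun_power2[OF bounded_fun_diff[OF bounded_fun_poly[of "p n"] bounded_fun_indicator[OF B]]]]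
      unfolding I_def sq_dist_def by (simp add: IB[unfolded I_def])
    finally show ?thesis .
  qed
  ultimately show "(norm (proj B x))\<^sup>2 = measure (spm x) B"
    using tendsto_add[OF tendsto_add[OF p tendsto_mult_right[OF h0, of 2]] tendsto_const[of "measure (spm x) B"]]
    by (auto intro: LIMSEQ_unique simp: mult.commute)
qed

text \<open>Idempotence and finite additivity compare symmetric operators, so
  \<open>symmetric_zero_form\<close> reduces them to values of \<open>spm x\<close>. Countable
  additivity is continuity of this measure along the tails \<open>R n\<close>.\<close>

lemma proj_pvm: "real_pvm proj"
proof (rule real_pvm.intro)
  show "linear (proj B)" if "B \<in> sets borel" for B using that by (rule proj_linear)
  show "inner x (proj B y) = inner (proj B x) y" if "B \<in> sets borel" for B x y
    using that by (rule proj_self_adj)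
next
  fix B :: "real set" and x assume B: "B \<in> sets borel"
  interpret L: linear "proj B" by (rule proj_linear[OF B])
  have "linear (\<lambda>x. proj B (proj B x) - proj B x)"
    by (rule linearI) (auto simp: L.add L.scale algebra_simps)
  then have "proj B (proj B x) - proj B x = 0"
  proof (rule symmetric_zero_form)
    fix x y
    show "inner x (proj B (proj B y) - proj B y) = inner (proj B (proj B x) - proj B x) y"
      by (simp add: inner_diff_left inner_diff_right proj_self_adj[OF B])
    have "inner x (proj B (proj B x)) = (norm (proj B x))\<^sup>2"
      by (simp add: proj_self_adj[OF B] power2_norm_eq_inner)
    then show "inner x (proj B (proj B x) - proj B x) = 0"
      by (simp add: inner_diff_right proj_norm_form[OF B])
  qed
  then show "proj B (proj B x) = proj B x" by simp
next
  fix x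
  have "(\<lambda>n::nat. sq_dist x (poly 1) (indicator UNIV)) \<longlonglongrightarrow> 0" by (simp add: sq_dist_def)
  from proj_lim[OF _ this] show "proj UNIV x = x" by (simp add: LIMSEQ_const_iff)
next
  fix E :: "nat \<Rightarrow> real set" and x
  assume E: "range E \<subseteq> sets borel" "disjoint_family E"
  then have Eb [measurable]: "\<And>i. E i \<in> sets borel" by auto
  define R where "R n = (\<Union>i. E i) - (\<Union>i<n. E i)" for n
  have Rb [measurable]: "R n \<in> sets borel" for n unfolding R_def by measurable
  have Ub: "(\<Union>i. E i) \<in> sets borel" by measurable
  have eq: "proj (\<Union>i. E i) x - (\<Sum>i<n. proj (E i) x) = proj (R n) x" for n
  proof -
    have "linear (\<lambda>x. (proj (\<Union>i. E i) x - (\<Sum>i<n. proj (E i) x)) - proj (R n) x)"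
      by (intro linear_compose_sub linear_compose_sum ballI proj_linear Ub Rb Eb)
    then have "(proj (\<Union>i. E i) x - (\<Sum>i<n. proj (E i) x)) - proj (R n) x = 0"
    proof (rule symmetric_zero_form)
      fix x y
      show "inner x (proj (\<Union>i. E i) y - (\<Sum>i<n. proj (E i) y) - proj (R n) y) =
        inner (proj (\<Union>i. E i) x - (\<Sum>i<n. proj (E i) x) - proj (R n) x) y"
        by (simp add: inner_diff_left inner_diff_right inner_sum_left inner_sum_right
            proj_self_adj[OF Ub] proj_self_adj[OF Eb] proj_self_adj[OF Rb])
      have d: "disjoint_family_on E {..<n}" using E(2) by (auto simp: disjoint_family_on_def)
      have "measure (spm x) (\<Union>i<n. E i) = (\<Sum>i<n. measure (spm x) (E i))"
        by (rule spm.finite_measure_finite_Union) (use d in auto)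
      moreover have "measure (spm x) (R n) = measure (spm x) (\<Union>i. E i) - measure (spm x) (\<Union>i<n. E i)"
        unfolding R_def by (rule spm.finite_measure_Diff) auto
      ultimately show "inner x (proj (\<Union>i. E i) x - (\<Sum>i<n. proj (E i) x) - proj (R n) x) = 0"
        by (simp add: inner_diff_right inner_sum_right proj_norm_form(1)[OF Ub] proj_norm_form(1)[OF Eb] proj_norm_form(1)[OF Rb])
    qed
    then show ?thesis by simp
  qed
  have "(\<lambda>n. measure (spm x) (R n)) \<longlonglongrightarrow> measure (spm x) (\<Inter>n. R n)"
    by (rule spm.finite_Lim_measure_decseq) (auto simp: decseq_def R_def)
  moreover have "(\<Inter>n. R n) = {}" by (auto simp: R_def)
  ultimately have "(\<lambda>n. measure (spm x) (R n)) \<longlonglongrightarrow> 0" by simp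
  from tendsto_real_sqrt[OF this]
  have "(\<lambda>n. norm (proj (R n) x)) \<longlonglongrightarrow> 0"
    by (simp add: proj_norm_form(2)[OF Rb, symmetric])
  then show "(\<lambda>n. norm (proj (\<Union>i. E i) x - (\<Sum>i<n. proj (E i) x))) \<longlonglongrightarrow> 0"
    by (simp add: eq)
qed

end

text \<open>Polarization produces differences of measures. With the negative terms moved across, the
  identity involves sums only, and the usual induction over nonnegative functions applies.\<close>

lemma nn_integral_add_measures:
  fixes f :: "'a::topological_space \<Rightarrow> ennreal"
  assumes s: "sets M1 = sets borel" "sets M2 = sets borel" "sets N1 = sets borel" "sets N2 = sets borel"
    and e: "\<And>C. C \<in> sets borel \<Longrightarrow> emeasure M1 C + emeasure M2 C = emeasure N1 C + emeasure N2 C"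
    and f: "f \<in> borel_measurable borel"
  shows "(\<integral>\<^sup>+t. f t \<partial>M1) + (\<integral>\<^sup>+t. f t \<partial>M2) = (\<integral>\<^sup>+t. f t \<partial>N1) + (\<integral>\<^sup>+t. f t \<partial>N2)"
proof -
  have mb: "u \<in> borel_measurable M" if "u \<in> borel_measurable borel" "sets M = sets borel"
    for u :: "'a \<Rightarrow> ennreal" and M
    using that by (simp cong: measurable_cong_sets)
  from f show ?thesis
proof (induction rule: borel_measurable_induct)
  case (cong f g)
  then have "f = g" by (auto simp: fun_eq_iff)
  then show ?case using cong by simp
next
  case (set A)
  then show ?case using e[of A] s by simp
next
  case (mult u c)
  have "u \<in> borel_measurable borel" by fact
  from mb[OF this] show ?case using mult.IH s by (simp add: nn_integral_cmult flip: distrib_left)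
next
  case (add u v)
  have "u \<in> borel_measurable borel" "v \<in> borel_measurable borel" by fact+
  from mb[OF this(1)] mb[OF this(2)]
  have *: "(\<integral>\<^sup>+t. v t + u t \<partial>M) = (\<integral>\<^sup>+t. v t \<partial>M) + (\<integral>\<^sup>+t. u t \<partial>M)" if "sets M = sets borel" for M :: "_ measure"
    using that by (intro nn_integral_add)
  have swap: "(a + b) + (c + d) = (a + c) + (b + d)" for a b c d :: ennreal by (simp only: ac_simps)
  show ?case
    unfolding *[OF s(1)] *[OF s(2)] *[OF s(3)] *[OF s(4)]
    by (subst (1 2) swap) (simp only: add.IH)
next
  case (seq U)
  have "U i \<in> borel_measurable borel" for i by fact
  note m = mb[OF this]
  have S: "(\<integral>\<^sup>+t. (SUP i. U i) t \<partial>M) = (SUP i. \<integral>\<^sup>+t. U i t \<partial>M)" if "sets M = sets borel" for M :: "_ measure"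
    using nn_integral_monotone_convergence_SUP[OF \<open>incseq U\<close> m[OF that]] by (simp add: SUP_apply image_comp)
  have mono: "incseq (\<lambda>i. \<integral>\<^sup>+t. U i t \<partial>M)" for M :: "_ measure"
    using \<open>incseq U\<close> by (auto simp: incseq_def le_fun_def intro!: nn_integral_mono)
  show ?case
    unfolding S[OF s(1)] S[OF s(2)] S[OF s(3)] S[OF s(4)]
    by (subst (1 2) ennreal_SUP_add[OF mono mono, symmetric]) (simp add: seq.IH)
qed
qed

lemma integral_add_measures:
  fixes f :: "_ \<Rightarrow> real"
  assumes s: "sets M1 = sets borel" "sets M2 = sets borel" "sets N1 = sets borel" "sets N2 = sets borel"
    and e: "\<And>C. C \<in> sets borel \<Longrightarrow> emeasure M1 C + emeasure M2 C = emeasure N1 C + emeasure N2 C"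
    and i: "integrable M1 f" "integrable M2 f" "integrable N1 f" "integrable N2 f"
  shows "integral\<^sup>L M1 f + integral\<^sup>L M2 f = integral\<^sup>L N1 f + integral\<^sup>L N2 f"
proof -
  have fb: "f \<in> borel_measurable borel"
    using borel_measurable_integrable[OF i(1)] s(1) measurable_cong_sets by blast
  have fin: "(\<integral>\<^sup>+t. ennreal (f t) \<partial>M) < \<infinity>" "(\<integral>\<^sup>+t. ennreal (- f t) \<partial>M) < \<infinity>"
    if "integrable M f" for M
    using that by (auto simp: real_integrable_def less_top)
  have p: "(\<integral>\<^sup>+t. ennreal (f t) \<partial>M1) + (\<integral>\<^sup>+t. ennreal (f t) \<partial>M2) = (\<integral>\<^sup>+t. ennreal (f t) \<partial>N1) + (\<integral>\<^sup>+t. ennreal (f t) \<partial>N2)"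
    "(\<integral>\<^sup>+t. ennreal (- f t) \<partial>M1) + (\<integral>\<^sup>+t. ennreal (- f t) \<partial>M2) = (\<integral>\<^sup>+t. ennreal (- f t) \<partial>N1) + (\<integral>\<^sup>+t. ennreal (- f t) \<partial>N2)"
    by (rule nn_integral_add_measures[OF s e], assumption, use fb in measurable)+
  have r: "enn2real (a + b) = enn2real a + enn2real b" if "a < \<infinity>" "b < \<infinity>" for a b
    using that by (intro enn2real_plus) auto
  from arg_cong[OF p(1), of enn2real] arg_cong[OF p(2), of enn2real] show ?thesis
    using fin[OF i(1)] fin[OF i(2)] fin[OF i(3)] fin[OF i(4)]
    by (simp add: r real_lebesgue_integral_def i)
qed

section \<open>Algebra of the projections and their scalar measures\<close>

context real_pvm
begin

text \<open>For the constant sequence of empty sets, additivity forces |1 - n| times the norm of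
  this vector to tend to 0.\<close>

lemma P_empty: "P {} x = 0"
proof -
  have "(\<lambda>n. norm (P {} x - (\<Sum>i<n. P {} x))) \<longlonglongrightarrow> 0"
    using sums_norm[of "\<lambda>_. {}" x] by (simp add: disjoint_family_on_def)
  moreover have "norm (P {} x - (\<Sum>i<n. P {} x)) = \<bar>1 - real n\<bar> * norm (P {} x)" for n
  proof -
    have "P {} x - (\<Sum>i<n. P {} x) = (1 - real n) *\<^sub>R P {} x"
      by (simp add: scaleR_left_diff_distrib sum_constant_scaleR)
    then show ?thesis by simp
  qed
  \<comment> \<open>The shift by 2 keeps the factor at least 1.\<close>
  ultimately have "(\<lambda>n. \<bar>1 - real (n + 2)\<bar> * norm (P {} x)) \<longlonglongrightarrow> 0"
    by (subst LIMSEQ_ignore_initial_segment) auto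
  then have "norm (P {} x) \<le> 0"
  proof (rule tendsto_lowerbound)
    have "1 * norm (P {} x) \<le> \<bar>1 - real (n + 2)\<bar> * norm (P {} x)" for n
      by (intro mult_right_mono) auto
    then show "\<forall>\<^sub>F n in sequentially. norm (P {} x) \<le> \<bar>1 - real (n + 2)\<bar> * norm (P {} x)" by simp
  qed simp
  then show ?thesis by simp
qed

lemma P_Un:
  assumes "A \<in> sets borel" "B \<in> sets borel" "A \<inter> B = {}"
  shows "P (A \<union> B) x = P A x + P B x"
proof -
  have "(\<lambda>n. norm (P (\<Union>i. binaryset A B i) x - (\<Sum>i<n. P (binaryset A B i) x))) \<longlonglongrightarrow> 0"
    using assms by (intro sums_norm) (auto simp: range_binaryset_eq disjoint_family_on_def binaryset_def)
  then have "(\<lambda>n. norm (P (A \<union> B) x - (\<Sum>i<n+2. P (binaryset A B i) x))) \<longlonglongrightarrow> 0"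
    by (subst (asm) UN_binaryset_eq) (rule LIMSEQ_ignore_initial_segment)
  moreover have "(\<Sum>i<n+2. P (binaryset A B i) x) = P A x + P B x" for n
  proof (induction n)
    case 0 show ?case by (simp add: binaryset_def numeral_2_eq_2)
  next
    case (Suc n) then show ?case by (simp add: binaryset_def P_empty)
  qed
  ultimately show ?thesis by (simp add: LIMSEQ_const_iff)
qed

lemma P_Compl:
  assumes "B \<in> sets borel" shows "P (- B) x = x - P B x"
proof -
  have "P (B \<union> - B) x = P B x + P (- B) x"
    using assms by (intro P_Un) (auto simp: Compl_eq_Diff_UNIV)
  then show ?thesis by (metis P_UNIV Compl_partition add_diff_cancel_left')
qed

text \<open>The sum of the two projections is idempotent, so they anticommute. Multiplying this
  relation by \<open>P A\<close> shows that they also commute, hence the products vanish.\<close>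

lemma P_disjoint:
  assumes A: "A \<in> sets borel" and B: "B \<in> sets borel" and d: "A \<inter> B = {}"
  shows "P A (P B x) = 0"
proof -
  interpret LA: linear "P A" by (rule linear_P[OF A])
  interpret LB: linear "P B" by (rule linear_P[OF B])
  have AB: "A \<union> B \<in> sets borel" using A B by auto
  have "P (A \<union> B) (P (A \<union> B) x) = P (A \<union> B) x" by (rule idem[OF AB])
  then have s: "P A (P B x) + P B (P A x) = 0" for x
    using idem[OF AB, of x] by (simp add: P_Un[OF A B d] LA.add LB.add idem A B)
  have "P A (P B (P A x)) = - P A (P B x)" for x
    using arg_cong[OF s[of x], of "P A"] by (simp add: LA.add LA.zero idem[OF A] eq_neg_iff_add_eq_0 add.commute)
  moreover have "P A (P B (P A x)) = - P B (P A x)" for x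
    using s[of "P A x"] by (simp add: idem[OF A] eq_neg_iff_add_eq_0)
  ultimately have "P A (P B x) = P B (P A x)" by (metis minus_minus)
  with s[of x] have "2 *\<^sub>R P A (P B x) = 0" by (simp add: scaleR_2)
  then show ?thesis by simp
qed

lemma P_Int:
  assumes A: "A \<in> sets borel" and B: "B \<in> sets borel"
  shows "P A (P B x) = P (A \<inter> B) x"
proof -
  have i: "A \<inter> B \<in> sets borel" "B - A \<in> sets borel" "A - B \<in> sets borel" using A B by auto
  interpret LA: linear "P A" by (rule linear_P[OF A])
  have "B = (A \<inter> B) \<union> (B - A)" by auto
  then have "P B x = P (A \<inter> B) x + P (B - A) x" using P_Un[OF i(1,2)] by (metis Diff_disjoint Int_Diff Int_assoc inf_commute)
  then have "P A (P B x) = P A (P (A \<inter> B) x)"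
    using P_disjoint[OF A i(2)] by (simp add: LA.add Int_Diff)
  also have "P A y = P (A \<inter> B) y + P (A - B) y" for y
    using P_Un[OF i(1,3)] by (metis Diff_Int2 Diff_disjoint Int_Diff Int_Diff_Un Int_absorb inf_commute)
  finally show ?thesis
    using P_disjoint[OF i(3,1)] idem[OF i(1)] by (simp add: Int_assoc[symmetric]) auto
qed

lemma inner_P: "B \<in> sets borel \<Longrightarrow> inner x (P B x) = (norm (P B x))\<^sup>2"
  by (metis idem self_adj power2_norm_eq_inner)

definition pm :: "'h \<Rightarrow> real measure" where
  "pm x = measure_of UNIV (sets borel) (\<lambda>B. ennreal (inner x (P B x)))"

lemma sets_pm [measurable_cong, simp]: "sets (pm x) = sets borel"
  unfolding pm_def by (metis sets.top sets.sets_measure_of_eq sets_measure_of_conv space_borel)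

lemma space_pm [simp]: "space (pm x) = UNIV"
  using sets_eq_imp_space_eq[OF sets_pm[of x]] by simp

lemma emeasure_pm:
  assumes "B \<in> sets borel"
  shows "emeasure (pm x) B = ennreal (inner x (P B x))"
proof (rule emeasure_measure_of[OF pm_def])
  show "positive (sets (pm x)) (\<lambda>B. ennreal (inner x (P B x)))"
    by (simp add: positive_def P_empty)
  show "countably_additive (sets (pm x)) (\<lambda>B. ennreal (inner x (P B x)))"
  proof (rule countably_additiveI)
    fix E :: "nat \<Rightarrow> real set" assume E: "range E \<subseteq> sets (pm x)" "disjoint_family E"
    then have Eb: "\<And>i. E i \<in> sets borel" by auto
    have "(\<lambda>n. norm (P (\<Union>i. E i) x - (\<Sum>i<n. P (E i) x))) \<longlonglongrightarrow> 0"
      using E by (intro sums_norm) auto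
    then have "(\<lambda>n. P (\<Union>i. E i) x - (\<Sum>i<n. P (E i) x)) \<longlonglongrightarrow> 0"
      by (simp add: tendsto_norm_zero_iff)
    then have "(\<lambda>n. inner x (P (\<Union>i. E i) x - (P (\<Union>i. E i) x - (\<Sum>i<n. P (E i) x)))) \<longlonglongrightarrow> inner x (P (\<Union>i. E i) x - 0)"
      by (intro tendsto_intros)
    then have "(\<lambda>i. inner x (P (E i) x)) sums inner x (P (\<Union>i. E i) x)"
      by (simp add: sums_def inner_sum_right)
    then show "(\<Sum>i. ennreal (inner x (P (E i) x))) = ennreal (inner x (P (\<Union> (range E)) x))"
      using inner_P[OF Eb] inner_P[of "\<Union> (range E)"] Eb by (intro sums_unique[symmetric] sums_ennreal[THEN iffD2]) (auto simp: inner_P)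
  qed
qed (use assms in auto)

sublocale pm: finite_measure "pm x" for x
  by (rule finite_measureI) (simp add: emeasure_pm)

lemma measure_pm: "B \<in> sets borel \<Longrightarrow> measure (pm x) B = (norm (P B x))\<^sup>2"
  by (simp add: measure_def emeasure_pm inner_P)

lemma P_eq_0_iff: "B \<in> sets borel \<Longrightarrow> P B x = 0 \<longleftrightarrow> emeasure (pm x) B = 0"
  by (simp add: emeasure_pm inner_P)

lemma pm_P:
  assumes B: "B \<in> sets borel"
  shows "pm (P B x) = density (pm x) (indicator B)"
proof (rule measure_eqI)
  fix C assume "C \<in> sets (pm (P B x))"
  then have C: "C \<in> sets borel" by simp
  have "P C (P B x) = P (B \<inter> C) x" using P_Int[OF C B] by (simp add: Int_commute)
  then have "emeasure (pm (P B x)) C = emeasure (pm x) (B \<inter> C)"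
    using B C inner_P[OF C, of "P B x"] inner_P[of "B \<inter> C" x] by (simp add: emeasure_pm)
  also have "\<dots> = emeasure (density (pm x) (indicator B)) C"
    using B C by (simp add: emeasure_density indicator_inter_arith[symmetric])
  finally show "emeasure (pm (P B x)) C = emeasure (density (pm x) (indicator B)) C" .
qed simp

lemma integral_pm_P:
  fixes f :: "real \<Rightarrow> real"
  assumes B: "B \<in> sets borel" and [measurable]: "f \<in> borel_measurable borel"
  shows "integral\<^sup>L (pm (P B x)) f = (\<integral>t. indicator B t * f t \<partial>pm x)"
proof -
  have "(indicator B :: real \<Rightarrow> ennreal) = (\<lambda>t. ennreal (indicator B t))"
    by (auto simp: fun_eq_iff indicator_def)
  then have "pm (P B x) = density (pm x) (\<lambda>t. ennreal (indicator B t))" by (simp add: pm_P[OF B])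
  then show ?thesis using B by (simp add: integral_density)
qed

end

text \<open>For an operator defined everywhere, \<open>spectral_resolution_of\<close> ties
  \<open>A\<close> to the projections only through these moment conditions. That \<open>A\<close>
  commutes with them and acts as multiplication by t has to be extracted from quadratic
  forms.\<close>

locale real_resolution = real_pvm P
  for P :: "real set \<Rightarrow> 'h::real_inner \<Rightarrow> 'h" +
  fixes A :: "'h \<Rightarrow> 'h"
  assumes A: "symmetric_op A"
    and second_moment: "(\<integral>\<^sup>+t. ennreal (t\<^sup>2) \<partial>pm x) < \<infinity>"
    and first_moment: "inner x (A x) = (\<integral>t. t \<partial>pm x)"
begin

lemma linear_A: "linear A" and A_sym: "inner x (A y) = inner (A x) y"
  using symmetric_opD[OF A] by auto

interpretation A: linear A by (rule linear_A)

lemma integrable_sq: "integrable (pm x) (\<lambda>t. (t - c)\<^sup>2)"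
  and integrable_lin: "integrable (pm x) (\<lambda>t. t - c)"
  and integrable_id: "integrable (pm x) (\<lambda>t. t)"
proof -
  have sq: "integrable (pm x) (\<lambda>t. t\<^sup>2)"
    using second_moment[of x] by (intro integrableI_bounded) auto
  show id: "integrable (pm x) (\<lambda>t. t)"
  proof (rule Bochner_Integration.integrable_bound[of _ "\<lambda>t. 1 + t\<^sup>2"])
    show "AE t in pm x. norm t \<le> norm (1 + t\<^sup>2)"
    proof (rule AE_I2)
      fix t :: real
      have "0 \<le> (\<bar>t\<bar> - 1)\<^sup>2 + t\<^sup>2 + 1" by simp
      then show "norm t \<le> norm (1 + t\<^sup>2)" by (simp add: power2_eq_square algebra_simps flip: abs_mult)
    qed
  qed (use sq in auto)
  then show "integrable (pm x) (\<lambda>t. t - c)" by auto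
  have "integrable (pm x) (\<lambda>t. t\<^sup>2 - 2 * c * t + c\<^sup>2)" using sq id by auto
  then show "integrable (pm x) (\<lambda>t. (t - c)\<^sup>2)"
    by (rule Bochner_Integration.integrable_cong[THEN iffD1, rotated 2]) (auto simp: power2_eq_square algebra_simps)
qed

lemma first_moment_shift: "inner x (A x - c *\<^sub>R x) = (\<integral>t. t - c \<partial>pm x)"
proof -
  have "measure (pm x) UNIV = inner x x" by (simp add: measure_pm P_UNIV power2_norm_eq_inner)
  then show ?thesis using integrable_id[of x] by (simp add: inner_diff_right first_moment)
qed

text \<open>For a in the range of \<open>P B\<close> and b in that of \<open>P (- B)\<close>,
  \<open>pm (a + b)\<close> is the sum of \<open>pm a\<close> and \<open>pm b\<close>. By the first
  moments the form of \<open>A\<close> is additive as well, so its cross term vanishes.\<close>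

lemma A_orthogonal:
  assumes B: "B \<in> sets borel"
  shows "inner (P B x) (A (P (- B) y)) = 0"
proof -
  have nB: "- B \<in> sets borel" using B by (auto simp: Compl_eq_Diff_UNIV)
  let ?a = "P B x" and ?b = "P (- B) y"
  \<comment> \<open>\<open>pm 0\<close> has no mass and only pads the right side to two
    measures.\<close>
  have "integral\<^sup>L (pm ?a) (\<lambda>t. t) + integral\<^sup>L (pm ?b) (\<lambda>t. t)
     = integral\<^sup>L (pm (?a + ?b)) (\<lambda>t. t) + integral\<^sup>L (pm 0) (\<lambda>t. t)"
  proof (rule integral_add_measures)
    fix C :: "real set" assume C: "C \<in> sets borel"
    have "inner (P C ?a) (P C ?b) = inner x (P (B \<inter> C \<inter> C \<inter> - B) y)"
      using B C nB by (simp add: P_Int self_adj[symmetric] Int_assoc)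
    also have "B \<inter> C \<inter> C \<inter> - B = {}" by auto
    finally have "inner (P C ?a) (P C ?b) = 0" by (simp add: P_empty)
    then have "(norm (P C (?a + ?b)))\<^sup>2 = (norm (P C ?a))\<^sup>2 + (norm (P C ?b))\<^sup>2"
      by (simp add: linear_add[OF linear_P[OF C]] power2_norm_eq_inner inner_add_left inner_add_right inner_commute)
    then show "emeasure (pm ?a) C + emeasure (pm ?b) C = emeasure (pm (?a + ?b)) C + emeasure (pm 0) C"
      using C by (simp add: emeasure_pm inner_P flip: ennreal_plus)
  qed (auto intro: integrable_id)
  then have "inner ?a (A ?a) + inner ?b (A ?b) = inner (?a + ?b) (A (?a + ?b))"
    using first_moment[of 0] by (simp add: first_moment)
  then have "inner ?a (A ?b) + inner ?b (A ?a) = 0"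
    by (simp add: A.add inner_add_left inner_add_right)
  moreover have "inner ?b (A ?a) = inner ?a (A ?b)" by (metis A_sym inner_commute)
  ultimately show ?thesis by simp
qed

text \<open>Testing the orthogonality on the image itself shows that \<open>A\<close> maps the
  ranges of \<open>P B\<close> and \<open>P (- B)\<close> into themselves.\<close>

lemma A_commute:
  assumes B: "B \<in> sets borel"
  shows "A (P B x) = P B (A x)"
proof -
  have nB: "- B \<in> sets borel" using B by (auto simp: Compl_eq_Diff_UNIV)
  have 1: "P B (A (P (- B) x)) = 0" for x
    using A_orthogonal[OF B, of "A (P (- B) x)" x] 
    by (simp add: self_adj[OF B, symmetric] inner_P[OF B])
  have 2: "P (- B) (A (P B x)) = 0" for x
    using A_orthogonal[OF nB, of "A (P B x)" x]
    by (simp add: self_adj[OF nB, symmetric] inner_P[OF nB])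
  have "A (P B x) = P B (A (P B x))"
    using 2[of x] P_Compl[OF B, of "A (P B x)"] by simp
  also have "\<dots> = P B (A (P B x + P (- B) x))"
    using 1[of x] by (simp add: A.add linear_add[OF linear_P[OF B]])
  also have "P B x + P (- B) x = x" by (simp add: P_Compl[OF B])
  finally show ?thesis .
qed

lemma shift_commute:
  assumes B: "B \<in> sets borel"
  shows "A (P B x) - c *\<^sub>R P B x = P B (A x - c *\<^sub>R x)"
  using A_commute[OF B] by (simp add: linear_diff[OF linear_P[OF B]] linear_scale[OF linear_P[OF B]])

text \<open>Put y = (A - c) x. The form of A - c on \<open>P C x\<close> shows that C -> <y, P C x>
  has density t - c against \<open>pm x\<close>. Polarization expresses it by
  \<open>pm (y + x)\<close> and \<open>pm (y - x)\<close>, and integrating t - c once more yields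
  <y, (A - c) x> on one side and the second moment on the other.\<close>

lemma norm_shift: "(norm (A x - c *\<^sub>R x))\<^sup>2 = (\<integral>t. (t - c)\<^sup>2 \<partial>pm x)"
proof -
  define y where "y = A x - c *\<^sub>R x"
  define f where "f t = t - c" for t :: real
  \<comment> \<open>Positive and negative part of t - c, with the factor 4 of polarization, so that
    both are densities of measures.\<close>
  define fp where "fp t = 4 * max 0 (f t)" for t
  define fm where "fm t = 4 * max 0 (- f t)" for t
  have fb [measurable]: "f \<in> borel_measurable borel" "fp \<in> borel_measurable borel" "fm \<in> borel_measurable borel"
    unfolding f_def fp_def fm_def by measurable
  have fi: "integrable (pm z) f" for z unfolding f_def by (rule integrable_lin)
  have fpi: "integrable (pm z) fp" "integrable (pm z) fm" for z
    unfolding fp_def fm_def using fi by (auto intro!: integrable_mult_right integrable_max)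
  have f2: "fp t * f t = 4 * (max 0 (f t))\<^sup>2" "fm t * f t = - (4 * (max 0 (- f t))\<^sup>2)" for t
    by (auto simp: fp_def fm_def max_def power2_eq_square)
  have sqi: "integrable (pm x) (\<lambda>t. fp t * f t)" "integrable (pm x) (\<lambda>t. fm t * f t)"
  proof -
    have b: "norm (fp t * f t) \<le> norm (4 * (t - c)\<^sup>2)" "norm (fm t * f t) \<le> norm (4 * (t - c)\<^sup>2)" for t
      unfolding f2 by (auto simp: f_def max_def power2_commute[of c])
    show "integrable (pm x) (\<lambda>t. fp t * f t)" "integrable (pm x) (\<lambda>t. fm t * f t)"
      using b by (auto intro!: Bochner_Integration.integrable_bound[OF integrable_mult_right[OF integrable_sq[of x c], of 4]])
  qed
  have S: "inner z (A z - c *\<^sub>R z) = integral\<^sup>L (pm z) f" for z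
    unfolding f_def by (rule first_moment_shift)
  have nn: "0 \<le> fp t" "0 \<le> fm t" for t by (auto simp: fp_def fm_def)
  have "integral\<^sup>L (pm (y + x)) f + integral\<^sup>L (density (pm x) fm) f
     = integral\<^sup>L (pm (y - x)) f + integral\<^sup>L (density (pm x) fp) f"
  proof (rule integral_add_measures)
    fix C :: "real set" assume C: "C \<in> sets borel"
    have "integral\<^sup>L (pm (P C x)) f = inner (P C x) (P C y)"
      unfolding S[symmetric] y_def shift_commute[OF C] ..
    also have "\<dots> = inner y (P C x)" by (metis idem[OF C] self_adj[OF C] inner_commute)
    also have "integral\<^sup>L (pm (P C x)) f = (\<integral>t. indicator C t * f t \<partial>pm x)"
      using C by (rule integral_pm_P) measurable
    finally have eq: "inner y (P C x) = (\<integral>t. indicator C t * f t \<partial>pm x)" ..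
    have ci: "integrable (pm x) (\<lambda>t. indicator C t * g t)" if "integrable (pm x) g" for g :: "real \<Rightarrow> real"
      using integrable_mult_indicator[OF _ that, of C] C by simp
    have "4 * (\<integral>t. indicator C t * f t \<partial>pm x) = (\<integral>t. indicator C t * fp t - indicator C t * fm t \<partial>pm x)"
    proof -
      have "indicator C t * fp t - indicator C t * fm t = 4 * (indicator C t * f t)" for t
        by (simp add: fp_def fm_def max_def)
      then show ?thesis by simp
    qed
    also have "\<dots> = (\<integral>t. indicator C t * fp t \<partial>pm x) - (\<integral>t. indicator C t * fm t \<partial>pm x)"
      by (intro Bochner_Integration.integral_diff ci fpi)
    finally have eq2: "4 * inner y (P C x) = (\<integral>t. indicator C t * fp t \<partial>pm x) - (\<integral>t. indicator C t * fm t \<partial>pm x)"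
      by (simp add: eq)
    have d: "emeasure (density (pm x) g) C = ennreal (\<integral>t. indicator C t * g t \<partial>pm x)"
      "0 \<le> (\<integral>t. indicator C t * g t \<partial>pm x)"
      if g: "integrable (pm x) g" "\<And>t. 0 \<le> g t" for g :: "real \<Rightarrow> real"
    proof -
      have [measurable]: "g \<in> borel_measurable borel"
        using borel_measurable_integrable[OF g(1)] by (simp add: measurable_cong_sets[OF sets_pm refl])
      have "emeasure (density (pm x) g) C = (\<integral>\<^sup>+t. ennreal (indicator C t * g t) \<partial>pm x)"
        using C by (subst emeasure_density) (auto intro!: nn_integral_cong simp: indicator_def)
      also have "\<dots> = ennreal (\<integral>t. indicator C t * g t \<partial>pm x)"
        using g ci[OF g(1)] by (intro nn_integral_eq_integral) (auto simp: indicator_def)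
      finally show "emeasure (density (pm x) g) C = ennreal (\<integral>t. indicator C t * g t \<partial>pm x)" .
      show "0 \<le> (\<integral>t. indicator C t * g t \<partial>pm x)"
        using g by (intro integral_nonneg_AE) (auto simp: indicator_def)
    qed
    have i: "inner (P C y) (P C x) = inner y (P C x)" by (metis idem[OF C] self_adj[OF C])
    have n: "(norm (P C (y + x)))\<^sup>2 = (norm (P C (y - x)))\<^sup>2 + 4 * inner y (P C x)"
      using i
      by (simp add: linear_add[OF linear_P[OF C]] linear_diff[OF linear_P[OF C]] power2_norm_eq_inner
          inner_add_left inner_add_right inner_diff_left inner_diff_right inner_commute)
    show "emeasure (pm (y + x)) C + emeasure (density (pm x) fm) C
        = emeasure (pm (y - x)) C + emeasure (density (pm x) fp) C"
    proof -
      have "(norm (P C (y + x)))\<^sup>2 + (\<integral>t. indicator C t * fm t \<partial>pm x)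
         = (norm (P C (y - x)))\<^sup>2 + (\<integral>t. indicator C t * fp t \<partial>pm x)"
        using n eq2 by linarith
      then show ?thesis
        unfolding d(1)[OF fpi(1) nn(1)] d(1)[OF fpi(2) nn(2)] emeasure_pm[OF C] inner_P[OF C]
        using d(2)[OF fpi(1) nn(1)] d(2)[OF fpi(2) nn(2)] by (simp flip: ennreal_plus)
    qed
  next
    show "integrable (density (pm x) (\<lambda>t. ennreal (fm t))) f"
      using sqi nn by (subst integrable_density) auto
    show "integrable (density (pm x) (\<lambda>t. ennreal (fp t))) f"
      using sqi nn by (subst integrable_density) auto
  qed (auto intro: fi)
  moreover have "integral\<^sup>L (density (pm x) fm) f = (\<integral>t. fm t * f t \<partial>pm x)"
    using nn by (subst integral_density) auto
  moreover have "integral\<^sup>L (density (pm x) fp) f = (\<integral>t. fp t * f t \<partial>pm x)"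
    using nn by (subst integral_density) auto
  moreover have "(\<integral>t. fp t * f t \<partial>pm x) - (\<integral>t. fm t * f t \<partial>pm x) = 4 * (\<integral>t. (t - c)\<^sup>2 \<partial>pm x)"
  proof -
    have "(\<integral>t. fp t * f t \<partial>pm x) - (\<integral>t. fm t * f t \<partial>pm x) = (\<integral>t. fp t * f t - fm t * f t \<partial>pm x)"
      using sqi by simp
    also have "\<dots> = (\<integral>t. 4 * (t - c)\<^sup>2 \<partial>pm x)"
      by (intro Bochner_Integration.integral_cong) (auto simp: f_def fp_def fm_def max_def power2_eq_square algebra_simps)
    finally show ?thesis by simp
  qed
  ultimately have "inner (y + x) (A (y + x) - c *\<^sub>R (y + x)) - inner (y - x) (A (y - x) - c *\<^sub>R (y - x))
     = 4 * (\<integral>t. (t - c)\<^sup>2 \<partial>pm x)"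
    unfolding S by simp
  moreover have "inner (y + x) (A (y + x) - c *\<^sub>R (y + x)) - inner (y - x) (A (y - x) - c *\<^sub>R (y - x)) = 4 * inner y y"
  proof -
    have "inner x (A y) = inner y (A x)" by (metis A_sym inner_commute)
    then show ?thesis
      by (simp add: A.add A.diff y_def[symmetric] inner_add_left inner_add_right inner_diff_left inner_diff_right
        algebra_simps inner_commute[of x y]) (simp add: y_def inner_diff_left inner_diff_right inner_commute algebra_simps)
  qed
  ultimately show ?thesis by (simp add: y_def power2_norm_eq_inner)
qed

lemma pm_shift:
  assumes C: "C \<in> sets borel"
  shows "emeasure (pm (A x - c *\<^sub>R x)) C = (\<integral>\<^sup>+t. ennreal ((t - c)\<^sup>2) * indicator C t \<partial>pm x)"
proof -
  have "emeasure (pm (A x - c *\<^sub>R x)) C = ennreal ((norm (P C (A x - c *\<^sub>R x)))\<^sup>2)"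
    using C by (simp add: emeasure_pm inner_P)
  also have "\<dots> = ennreal (\<integral>t. (t - c)\<^sup>2 \<partial>pm (P C x))"
    by (simp add: shift_commute[OF C, symmetric] norm_shift)
  also have "\<dots> = (\<integral>\<^sup>+t. ennreal ((t - c)\<^sup>2) \<partial>pm (P C x))"
    by (rule nn_integral_eq_integral[symmetric]) (auto intro: integrable_sq)
  also have "\<dots> = (\<integral>\<^sup>+t. ennreal ((t - c)\<^sup>2) * indicator C t \<partial>pm x)"
    using C by (simp add: pm_P nn_integral_density mult.commute)
  finally show ?thesis .
qed

end

subsection \<open>Resolvents and the Poisson integral of the spectral measure\<close>

text \<open>\<open>J\<close> is multiplication by i on the underlying real space; below,
  \<open>S c\<close> minus e times \<open>J\<close> is the operator minus the complex number c + i
  e.\<close>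

locale complex_resolution = real_resolution P A
  for P :: "real set \<Rightarrow> 'h::{real_inner,complete_space} \<Rightarrow> 'h" and A :: "'h \<Rightarrow> 'h" +
  fixes J :: "'h \<Rightarrow> 'h"
  assumes linear_J: "linear J" and J_iso: "inner (J x) (J y) = inner x y" and J_J: "J (J x) = - x"
    and J_A: "J (A x) = A (J x)" and J_P: "B \<in> sets borel \<Longrightarrow> J (P B x) = P B (J x)"
begin

interpretation A: linear A by (rule linear_A)
interpretation J: linear J by (rule linear_J)

definition S :: "real \<Rightarrow> 'h \<Rightarrow> 'h" where "S c x = A x - c *\<^sub>R x"

lemma S_sym: "inner x (S c y) = inner (S c x) y"
  by (simp add: S_def inner_diff_left inner_diff_right A_sym)

lemma linear_S: "linear (S c)"
  unfolding S_def by (rule linearI) (auto simp: A.add A.scale algebra_simps)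

lemma S_P: "B \<in> sets borel \<Longrightarrow> S c (P B x) = P B (S c x)"
  unfolding S_def by (rule shift_commute)

lemma J_S: "J (S c x) = S c (J x)"
  by (simp add: S_def J.diff J.scale J_A)

lemma norm_S: "(norm (S c x))\<^sup>2 = (\<integral>t. (t - c)\<^sup>2 \<partial>pm x)"
  unfolding S_def by (rule norm_shift)

text \<open>This says that the complex quadratic form of \<open>S c\<close> is real. Passing through
  \<open>J\<close>, which commutes with \<open>S c\<close> and squares to -1, changes the sign of
  the expression.\<close>

lemma S_J_orthogonal: "inner (S c x) (J x) = 0"
proof -
  have "inner (S c x) (J x) = inner (J (S c x)) (J (J x))" by (simp add: J_iso)
  also have "\<dots> = - inner (S c (J x)) x" by (simp add: J_J J_S)
  also have "\<dots> = - inner (S c x) (J x)" by (metis S_sym inner_commute)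
  finally show ?thesis by simp
qed

text \<open>Outside \<open>I\<close> the integrand (t - c)^2 is at least
  \<open>\<delta>\<^sup>2\<close>; the last term compensates for the mass inside
  \<open>I\<close>.\<close>

lemma S_lower:
  assumes I: "I \<in> sets borel" and \<delta>: "\<delta> > 0" "\<And>t. t \<notin> I \<Longrightarrow> \<delta> \<le> \<bar>t - c\<bar>"
  shows "\<delta>\<^sup>2 * (norm x)\<^sup>2 \<le> (norm (S c x))\<^sup>2 + \<delta>\<^sup>2 * (norm (P I x))\<^sup>2"
proof -
  have "\<delta>\<^sup>2 * (norm x)\<^sup>2 - \<delta>\<^sup>2 * (norm (P I x))\<^sup>2 = (\<integral>t. \<delta>\<^sup>2 - \<delta>\<^sup>2 * indicator I t \<partial>pm x)"
  proof -
    have "integrable (pm x) (\<lambda>t. \<delta>\<^sup>2 * indicator I t)"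
      using I by (intro integrable_mult_right integrable_real_indicator) (auto simp: pm.emeasure_finite less_top[symmetric])
    then have "(\<integral>t. \<delta>\<^sup>2 - \<delta>\<^sup>2 * indicator I t \<partial>pm x) = (\<integral>t. \<delta>\<^sup>2 \<partial>pm x) - (\<integral>t. \<delta>\<^sup>2 * indicator I t \<partial>pm x)"
      by (intro Bochner_Integration.integral_diff) auto
    then show ?thesis using I measure_pm[of UNIV x] measure_pm[OF I, of x] by (simp add: P_UNIV)
  qed
  also have "\<dots> \<le> (\<integral>t. (t - c)\<^sup>2 \<partial>pm x)"
  proof (rule integral_mono)
    fix t
    show "\<delta>\<^sup>2 - \<delta>\<^sup>2 * indicator I t \<le> (t - c)\<^sup>2"
      using \<delta>(2)[of t] \<delta>(1) by (auto simp: indicator_def abs_le_square_iff[of \<delta>, symmetric])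
  next
    show "integrable (pm x) (\<lambda>t. \<delta>\<^sup>2 - \<delta>\<^sup>2 * indicator I t)"
      using I by (intro Bochner_Integration.integrable_diff integrable_mult_right integrable_real_indicator)
        (auto simp: pm.emeasure_finite less_top[symmetric])
  qed (rule integrable_sq)
  also have "\<dots> = (norm (S c x))\<^sup>2" by (simp add: norm_S)
  finally show ?thesis by simp
qed

lemma S_bounded_below:
  assumes I: "I \<in> sets borel" and \<delta>: "\<delta> > 0" "\<And>t. t \<notin> I \<Longrightarrow> \<delta> \<le> \<bar>t - c\<bar>" and x: "P I x = 0"
  shows "\<delta> * norm x \<le> norm (S c x)"
proof (rule power2_le_imp_le)
  show "(\<delta> * norm x)\<^sup>2 \<le> (norm (S c x))\<^sup>2"
    using S_lower[OF I \<delta>, of x] by (simp add: x power_mult_distrib)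
qed simp

lemma bounded_linear_A: "bounded_linear A" using A by (simp add: symmetric_op_def)

lemma bounded_linear_S: "bounded_linear (S c)"
  unfolding S_def by (intro bounded_linear_sub bounded_linear_A bounded_linear_scaleR_right)

lemma bounded_linear_P:
  assumes B: "B \<in> sets borel" shows "bounded_linear (P B)"
proof (rule bounded_linear_intro[where K=1])
  interpret L: linear "P B" by (rule linear_P[OF B])
  show "P B (x + y) = P B x + P B y" "P B (r *\<^sub>R x) = r *\<^sub>R P B x" for x y r
    by (simp_all add: L.add L.scale)
  show "norm (P B x) \<le> norm x * 1" for x
  proof -
    have "(norm (P B x))\<^sup>2 \<le> (norm x)\<^sup>2"
      using pm.finite_measure_mono[of B UNIV x] B by (simp add: measure_pm P_UNIV)
    then show ?thesis by (simp only: mult_1_right) (rule power2_le_imp_le[OF _ norm_ge_zero])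
  qed
qed

lemma symmetric_SS: "symmetric_op (\<lambda>x. S c (S c x))"
  unfolding symmetric_op_def
  using bounded_linear_compose[OF bounded_linear_S bounded_linear_S] by (simp add: S_sym)

lemma inner_SS: "inner x (S c (S c x)) = (norm (S c x))\<^sup>2"
  by (simp add: S_sym power2_norm_eq_inner)

text \<open>The square of \<open>S c\<close> plus \<open>\<delta>\<^sup>2\<close> times
  \<open>P I\<close> is uniformly positive, so the equation with right side \<open>y\<close> has a
  solution \<open>w\<close>. It commutes with \<open>P I\<close>, hence \<open>P I w = 0\<close>,
  the added term drops out, and \<open>S c w\<close> is the preimage.\<close>

lemma S_surj_off:
  assumes I: "I \<in> sets borel" and \<delta>: "\<delta> > 0" "\<And>t. t \<notin> I \<Longrightarrow> \<delta> \<le> \<bar>t - c\<bar>" and y: "P I y = 0"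
  shows "\<exists>x. P I x = 0 \<and> S c x = y"
proof -
  define C where "C x = 1 *\<^sub>R S c (S c x) + \<delta>\<^sup>2 *\<^sub>R P I x" for x
  have "symmetric_op (P I)" using bounded_linear_P[OF I] self_adj[OF I] by (simp add: symmetric_op_def)
  then have C: "symmetric_op C"
    unfolding C_def by (intro symmetric_op_scale_add symmetric_SS)
  have low: "\<delta>\<^sup>2 * (norm x)\<^sup>2 \<le> inner x (C x)" for x
    using S_lower[OF I \<delta>, of x] by (simp add: C_def inner_add_right inner_SS inner_P[OF I])
  obtain w where w: "C w = y" using symmetric_op_surj[OF C _ low] \<delta> by auto
  have "C (P I w) = P I (C w)"
    using I by (simp add: C_def S_P linear_add[OF linear_P] linear_scale[OF linear_P])
  then have "C (P I w) = 0" using w y by simp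
  then have "\<delta>\<^sup>2 * (norm (P I w))\<^sup>2 \<le> 0" using low[of "P I w"] by simp
  then have Pw: "P I w = 0" using \<delta> by (simp add: mult_le_0_iff)
  then have "S c (S c w) = y" using w by (simp add: C_def)
  moreover have "P I (S c w) = 0" using S_P[OF I, of c w] Pw linear_0[OF linear_S] by simp
  ultimately show ?thesis by blast
qed

lemma norm_S_le:
  assumes \<eta>: "\<eta> > 0" and x: "P {c - \<eta><..<c + \<eta>} x = x"
  shows "norm (S c x) \<le> \<eta> * norm x"
proof (rule power2_le_imp_le)
  let ?B = "{c - \<eta><..<c + \<eta>}"
  have "(norm (S c x))\<^sup>2 = (\<integral>t. indicator ?B t * (t - c)\<^sup>2 \<partial>pm x)"
    using integral_pm_P[of ?B "\<lambda>t. (t - c)\<^sup>2" x] by (simp add: x norm_S)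
  also have "\<dots> \<le> (\<integral>t. \<eta>\<^sup>2 \<partial>pm x)"
  proof (rule integral_mono)
    show "integrable (pm x) (\<lambda>t. indicator ?B t * (t - c)\<^sup>2)"
      using integrable_mult_indicator[OF _ integrable_sq[of x c], of ?B] by simp
    fix t
    have "(t - c)\<^sup>2 \<le> \<eta>\<^sup>2" if "\<bar>t - c\<bar> \<le> \<bar>\<eta>\<bar>" using that by (simp only: abs_le_square_iff)
    then show "indicator ?B t * (t - c)\<^sup>2 \<le> \<eta>\<^sup>2"
      using \<eta> by (auto simp: indicator_def abs_le_iff)
  qed simp
  also have "\<dots> = (\<eta> * norm x)\<^sup>2"
    using measure_pm[of UNIV x] by (simp add: P_UNIV power_mult_distrib)
  finally show "(norm (S c x))\<^sup>2 \<le> (\<eta> * norm x)\<^sup>2" .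
qed (use \<eta> in simp)

text \<open>If v solves ((A - c)^2 + e^2) v = u, then w = (A - c) v + e J v is the resolvent at c +
  i e applied to u. Now \<open>pm u\<close> has density (t - c)^2 + e^2 against \<open>pm w\<close>,
  and dividing by this density recovers the squared norm of w.\<close>

lemma poisson_resolvent:
  assumes e: "e > 0"
  shows "\<exists>w. S c w - e *\<^sub>R J w = u \<and>
    ennreal ((norm w)\<^sup>2) = (\<integral>\<^sup>+t. ennreal (1 / ((t - c)\<^sup>2 + e\<^sup>2)) \<partial>pm u)"
proof -
  define C where "C x = 1 *\<^sub>R S c (S c x) + e\<^sup>2 *\<^sub>R x" for x
  have C: "symmetric_op C"
    unfolding C_def by (intro symmetric_op_scale_add symmetric_SS symmetric_op_id)
  have "e\<^sup>2 * (norm x)\<^sup>2 \<le> inner x (C x)" for x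
    by (simp add: C_def inner_add_right inner_SS power2_norm_eq_inner)
  then obtain v where v: "C v = u" using symmetric_op_surj[OF C, of "e\<^sup>2"] e by auto
  define w where "w = S c v + e *\<^sub>R J v"
  interpret S: linear "S c" by (rule linear_S)
  have w: "S c w - e *\<^sub>R J w = u"
    using v by (simp add: w_def C_def S.add S.scale J.add J.scale J_S J_J power2_eq_square algebra_simps)
  have pm_u: "emeasure (pm u) D = emeasure (density (pm w) (\<lambda>t. ennreal ((t - c)\<^sup>2 + e\<^sup>2))) D" if D: "D \<in> sets borel" for D
  proof -
    interpret L: linear "P D" by (rule linear_P[OF D])
    let ?z = "P D w"
    have "P D u = S c ?z - e *\<^sub>R J ?z"
      by (simp add: w[symmetric] L.diff L.scale S_P[OF D] J_P[OF D])
    then have "(norm (P D u))\<^sup>2 = (norm (S c ?z))\<^sup>2 + e\<^sup>2 * (norm ?z)\<^sup>2"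
      using S_J_orthogonal[of c ?z]
      by (simp add: power2_norm_eq_inner inner_diff_left inner_diff_right J_iso inner_commute)
        (simp add: power2_eq_square)
    also have "\<dots> = (\<integral>t. (t - c)\<^sup>2 + e\<^sup>2 \<partial>pm ?z)"
      using integrable_sq[of ?z c] measure_pm[of UNIV ?z] by (simp add: norm_S P_UNIV)
    finally have "emeasure (pm u) D = ennreal (\<integral>t. (t - c)\<^sup>2 + e\<^sup>2 \<partial>pm ?z)"
      using D by (simp add: emeasure_pm inner_P)
    also have "\<dots> = (\<integral>\<^sup>+t. ennreal ((t - c)\<^sup>2 + e\<^sup>2) \<partial>pm ?z)"
      using integrable_sq[of ?z c] by (intro nn_integral_eq_integral[symmetric]) auto
    also have "\<dots> = emeasure (density (pm w) (\<lambda>t. ennreal ((t - c)\<^sup>2 + e\<^sup>2))) D"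
      using D by (simp add: pm_P nn_integral_density emeasure_density mult.commute)
    finally show ?thesis .
  qed
  have "pm u = density (pm w) (\<lambda>t. ennreal ((t - c)\<^sup>2 + e\<^sup>2))"
    by (rule measure_eqI) (auto simp: pm_u)
  then have "(\<integral>\<^sup>+t. ennreal (1 / ((t - c)\<^sup>2 + e\<^sup>2)) \<partial>pm u)
     = (\<integral>\<^sup>+t. ennreal (1 / ((t - c)\<^sup>2 + e\<^sup>2)) \<partial>density (pm w) (\<lambda>t. ennreal ((t - c)\<^sup>2 + e\<^sup>2)))" by simp
  also have "\<dots> = (\<integral>\<^sup>+t. ennreal ((t - c)\<^sup>2 + e\<^sup>2) * ennreal (1 / ((t - c)\<^sup>2 + e\<^sup>2)) \<partial>pm w)"
    by (rule nn_integral_density) auto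
  also have "\<dots> = (\<integral>\<^sup>+t. 1 \<partial>pm w)"
  proof (rule nn_integral_cong)
    fix t
    have "(t - c)\<^sup>2 + e\<^sup>2 > 0" using e by (simp add: add_nonneg_pos)
    then show "ennreal ((t - c)\<^sup>2 + e\<^sup>2) * ennreal (1 / ((t - c)\<^sup>2 + e\<^sup>2)) = 1"
      by (subst ennreal_mult[symmetric]) (auto simp del: ennreal_plus)
  qed
  also have "\<dots> = ennreal ((norm w)\<^sup>2)"
    using emeasure_pm[of UNIV w] by (simp add: P_UNIV power2_norm_eq_inner)
  finally show ?thesis using w by auto
qed

end

subsection \<open>Boundary behaviour of Poisson integrals\<close>

lemma liminf_lessD:
  fixes x :: "nat \<Rightarrow> 'a::complete_linorder"
  assumes "liminf x < C" shows "\<exists>\<^sub>F k in sequentially. x k < C"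
proof (rule ccontr)
  assume "\<not> ?thesis"
  then have "\<forall>\<^sub>F k in sequentially. C \<le> x k"
    by (simp add: not_frequently not_less)
  then have "C \<le> liminf x" by (rule Liminf_bounded)
  with assms show False by simp
qed

lemma frequently_liminf_le:
  fixes x :: "nat \<Rightarrow> 'a::complete_linorder"
  assumes "\<exists>\<^sub>F k in sequentially. x k \<le> C" shows "liminf x \<le> C"
proof (rule ccontr)
  assume "\<not> ?thesis"
  then have "C < liminf x" by simp
  from less_LiminfD[OF this] have "\<forall>\<^sub>F k in sequentially. \<not> x k \<le> C" by (simp add: not_le)
  with assms show False by (simp add: frequently_def)
qed

text \<open>\<open>N\<close> is covered by an open set of small Lebesgue measure. The Poisson
  kernels centred at a point of this set have, in the end, integral at least 1 over it, so Fatou and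
  Fubini bound the measure of the set by integrals of \<open>g k\<close> over it. These are small
  because the \<open>g k\<close> are bounded in L2 along a subsequence.\<close>

lemma poisson_absolutely_continuous:
  fixes \<mu> :: "real measure" and g :: "nat \<Rightarrow> real \<Rightarrow> real"
  assumes \<mu>: "finite_measure \<mu>" and s [measurable_cong]: "sets \<mu> = sets borel"
    and gm [measurable]: "\<And>k. g k \<in> borel_measurable borel" and g0: "\<And>k c. 0 \<le> g k c"
    and bound: "\<And>k c. k > 0 \<Longrightarrow> c \<in> {a..b} \<Longrightarrow>
      (\<integral>\<^sup>+t. ennreal (1 / real k / ((t - c)\<^sup>2 + (1 / real k)\<^sup>2)) \<partial>\<mu>) \<le> ennreal (g k c)"
    and lim: "liminf (\<lambda>k. \<integral>\<^sup>+c\<in>{a..b}. ennreal ((g k c)\<^sup>2) \<partial>lborel) < \<infinity>"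
    and N: "N \<in> null_sets lborel" "N \<subseteq> {a<..<b}"
  shows "emeasure \<mu> N = 0"
proof -
  interpret finite_measure \<mu> by fact
  interpret pair_sigma_finite lborel \<mu> ..
  define L where "L = liminf (\<lambda>k. \<integral>\<^sup>+c\<in>{a..b}. ennreal ((g k c)\<^sup>2) \<partial>lborel)"
  \<comment> \<open>A finite number strictly above the lower limit, so that infinitely many
    \<open>k\<close> stay below it.\<close>
  define l where "l = enn2real L + 1"
  have l: "L < ennreal l" "l > 0"
  proof -
    have "L = ennreal (enn2real L)" using lim by (simp add: L_def less_top)
    also have "\<dots> < ennreal l" unfolding l_def by (rule ennreal_lessI) (auto simp: add_nonneg_pos)
    finally show "L < ennreal l" .
    show "l > 0" by (simp add: l_def add_nonneg_pos)
  qed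
  have "emeasure \<mu> N \<le> ennreal (s * (l + 1))" if s0: "s > 0" for s
  proof -
    have Nb: "N \<in> sets borel" using N by (auto simp: null_sets_def)
    have Nl: "N \<in> sets lborel" "emeasure lborel N = 0" using N by (auto simp: null_sets_def)
    \<comment> \<open>The tolerance is the square of \<open>s\<close> because the measure of the set
      is divided by \<open>s\<close> in the end.\<close>
    obtain U where U: "open U" "N \<subseteq> U" "emeasure lborel U < ennreal (s\<^sup>2)"
    proof -
      have "0 < s\<^sup>2" using s0 by simp
      then obtain U where U: "open U" "N \<subseteq> U" "U - N \<in> lmeasurable" "emeasure lebesgue (U - N) < ennreal (s\<^sup>2)"
        using sets_lebesgue_outer_open[of N "s\<^sup>2"] Nb by auto
      have "emeasure lborel U \<le> emeasure lborel (U - N) + emeasure lborel N"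
        using U(1,2) Nb by (subst plus_emeasure) (auto simp: Un_absorb2)
      moreover have "emeasure lborel (U - N) = emeasure lebesgue (U - N)"
        using U(1) Nb by simp
      ultimately have "emeasure lborel U < ennreal (s\<^sup>2)" using U(4) by (simp only: Nl add_0_right)
      from that[OF U(1,2) this] show ?thesis .
    qed
    define O' where "O' = U \<inter> {a<..<b}"
    have O': "open O'" "N \<subseteq> O'" "O' \<subseteq> {a..b}" "emeasure lborel O' \<le> ennreal (s\<^sup>2)"
    proof -
      have "emeasure lborel (U \<inter> {a<..<b}) \<le> emeasure lborel U"
        using U by (intro emeasure_mono) auto
      then show "emeasure lborel O' \<le> ennreal (s\<^sup>2)" using U(3) unfolding O'_def by (meson less_imp_le order_trans)
    qed (use U N in \<open>auto simp: O'_def\<close>)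
    have [measurable]: "O' \<in> sets borel" using O' by auto
    define p where "p k c t = 1 / real k / ((t - c)\<^sup>2 + (1 / real k)\<^sup>2)" for k :: nat and c t :: real
    have pm [measurable]: "(\<lambda>(c, t). ennreal (p k c t) * indicator O' c) \<in> borel_measurable (lborel \<Otimes>\<^sub>M \<mu>)" for k
      unfolding p_def by measurable
    \<comment> \<open>Within distance 1/k of \<open>t\<close> the kernel is at least k/2, on an
      interval of length 2/k.\<close>
    have low: "1 \<le> liminf (\<lambda>k. \<integral>\<^sup>+c. ennreal (p k c t) * indicator O' c \<partial>lborel)" if t: "t \<in> O'" for t
    proof (rule Liminf_bounded)
      obtain r where r: "r > 0" "cball t r \<subseteq> O'" using O'(1) t open_contains_cball by blast
      show "\<forall>\<^sub>F k in sequentially. 1 \<le> (\<integral>\<^sup>+c. ennreal (p k c t) * indicator O' c \<partial>lborel)"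
        using eventually_gt_at_top[of "nat \<lceil>1 / r\<rceil>"]
      proof eventually_elim
        case (elim k)
        then have "1 / r < real k" by linarith
        moreover have "0 < 1 / r" using r(1) by simp
        ultimately have k0: "real k > 0" by linarith
        with \<open>1 / r < real k\<close> r(1) have k: "1 / real k < r" "real k > 0" by (auto simp: field_simps)
        have "1 = ennreal (real k / 2) * ennreal (2 / real k)"
          using k by (simp flip: ennreal_mult)
        also have "\<dots> = (\<integral>\<^sup>+c. ennreal (real k / 2) * indicator {t - 1 / real k..t + 1 / real k} c \<partial>lborel)"
          using k by (simp add: nn_integral_cmult)
        also have "\<dots> \<le> (\<integral>\<^sup>+c. ennreal (p k c t) * indicator O' c \<partial>lborel)"
        proof (rule nn_integral_mono)
          fix c
          show "ennreal (real k / 2) * indicator {t - 1 / real k..t + 1 / real k} c \<le> ennreal (p k c t) * indicator O' c"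
          proof (cases "c \<in> {t - 1 / real k..t + 1 / real k}")
            case True
            then have "\<bar>t - c\<bar> \<le> \<bar>1 / real k\<bar>" by auto
            then have "(t - c)\<^sup>2 \<le> (1 / real k)\<^sup>2" by (simp only: abs_le_square_iff)
            then have "1 / real k / ((1 / real k)\<^sup>2 + (1 / real k)\<^sup>2) \<le> p k c t"
              unfolding p_def using k by (intro divide_left_mono add_right_mono mult_pos_pos add_nonneg_pos add_pos_pos) auto
            moreover have "1 / real k / ((1 / real k)\<^sup>2 + (1 / real k)\<^sup>2) = real k / 2"
              using k by (simp add: power2_eq_square field_simps)
            moreover have "c \<in> O'" using True k r by (intro subsetD[OF r(2)]) (auto simp: dist_real_def)
            ultimately have "real k / 2 \<le> p k c t" "c \<in> O'" by (simp only:)+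
            then show ?thesis using True by (simp add: ennreal_leI)
          qed simp
        qed
        finally show ?case .
      qed
    qed
    have "emeasure \<mu> N \<le> emeasure \<mu> O'" using O' by (intro emeasure_mono) (auto simp: s)
    also have "\<dots> = (\<integral>\<^sup>+t. indicator O' t \<partial>\<mu>)" by (simp add: s)
    also have "\<dots> \<le> (\<integral>\<^sup>+t. liminf (\<lambda>k. \<integral>\<^sup>+c. ennreal (p k c t) * indicator O' c \<partial>lborel) \<partial>\<mu>)"
      using low by (intro nn_integral_mono) (auto simp: indicator_def)
    also have "\<dots> \<le> liminf (\<lambda>k. \<integral>\<^sup>+t. (\<integral>\<^sup>+c. ennreal (p k c t) * indicator O' c \<partial>lborel) \<partial>\<mu>)"
      unfolding p_def by (intro nn_integral_liminf) measurable
    also have "\<dots> \<le> ennreal (s * (l + 1))"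
    proof (rule frequently_liminf_le)
      have f: "\<exists>\<^sub>F k in sequentially. (\<integral>\<^sup>+c\<in>{a..b}. ennreal ((g k c)\<^sup>2) \<partial>lborel) < ennreal l"
        using l(1) unfolding L_def by (rule liminf_lessD)
      then show "\<exists>\<^sub>F k in sequentially. (\<integral>\<^sup>+t. (\<integral>\<^sup>+c. ennreal (p k c t) * indicator O' c \<partial>lborel) \<partial>\<mu>) \<le> ennreal (s * (l + 1))"
      proof (rule frequently_rev_mp)
        show "\<forall>\<^sub>F k in sequentially. (\<integral>\<^sup>+c\<in>{a..b}. ennreal ((g k c)\<^sup>2) \<partial>lborel) < ennreal l \<longrightarrow>
          (\<integral>\<^sup>+t. (\<integral>\<^sup>+c. ennreal (p k c t) * indicator O' c \<partial>lborel) \<partial>\<mu>) \<le> ennreal (s * (l + 1))"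
          using eventually_gt_at_top[of 0]
        proof (eventually_elim, intro impI)
          fix k :: nat assume k: "0 < k" and gl: "(\<integral>\<^sup>+c\<in>{a..b}. ennreal ((g k c)\<^sup>2) \<partial>lborel) < ennreal l"
          have "(\<integral>\<^sup>+t. (\<integral>\<^sup>+c. ennreal (p k c t) * indicator O' c \<partial>lborel) \<partial>\<mu>)
            = (\<integral>\<^sup>+c. (\<integral>\<^sup>+t. ennreal (p k c t) * indicator O' c \<partial>\<mu>) \<partial>lborel)"
            using Fubini'[OF pm[of k]] by simp
          also have "\<dots> = (\<integral>\<^sup>+c. (\<integral>\<^sup>+t. ennreal (p k c t) \<partial>\<mu>) * indicator O' c \<partial>lborel)"
            unfolding p_def by (intro nn_integral_cong nn_integral_multc) measurable
          also have "\<dots> \<le> (\<integral>\<^sup>+c. ennreal s * (ennreal ((g k c)\<^sup>2) * indicator {a..b} c) + ennreal (1 / s) * indicator O' c \<partial>lborel)"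
          proof (rule nn_integral_mono)
            fix c
            show "(\<integral>\<^sup>+t. ennreal (p k c t) \<partial>\<mu>) * indicator O' c
              \<le> ennreal s * (ennreal ((g k c)\<^sup>2) * indicator {a..b} c) + ennreal (1 / s) * indicator O' c"
            proof (cases "c \<in> O'")
              case True
              then have c: "c \<in> {a..b}" using O' by auto
              \<comment> \<open>A pointwise form of Cauchy-Schwarz: integrated over the open set,
                both terms are of order \<open>s\<close>.\<close>
              have "g k c \<le> s * (g k c)\<^sup>2 + 1 / s"
              proof (cases "g k c \<le> 1 / s")
                case True
                then show ?thesis using s0 by (simp add: add_increasing)
              next
                case False
                then have "1 \<le> s * g k c" using s0 by (simp add: field_simps)
                from mult_right_mono[OF this g0[of k c]] show ?thesis
                  using s0 by (simp add: power2_eq_square add_increasing2)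
              qed
              then have "ennreal (g k c) \<le> ennreal (s * (g k c)\<^sup>2 + 1 / s)" by (rule ennreal_leI)
              also have "\<dots> = ennreal s * ennreal ((g k c)\<^sup>2) + ennreal (1 / s)"
                using s0 by (simp add: ennreal_mult)
              finally have "(\<integral>\<^sup>+t. ennreal (p k c t) \<partial>\<mu>) \<le> ennreal s * ennreal ((g k c)\<^sup>2) + ennreal (1 / s)"
                by (rule order_trans[OF bound[OF k c], folded p_def])
              then show ?thesis using True c by simp
            qed simp
          qed
          also have "\<dots> = ennreal s * (\<integral>\<^sup>+c\<in>{a..b}. ennreal ((g k c)\<^sup>2) \<partial>lborel) + ennreal (1 / s) * emeasure lborel O'"
            by (subst nn_integral_add) (auto simp: nn_integral_cmult)
          also have "\<dots> \<le> ennreal s * ennreal l + ennreal (1 / s) * ennreal (s\<^sup>2)"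
            using gl O'(4) by (intro add_mono mult_left_mono) auto
          also have "\<dots> = ennreal (s * (l + 1))"
            using s0 l by (simp add: power2_eq_square algebra_simps flip: ennreal_mult ennreal_plus)
          finally show "(\<integral>\<^sup>+t. (\<integral>\<^sup>+c. ennreal (p k c t) * indicator O' c \<partial>lborel) \<partial>\<mu>) \<le> ennreal (s * (l + 1))" .
        qed
      qed
    qed
    finally show ?thesis .
  qed
  note b = this
  have "measure \<mu> N \<le> s" if "s > 0" for s
  proof -
    have "emeasure \<mu> N \<le> ennreal (s / (l + 1) * (l + 1))" using that l by (intro b) auto
    then have "ennreal (measure \<mu> N) \<le> ennreal s" using l by (simp add: emeasure_eq_measure)
    then show ?thesis using that by (simp add: ennreal_le_iff)
  qed
  then have "measure \<mu> N \<le> 0" by (meson dense_ge)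
  then have "measure \<mu> N = 0" using measure_nonneg[of \<mu> N] by (rule antisym)
  then show ?thesis by (simp add: emeasure_eq_measure)
qed

text \<open>Serves to refute a gap in the spectral measure of the root, which would bound the
  control function below by a multiple of k on a whole interval.\<close>

lemma liminf_square_integral_contradiction:
  fixes g :: "nat \<Rightarrow> real \<Rightarrow> real"
  assumes "a < b" "\<kappa> > 0"
    and low: "\<forall>\<^sub>F k in sequentially. \<forall>c\<in>{a..b}. \<kappa> * real k \<le> g k c"
    and lim: "liminf (\<lambda>k. \<integral>\<^sup>+c\<in>{a..b}. ennreal ((g k c)\<^sup>2) \<partial>lborel) < \<infinity>"
  shows False
proof -
  define L where "L = liminf (\<lambda>k. \<integral>\<^sup>+c\<in>{a..b}. ennreal ((g k c)\<^sup>2) \<partial>lborel)"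
  have f: "\<exists>\<^sub>F k in sequentially. (\<integral>\<^sup>+c\<in>{a..b}. ennreal ((g k c)\<^sup>2) \<partial>lborel) < ennreal (enn2real L + 1)"
  proof (rule liminf_lessD)
    have "L = ennreal (enn2real L)" using lim by (simp add: L_def less_top)
    also have "\<dots> < ennreal (enn2real L + 1)" by (rule ennreal_lessI) (auto simp: add_nonneg_pos)
    finally show "liminf (\<lambda>k. \<integral>\<^sup>+c\<in>{a..b}. ennreal ((g k c)\<^sup>2) \<partial>lborel) < ennreal (enn2real L + 1)"
      unfolding L_def .
  qed
  have "filterlim (\<lambda>k. (\<kappa> * real k)\<^sup>2 * (b - a)) at_top sequentially"
    using assms by (intro filterlim_at_top_mult_tendsto_pos[OF tendsto_const] filterlim_pow_at_top
      filterlim_tendsto_pos_mult_at_top[OF tendsto_const] filterlim_real_sequentially) auto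
  then have "\<forall>\<^sub>F k in sequentially. enn2real L + 1 \<le> (\<kappa> * real k)\<^sup>2 * (b - a)"
    by (simp add: filterlim_at_top)
  with low have "\<forall>\<^sub>F k in sequentially. \<not> (\<integral>\<^sup>+c\<in>{a..b}. ennreal ((g k c)\<^sup>2) \<partial>lborel) < ennreal (enn2real L + 1)"
  proof eventually_elim
    case (elim k)
    have "ennreal (enn2real L + 1) \<le> ennreal ((\<kappa> * real k)\<^sup>2 * (b - a))" using elim(2) by (rule ennreal_leI)
    also have "\<dots> = (\<integral>\<^sup>+c. ennreal ((\<kappa> * real k)\<^sup>2) * indicator {a..b} c \<partial>lborel)"
      using assms by (simp add: nn_integral_cmult ennreal_mult)
    also have "\<dots> \<le> (\<integral>\<^sup>+c\<in>{a..b}. ennreal ((g k c)\<^sup>2) \<partial>lborel)"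
      using elim(1) \<open>\<kappa> > 0\<close> by (intro nn_integral_mono) (auto simp: indicator_def intro!: ennreal_leI power_mono)
    finally show ?case by (simp add: not_less)
  qed
  with f show False by (simp add: frequently_def)
qed

section \<open>The Hilbert space of the tree\<close>

lemma ell2_combine:
  assumes "\<phi> \<in> ell2 S" "\<psi> \<in> ell2 S"
  shows "(\<lambda>x. a * \<phi> x + b * \<psi> x) \<in> ell2 S"
proof -
  have "(\<lambda>x. (cmod (a * \<phi> x + b * \<psi> x))\<^sup>2) summable_on S"
  proof (rule summable_on_comparison_test)
    show "(\<lambda>x. 2 * (cmod a)\<^sup>2 * (cmod (\<phi> x))\<^sup>2 + 2 * (cmod b)\<^sup>2 * (cmod (\<psi> x))\<^sup>2) summable_on S"
      using assms by (intro summable_on_add summable_on_cmult_right) (auto simp: ell2_def)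
    fix x
    have "(cmod (a * \<phi> x + b * \<psi> x))\<^sup>2 \<le> (cmod (a * \<phi> x) + cmod (b * \<psi> x))\<^sup>2"
      by (intro power_mono norm_triangle_ineq) auto
    also have "\<dots> \<le> 2 * (cmod (a * \<phi> x))\<^sup>2 + 2 * (cmod (b * \<psi> x))\<^sup>2"
      using sum_squares_bound[of "cmod (a * \<phi> x)" "cmod (b * \<psi> x)"] by (simp add: power2_sum)
    finally show "(cmod (a * \<phi> x + b * \<psi> x))\<^sup>2 \<le> 2 * (cmod a)\<^sup>2 * (cmod (\<phi> x))\<^sup>2 + 2 * (cmod b)\<^sup>2 * (cmod (\<psi> x))\<^sup>2"
      by (simp add: norm_mult power_mult_distrib)
  qed simp
  then show ?thesis using assms by (auto simp: ell2_def)
qed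

lemma ell2_zero: "(\<lambda>_. 0) \<in> ell2 S"
  by (simp add: ell2_def)

lemma ell2_inner_summable:
  assumes "\<phi> \<in> ell2 S" "\<psi> \<in> ell2 S"
  shows "(\<lambda>x. cnj (\<phi> x) * \<psi> x) summable_on S"
proof (rule abs_summable_summable, rule summable_on_comparison_test)
  show "(\<lambda>x. (cmod (\<phi> x))\<^sup>2 + (cmod (\<psi> x))\<^sup>2) summable_on S"
    using assms by (intro summable_on_add) (auto simp: ell2_def)
  show "cmod (cnj (\<phi> x) * \<psi> x) \<le> (cmod (\<phi> x))\<^sup>2 + (cmod (\<psi> x))\<^sup>2" for x
  proof -
    have "0 \<le> cmod (\<phi> x) * cmod (\<psi> x)" by simp
    then show ?thesis
      using sum_squares_bound[of "cmod (\<phi> x)" "cmod (\<psi> x)"]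
      unfolding norm_mult complex_mod_cnj by linarith
  qed
qed simp

lemma ell2_inner_combine:
  assumes "\<phi> \<in> ell2 S" "\<psi> \<in> ell2 S" "\<xi> \<in> ell2 S"
  shows "ell2_inner S \<xi> (\<lambda>x. a * \<phi> x + b * \<psi> x) = a * ell2_inner S \<xi> \<phi> + b * ell2_inner S \<xi> \<psi>"
proof -
  have "ell2_inner S \<xi> (\<lambda>x. a * \<phi> x + b * \<psi> x)
      = (\<Sum>\<^sub>\<infinity>x\<in>S. a * (cnj (\<xi> x) * \<phi> x) + b * (cnj (\<xi> x) * \<psi> x))"
    unfolding ell2_inner_def by (intro infsum_cong) (simp add: algebra_simps)
  also have "\<dots> = (\<Sum>\<^sub>\<infinity>x\<in>S. a * (cnj (\<xi> x) * \<phi> x)) + (\<Sum>\<^sub>\<infinity>x\<in>S. b * (cnj (\<xi> x) * \<psi> x))"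
    using assms by (intro infsum_add summable_on_cmult_right ell2_inner_summable)
  finally show ?thesis using assms
    by (simp add: ell2_inner_def infsum_cmult_right ell2_inner_summable)
qed

lemma ell2_inner_cnj: "ell2_inner S \<psi> \<phi> = cnj (ell2_inner S \<phi> \<psi>)"
  unfolding ell2_inner_def by (simp add: mult.commute flip: infsum_cnj)

lemma ell2_inner_self: "\<psi> \<in> ell2 S \<Longrightarrow> ell2_inner S \<psi> \<psi> = complex_of_real ((ell2_norm S \<psi>)\<^sup>2)"
proof -
  assume \<psi>: "\<psi> \<in> ell2 S"
  have "ell2_inner S \<psi> \<psi> = (\<Sum>\<^sub>\<infinity>x\<in>S. complex_of_real ((cmod (\<psi> x))\<^sup>2))"
    unfolding ell2_inner_def by (intro infsum_cong) (metis complex_norm_square mult.commute)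
  also have "\<dots> = complex_of_real (\<Sum>\<^sub>\<infinity>x\<in>S. (cmod (\<psi> x))\<^sup>2)" 
    using \<psi> by (intro infsumI) (simp add: ell2_def has_sum_of_real_iff flip: of_real_power)
  finally show ?thesis by (simp add: ell2_norm_def infsum_nonneg)
qed

lemma ell2_norm_finite_sum_le:
  assumes "\<psi> \<in> ell2 S" "finite F" "F \<subseteq> S"
  shows "(\<Sum>x\<in>F. (cmod (\<psi> x))\<^sup>2) \<le> (ell2_norm S \<psi>)\<^sup>2"
  using assms by (simp add: ell2_norm_def infsum_nonneg ell2_def finite_sum_le_infsum)

lemma ell2_norm_leI:
  assumes "\<psi> \<in> ell2 S" "\<And>F. finite F \<Longrightarrow> F \<subseteq> S \<Longrightarrow> (\<Sum>x\<in>F. (cmod (\<psi> x))\<^sup>2) \<le> e\<^sup>2" "0 \<le> e"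
  shows "ell2_norm S \<psi> \<le> e"
proof -
  have "(\<Sum>\<^sub>\<infinity>x\<in>S. (cmod (\<psi> x))\<^sup>2) \<le> e\<^sup>2"
    using assms by (intro infsum_le_finite_sums) (auto simp: ell2_def)
  then show ?thesis unfolding ell2_norm_def using assms(3) by (simp add: real_le_lsqrt infsum_nonneg)
qed

lemma ell2_bounded_sumsI:
  assumes "\<And>x. x \<notin> S \<Longrightarrow> \<psi> x = 0" "\<And>F. finite F \<Longrightarrow> F \<subseteq> S \<Longrightarrow> (\<Sum>x\<in>F. (cmod (\<psi> x))\<^sup>2) \<le> C"
  shows "\<psi> \<in> ell2 S"
proof -
  have "(\<lambda>x. (cmod (\<psi> x))\<^sup>2) summable_on S"
    using assms(2) by (intro nonneg_bdd_above_summable_on) (auto intro!: bdd_aboveI[where M=C])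
  then show ?thesis using assms(1) by (simp add: ell2_def)
qed

text \<open>The complex space is treated as a real Hilbert space whose inner product is the real
  part; \<open>imul\<close> keeps the complex structure. Real inner product and norm then come from
  type classes.\<close>

typedef l2 = "ell2 G2" morphisms fn Abs_l2
  using ell2_zero by blast

setup_lifting type_definition_l2

lemma fn_ell2 [simp]: "fn x \<in> ell2 G2" by (rule fn)

lemma fn_outside: "v \<notin> G2 \<Longrightarrow> fn x v = 0"
  using fn[of x] unfolding ell2_def by blast

lemma l2_eqI: "(\<And>v. fn x v = fn y v) \<Longrightarrow> x = y"
  by (simp add: fn_inject fun_eq_iff flip: fn_inject)

instantiation l2 :: real_inner
begin

lift_definition zero_l2 :: l2 is "\<lambda>_. 0" by (rule ell2_zero)
lift_definition plus_l2 :: "l2 \<Rightarrow> l2 \<Rightarrow> l2" is "\<lambda>f g v. f v + g v"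
  using ell2_combine[where a=1 and b=1] by simp
lift_definition minus_l2 :: "l2 \<Rightarrow> l2 \<Rightarrow> l2" is "\<lambda>f g v. f v - g v"
  using ell2_combine[where a=1 and b="-1"] by simp
lift_definition uminus_l2 :: "l2 \<Rightarrow> l2" is "\<lambda>f v. - f v"
  using ell2_combine[OF _ ell2_zero, where a="-1" and b=0] by simp
lift_definition scaleR_l2 :: "real \<Rightarrow> l2 \<Rightarrow> l2" is "\<lambda>r f v. complex_of_real r * f v"
  using ell2_combine[OF _ ell2_zero, where b=0] by simp
lift_definition inner_l2 :: "l2 \<Rightarrow> l2 \<Rightarrow> real" is "\<lambda>f g. Re (ell2_inner G2 f g)" .
lift_definition norm_l2 :: "l2 \<Rightarrow> real" is "ell2_norm G2" .
definition dist_l2 :: "l2 \<Rightarrow> l2 \<Rightarrow> real" where "dist_l2 x y = norm (x - y)"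
definition sgn_l2 :: "l2 \<Rightarrow> l2" where "sgn_l2 x = inverse (norm x) *\<^sub>R x"
definition uniformity_l2 :: "(l2 \<times> l2) filter" where
  "uniformity_l2 = (INF e\<in>{0 <..}. principal {(x, y). dist x y < e})"
definition open_l2 :: "l2 set \<Rightarrow> bool" where
  "open_l2 U \<longleftrightarrow> (\<forall>x\<in>U. \<forall>\<^sub>F (x', y) in uniformity. x' = x \<longrightarrow> y \<in> U)"

instance
proof
  fix x y z :: l2 and r s :: real and U :: "l2 set"
  show "dist x y = norm (x - y)" by (rule dist_l2_def)
  show "sgn x = inverse (norm x) *\<^sub>R x" by (rule sgn_l2_def)
  show "uniformity = (INF e\<in>{0 <..}. principal {(x, y). dist x y < (e::real)} :: (l2 \<times> l2) filter)" by (rule uniformity_l2_def)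
  show "open U = (\<forall>x\<in>U. \<forall>\<^sub>F (x', y) in uniformity. x' = x \<longrightarrow> y \<in> U)" by (rule open_l2_def)
  show "x + y + z = x + (y + z)" "x + y = y + x" "0 + x = x" "- x + x = 0" "x - y = x + - y"
    by (transfer, simp add: algebra_simps)+
  show "r *\<^sub>R (x + y) = r *\<^sub>R x + r *\<^sub>R y" "(r + s) *\<^sub>R x = r *\<^sub>R x + s *\<^sub>R x" "r *\<^sub>R s *\<^sub>R x = (r * s) *\<^sub>R x"
    "1 *\<^sub>R x = x"
    by (transfer, simp add: algebra_simps)+
  show "inner x y = inner y x"
    by transfer (subst ell2_inner_cnj, simp)
  show "inner (x + y) z = inner x z + inner y z"
  proof transfer
    fix x y z :: "nat \<times> nat \<Rightarrow> complex" assume "x \<in> ell2 G2" "y \<in> ell2 G2" "z \<in> ell2 G2"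
    then have "ell2_inner G2 z (\<lambda>v. x v + y v) = ell2_inner G2 z x + ell2_inner G2 z y"
      using ell2_inner_combine[where a=1 and b=1] by simp
    then show "Re (ell2_inner G2 (\<lambda>v. x v + y v) z) = Re (ell2_inner G2 x z) + Re (ell2_inner G2 y z)"
      by (simp add: ell2_inner_cnj[of G2 _ z])
  qed
  show "inner (r *\<^sub>R x) y = r * inner x y"
  proof transfer
    fix x y :: "nat \<times> nat \<Rightarrow> complex" and r :: real assume "x \<in> ell2 G2" "y \<in> ell2 G2"
    then have "ell2_inner G2 y (\<lambda>v. complex_of_real r * x v) = complex_of_real r * ell2_inner G2 y x"
      using ell2_inner_combine[of x G2 x y "complex_of_real r" 0] by simp
    then show "Re (ell2_inner G2 (\<lambda>v. complex_of_real r * x v) y) = r * Re (ell2_inner G2 x y)"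
      by (simp add: ell2_inner_cnj[of G2 _ y])
  qed
  show "0 \<le> inner x x" by transfer (simp add: ell2_inner_self)
  show "(inner x x = 0) = (x = 0)"
  proof transfer
    fix x :: "nat \<times> nat \<Rightarrow> complex" assume x: "x \<in> ell2 G2"
    show "(Re (ell2_inner G2 x x) = 0) = (x = (\<lambda>_. 0))"
    proof
      assume "Re (ell2_inner G2 x x) = 0"
      then have "(ell2_norm G2 x)\<^sup>2 = 0" using x by (simp add: ell2_inner_self)
      then have "(cmod (x v))\<^sup>2 \<le> 0" if "v \<in> G2" for v
        using ell2_norm_finite_sum_le[OF x, of "{v}"] that by simp
      then show "x = (\<lambda>_. 0)" using x by (fastforce simp: ell2_def)
    qed (simp add: ell2_inner_def)
  qed
  show "norm x = sqrt (inner x x)"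
    by transfer (simp add: ell2_inner_self ell2_norm_def infsum_nonneg)
qed

end

lemma fn_simps [simp]: "fn 0 v = 0" "fn (x + y) v = fn x v + fn y v" "fn (x - y) v = fn x v - fn y v"
  "fn (- x) v = - fn x v" "fn (r *\<^sub>R x) v = complex_of_real r * fn x v"
  by (transfer, simp)+

lemma fn_sum: "fn (sum f I) v = (\<Sum>i\<in>I. fn (f i) v)"
  by (induction I rule: infinite_finite_induct) auto

lemma norm_fn: "norm x = ell2_norm G2 (fn x)" by transfer simp

lemma inner_fn: "inner x y = Re (ell2_inner G2 (fn x) (fn y))" by transfer simp

lemma norm_fn_le: "cmod (fn x v) \<le> norm x"
proof (cases "v \<in> G2")
  case True
  then have "(cmod (fn x v))\<^sup>2 \<le> (norm x)\<^sup>2"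
    using ell2_norm_finite_sum_le[OF fn, of "{v}" x] by (simp add: norm_fn)
  then show ?thesis by (rule power2_le_imp_le) simp
qed (simp add: fn_outside)

instance l2 :: complete_space
proof
  fix X :: "nat \<Rightarrow> l2" assume X: "Cauchy X"
  have "Cauchy (\<lambda>n. fn (X n) v)" for v
    unfolding Cauchy_iff
  proof (intro allI impI)
    fix e :: real assume "e > 0"
    then obtain N where N: "\<And>m n. m \<ge> N \<Longrightarrow> n \<ge> N \<Longrightarrow> norm (X m - X n) < e"
      using X unfolding Cauchy_iff by meson
    have "norm (fn (X m) v - fn (X n) v) < e" if "m \<ge> N" "n \<ge> N" for m n
      using norm_fn_le[of "X m - X n" v] N[OF that] by simp
    then show "\<exists>M. \<forall>m\<ge>M. \<forall>n\<ge>M. norm (fn (X m) v - fn (X n) v) < e" by blast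
  qed
  then have "\<forall>v. \<exists>l. (\<lambda>n. fn (X n) v) \<longlonglongrightarrow> l"
    by (simp add: Cauchy_convergent_iff convergent_def)
  then obtain f where f: "\<And>v. (\<lambda>n. fn (X n) v) \<longlonglongrightarrow> f v" by metis
  have f0: "f v = 0" if "v \<notin> G2" for v
    using f[of v] by (simp add: fn_outside that LIMSEQ_const_iff)
  \<comment> \<open>On a finite set of vertices the Cauchy bound passes to the pointwise limit; it
    does not depend on the set and so gives convergence in norm.\<close>
  have bound: "(\<Sum>v\<in>F. (cmod (fn (X m) v - f v))\<^sup>2) \<le> e\<^sup>2"
    if N: "\<And>m n. m \<ge> N \<Longrightarrow> n \<ge> N \<Longrightarrow> norm (X m - X n) < e" and F: "finite F" "F \<subseteq> G2" and m: "m \<ge> N" for F m N e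
  proof (rule tendsto_upperbound)
    show "(\<lambda>n. \<Sum>v\<in>F. (cmod (fn (X m) v - fn (X n) v))\<^sup>2) \<longlonglongrightarrow> (\<Sum>v\<in>F. (cmod (fn (X m) v - f v))\<^sup>2)"
      by (intro tendsto_intros f)
    show "\<forall>\<^sub>F n in sequentially. (\<Sum>v\<in>F. (cmod (fn (X m) v - fn (X n) v))\<^sup>2) \<le> e\<^sup>2"
      using eventually_ge_at_top[of N]
    proof eventually_elim
      case (elim n)
      have "(\<Sum>v\<in>F. (cmod (fn (X m) v - fn (X n) v))\<^sup>2) \<le> (norm (X m - X n))\<^sup>2"
        using ell2_norm_finite_sum_le[OF fn F, of "X m - X n"] by (simp add: norm_fn)
      also have "\<dots> \<le> e\<^sup>2" using N[OF m elim] by (intro power_mono) auto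
      finally show ?case .
    qed
  qed simp
  have diff: "(\<lambda>v. fn (X m) v - f v) \<in> ell2 G2"
    if N: "\<And>m n. m \<ge> N \<Longrightarrow> n \<ge> N \<Longrightarrow> norm (X m - X n) < e" and m: "m \<ge> N" for N e m
    using bound[OF N _ _ m] by (intro ell2_bounded_sumsI[where C="e\<^sup>2"]) (auto simp: f0 fn_outside)
  obtain N1 where N1: "\<And>m n. m \<ge> N1 \<Longrightarrow> n \<ge> N1 \<Longrightarrow> norm (X m - X n) < 1"
    using X unfolding Cauchy_iff by (meson zero_less_one)
  have "(\<lambda>v. 1 * fn (X N1) v + (-1) * (fn (X N1) v - f v)) \<in> ell2 G2"
    by (intro ell2_combine fn diff[OF N1]) auto
  then have fe: "f \<in> ell2 G2" by simp
  define x where "x = Abs_l2 f"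
  have fx: "fn x = f" unfolding x_def using fe by (rule Abs_l2_inverse)
  have "X \<longlonglongrightarrow> x"
    unfolding LIMSEQ_iff
  proof (intro allI impI)
    fix e :: real assume e: "e > 0"
    then have "e / 2 > 0" by simp
    then obtain N where N: "\<And>m n. m \<ge> N \<Longrightarrow> n \<ge> N \<Longrightarrow> norm (X m - X n) < e / 2"
      using X unfolding Cauchy_iff by meson
    have "norm (X m - x) < e" if m: "m \<ge> N" for m
    proof -
      have "norm (X m - x) \<le> e / 2"
        unfolding norm_fn using bound[OF N _ _ m] e by (intro ell2_norm_leI) (auto simp: fx)
      then show ?thesis using e by simp
    qed
    then show "\<exists>no. \<forall>n\<ge>no. norm (X n - x) < e" by blast
  qed
  then show "convergent X" by (auto simp: convergent_def)
qed

lift_definition imul :: "l2 \<Rightarrow> l2" is "\<lambda>f v. \<i> * f v"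
  using ell2_combine[OF _ ell2_zero, where a="\<i>" and b=0] by simp

lemma fn_imul [simp]: "fn (imul x) v = \<i> * fn x v"
  by transfer simp

lemma linear_imul: "linear imul"
  by (rule linearI) (auto intro!: l2_eqI simp: algebra_simps)

lemma imul_imul: "imul (imul x) = - x"
  by (auto intro!: l2_eqI simp flip: mult.assoc)

lemma inner_imul: "inner (imul x) (imul y) = inner x y"
  by (simp add: inner_fn ell2_inner_def flip: mult.assoc) (simp add: mult.assoc mult.left_commute)

lemma bounded_linear_imul: "bounded_linear imul"
proof (rule bounded_linear_intro[where K=1])
  show "norm (imul x) \<le> norm x * 1" for x
    by (simp add: norm_eq_sqrt_inner inner_imul)
qed (auto simp: linear_add[OF linear_imul] linear_scale[OF linear_imul])

lemma ell2_inner_fn: "ell2_inner G2 (fn x) (fn y) = Complex (inner x y) (inner (imul x) y)"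
proof -
  have "ell2_inner G2 (fn (imul x)) (fn y) = - \<i> * ell2_inner G2 (fn x) (fn y)"
    unfolding ell2_inner_def infsum_cmult_right'[symmetric]
    by (intro infsum_cong) auto
  then show ?thesis by (simp add: inner_fn complex_eq_iff)
qed

section \<open>Spectral resolutions of bounded operators on the tree\<close>

lemma fn_Abs [simp]: "f \<in> ell2 G2 \<Longrightarrow> fn (Abs_l2 f) = f"
  by (rule Abs_l2_inverse)

definition lift_P :: "(real set \<Rightarrow> (nat \<times> nat \<Rightarrow> complex) \<Rightarrow> nat \<times> nat \<Rightarrow> complex) \<Rightarrow> real set \<Rightarrow> l2 \<Rightarrow> l2" where
  "lift_P P B x = Abs_l2 (P B (fn x))"

definition cscale :: "complex \<Rightarrow> l2 \<Rightarrow> l2" where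
  "cscale a x = Re a *\<^sub>R x + Im a *\<^sub>R imul x"

lemma fn_cscale [simp]: "fn (cscale a x) v = a * fn x v"
proof -
  have "complex_of_real (Re a) * fn x v + complex_of_real (Im a) * (\<i> * fn x v) = a * fn x v"
    by (simp add: complex_eq_iff algebra_simps)
  then show ?thesis by (simp add: cscale_def)
qed

lemma scalar_measure_eq:
  assumes "\<And>B. B \<in> sets borel \<Longrightarrow> Re (ell2_inner G2 (fn x) (P B (fn x))) = inner x (Q B x)"
  shows "scalar_measure G2 P (fn x) = measure_of UNIV (sets borel) (\<lambda>B. ennreal (inner x (Q B x)))"
  unfolding scalar_measure_def
proof (rule measure_of_eq)
  fix B :: "real set" assume "B \<in> sigma_sets UNIV (sets borel)"
  then have "B \<in> sets borel" by (metis sets.sigma_sets_eq space_borel)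
  then show "ennreal (Re (ell2_inner G2 (fn x) (P B (fn x)))) = ennreal (inner x (Q B x))"
    by (simp add: assms)
qed simp

text \<open>An operator in the sense of pairs together with its copy on \<open>l2\<close>.
  Commutation with \<open>imul\<close> expresses complex linearity.\<close>

locale tree_operator =
  fixes A :: "l2 \<Rightarrow> l2" and op :: "(nat \<times> nat) operator"
  assumes sym_A: "symmetric_op A" and A_imul: "imul (A x) = A (imul x)"
    and dom_op: "fst op = ell2 G2" and op_fn: "snd op (fn x) = fn (A x)"
begin

text \<open>With \<open>K\<close> a norm bound, T = A/(2K) + 1/2 lies between 0 and 1. The
  projections of \<open>T\<close>, pulled back along the inverse affine map, resolve
  \<open>A\<close>.\<close>

lemma spectral_resolution_exists: "\<exists>P. spectral_resolution_of G2 op P"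
proof -
  interpret A: bounded_linear A using sym_A by (simp add: symmetric_op_def)
  obtain K0 where K0: "\<And>x. norm (A x) \<le> norm x * K0" using A.bounded by blast
  define K where "K = max K0 1"
  have K: "K > 0" "norm (A x) \<le> K * norm x" for x
    using K0[of x] mult_left_mono[of K0 K "norm x"] by (auto simp: K_def mult.commute max_def split: if_splits)
  have form: "\<bar>inner x (A x)\<bar> \<le> K * (norm x)\<^sup>2" for x
  proof -
    have "\<bar>inner x (A x)\<bar> \<le> norm x * norm (A x)" by (rule Cauchy_Schwarz_ineq2)
    also have "\<dots> \<le> norm x * (K * norm x)" using K by (intro mult_left_mono) auto
    finally show ?thesis by (simp add: power2_eq_square mult_ac)
  qed
  define T where "T x = (1/(2*K)) *\<^sub>R A x + (1/2) *\<^sub>R x" for x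
  have symT: "symmetric_op T"
    unfolding T_def by (intro symmetric_op_scale_add sym_A symmetric_op_id)
  have TA: "inner x (T x) = inner x (A x) / (2 * K) + (norm x)\<^sup>2 / 2" for x
    by (simp add: T_def inner_add_right power2_norm_eq_inner)
  interpret T: unit_op T
  proof
    fix x
    show "0 \<le> inner x (T x)" "inner x (T x) \<le> (norm x)\<^sup>2"
      using form[of x] K(1) by (auto simp: TA abs_le_iff field_simps)
  qed (rule symT)
  interpret Q: real_pvm T.proj by (rule T.proj_pvm)
  \<comment> \<open>The inverse of the affine map from \<open>A\<close> to \<open>T\<close>; it
    carries [0,1] onto [-K,K].\<close>
  define h where "h t = 2 * K * t - K" for t :: real
  have [measurable]: "h \<in> borel_measurable borel" unfolding h_def by measurable
  have hB: "h -` B \<in> sets borel" if "B \<in> sets borel" for B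
    using measurable_sets[OF _ that, of h borel] by simp
  define R where "R B = T.proj (h -` B)" for B
  have J: "imul (R B x) = R B (imul x)" if "B \<in> sets borel" for B x
    unfolding R_def
    by (rule T.proj_commute[OF hB[OF that] bounded_linear_imul])
      (simp add: T_def linear_add[OF linear_imul] linear_scale[OF linear_imul] A_imul)
  interpret R: real_pvm R
  proof (rule real_pvm.intro)
    fix E :: "nat \<Rightarrow> real set" and x
    assume E: "range E \<subseteq> sets borel" "disjoint_family E"
    have "(\<lambda>n. norm (T.proj (\<Union>i. h -` E i) x - (\<Sum>i<n. T.proj (h -` E i) x))) \<longlonglongrightarrow> 0"
      using E hB by (intro Q.sums_norm) (auto simp: disjoint_family_on_def)
    then show "(\<lambda>n. norm (R (\<Union>i. E i) x - (\<Sum>i<n. R (E i) x))) \<longlonglongrightarrow> 0"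
      by (simp add: R_def vimage_UN)
  qed (auto simp: R_def Q.linear_P Q.idem Q.P_UNIV hB Q.self_adj)
  have emR: "emeasure (R.pm x) B = emeasure (distr (T.spm x) borel h) B" if "B \<in> sets borel" for x B
    using that hB by (simp add: R.emeasure_pm R_def T.proj_norm_form(1) emeasure_distr T.spm.emeasure_eq_measure)
  have pmR: "R.pm x = distr (T.spm x) borel h" for x
    by (rule measure_eqI) (simp_all add: emR)
  define P where "P B f = fn (R B (Abs_l2 f))" for B f
  have PR: "P B (fn x) = fn (R B x)" for B x by (simp add: P_def fn_inverse)
  have sm: "scalar_measure G2 P (fn x) = R.pm x" for x
    unfolding R.pm_def by (rule scalar_measure_eq) (simp add: PR inner_fn)
  have ex: "\<exists>x. f = fn x" if "f \<in> ell2 G2" for f using that by (metis fn_Abs)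
  have clin: "R B (cscale a x + cscale b y) = cscale a (R B x) + cscale b (R B y)" if "B \<in> sets borel" for B a b x y
    using R.linear_P[OF that]
    by (simp add: cscale_def linear_add linear_scale J[OF that, symmetric])
  have "projection_valued_measure G2 P"
    unfolding projection_valued_measure_def orthogonal_projection_def
  proof (intro conjI ballI allI impI)
    fix B :: "real set" and f assume B: "B \<in> sets borel" and "f \<in> ell2 G2"
    then obtain x where f: "f = fn x" using ex by blast
    show "P B f \<in> ell2 G2" by (simp add: P_def)
    show "P B (P B f) = P B f" using B by (simp add: f PR R.idem)
  next
    fix B :: "real set" and f g a b assume B: "B \<in> sets borel" and "f \<in> ell2 G2" "g \<in> ell2 G2"
    then obtain x y where f: "f = fn x" "g = fn y" using ex by blast
    have "(\<lambda>v. a * f v + b * g v) = fn (cscale a x + cscale b y)" by (auto simp: f)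
    then show "P B (\<lambda>v. a * f v + b * g v) = (\<lambda>v. a * P B f v + b * P B g v)"
      by (simp only: PR clin[OF B]) (auto simp: f PR)
  next
    fix B :: "real set" and f g assume B: "B \<in> sets borel" and "f \<in> ell2 G2" "g \<in> ell2 G2"
    then obtain x y where f: "f = fn x" "g = fn y" using ex by blast
    show "ell2_inner G2 f (P B g) = ell2_inner G2 (P B f) g"
      using B by (simp add: f PR ell2_inner_fn R.self_adj J)
  next
    fix f assume "f \<in> ell2 G2"
    then obtain x where f: "f = fn x" using ex by blast
    show "P UNIV f = f" by (simp add: f PR R.P_UNIV)
  next
    fix E :: "nat \<Rightarrow> real set" and f
    assume E: "range E \<subseteq> sets borel" "disjoint_family E" and "f \<in> ell2 G2"
    then obtain x where f: "f = fn x" using ex by blast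
    have "(\<lambda>v. P (\<Union>i. E i) f v - (\<Sum>i<n. P (E i) f v)) = fn (R (\<Union>i. E i) x - (\<Sum>i<n. R (E i) x))" for n
      by (auto simp: f PR fn_sum)
    then show "(\<lambda>n. ell2_norm G2 (\<lambda>v. P (\<Union> (range E)) f v - (\<Sum>i<n. P (E i) f v))) \<longlonglongrightarrow> 0"
      using R.sums_norm[OF E, of x] by (simp add: norm_fn)
  qed
  moreover have fin: "(\<integral>\<^sup>+t. ennreal (t\<^sup>2) \<partial>R.pm x) < \<infinity>" for x
  proof -
    have "(\<integral>\<^sup>+t. ennreal (t\<^sup>2) \<partial>R.pm x) = (\<integral>\<^sup>+t. ennreal ((h t)\<^sup>2) \<partial>T.spm x)"
      unfolding pmR by (subst nn_integral_distr) auto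
    also have "\<dots> < \<infinity>"
    proof -
      have "integrable (T.spm x) (\<lambda>t. (h t)\<^sup>2)"
        unfolding h_def by (intro T.bounded_fun_integrable T.bounded_fun_continuous continuous_intros)
      from nn_integral_eq_integral[OF this] show ?thesis by simp
    qed
    finally show ?thesis .
  qed
  moreover have int: "inner x (A x) = (\<integral>t. t \<partial>R.pm x)" for x
  proof -
    have "(\<integral>t. t \<partial>R.pm x) = (\<integral>t. h t \<partial>T.spm x)"
      unfolding pmR by (subst integral_distr) auto
    also have "\<dots> = 2 * K * (\<integral>t. t \<partial>T.spm x) - K * (norm x)\<^sup>2"
    proof -
      have "integrable (T.spm x) (\<lambda>t. t)" by (intro T.bounded_fun_integrable T.bounded_fun_continuous continuous_intros)
      then show ?thesis unfolding h_def by (simp add: T.measure_spm_UNIV)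
    qed
    also have "(\<integral>t. t \<partial>T.spm x) = inner x (T x)" using T.spm(4)[of x 1] by simp
    finally show ?thesis using K(1) by (simp add: TA field_simps)
  qed
  ultimately have "spectral_resolution_of G2 op P"
    unfolding spectral_resolution_of_def dom_op
  proof (intro conjI ballI)
    show "ell2 G2 = {f \<in> ell2 G2. (\<integral>\<^sup>+t. ennreal (t\<^sup>2) \<partial>scalar_measure G2 P f) < \<infinity>}"
    proof -
      have "(\<integral>\<^sup>+t. ennreal (t\<^sup>2) \<partial>scalar_measure G2 P f) < \<infinity>" if "f \<in> ell2 G2" for f
        using ex[OF that] fin sm by auto
      then show ?thesis by blast
    qed
    fix f assume "f \<in> ell2 G2"
    then obtain x where f: "f = fn x" using ex by blast
    show "snd op f \<in> ell2 G2" by (simp add: f op_fn)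
    \<comment> \<open>The imaginary part of <x, A x>, which vanishes because \<open>A\<close> is
      symmetric and commutes with i.\<close>
    have "inner (imul x) (A x) = 0"
    proof -
      have "inner (imul x) (A x) = inner (imul (imul x)) (imul (A x))" by (simp add: inner_imul)
      also have "\<dots> = - inner x (A (imul x))" by (simp add: imul_imul A_imul)
      also have "\<dots> = - inner (imul x) (A x)" by (metis inner_commute symmetric_opD(3)[OF sym_A])
      finally show ?thesis by simp
    qed
    then show "ell2_inner G2 f (snd op f) = complex_of_real (\<integral>t. t \<partial>scalar_measure G2 P f)"
      by (simp add: f op_fn ell2_inner_fn sm int complex_of_real_def)
  qed
  then show ?thesis by (rule exI[of _ P])
qed

context
  fixes P assumes P: "spectral_resolution_of G2 op P"
begin

lemma pvm: "projection_valued_measure G2 P"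
  using P by (simp add: spectral_resolution_of_def)

lemma fn_lift_P: "B \<in> sets borel \<Longrightarrow> fn (lift_P P B x) = P B (fn x)"
  using pvm unfolding lift_P_def projection_valued_measure_def orthogonal_projection_def by simp

lemma P_combine:
  assumes "B \<in> sets borel"
  shows "P B (\<lambda>v. a * fn x v + b * fn y v) = (\<lambda>v. a * P B (fn x) v + b * P B (fn y) v)"
  using pvm assms fn unfolding projection_valued_measure_def orthogonal_projection_def by blast

lemma lift_pvm: "real_pvm (lift_P P)"
proof (rule real_pvm.intro)
  fix B :: "real set" assume B: "B \<in> sets borel"
  show "linear (lift_P P B)"
  proof (rule linearI)
    fix x y r
    have e: "fn (x + y) = (\<lambda>v. fn x v + fn y v)" "fn (r *\<^sub>R x) = (\<lambda>v. complex_of_real r * fn x v)" by auto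
    have "P B (fn (x + y)) = (\<lambda>v. P B (fn x) v + P B (fn y) v)"
      unfolding e using P_combine[OF B, of 1 x 1 y] by (simp only: mult_1)
    then show "lift_P P B (x + y) = lift_P P B x + lift_P P B y"
      by (intro l2_eqI) (simp only: fn_lift_P[OF B] fn_simps)
    have "P B (fn (r *\<^sub>R x)) = (\<lambda>v. complex_of_real r * P B (fn x) v)"
      unfolding e using P_combine[OF B, of "complex_of_real r" x 0 x]
      by (simp only: mult_zero_left add_0_right)
    then show "lift_P P B (r *\<^sub>R x) = r *\<^sub>R lift_P P B x"
      by (intro l2_eqI) (simp only: fn_lift_P[OF B] fn_simps)
  qed
  fix x y
  have "\<forall>\<psi>\<in>ell2 G2. P B \<psi> \<in> ell2 G2 \<and> P B (P B \<psi>) = P B \<psi>"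
    using pvm B unfolding projection_valued_measure_def orthogonal_projection_def by simp
  from bspec[OF this fn[of x]] have "P B (P B (fn x)) = P B (fn x)" ..
  then show "lift_P P B (lift_P P B x) = lift_P P B x"
    by (intro l2_eqI) (simp add: fn_lift_P[OF B])
  have "\<forall>\<phi>\<in>ell2 G2. \<forall>\<psi>\<in>ell2 G2. ell2_inner G2 \<phi> (P B \<psi>) = ell2_inner G2 (P B \<phi>) \<psi>"
    using pvm B unfolding projection_valued_measure_def orthogonal_projection_def by simp
  then have "ell2_inner G2 (fn x) (P B (fn y)) = ell2_inner G2 (P B (fn x)) (fn y)"
    by (simp only: fn)
  then show "inner x (lift_P P B y) = inner (lift_P P B x) y"
    by (simp add: inner_fn fn_lift_P[OF B])
next
  fix x
  show "lift_P P UNIV x = x"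
  proof (rule l2_eqI)
    have "P UNIV (fn x) = fn x" using pvm fn unfolding projection_valued_measure_def by blast
    then show "fn (lift_P P UNIV x) v = fn x v" for v by (simp add: fn_lift_P)
  qed
next
  fix E :: "nat \<Rightarrow> real set" and x assume E: "range E \<subseteq> sets borel" "disjoint_family E"
  then have Eb: "E i \<in> sets borel" "(\<Union>i. E i) \<in> sets borel" for i by auto
  have "norm (lift_P P (\<Union>i. E i) x - (\<Sum>i<n. lift_P P (E i) x))
    = ell2_norm G2 (\<lambda>v. P (\<Union>i. E i) (fn x) v - (\<Sum>i<n. P (E i) (fn x) v))" for n
    unfolding norm_fn
    by (intro arg_cong[where f="ell2_norm G2"] ext) (simp add: fn_sum fn_lift_P[OF Eb(1)] fn_lift_P[OF Eb(2)])
  moreover have "(\<lambda>n. ell2_norm G2 (\<lambda>v. P (\<Union>i. E i) (fn x) v - (\<Sum>i<n. P (E i) (fn x) v))) \<longlonglongrightarrow> 0"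
    using pvm E fn[of x] unfolding projection_valued_measure_def by blast
  ultimately show "(\<lambda>n. norm (lift_P P (\<Union>i. E i) x - (\<Sum>i<n. lift_P P (E i) x))) \<longlonglongrightarrow> 0" by simp
qed

lemma scalar_measure_lift: "scalar_measure G2 P (fn x) = real_pvm.pm (lift_P P) x"
  unfolding real_pvm.pm_def[OF lift_pvm]
  by (rule scalar_measure_eq) (simp add: inner_fn fn_lift_P)

text \<open>\<open>P\<close> is an arbitrary resolution, so this applies to the one that
  \<open>spectral_measure\<close> selects by choice.\<close>

lemma lift_resolution: "complex_resolution (lift_P P) A imul"
proof -
  interpret Q: real_pvm "lift_P P" by (rule lift_pvm)
  interpret real_resolution "lift_P P" A
  proof
    show "symmetric_op A" by (rule sym_A)
    fix x
    have "fn x \<in> fst op" by (simp add: dom_op)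
    then show "(\<integral>\<^sup>+t. ennreal (t\<^sup>2) \<partial>Q.pm x) < \<infinity>"
      using P unfolding spectral_resolution_of_def by (auto simp: scalar_measure_lift)
    have "ell2_inner G2 (fn x) (snd op (fn x)) = complex_of_real (\<integral>t. t \<partial>scalar_measure G2 P (fn x))"
      using P \<open>fn x \<in> fst op\<close> unfolding spectral_resolution_of_def by blast
    then show "inner x (A x) = (\<integral>t. t \<partial>Q.pm x)"
      by (simp add: inner_fn op_fn scalar_measure_lift)
  qed
  show ?thesis
  proof (rule complex_resolution.intro[OF real_resolution_axioms], rule complex_resolution_axioms.intro)
    fix B :: "real set" and x assume B: "B \<in> sets borel"
    have e: "fn (imul x) = (\<lambda>v. \<i> * fn x v)" by auto
    have "P B (fn (imul x)) = (\<lambda>v. \<i> * P B (fn x) v)"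
      unfolding e using P_combine[OF B, of "\<i>" x 0 x]
      by (simp only: mult_zero_left add_0_right)
    then show "imul (lift_P P B x) = lift_P P B (imul x)"
      by (intro l2_eqI) (simp only: fn_lift_P[OF B] fn_imul)
  qed (simp_all add: linear_imul inner_imul imul_imul A_imul)
qed

end

end

section \<open>Vertex vectors, and null sets under H - c\<close>

lift_definition unit_vec :: "nat \<times> nat \<Rightarrow> l2" is "\<lambda>v w. if w = v \<and> v \<in> G2 then 1 else 0"
proof -
  fix v :: "nat \<times> nat"
  show "(\<lambda>w. if w = v \<and> v \<in> G2 then 1 else 0) \<in> ell2 G2"
  proof (rule ell2_bounded_sumsI[where C=1])
    fix F :: "(nat \<times> nat) set" assume F: "finite F" "F \<subseteq> G2"
    have "(\<Sum>w\<in>F. (cmod (if w = v \<and> v \<in> G2 then 1 else 0))\<^sup>2) \<le> (\<Sum>w\<in>F. if w = v then 1 else 0)"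
      by (intro sum_mono) auto
    also have "\<dots> \<le> 1" using F by simp
    finally show "(\<Sum>w\<in>F. (cmod (if w = v \<and> v \<in> G2 then 1 else 0))\<^sup>2) \<le> 1" .
  qed auto
qed

lemma fn_unit_vec: "v \<in> G2 \<Longrightarrow> fn (unit_vec v) w = (if w = v then 1 else 0)"
  by transfer auto

lemma ell2_inner_unit_vec:
  assumes "v \<in> G2"
  shows "ell2_inner G2 (fn (unit_vec v)) f = f v"
proof -
  have "ell2_inner G2 (fn (unit_vec v)) f = (\<Sum>\<^sub>\<infinity>w\<in>{v}. cnj (fn (unit_vec v) w) * f w)"
    unfolding ell2_inner_def using assms by (intro infsum_cong_neutral) (auto simp: fn_unit_vec)
  then show ?thesis using assms by (simp add: fn_unit_vec)
qed

lemma inner_unit_vec: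
  assumes "v \<in> G2"
  shows "inner (unit_vec v) x = Re (fn x v)" "inner (imul (unit_vec v)) x = Im (fn x v)"
  using ell2_inner_fn[of "unit_vec v" x] by (simp_all add: ell2_inner_unit_vec[OF assms] complex_eq_iff)

context complex_resolution
begin

lemma pm_S_null:
  assumes D: "D \<in> sets borel" "emeasure (pm x) D = 0"
  shows "emeasure (pm (S c x)) D = 0"
proof -
  have "P D x = 0" using P_eq_0_iff[OF D(1)] D(2) by simp
  then have "P D (S c x) = 0" using S_P[OF D(1), of c x] linear_0[OF linear_S] by simp
  then show ?thesis using P_eq_0_iff[OF D(1)] by simp
qed

text \<open>\<open>pm (S c x)\<close> has density (t - c)^2 against \<open>pm x\<close>. The density
  vanishes at \<open>c\<close> alone, which is why \<open>c\<close> must not be an atom.\<close>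

lemma pm_S_nullD:
  assumes D: "D \<in> sets borel" "emeasure (pm (S c x)) D = 0" and c: "emeasure (pm x) {c} = 0"
  shows "emeasure (pm x) D = 0"
proof -
  have "(\<integral>\<^sup>+t. ennreal ((t - c)\<^sup>2) * indicator D t \<partial>pm x) = 0"
    using pm_shift[OF D(1), of x c] D(2) by (simp add: S_def)
  moreover have "(\<lambda>t. ennreal ((t - c)\<^sup>2) * indicator D t) \<in> borel_measurable (pm x)"
    using D(1) by measurable
  ultimately have "AE t in pm x. ennreal ((t - c)\<^sup>2) * indicator D t = 0"
    by (simp add: nn_integral_0_iff_AE)
  moreover have "AE t in pm x. t \<noteq> c"
    using c by (intro AE_I[where N="{c}"]) auto
  ultimately have "AE t in pm x. t \<notin> D"
    by eventually_elim (auto simp: indicator_def split: if_splits)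
  then show ?thesis using D(1) by (simp add: AE_iff_measurable[OF _ refl])
qed

end

section \<open>From Poisson bounds to the spectral types\<close>

context tree_operator
begin

text \<open>The last two conditions bound the Poisson integral \<open>\<parallel>w\<parallel>\<^sup>2 / k\<close> of the spectral measure of the
  vertex \<open>v\<close> from above and, at the root, from below.\<close>

definition poisson_control :: "real \<Rightarrow> nat \<times> nat \<Rightarrow> (nat \<Rightarrow> real \<Rightarrow> real) \<Rightarrow> bool" where
  "poisson_control r v g \<longleftrightarrow>
     (\<forall>k. g k \<in> borel_measurable borel) \<and> (\<forall>k c. 0 \<le> g k c) \<and>
     liminf (\<lambda>k. \<integral>\<^sup>+c\<in>{- r..r}. ennreal ((g k c)\<^sup>2) \<partial>lborel) < \<infinity> \<and>
     (\<forall>k>0. \<forall>c\<in>{- r..r}. \<forall>w. A w - c *\<^sub>R w - (1 / real k) *\<^sub>R imul w = unit_vec v \<longrightarrow>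
        (norm w)\<^sup>2 / real k \<le> g k c) \<and>
     (v = (0, 1) \<longrightarrow> (\<forall>C. \<exists>\<kappa>>0. \<forall>\<^sub>F k in sequentially. \<forall>c\<in>{- r..r}. \<forall>w.
        A w - c *\<^sub>R w - (1 / real k) *\<^sub>R imul w = unit_vec v \<longrightarrow> (norm w)\<^sup>2 \<le> C \<longrightarrow> \<kappa> * real k \<le> g k c))"

lemma poisson_controlD:
  assumes "poisson_control r v g"
  shows "g k \<in> borel_measurable borel" "0 \<le> g k c"
    "liminf (\<lambda>k. \<integral>\<^sup>+c\<in>{- r..r}. ennreal ((g k c)\<^sup>2) \<partial>lborel) < \<infinity>"
    "k > 0 \<Longrightarrow> c \<in> {- r..r} \<Longrightarrow> A w - c *\<^sub>R w - (1 / real k) *\<^sub>R imul w = unit_vec v \<Longrightarrow>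
      (norm w)\<^sup>2 / real k \<le> g k c"
    "v = (0, 1) \<Longrightarrow> \<exists>\<kappa>>0. \<forall>\<^sub>F k in sequentially. \<forall>c\<in>{- r..r}. \<forall>w.
      A w - c *\<^sub>R w - (1 / real k) *\<^sub>R imul w = unit_vec v \<longrightarrow> (norm w)\<^sup>2 \<le> C \<longrightarrow> \<kappa> * real k \<le> g k c"
  using assms unfolding poisson_control_def by (elim conjE; simp)+

text \<open>Control of every vertex makes all spectral measures absolutely continuous inside the
  interval. The pp and sc parts then have no mass there, so H - c is invertible on them. For the ac
  part, the root has mass in every subinterval and thus provides approximate eigenvectors.\<close>

lemma spectral_types:
  assumes r: "\<And>i::nat. r i < c0" "\<And>t. t < c0 \<Longrightarrow> \<exists>i. t < r i"
    and H: "\<And>i v. v \<in> G2 \<Longrightarrow> \<exists>g. poisson_control (r i) v g"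
  shows "complex_of_real ` {- c0<..<c0} \<subseteq> spec_ac G2 op"
    and "spec_pp G2 op \<inter> complex_of_real ` {- c0<..<c0} = {}"
    and "spec_sc G2 op \<inter> complex_of_real ` {- c0<..<c0} = {}"
proof -
  define Pf where "Pf = (SOME P. spectral_resolution_of G2 op P)"
  have Pf: "spectral_resolution_of G2 op Pf"
    unfolding Pf_def by (rule someI_ex[OF spectral_resolution_exists])
  interpret R: complex_resolution "lift_P Pf" A imul by (rule lift_resolution[OF Pf])
  let ?Q = "lift_P Pf"
  have sm: "spectral_measure G2 op (fn x) = R.pm x" for x
    unfolding spectral_measure_def Pf_def[symmetric] by (rule scalar_measure_lift[OF Pf])
  have G: "(0, 1) \<in> G2" by (simp add: G2_def)
  let ?I = "{- c0<..<c0}"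
  have null_i: "emeasure (R.pm (unit_vec v)) N = 0"
    if v: "v \<in> G2" and N: "N \<in> null_sets lborel" "N \<subseteq> {- r i<..<r i}" for v i N
  proof -
    from H[OF v, of i] obtain g where "poisson_control (r i) v g" by blast
    note g = poisson_controlD[OF this]
    show ?thesis
    proof (rule poisson_absolutely_continuous[OF R.pm.finite_measure_axioms R.sets_pm g(1,2) _ g(3) N])
      fix k :: nat and c :: real assume k: "k > 0" and c: "c \<in> {- r i..r i}"
      obtain w where w: "R.S c w - (1 / real k) *\<^sub>R imul w = unit_vec v"
        "ennreal ((norm w)\<^sup>2) = (\<integral>\<^sup>+t. ennreal (1 / ((t - c)\<^sup>2 + (1 / real k)\<^sup>2)) \<partial>R.pm (unit_vec v))"
        using R.poisson_resolvent[of "1 / real k" c "unit_vec v"] k by auto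
      have "(\<integral>\<^sup>+t. ennreal (1 / real k / ((t - c)\<^sup>2 + (1 / real k)\<^sup>2)) \<partial>R.pm (unit_vec v))
         = (\<integral>\<^sup>+t. ennreal (1 / real k) * ennreal (1 / ((t - c)\<^sup>2 + (1 / real k)\<^sup>2)) \<partial>R.pm (unit_vec v))"
        by (intro nn_integral_cong) (simp flip: ennreal_mult)
      also have "\<dots> = ennreal (1 / real k) * ennreal ((norm w)\<^sup>2)"
        unfolding w(2) by (rule nn_integral_cmult) measurable
      also have "\<dots> = ennreal ((norm w)\<^sup>2 / real k)"
        by (simp flip: ennreal_mult)
      also have "\<dots> \<le> ennreal (g k c)"
        using w(1) by (intro ennreal_leI g(4)[OF k c]) (simp add: R.S_def)
      finally show "(\<integral>\<^sup>+t. ennreal (1 / real k / ((t - c)\<^sup>2 + (1 / real k)\<^sup>2)) \<partial>R.pm (unit_vec v)) \<le> ennreal (g k c)" .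
    qed
  qed
  have null_v: "?Q N (unit_vec v) = 0"
    if v: "v \<in> G2" and N: "N \<in> null_sets lborel" "N \<subseteq> ?I" for v N
  proof -
    have Nb: "N \<in> sets borel" using N by (auto simp: null_sets_def)
    have eq: "N = (\<Union>i. N \<inter> {- r i<..<r i})"
    proof
      show "N \<subseteq> (\<Union>i. N \<inter> {- r i<..<r i})"
      proof
        fix t assume t: "t \<in> N"
        with N(2) have "t \<in> ?I" by blast
        then have "\<bar>t\<bar> < c0" by (auto simp: abs_less_iff)
        from r(2)[OF this] obtain i where "\<bar>t\<bar> < r i" by blast
        then have "t \<in> {- r i<..<r i}" by (auto simp: abs_less_iff)
        with t show "t \<in> (\<Union>i. N \<inter> {- r i<..<r i})" by blast
      qed
    qed auto
    have "emeasure (R.pm (unit_vec v)) (N \<inter> {- r i<..<r i}) = 0" for i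
      using N by (intro null_i[OF v, of _ i]) (auto intro: null_set_Int2)
    then have "emeasure (R.pm (unit_vec v)) (\<Union>i. N \<inter> {- r i<..<r i}) = 0"
      using Nb by (intro emeasure_UN_eq_0) auto
    with eq have "emeasure (R.pm (unit_vec v)) N = 0" by simp
    then show ?thesis using R.P_eq_0_iff[OF Nb] by simp
  qed
  \<comment> \<open>Real and imaginary part of the value at a vertex are inner products of
    \<open>x\<close> with \<open>?Q N\<close> applied to the vertex vector and to i times it; both
    vectors are 0.\<close>
  have null: "?Q N x = 0" if N: "N \<in> null_sets lborel" "N \<subseteq> ?I" for N x
  proof (rule l2_eqI)
    have Nb: "N \<in> sets borel" using N by (auto simp: null_sets_def)
    fix v
    show "fn (?Q N x) v = fn 0 v"
    proof (cases "v \<in> G2")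
      case True
      have "Re (fn (?Q N x) v) = 0"
        using null_v[OF True N] R.self_adj[OF Nb, of "unit_vec v" x]
        by (simp flip: inner_unit_vec[OF True])
      moreover have "Im (fn (?Q N x) v) = 0"
        using null_v[OF True N] R.self_adj[OF Nb, of "imul (unit_vec v)" x] R.J_P[OF Nb, of "unit_vec v"]
          linear_0[OF linear_imul]
        by (simp flip: inner_unit_vec[OF True])
      ultimately show ?thesis by (simp add: complex_eq_iff)
    qed (simp add: fn_outside)
  qed
  \<comment> \<open>A vector whose measure is carried by a Lebesgue null set, as in the pp and sc
    parts, has no spectral mass in the interval.\<close>
  have null_I: "?Q ?I x = 0" if D: "D \<in> null_sets lborel" "emeasure (R.pm x) (UNIV - D) = 0" for D x
  proof -
    have Db: "D \<in> sets borel" using D by (auto simp: null_sets_def)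
    have "?Q (D \<inter> ?I) x = 0" using D by (intro null) (auto intro: null_set_Int2)
    then have "emeasure (R.pm x) (D \<inter> ?I) = 0" using R.P_eq_0_iff[of "D \<inter> ?I"] Db by simp
    moreover have "emeasure (R.pm x) ?I \<le> emeasure (R.pm x) (D \<inter> ?I) + emeasure (R.pm x) (UNIV - D)"
      using Db by (intro order_trans[OF emeasure_mono emeasure_subadditive]) auto
    ultimately have "emeasure (R.pm x) ?I = 0" using D(2) by simp
    then show ?thesis using R.P_eq_0_iff[of ?I] by simp
  qed
  have op_shift: "(\<lambda>v. snd op (fn x) v - complex_of_real c * fn x v) = fn (R.S c x)" for c x
    by (auto simp: op_fn R.S_def)
  have ex: "\<exists>x. f = fn x" if "f \<in> ell2 G2" for f using that by (metis fn_Abs)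
  \<comment> \<open>Without spectral mass in the interval, \<open>R.S c\<close> is bounded below by
    the distance from \<open>c\<close> to the complement, and it is onto. The last two conditions
    make \<open>M\<close> invariant under it and under its inverse.\<close>
  have off: "complex_of_real c \<notin> spectrum_in G2 M op"
    if c: "c \<in> ?I" and M: "M \<subseteq> ell2 G2" and m1: "\<And>x. fn x \<in> M \<Longrightarrow> ?Q ?I x = 0"
      and m2: "\<And>x. fn x \<in> M \<Longrightarrow> fn (R.S c x) \<in> M"
      and m3: "\<And>x. ?Q ?I x = 0 \<Longrightarrow> fn (R.S c x) \<in> M \<Longrightarrow> fn x \<in> M" for c M
  proof -
    define \<delta> where "\<delta> = c0 - \<bar>c\<bar>"
    have \<delta>: "\<delta> > 0" "\<And>t. t \<notin> ?I \<Longrightarrow> \<delta> \<le> \<bar>t - c\<bar>" using c by (auto simp: \<delta>_def)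
    have Ib: "?I \<in> sets borel" by simp
    have dM: "fst op \<inter> M = M" using M by (auto simp: dom_op)
    let ?f = "\<lambda>\<psi> x. snd op \<psi> x - complex_of_real c * \<psi> x"
    have exM: "\<exists>x. f = fn x" if "f \<in> M" for f using that M ex by blast
    have low: "\<delta> * norm x \<le> norm (R.S c x)" if "?Q ?I x = 0" for x
      by (rule R.S_bounded_below[OF Ib \<delta> that])
    have "bij_betw ?f M M"
      unfolding bij_betw_def
    proof
      show "inj_on ?f M"
      proof (rule inj_onI)
        fix f g assume "f \<in> M" "g \<in> M" and eq: "?f f = ?f g"
        then obtain x y where xy: "f = fn x" "g = fn y" using exM by blast
        have "fn (R.S c x) = fn (R.S c y)" using eq unfolding xy op_shift .
        then have "R.S c (x - y) = 0"
          using linear_diff[OF R.linear_S, of c x y] by (simp add: fn_inject)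
        moreover have "?Q ?I (x - y) = 0"
          using m1[of x] m1[of y] \<open>f \<in> M\<close> \<open>g \<in> M\<close> linear_diff[OF R.linear_P[OF Ib], of x y] by (simp add: xy)
        ultimately have "\<delta> * norm (x - y) \<le> 0" using low[of "x - y"] by simp
        then show "f = g" using \<delta> by (simp add: xy mult_le_0_iff)
      qed
      show "?f ` M = M"
      proof
        show "?f ` M \<subseteq> M" using m2 exM op_shift by force
        show "M \<subseteq> ?f ` M"
        proof
          fix f assume f: "f \<in> M"
          then obtain y where y: "f = fn y" using exM by blast
          from R.S_surj_off[OF Ib \<delta>, of y] m1[of y] f y
          obtain x where x: "?Q ?I x = 0" "R.S c x = y" by auto
          then have "fn x \<in> M" using m3[of x] f y by simp
          moreover have "f = ?f (fn x)" unfolding op_shift x y ..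
          ultimately show "f \<in> ?f ` M" by blast
        qed
      qed
    qed
    moreover have "\<exists>d. \<forall>\<psi>\<in>M. ell2_norm G2 \<psi> \<le> d * ell2_norm G2 (?f \<psi>)"
    proof (intro exI ballI)
      fix f assume f: "f \<in> M"
      then obtain x where x: "f = fn x" using exM by blast
      show "ell2_norm G2 f \<le> (1/\<delta>) * ell2_norm G2 (?f f)"
        unfolding x op_shift norm_fn[symmetric]
        using low[OF m1] f x \<delta>(1) by (simp add: field_simps)
    qed
    ultimately show ?thesis unfolding spectrum_in_def dM by simp
  qed
  have pm_c: "emeasure (R.pm x) {c} = 0" if "?Q ?I x = 0" "c \<in> ?I" for x c
  proof -
    have "emeasure (R.pm x) {c} \<le> emeasure (R.pm x) ?I" using that by (intro emeasure_mono) auto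
    then show ?thesis using that R.P_eq_0_iff[of ?I x] by simp
  qed
  have pp: "spec_pp G2 op \<inter> complex_of_real ` ?I = {}"
  proof -
    have "complex_of_real c \<notin> spec_pp G2 op" if c: "c \<in> ?I" for c
      unfolding spec_pp_def
    proof (rule off[OF c])
      show "pp_subspace G2 op \<subseteq> ell2 G2" by (auto simp: pp_subspace_def)
      fix x
      have iff: "fn x \<in> pp_subspace G2 op \<longleftrightarrow> (\<exists>C. countable C \<and> emeasure (R.pm x) (UNIV - C) = 0)" for x
        by (simp add: pp_subspace_def sm)
      have cb: "UNIV - C \<in> sets borel" "C \<in> null_sets lborel" if "countable C" for C :: "real set"
      proof -
        show C: "C \<in> null_sets lborel" using that by (rule countable_imp_null_set_lborel)
        then have "C \<in> sets borel" by (auto simp: null_sets_def)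
        then show "UNIV - C \<in> sets borel" by auto
      qed
      show "?Q ?I x = 0" if "fn x \<in> pp_subspace G2 op"
      proof -
        from that obtain C where "countable C" "emeasure (R.pm x) (UNIV - C) = 0" unfolding iff by blast
        then show ?thesis by (intro null_I[OF cb(2)])
      qed
      show "fn (R.S c x) \<in> pp_subspace G2 op" if "fn x \<in> pp_subspace G2 op"
      proof -
        from that obtain C where C: "countable C" "emeasure (R.pm x) (UNIV - C) = 0" unfolding iff by blast
        with R.pm_S_null[OF cb(1)[OF C(1)] C(2), of c] show ?thesis unfolding iff by blast
      qed
      show "fn x \<in> pp_subspace G2 op" if "?Q ?I x = 0" "fn (R.S c x) \<in> pp_subspace G2 op"
      proof -
        from that(2) obtain C where C: "countable C" "emeasure (R.pm (R.S c x)) (UNIV - C) = 0" unfolding iff by blast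
        with R.pm_S_nullD[OF cb(1)[OF C(1)] C(2) pm_c[OF that(1) c]] show ?thesis unfolding iff by blast
      qed
    qed
    then show ?thesis by auto
  qed
  have sc: "spec_sc G2 op \<inter> complex_of_real ` ?I = {}"
  proof -
    have "complex_of_real c \<notin> spec_sc G2 op" if c: "c \<in> ?I" for c
      unfolding spec_sc_def
    proof (rule off[OF c])
      show "sc_subspace G2 op \<subseteq> ell2 G2" by (auto simp: sc_subspace_def)
      fix x
      have iff: "fn x \<in> sc_subspace G2 op \<longleftrightarrow>
          (\<exists>N\<in>null_sets lborel. emeasure (R.pm x) (UNIV - N) = 0) \<and> (\<forall>t. emeasure (R.pm x) {t} = 0)" for x
        by (simp add: sc_subspace_def sm)
      have nb: "UNIV - N \<in> sets borel" if "N \<in> null_sets lborel" for N :: "real set"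
        using that by (auto simp: null_sets_def)
      have tb: "{t} \<in> sets borel" for t :: real by simp
      show "?Q ?I x = 0" if "fn x \<in> sc_subspace G2 op"
      proof -
        from that obtain N where "N \<in> null_sets lborel" "emeasure (R.pm x) (UNIV - N) = 0" unfolding iff by blast
        then show ?thesis by (rule null_I)
      qed
      show "fn (R.S c x) \<in> sc_subspace G2 op" if "fn x \<in> sc_subspace G2 op"
      proof -
        from that obtain N where N: "N \<in> null_sets lborel" "emeasure (R.pm x) (UNIV - N) = 0"
          and t: "\<And>t. emeasure (R.pm x) {t} = 0" unfolding iff by blast
        from R.pm_S_null[OF nb[OF N(1)] N(2), of c] R.pm_S_null[OF tb t, of c] N(1)
        show ?thesis unfolding iff by blast
      qed
      show "fn x \<in> sc_subspace G2 op" if "?Q ?I x = 0" "fn (R.S c x) \<in> sc_subspace G2 op"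
      proof -
        note d = R.pm_S_nullD[OF _ _ pm_c[OF that(1) c]]
        from that(2) obtain N where N: "N \<in> null_sets lborel" "emeasure (R.pm (R.S c x)) (UNIV - N) = 0"
          and t: "\<And>t. emeasure (R.pm (R.S c x)) {t} = 0" unfolding iff by blast
        from d[OF nb[OF N(1)] N(2)] d[OF tb t] N(1) show ?thesis unfolding iff by blast
      qed
    qed
    then show ?thesis by auto
  qed
  have pos: "?Q {a<..<b} (unit_vec (0, 1)) \<noteq> 0" if ab: "a < b" "{a<..<b} \<subseteq> ?I" for a b
  proof
    assume 0: "?Q {a<..<b} (unit_vec (0, 1)) = 0"
    let ?m = "R.pm (unit_vec (0, 1))"
    have m0: "emeasure ?m {a<..<b} = 0" using 0 R.P_eq_0_iff[of "{a<..<b}"] by simp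
    \<comment> \<open>Energies are taken from the middle third of the supposed gap. There the
      resolvents are bounded uniformly in \<open>k\<close>, since the measure lives at distance at
      least \<open>d\<close>.\<close>
    define d where "d = (b - a) / 3"
    define a' where "a' = a + d"
    define b' where "b' = b - d"
    have d3: "3 * d = b - a" by (simp add: d_def)
    have d: "d > 0" "a' < b'" "a < a'" "b' < b" using ab(1) d3 unfolding a'_def b'_def by linarith+
    have "a' \<in> {a<..<b}" "b' \<in> {a<..<b}" using d by auto
    then have "a' \<in> ?I" "b' \<in> ?I" using ab(2) by blast+
    then have "max \<bar>a'\<bar> \<bar>b'\<bar> < c0" by (simp add: abs_less_iff)
    from r(2)[OF this] obtain i where i: "\<bar>a'\<bar> < r i" "\<bar>b'\<bar> < r i" by auto
    then have sub: "{a'..b'} \<subseteq> {- r i..r i}" unfolding abs_less_iff atLeastatMost_subset_iff by linarith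
    define C where "C = measure ?m UNIV / d\<^sup>2"
    from H[OF G, of i] obtain g where "poisson_control (r i) (0, 1) g" by blast
    note g = poisson_controlD[OF this]
    obtain \<kappa> where \<kappa>: "\<kappa> > 0" "\<forall>\<^sub>F k in sequentially. \<forall>c\<in>{- r i..r i}. \<forall>w.
         A w - c *\<^sub>R w - (1 / real k) *\<^sub>R imul w = unit_vec (0, 1) \<longrightarrow> (norm w)\<^sup>2 \<le> C \<longrightarrow> \<kappa> * real k \<le> g k c"
      using g(5)[OF refl, of C] by blast
    have "\<forall>\<^sub>F k in sequentially. \<forall>c\<in>{a'..b'}. \<kappa> * real k \<le> g k c"
      using \<kappa>(2) eventually_gt_at_top[of 0]
    proof eventually_elim
      case (elim k)
      show ?case
      proof
        fix c assume c: "c \<in> {a'..b'}"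
        obtain w where w: "R.S c w - (1 / real k) *\<^sub>R imul w = unit_vec (0, 1)"
          "ennreal ((norm w)\<^sup>2) = (\<integral>\<^sup>+t. ennreal (1 / ((t - c)\<^sup>2 + (1 / real k)\<^sup>2)) \<partial>?m)"
          using R.poisson_resolvent[of "1 / real k" c "unit_vec (0, 1)"] elim by auto
        have "ennreal ((norm w)\<^sup>2) \<le> (\<integral>\<^sup>+t. ennreal (1 / d\<^sup>2) \<partial>?m)"
          unfolding w(2)
        proof (rule nn_integral_mono_AE)
          have "AE t in ?m. t \<notin> {a<..<b}"
            using m0 by (intro AE_I[where N="{a<..<b}"]) auto
          then show "AE t in ?m. ennreal (1 / ((t - c)\<^sup>2 + (1 / real k)\<^sup>2)) \<le> ennreal (1 / d\<^sup>2)"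
          proof eventually_elim
            case (elim t)
            then have "\<bar>d\<bar> \<le> \<bar>t - c\<bar>" using c d by (auto simp: a'_def b'_def)
            then have "d\<^sup>2 \<le> (t - c)\<^sup>2" by (simp only: abs_le_square_iff)
            then have "d\<^sup>2 \<le> (t - c)\<^sup>2 + (1 / real k)\<^sup>2" by (simp add: add_increasing2)
            then show ?case using d by (intro ennreal_leI divide_left_mono mult_pos_pos) (auto intro: order_less_le_trans[of 0 "d\<^sup>2"])
          qed
        qed
        also have "\<dots> = ennreal C"
          by (simp add: C_def R.pm.emeasure_eq_measure mult.commute flip: ennreal_mult)
        finally have "(norm w)\<^sup>2 \<le> C" by (simp add: C_def ennreal_le_iff)
        moreover have "A w - c *\<^sub>R w - (1 / real k) *\<^sub>R imul w = unit_vec (0, 1)"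
          using w(1) by (simp add: R.S_def)
        ultimately show "\<kappa> * real k \<le> g k c" using elim(1) sub c by blast
      qed
    qed
    moreover have "liminf (\<lambda>k. \<integral>\<^sup>+c\<in>{a'..b'}. ennreal ((g k c)\<^sup>2) \<partial>lborel) < \<infinity>"
    proof -
      have "liminf (\<lambda>k. \<integral>\<^sup>+c\<in>{a'..b'}. ennreal ((g k c)\<^sup>2) \<partial>lborel) \<le> liminf (\<lambda>k. \<integral>\<^sup>+c\<in>{- r i..r i}. ennreal ((g k c)\<^sup>2) \<partial>lborel)"
        using sub by (intro Liminf_mono always_eventually allI nn_integral_mono mult_left_mono) (auto simp: indicator_def)
      then show ?thesis using g(3) by (rule order_le_less_trans)
    qed
    ultimately show False by (rule liminf_square_integral_contradiction[OF d(2) \<kappa>(1)])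
  qed
  have ac: "complex_of_real ` ?I \<subseteq> spec_ac G2 op"
  proof -
    have "complex_of_real c \<in> spec_ac G2 op" if c: "c \<in> ?I" for c
    proof (rule ccontr)
      assume "complex_of_real c \<notin> spec_ac G2 op"
      then obtain d where d: "\<And>f. f \<in> fst op \<inter> ac_subspace G2 op \<Longrightarrow>
          ell2_norm G2 f \<le> d * ell2_norm G2 (\<lambda>x. snd op f x - complex_of_real c * f x)"
        unfolding spec_ac_def spectrum_in_def by blast
      \<comment> \<open>Half the distance to the nearer end keeps \<open>?B\<close> inside the
        interval. The second bound makes the product of \<open>\<eta>\<close> with the supposed
        inverse bound less than 1.\<close>
      define \<eta> where "\<eta> = min ((c0 - \<bar>c\<bar>) / 2) (1 / (\<bar>d\<bar> + 1) / 2)"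
      have \<eta>: "\<eta> > 0" using c by (auto simp: \<eta>_def add_nonneg_pos)
      have d\<eta>: "\<bar>d\<bar> * \<eta> < 1"
      proof -
        have "\<bar>d\<bar> * \<eta> \<le> \<bar>d\<bar> * (1 / (\<bar>d\<bar> + 1))" by (intro mult_left_mono) (auto simp: \<eta>_def min_le_iff_disj field_simps)
        also have "\<dots> < 1" by (simp add: field_simps add_nonneg_pos)
        finally show ?thesis .
      qed
      let ?B = "{c - \<eta><..<c + \<eta>}"
      have BI: "?B \<subseteq> ?I" 
      proof -
        have "\<eta> \<le> (c0 - \<bar>c\<bar>) / 2" unfolding \<eta>_def by (rule min.cobounded1)
        then show ?thesis using c by (auto simp: abs_if split: if_splits)
      qed
      \<comment> \<open>Nonzero, absolutely continuous, and moved by H - c by at most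
        \<open>\<eta>\<close> times its norm.\<close>
      define x where "x = ?Q ?B (unit_vec (0, 1))"
      have x0: "x \<noteq> 0" unfolding x_def using \<eta> BI by (intro pos) auto
      have "fn x \<in> ac_subspace G2 op"
        unfolding ac_subspace_def absolutely_continuous_def mem_Collect_eq sm
      proof (intro conjI subsetI fn)
        fix N :: "real set" assume N: "N \<in> null_sets lborel"
        then have Nb: "N \<in> sets borel" by (auto simp: null_sets_def)
        have "?Q N x = ?Q (N \<inter> ?B) (unit_vec (0, 1))"
          unfolding x_def using Nb by (intro R.P_Int) auto
        also have "\<dots> = 0" using N BI by (intro null) (auto intro: null_set_Int2)
        finally show "N \<in> null_sets (R.pm x)" using Nb R.P_eq_0_iff[OF Nb, of x] by (simp add: null_sets_def)
      qed
      then have "norm x \<le> d * norm (R.S c x)"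
        using d[of "fn x"] unfolding op_shift norm_fn by (simp add: dom_op)
      also have "\<dots> \<le> \<bar>d\<bar> * norm (R.S c x)" by (intro mult_right_mono) auto
      also have "\<dots> \<le> \<bar>d\<bar> * (\<eta> * norm x)"
        by (intro mult_left_mono R.norm_S_le[OF \<eta>]) (auto simp: x_def R.idem)
      finally have "norm x \<le> (\<bar>d\<bar> * \<eta>) * norm x" by simp
      moreover have "(\<bar>d\<bar> * \<eta>) * norm x < 1 * norm x" using d\<eta> x0 by (intro mult_strict_right_mono) auto
      ultimately show False by simp
    qed
    then show ?thesis by blast
  qed
  from ac pp sc show "complex_of_real ` {- c0<..<c0} \<subseteq> spec_ac G2 op"
    "spec_pp G2 op \<inter> complex_of_real ` {- c0<..<c0} = {}"
    "spec_sc G2 op \<inter> complex_of_real ` {- c0<..<c0} = {}" by blast+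
qed

end

section \<open>Layers of the tree\<close>

definition layer_sq :: "nat \<Rightarrow> (nat \<Rightarrow> complex) \<Rightarrow> real" where
  "layer_sq n f = (\<Sum>j\<in>{1..2 ^ n}. (cmod (f j))\<^sup>2)"

definition layer_inner :: "nat \<Rightarrow> (nat \<Rightarrow> complex) \<Rightarrow> (nat \<Rightarrow> complex) \<Rightarrow> complex" where
  "layer_inner n f g = (\<Sum>j\<in>{1..2 ^ n}. cnj (f j) * g j)"

text \<open>The lift of a layer to the next one. Its adjoint sums over the two children of a vertex,
  and it multiplies norms by sqrt 2.\<close>

definition dup :: "(nat \<Rightarrow> complex) \<Rightarrow> nat \<Rightarrow> complex" where
  "dup f j = f ((j + 1) div 2)"

definition matvec :: "nat \<Rightarrow> (nat \<Rightarrow> nat \<Rightarrow> complex) \<Rightarrow> (nat \<Rightarrow> complex) \<Rightarrow> nat \<Rightarrow> complex" where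
  "matvec n A f i = (\<Sum>k\<in>{1..2 ^ n}. A i k * f k)"

lemma sum_pairs: "(\<Sum>j\<in>{1..2 * N}. F j) = (\<Sum>i\<in>{1..N}. F (2 * i - 1) + F (2 * i))" for F :: "nat \<Rightarrow> 'a::comm_monoid_add"
proof (induction N)
  case (Suc N)
  have "{1..2 * Suc N} = insert (2 * Suc N) (insert (2 * Suc N - 1) {1..2 * N})" by auto
  then have "(\<Sum>j\<in>{1..2 * Suc N}. F j) = F (2 * Suc N) + (F (2 * Suc N - 1) + (\<Sum>j\<in>{1..2 * N}. F j))"
    by simp
  then show ?case using Suc.IH by (simp add: ac_simps)
qed simp

lemma layer_sum_children:
  "(\<Sum>j\<in>{1..2 ^ Suc n}. F j) = (\<Sum>i\<in>{1..2 ^ n}. F (2 * i - 1) + F (2 * i))" for F :: "nat \<Rightarrow> 'a::comm_monoid_add"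
  using sum_pairs[of F "2 ^ n"] by simp

lemma dup_child: "i \<ge> 1 \<Longrightarrow> dup f (2 * i - 1) = f i" "i \<ge> 1 \<Longrightarrow> dup f (2 * i) = f i"
proof -
  assume "i \<ge> 1"
  then have "(2 * i - 1 + 1) div 2 = i" by simp
  then show "dup f (2 * i - 1) = f i" by (simp add: dup_def)
next
  show "dup f (2 * i) = f i" by (simp add: dup_def)
qed

lemma layer_sq_dup: "layer_sq (Suc n) (dup f) = 2 * layer_sq n f"
  unfolding layer_sq_def layer_sum_children sum_distrib_left
proof (rule sum.cong[OF refl])
  fix i :: nat assume "i \<in> {1..2 ^ n}"
  then have "i \<ge> 1" by simp
  from dup_child[OF this, of f]
  show "(cmod (dup f (2 * i - 1)))\<^sup>2 + (cmod (dup f (2 * i)))\<^sup>2 = 2 * (cmod (f i))\<^sup>2"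
    by (simp only:)
qed

lemma layer_inner_dup:
  "layer_inner (Suc n) (dup f) g = (\<Sum>i\<in>{1..2 ^ n}. cnj (f i) * (g (2 * i - 1) + g (2 * i)))"
  unfolding layer_inner_def layer_sum_children
proof (rule sum.cong[OF refl])
  fix i :: nat assume "i \<in> {1..2 ^ n}"
  then have "i \<ge> 1" by simp
  from dup_child[OF this, of f]
  show "cnj (dup f (2 * i - 1)) * g (2 * i - 1) + cnj (dup f (2 * i)) * g (2 * i)
      = cnj (f i) * (g (2 * i - 1) + g (2 * i))"
    by (simp only: distrib_left)
qed

lemma layer_sq_nonneg: "0 \<le> layer_sq n f"
  by (simp add: layer_sq_def sum_nonneg)

lemma layer_sq_L2: "L2_set (\<lambda>j. cmod (f j)) {1..2 ^ n} = sqrt (layer_sq n f)"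
  by (simp add: L2_set_def layer_sq_def)

lemma layer_inner_cnj: "cnj (layer_inner n f g) = layer_inner n g f"
  by (simp add: layer_inner_def mult.commute)

lemma layer_inner_le: "cmod (layer_inner n f g) \<le> sqrt (layer_sq n f) * sqrt (layer_sq n g)"
proof -
  have "cmod (layer_inner n f g) \<le> (\<Sum>j\<in>{1..2 ^ n}. \<bar>cmod (f j)\<bar> * \<bar>cmod (g j)\<bar>)"
    unfolding layer_inner_def by (rule order_trans[OF norm_sum]) (simp add: norm_mult)
  also have "\<dots> \<le> L2_set (\<lambda>j. cmod (f j)) {1..2 ^ n} * L2_set (\<lambda>j. cmod (g j)) {1..2 ^ n}"
    by (rule L2_set_mult_ineq)
  finally show ?thesis unfolding layer_sq_L2 .
qed

lemma layer_inner_add_right: "layer_inner n f (\<lambda>j. g j + h j) = layer_inner n f g + layer_inner n f h"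
  and layer_inner_minus_right: "layer_inner n f (\<lambda>j. - g j) = - layer_inner n f g"
  and layer_inner_diff_right: "layer_inner n f (\<lambda>j. g j - h j) = layer_inner n f g - layer_inner n f h"
  and layer_inner_scale_right: "layer_inner n f (\<lambda>j. a * g j) = a * layer_inner n f g"
  by (simp_all add: layer_inner_def algebra_simps sum.distrib sum_subtractf sum_negf sum_distrib_left)

lemma layer_inner_cong:
  "(\<And>j. j \<in> {1..2 ^ n} \<Longrightarrow> f j = f' j) \<Longrightarrow> (\<And>j. j \<in> {1..2 ^ n} \<Longrightarrow> g j = g' j) \<Longrightarrow> layer_inner n f g = layer_inner n f' g'"
  unfolding layer_inner_def by (intro sum.cong) auto

lemma layer_sq_cong:
  "(\<And>j. j \<in> {1..2 ^ n} \<Longrightarrow> f j = f' j) \<Longrightarrow> layer_sq n f = layer_sq n f'"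
  unfolding layer_sq_def by (intro sum.cong) auto

lemma layer_sq_add_le: "layer_sq n (\<lambda>j. f j + g j) \<le> 2 * layer_sq n f + 2 * layer_sq n g"
proof -
  have "(cmod (f j + g j))\<^sup>2 \<le> 2 * (cmod (f j))\<^sup>2 + 2 * (cmod (g j))\<^sup>2" for j
  proof -
    have "(cmod (f j + g j))\<^sup>2 \<le> (cmod (f j) + cmod (g j))\<^sup>2"
      by (intro power_mono norm_triangle_ineq) auto
    then show ?thesis using sum_squares_bound[of "cmod (f j)" "cmod (g j)"] by (simp add: power2_sum)
  qed
  then show ?thesis unfolding layer_sq_def sum_distrib_left sum.distrib[symmetric] by (rule sum_mono)
qed

lemma matvec_hermitian:
  assumes "hermitian_mat (2 ^ n) A"
  shows "layer_inner n f (matvec n A g) = layer_inner n (matvec n A f) g"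
proof -
  have "layer_inner n f (matvec n A g) = (\<Sum>j\<in>{1..2 ^ n}. \<Sum>k\<in>{1..2 ^ n}. cnj (f j) * A j k * g k)"
    by (simp add: layer_inner_def matvec_def sum_distrib_left mult.assoc)
  also have "\<dots> = (\<Sum>j\<in>{1..2 ^ n}. \<Sum>k\<in>{1..2 ^ n}. cnj (A k j * f j) * g k)"
  proof (intro sum.cong refl)
    fix j k :: nat assume "j \<in> {1..2 ^ n}" "k \<in> {1..2 ^ n}"
    then have "A j k = cnj (A k j)" using assms unfolding hermitian_mat_def by blast
    then show "cnj (f j) * A j k * g k = cnj (A k j * f j) * g k" by simp
  qed
  also have "\<dots> = layer_inner n (matvec n A f) g"
    by (subst sum.swap) (simp add: layer_inner_def matvec_def sum_distrib_right)
  finally show ?thesis .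
qed

subsection \<open>The operator norm of matrices\<close>

lemma mat_op_norm_aux:
  fixes A :: "nat \<Rightarrow> nat \<Rightarrow> complex" and N :: nat
  defines "X \<equiv> {L2_set (\<lambda>i. cmod (\<Sum>j\<in>{1..N}. A i j * u j)) {1..N} | u. L2_set (\<lambda>j. cmod (u j)) {1..N} \<le> 1}"
  shows "bdd_above X" "0 \<in> X" "\<And>x. x \<in> X \<Longrightarrow> x \<le> (\<Sum>i\<in>{1..N}. \<Sum>j\<in>{1..N}. cmod (A i j))"
proof -
  show *: "x \<le> (\<Sum>i\<in>{1..N}. \<Sum>j\<in>{1..N}. cmod (A i j))" if "x \<in> X" for x
  proof -
    from that obtain u where u: "L2_set (\<lambda>j. cmod (u j)) {1..N} \<le> 1"
      and x: "x = L2_set (\<lambda>i. cmod (\<Sum>j\<in>{1..N}. A i j * u j)) {1..N}" unfolding X_def by blast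
    have u1: "cmod (u j) \<le> 1" if "j \<in> {1..N}" for j
      using member_le_L2_set[of "{1..N}" j "\<lambda>j. cmod (u j)"] that u by simp
    have "x \<le> (\<Sum>i\<in>{1..N}. cmod (\<Sum>j\<in>{1..N}. A i j * u j))"
      unfolding x by (rule L2_set_le_sum) simp
    also have "\<dots> \<le> (\<Sum>i\<in>{1..N}. \<Sum>j\<in>{1..N}. cmod (A i j))"
    proof (rule sum_mono)
      fix i assume "i \<in> {1..N}"
      have "cmod (\<Sum>j\<in>{1..N}. A i j * u j) \<le> (\<Sum>j\<in>{1..N}. cmod (A i j * u j))" by (rule norm_sum)
      also have "\<dots> \<le> (\<Sum>j\<in>{1..N}. cmod (A i j))"
        using u1 by (intro sum_mono) (simp add: norm_mult mult_left_le)
      finally show "cmod (\<Sum>j\<in>{1..N}. A i j * u j) \<le> (\<Sum>j\<in>{1..N}. cmod (A i j))" .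
    qed
    finally show ?thesis .
  qed
  then show "bdd_above X" by (rule bdd_aboveI)
  show "0 \<in> X" unfolding X_def by (intro CollectI exI[of _ "\<lambda>_. 0"]) (simp add: L2_set_def)
qed

lemma mat_op_norm_nonneg: "0 \<le> mat_op_norm N A"
  unfolding mat_op_norm_def by (rule cSup_upper[OF mat_op_norm_aux(2,1)])

lemma mat_op_norm_le_sum: "mat_op_norm N A \<le> (\<Sum>i\<in>{1..N}. \<Sum>j\<in>{1..N}. cmod (A i j))"
  unfolding mat_op_norm_def using mat_op_norm_aux(2)[where N=N and A=A] by (intro cSup_least mat_op_norm_aux(3)) auto

lemma mat_op_norm_bound:
  "L2_set (\<lambda>i. cmod (\<Sum>j\<in>{1..N}. A i j * u j)) {1..N} \<le> mat_op_norm N A * L2_set (\<lambda>j. cmod (u j)) {1..N}"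
proof (cases "L2_set (\<lambda>j. cmod (u j)) {1..N} = 0")
  case True
  then have "cmod (u j) = 0" if "j \<in> {1..N}" for j
    using that by (subst (asm) L2_set_eq_0_iff) auto
  then have "L2_set (\<lambda>i. cmod (\<Sum>j\<in>{1..N}. A i j * u j)) {1..N} = 0"
    by (intro L2_set_0') auto
  then show ?thesis using True by simp
next
  case False
  define s where "s = L2_set (\<lambda>j. cmod (u j)) {1..N}"
  have "s \<ge> 0" unfolding s_def by (rule L2_set_nonneg)
  moreover have "s \<noteq> 0" unfolding s_def by (rule False)
  ultimately have s: "s > 0" by simp
  define w where "w j = complex_of_real (1 / s) * u j" for j
  have sc: "L2_set (\<lambda>i. (1/s) * f i) {1..N} = (1/s) * L2_set f {1..N}" for f
    using s by (simp only: L2_set_right_distrib[of "1/s" f, symmetric] less_imp_le zero_less_divide_1_iff)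
  have cw: "cmod (w j) = (1/s) * cmod (u j)" for j using s by (simp add: w_def norm_mult norm_divide)
  have "L2_set (\<lambda>j. cmod (w j)) {1..N} \<le> 1"
    unfolding cw sc using s by (simp add: s_def)
  then have "L2_set (\<lambda>i. cmod (\<Sum>j\<in>{1..N}. A i j * w j)) {1..N} \<le> mat_op_norm N A"
    unfolding mat_op_norm_def by (intro cSup_upper[OF _ mat_op_norm_aux(1)]) blast
  moreover have "cmod (\<Sum>j\<in>{1..N}. A i j * w j) = (1/s) * cmod (\<Sum>j\<in>{1..N}. A i j * u j)" for i
  proof -
    have "(\<Sum>j\<in>{1..N}. A i j * w j) = complex_of_real (1/s) * (\<Sum>j\<in>{1..N}. A i j * u j)"
      unfolding sum_distrib_left by (intro sum.cong) (auto simp: w_def)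
    then show ?thesis using s by (simp add: norm_mult norm_divide)
  qed
  ultimately have "(1/s) * L2_set (\<lambda>i. cmod (\<Sum>j\<in>{1..N}. A i j * u j)) {1..N} \<le> mat_op_norm N A"
    by (simp only: sc)
  then have "L2_set (\<lambda>i. cmod (\<Sum>j\<in>{1..N}. A i j * u j)) {1..N} \<le> mat_op_norm N A * s"
    using s by (simp add: field_simps)
  then show ?thesis unfolding s_def .
qed

lemma layer_sq_matvec: "sqrt (layer_sq n (matvec n A f)) \<le> mat_op_norm (2 ^ n) A * sqrt (layer_sq n f)"
  using mat_op_norm_bound[where N="2 ^ n" and A=A and u=f] by (simp add: layer_sq_L2[symmetric] matvec_def)

lemma layer_sq_matvec_sq: "layer_sq n (matvec n A f) \<le> (mat_op_norm (2 ^ n) A)\<^sup>2 * layer_sq n f"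
proof -
  have "(sqrt (layer_sq n (matvec n A f)))\<^sup>2 \<le> (mat_op_norm (2 ^ n) A * sqrt (layer_sq n f))\<^sup>2"
    by (intro power_mono layer_sq_matvec) (simp add: layer_sq_nonneg)
  then show ?thesis by (simp add: layer_sq_nonneg power_mult_distrib)
qed

subsection \<open>Green's identity\<close>

definition at_layer :: "(nat \<times> nat \<Rightarrow> complex) \<Rightarrow> nat \<Rightarrow> nat \<Rightarrow> complex" where
  "at_layer f n j = f (n, j)"

text \<open>The discrete Wronskian of \<open>f\<close> and \<open>g\<close> on the edges between
  layers n and n + 1.\<close>

definition flux :: "(nat \<times> nat \<Rightarrow> complex) \<Rightarrow> (nat \<times> nat \<Rightarrow> complex) \<Rightarrow> nat \<Rightarrow> complex" where
  "flux f g n = cnj (layer_inner (Suc n) (dup (at_layer g n)) (at_layer f (Suc n)))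
     - layer_inner (Suc n) (dup (at_layer f n)) (at_layer g (Suc n))"

lemma H2_action:
  assumes "j \<in> {1..2 ^ n}"
  shows "snd (H2 W) f (n, j) = - (if n = 0 then 0 else dup (at_layer f (n - 1)) j)
    - (at_layer f (Suc n) (2 * j - 1) + at_layer f (Suc n) (2 * j)) + matvec n (W n) (at_layer f n) j"
  using assms by (simp add: H2_def Delta2_def potential_def G2_def dup_def at_layer_def matvec_def)

lemma layer_inner_H2:
  "layer_inner n (at_layer f n) (at_layer (snd (H2 W) g) n) =
     - (if n = 0 then 0 else cnj (layer_inner n (dup (at_layer g (n - 1))) (at_layer f n)))
     - layer_inner (Suc n) (dup (at_layer f n)) (at_layer g (Suc n))
     + layer_inner n (at_layer f n) (matvec n (W n) (at_layer g n))"
proof -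
  have "layer_inner n (at_layer f n) (at_layer (snd (H2 W) g) n)
     = layer_inner n (at_layer f n) (\<lambda>j. - (if n = 0 then 0 else dup (at_layer g (n - 1)) j)
       - (at_layer g (Suc n) (2 * j - 1) + at_layer g (Suc n) (2 * j)) + matvec n (W n) (at_layer g n) j)"
    by (intro layer_inner_cong refl) (simp only: at_layer_def[of "snd (H2 W) g"] H2_action)
  also have "\<dots> = - layer_inner n (at_layer f n) (\<lambda>j. if n = 0 then 0 else dup (at_layer g (n - 1)) j)
     - layer_inner n (at_layer f n) (\<lambda>j. at_layer g (Suc n) (2 * j - 1) + at_layer g (Suc n) (2 * j))
     + layer_inner n (at_layer f n) (matvec n (W n) (at_layer g n))"
    by (simp only: layer_inner_add_right layer_inner_diff_right layer_inner_minus_right)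
  also have "layer_inner n (at_layer f n) (\<lambda>j. at_layer g (Suc n) (2 * j - 1) + at_layer g (Suc n) (2 * j))
     = layer_inner (Suc n) (dup (at_layer f n)) (at_layer g (Suc n))"
    by (simp only: layer_inner_dup) (simp only: layer_inner_def)
  also have "layer_inner n (at_layer f n) (\<lambda>j. if n = 0 then 0 else dup (at_layer g (n - 1)) j)
     = (if n = 0 then 0 else cnj (layer_inner n (dup (at_layer g (n - 1))) (at_layer f n)))"
    by (simp add: layer_inner_cnj) (simp add: layer_inner_def)
  finally show ?thesis .
qed

text \<open>The Hermitian potential cancels. What remains of the hopping terms lives on the edges to
  the neighbouring layers, so sums over layers telescope.\<close>

lemma green_identity:
  assumes "hermitian_mat (2 ^ n) (W n)"
  shows "layer_inner n (at_layer f n) (at_layer (snd (H2 W) g) n) - layer_inner n (at_layer (snd (H2 W) f) n) (at_layer g n)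
     = flux f g n - (if n = 0 then 0 else flux f g (n - 1))"
proof -
  have "layer_inner n (at_layer (snd (H2 W) f) n) (at_layer g n)
     = cnj (layer_inner n (at_layer g n) (at_layer (snd (H2 W) f) n))" by (simp add: layer_inner_cnj)
  also have "\<dots> = - (if n = 0 then 0 else layer_inner n (dup (at_layer f (n - 1))) (at_layer g n))
     - cnj (layer_inner (Suc n) (dup (at_layer g n)) (at_layer f (Suc n)))
     + layer_inner n (at_layer f n) (matvec n (W n) (at_layer g n))"
    unfolding layer_inner_H2 using matvec_hermitian[OF assms] by (simp add: layer_inner_cnj)
  finally show ?thesis unfolding layer_inner_H2 flux_def by (cases n) auto
qed

lemma flux_le:
  "cmod (flux f g n) \<le> sqrt 2 * (sqrt (layer_sq n (at_layer g n)) * sqrt (layer_sq (Suc n) (at_layer f (Suc n)))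
     + sqrt (layer_sq n (at_layer f n)) * sqrt (layer_sq (Suc n) (at_layer g (Suc n))))"
proof -
  have "cmod (layer_inner (Suc n) (dup (at_layer h n)) (at_layer k (Suc n)))
    \<le> sqrt 2 * (sqrt (layer_sq n (at_layer h n)) * sqrt (layer_sq (Suc n) (at_layer k (Suc n))))" for h k
    using layer_inner_le[of "Suc n" "dup (at_layer h n)" "at_layer k (Suc n)"]
    by (simp add: layer_sq_dup real_sqrt_mult mult.assoc)
  from this[of g f] this[of f g] show ?thesis
    unfolding flux_def
    by (intro order_trans[OF norm_triangle_ineq4]) (simp add: distrib_left)
qed

subsection \<open>The Schroedinger operator as a bounded symmetric operator\<close>

definition ball_set :: "nat \<Rightarrow> (nat \<times> nat) set" where
  "ball_set N = Sigma {..<N} (\<lambda>n. {1..2 ^ n})"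

lemma sum_ball_set: "(\<Sum>v\<in>ball_set N. F v) = (\<Sum>n<N. \<Sum>j\<in>{1..2 ^ n}. F (n, j))"
  unfolding ball_set_def by (subst sum.Sigma) (auto simp: split_def)

lemma ball_set: "finite (ball_set N)" "ball_set N \<subseteq> G2"
  by (auto simp: ball_set_def G2_def)

lemma finite_subset_ball_set:
  assumes "finite F" "F \<subseteq> G2" obtains N where "F \<subseteq> ball_set N"
proof
  show "F \<subseteq> ball_set (Suc (Max (fst ` F)))"
  proof
    fix v assume v: "v \<in> F"
    then have "fst v \<le> Max (fst ` F)" using assms by (intro Max_ge) auto
    moreover have "v \<in> G2" using v assms by blast
    ultimately show "v \<in> ball_set (Suc (Max (fst ` F)))" by (cases v) (auto simp: ball_set_def G2_def)
  qed
qed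

lemma layer_sums_le: "f \<in> ell2 G2 \<Longrightarrow> (\<Sum>n<N. layer_sq n (at_layer f n)) \<le> (ell2_norm G2 f)\<^sup>2"
  using ell2_norm_finite_sum_le[OF _ ball_set, of f N] by (simp add: sum_ball_set layer_sq_def at_layer_def)

lemma ell2_layersI:
  assumes "\<And>v. v \<notin> G2 \<Longrightarrow> f v = 0" "\<And>N. (\<Sum>n<N. layer_sq n (at_layer f n)) \<le> C"
  shows "f \<in> ell2 G2" "C \<le> d\<^sup>2 \<Longrightarrow> 0 \<le> d \<Longrightarrow> ell2_norm G2 f \<le> d"
proof -
  have b: "(\<Sum>v\<in>F. (cmod (f v))\<^sup>2) \<le> C" if F: "finite F" "F \<subseteq> G2" for F
  proof -
    obtain N where "F \<subseteq> ball_set N" by (rule finite_subset_ball_set[OF F])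
    then have "(\<Sum>v\<in>F. (cmod (f v))\<^sup>2) \<le> (\<Sum>v\<in>ball_set N. (cmod (f v))\<^sup>2)"
      by (intro sum_mono2 ball_set) auto
    also have "\<dots> \<le> C" using assms(2)[of N] by (simp add: sum_ball_set layer_sq_def at_layer_def)
    finally show ?thesis .
  qed
  show e: "f \<in> ell2 G2" using assms(1) b by (rule ell2_bounded_sumsI)
  show "ell2_norm G2 f \<le> d" if "C \<le> d\<^sup>2" "0 \<le> d"
    using e by (rule ell2_norm_leI) (use b that in \<open>auto intro: order_trans\<close>)
qed

text \<open>The sets formed by the first N layers are cofinal among the finite sets of vertices, so
  the unordered sum is the limit of the layer sums.\<close>

lemma ell2_inner_layers:
  assumes "f \<in> ell2 G2" "g \<in> ell2 G2"
  shows "(\<lambda>N. \<Sum>n<N. layer_inner n (at_layer f n) (at_layer g n)) \<longlonglongrightarrow> ell2_inner G2 f g"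
proof -
  have "((\<lambda>v. cnj (f v) * g v) has_sum ell2_inner G2 f g) G2"
    unfolding ell2_inner_def by (rule has_sum_infsum[OF ell2_inner_summable[OF assms]])
  then have "(sum (\<lambda>v. cnj (f v) * g v) \<longlongrightarrow> ell2_inner G2 f g) (finite_subsets_at_top G2)"
    by (simp add: has_sum_def)
  moreover have "filterlim ball_set (finite_subsets_at_top G2) sequentially"
    unfolding filterlim_iff eventually_finite_subsets_at_top
  proof (intro allI impI)
    fix Q assume "\<exists>X. finite X \<and> X \<subseteq> G2 \<and> (\<forall>Y. finite Y \<and> X \<subseteq> Y \<and> Y \<subseteq> G2 \<longrightarrow> Q Y)"
    then obtain X where X: "finite X" "X \<subseteq> G2" "\<forall>Y. finite Y \<and> X \<subseteq> Y \<and> Y \<subseteq> G2 \<longrightarrow> Q Y"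
      by (elim exE conjE)
    obtain N where N: "X \<subseteq> ball_set N" by (rule finite_subset_ball_set[OF X(1,2)])
    show "\<forall>\<^sub>F N in sequentially. Q (ball_set N)"
      using eventually_ge_at_top[of N]
    proof eventually_elim
      case (elim M)
      then have "ball_set N \<subseteq> ball_set M" by (auto simp: ball_set_def)
      then have "X \<subseteq> ball_set M" using N by (rule order_trans[rotated])
      then show ?case using X(3)[rule_format, of "ball_set M"] ball_set[of M] by simp
    qed
  qed
  ultimately have "(\<lambda>N. sum (\<lambda>v. cnj (f v) * g v) (ball_set N)) \<longlonglongrightarrow> ell2_inner G2 f g"
    by (rule filterlim_compose)
  then show ?thesis by (simp add: sum_ball_set layer_inner_def at_layer_def)
qed

lemma layer_sq_tendsto_0:
  assumes "f \<in> ell2 G2"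
  shows "(\<lambda>n. layer_sq n (at_layer f n)) \<longlonglongrightarrow> 0"
proof (rule summable_LIMSEQ_zero)
  show "summable (\<lambda>n. layer_sq n (at_layer f n))"
    using layer_sums_le[OF assms] by (intro bounded_imp_summable[where B="(ell2_norm G2 f)\<^sup>2"])
      (auto simp: layer_sq_nonneg lessThan_Suc_atMost[symmetric] simp del: sum.lessThan_Suc)
qed

locale tree_potential =
  fixes W :: "nat \<Rightarrow> nat \<Rightarrow> nat \<Rightarrow> complex" and K :: real
  assumes herm: "\<And>n. hermitian_mat (2 ^ n) (W n)" and bounded: "\<And>n. mat_op_norm (2 ^ n) (W n) \<le> K"
begin

lemma potential_bounds:
  assumes f: "f \<in> ell2 G2"
  shows "potential W f \<in> ell2 G2"
proof (rule ell2_layersI(1))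
  show "potential W f v = 0" if "v \<notin> G2" for v using that by (cases v) (simp add: potential_def)
  fix N
  have "layer_sq n (at_layer (potential W f) n) \<le> K\<^sup>2 * layer_sq n (at_layer f n)" for n
  proof -
    have "layer_sq n (at_layer (potential W f) n) = layer_sq n (matvec n (W n) (at_layer f n))"
      by (rule layer_sq_cong) (simp add: at_layer_def potential_def G2_def matvec_def)
    also have "\<dots> \<le> (mat_op_norm (2 ^ n) (W n))\<^sup>2 * layer_sq n (at_layer f n)" by (rule layer_sq_matvec_sq)
    also have "\<dots> \<le> K\<^sup>2 * layer_sq n (at_layer f n)"
      by (intro mult_right_mono power_mono bounded mat_op_norm_nonneg layer_sq_nonneg)
    finally show ?thesis .
  qed
  then have "(\<Sum>n<N. layer_sq n (at_layer (potential W f) n)) \<le> K\<^sup>2 * (\<Sum>n<N. layer_sq n (at_layer f n))"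
    unfolding sum_distrib_left by (rule sum_mono)
  also have "\<dots> \<le> K\<^sup>2 * (ell2_norm G2 f)\<^sup>2" by (intro mult_left_mono layer_sums_le f) auto
  finally show "(\<Sum>n<N. layer_sq n (at_layer (potential W f) n)) \<le> K\<^sup>2 * (ell2_norm G2 f)\<^sup>2" .
qed

text \<open>The coefficient 8 comes from applying |u + v|^2 \<le> 2 |u|^2 + 2 |v|^2 twice and from a
  factor 2 for the two children.\<close>

lemma H2_layer_le:
  "layer_sq n (at_layer (snd (H2 W) f) n) \<le> 8 * (if n = 0 then 0 else layer_sq (n - 1) (at_layer f (n - 1)))
     + 8 * layer_sq (Suc n) (at_layer f (Suc n)) + 2 * K\<^sup>2 * layer_sq n (at_layer f n)"
proof -
  define a where "a j = - (if n = 0 then 0 else dup (at_layer f (n - 1)) j)" for j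
  define b where "b j = - (at_layer f (Suc n) (2 * j - 1) + at_layer f (Suc n) (2 * j))" for j
  have "layer_sq n (at_layer (snd (H2 W) f) n) = layer_sq n (\<lambda>j. (a j + b j) + matvec n (W n) (at_layer f n) j)"
    by (rule layer_sq_cong) (simp only: at_layer_def[of "snd (H2 W) f"] H2_action a_def b_def, simp)
  also have "\<dots> \<le> 2 * layer_sq n (\<lambda>j. a j + b j) + 2 * layer_sq n (matvec n (W n) (at_layer f n))"
    by (rule layer_sq_add_le)
  also have "layer_sq n (\<lambda>j. a j + b j) \<le> 2 * layer_sq n a + 2 * layer_sq n b" by (rule layer_sq_add_le)
  also have "layer_sq n a = (if n = 0 then 0 else 2 * layer_sq (n - 1) (at_layer f (n - 1)))"
  proof (cases n)
    case (Suc m)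
    then have "layer_sq n a = layer_sq (Suc m) (dup (at_layer f m))" by (simp add: layer_sq_def a_def)
    then show ?thesis using Suc by (simp add: layer_sq_dup)
  qed (simp add: a_def layer_sq_def)
  also have "layer_sq n b \<le> 2 * layer_sq (Suc n) (at_layer f (Suc n))"
  proof -
    have "layer_sq n b \<le> 2 * layer_sq n (\<lambda>j. at_layer f (Suc n) (2 * j - 1)) + 2 * layer_sq n (\<lambda>j. at_layer f (Suc n) (2 * j))"
      using layer_sq_add_le[of n "\<lambda>j. at_layer f (Suc n) (2 * j - 1)" "\<lambda>j. at_layer f (Suc n) (2 * j)"]
      by (simp add: b_def layer_sq_def norm_minus_commute[symmetric] flip: minus_add_distrib)
    also have "\<dots> = 2 * layer_sq (Suc n) (at_layer f (Suc n))"
      unfolding layer_sq_def layer_sum_children sum.distrib by simp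
    finally show ?thesis .
  qed
  also have "layer_sq n (matvec n (W n) (at_layer f n)) \<le> K\<^sup>2 * layer_sq n (at_layer f n)"
  proof -
    have "(mat_op_norm (2 ^ n) (W n))\<^sup>2 * layer_sq n (at_layer f n) \<le> K\<^sup>2 * layer_sq n (at_layer f n)"
      by (intro mult_right_mono power_mono bounded mat_op_norm_nonneg layer_sq_nonneg)
    with layer_sq_matvec_sq show ?thesis by (rule order_trans)
  qed
  finally show ?thesis by (simp add: algebra_simps split: if_splits)
qed

lemma H2_bounded:
  assumes f: "f \<in> ell2 G2"
  shows "snd (H2 W) f \<in> ell2 G2" "ell2_norm G2 (snd (H2 W) f) \<le> sqrt (16 + 2 * K\<^sup>2) * ell2_norm G2 f"
proof -
  have z: "snd (H2 W) f v = 0" if "v \<notin> G2" for v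
    using that by (cases v) (simp add: H2_def Delta2_def potential_def)
  have b: "(\<Sum>n<N. layer_sq n (at_layer (snd (H2 W) f) n)) \<le> (16 + 2 * K\<^sup>2) * (ell2_norm G2 f)\<^sup>2" for N
  proof -
    let ?l = "\<lambda>n. layer_sq n (at_layer f n)"
    have "(\<Sum>n<N. layer_sq n (at_layer (snd (H2 W) f) n))
      \<le> (\<Sum>n<N. 8 * (if n = 0 then 0 else ?l (n - 1)) + 8 * ?l (Suc n) + 2 * K\<^sup>2 * ?l n)"
      by (intro sum_mono H2_layer_le)
    also have "\<dots> = 8 * (\<Sum>n<N. if n = 0 then 0 else ?l (n - 1)) + 8 * (\<Sum>n<N. ?l (Suc n)) + 2 * K\<^sup>2 * (\<Sum>n<N. ?l n)"
      by (simp add: sum.distrib sum_distrib_left)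
    also have "(\<Sum>n<N. if n = 0 then 0 else ?l (n - 1)) \<le> (\<Sum>n<N. ?l n)"
    proof (cases N)
      case (Suc M)
      then have "(\<Sum>n<N. if n = 0 then 0 else ?l (n - 1)) = (\<Sum>n<M. ?l n)"
        by (simp add: sum.lessThan_Suc_shift del: sum.lessThan_Suc)
      also have "\<dots> \<le> (\<Sum>n<N. ?l n)" using Suc by (intro sum_mono2) (auto simp: layer_sq_nonneg)
      finally show ?thesis .
    qed simp
    also have "(\<Sum>n<N. ?l (Suc n)) \<le> (\<Sum>n<Suc N. ?l n)"
      by (simp add: sum.lessThan_Suc_shift layer_sq_nonneg del: sum.lessThan_Suc)
    also have "8 * (\<Sum>n<N. ?l n) + 8 * (\<Sum>n<Suc N. ?l n) + 2 * K\<^sup>2 * (\<Sum>n<N. ?l n)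
      \<le> 8 * (ell2_norm G2 f)\<^sup>2 + 8 * (ell2_norm G2 f)\<^sup>2 + 2 * K\<^sup>2 * (ell2_norm G2 f)\<^sup>2"
      by (intro add_mono mult_left_mono layer_sums_le f) auto
    finally show ?thesis by (simp add: algebra_simps)
  qed
  show "snd (H2 W) f \<in> ell2 G2" using z b by (rule ell2_layersI(1))
  show "ell2_norm G2 (snd (H2 W) f) \<le> sqrt (16 + 2 * K\<^sup>2) * ell2_norm G2 f"
    using z b by (rule ell2_layersI(2)) (auto simp: power_mult_distrib ell2_norm_def infsum_nonneg)
qed

lift_definition A :: "l2 \<Rightarrow> l2" is "snd (H2 W)" by (rule H2_bounded)

end

context tree_potential
begin

lemma fn_A: "fn (A x) v = snd (H2 W) (fn x) v"
  by transfer simp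

lemma H2_linear: "snd (H2 W) (\<lambda>v. a * f v + b * g v) v = a * snd (H2 W) f v + b * snd (H2 W) g v"
  by (cases v) (simp add: H2_def Delta2_def potential_def algebra_simps sum.distrib sum_distrib_left)

lemma bounded_linear_A: "bounded_linear A"
proof (rule bounded_linear_intro[where K="sqrt (16 + 2 * K\<^sup>2)"])
  fix x y and r :: real
  have "fn (x + y) = (\<lambda>v. 1 * fn x v + 1 * fn y v)" "fn (r *\<^sub>R x) = (\<lambda>v. complex_of_real r * fn x v + 0 * fn x v)" by auto
  then show "A (x + y) = A x + A y" "A (r *\<^sub>R x) = r *\<^sub>R A x"
    by (intro l2_eqI; simp only: fn_A H2_linear fn_simps; simp add: fn_A)+
  show "norm (A x) \<le> norm x * sqrt (16 + 2 * K\<^sup>2)"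
    using H2_bounded(2)[OF fn, of x] by (simp add: norm_fn fn_A[abs_def] mult.commute)
qed

lemma A_imul: "imul (A x) = A (imul x)"
proof -
  have "fn (imul x) = (\<lambda>v. \<i> * fn x v + 0 * fn x v)" by auto
  then show ?thesis by (intro l2_eqI) (simp only: fn_A H2_linear fn_imul, simp)
qed

text \<open>Green's identity summed up to layer N leaves the flux at N, and this tends to 0 for
  square-summable functions.\<close>

lemma inner_A: "inner x (A y) = inner (A x) y"
proof -
  let ?f = "fn x" and ?g = "fn y"
  have Hf: "snd (H2 W) ?f \<in> ell2 G2" "snd (H2 W) ?g \<in> ell2 G2" by (intro H2_bounded fn)+
  have tele: "(\<Sum>n<Suc N. layer_inner n (at_layer ?f n) (at_layer (snd (H2 W) ?g) n))
     - (\<Sum>n<Suc N. layer_inner n (at_layer (snd (H2 W) ?f) n) (at_layer ?g n)) = flux ?f ?g N" for N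
  proof (induction N)
    case 0 show ?case using green_identity[where W=W and n=0, OF herm, of ?f ?g] by simp
  next
    case (Suc N)
    then show ?case using green_identity[where W=W and n="Suc N", OF herm, of ?f ?g] by (simp add: algebra_simps)
  qed
  have "(\<lambda>N. (\<Sum>n<Suc N. layer_inner n (at_layer ?f n) (at_layer (snd (H2 W) ?g) n))
     - (\<Sum>n<Suc N. layer_inner n (at_layer (snd (H2 W) ?f) n) (at_layer ?g n)))
     \<longlonglongrightarrow> ell2_inner G2 ?f (snd (H2 W) ?g) - ell2_inner G2 (snd (H2 W) ?f) ?g"
    by (intro tendsto_diff LIMSEQ_Suc ell2_inner_layers fn Hf)
  then have lim: "flux ?f ?g \<longlonglongrightarrow> ell2_inner G2 ?f (snd (H2 W) ?g) - ell2_inner G2 (snd (H2 W) ?f) ?g"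
    unfolding tele .
  have "flux ?f ?g \<longlonglongrightarrow> 0"
  proof (rule Lim_null_comparison[OF always_eventually])
    show "\<forall>n. norm (flux ?f ?g n) \<le> sqrt 2 * (sqrt (layer_sq n (at_layer ?g n)) * sqrt (layer_sq (Suc n) (at_layer ?f (Suc n)))
     + sqrt (layer_sq n (at_layer ?f n)) * sqrt (layer_sq (Suc n) (at_layer ?g (Suc n))))"
      using flux_le by blast
    have z: "(\<lambda>n. sqrt (layer_sq n (at_layer h n))) \<longlonglongrightarrow> 0" if "h \<in> ell2 G2" for h
      using tendsto_real_sqrt[OF layer_sq_tendsto_0[OF that]] by simp
    have "(\<lambda>n. sqrt 2 * (sqrt (layer_sq n (at_layer ?g n)) * sqrt (layer_sq (Suc n) (at_layer ?f (Suc n)))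
     + sqrt (layer_sq n (at_layer ?f n)) * sqrt (layer_sq (Suc n) (at_layer ?g (Suc n))))) \<longlonglongrightarrow> sqrt 2 * (0 * 0 + 0 * 0)"
      by (intro tendsto_intros z LIMSEQ_Suc[OF z] fn)
    then show "(\<lambda>n. sqrt 2 * (sqrt (layer_sq n (at_layer ?g n)) * sqrt (layer_sq (Suc n) (at_layer ?f (Suc n)))
     + sqrt (layer_sq n (at_layer ?f n)) * sqrt (layer_sq (Suc n) (at_layer ?g (Suc n))))) \<longlonglongrightarrow> 0" by simp
  qed
  from LIMSEQ_unique[OF lim this] show ?thesis
    by (simp add: inner_fn fn_A[abs_def])
qed

lemma tree_operator_A: "tree_operator A (H2 W)"
proof
  show "symmetric_op A" using bounded_linear_A inner_A by (simp add: symmetric_op_def)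
  show "imul (A x) = A (imul x)" for x by (rule A_imul)
  show "fst (H2 W) = ell2 G2" using potential_bounds by (auto simp: H2_def)
  show "snd (H2 W) (fn x) = fn (A x)" for x by (simp add: fn_A[abs_def])
qed

sublocale op: tree_operator A "H2 W" by (rule tree_operator_A)

end

section \<open>Generalized eigenfunctions that agree on siblings\<close>

text \<open>The equation at a vertex prescribes the sum over its two children; the factor 1/2
  divides it equally between them. Step \<open>i\<close> uses the potential of the layers strictly
  between m and m + i only.\<close>

fun sol :: "(nat \<Rightarrow> nat \<Rightarrow> nat \<Rightarrow> complex) \<Rightarrow> real \<Rightarrow> nat \<Rightarrow> (nat \<Rightarrow> complex) \<Rightarrow> (nat \<Rightarrow> complex) \<Rightarrow> nat \<Rightarrow> nat \<Rightarrow> complex" where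
  "sol W c m p q 0 = p"
| "sol W c m p q (Suc 0) = q"
| "sol W c m p q (Suc (Suc k)) = dup (\<lambda>i. (1 / 2) * (- dup (sol W c m p q k) i
     + matvec (m + Suc k) (W (m + Suc k)) (sol W c m p q (Suc k)) i - complex_of_real c * sol W c m p q (Suc k) i))"

text \<open>The data \<open>p\<close>, \<open>q\<close> on layers m and m + 1 are free, so the
  eigenvalue equation holds in the layers after m but in general not at m itself.\<close>

definition tree_sol :: "(nat \<Rightarrow> nat \<Rightarrow> nat \<Rightarrow> complex) \<Rightarrow> real \<Rightarrow> nat \<Rightarrow> (nat \<Rightarrow> complex) \<Rightarrow> (nat \<Rightarrow> complex) \<Rightarrow> nat \<times> nat \<Rightarrow> complex" where
  "tree_sol W c m p q = (\<lambda>(n, j). if n < m then 0 else sol W c m p q (n - m) j)"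

lemma at_layer_tree_sol [simp]: "at_layer (tree_sol W c m p q) (m + k) = sol W c m p q k"
  by (auto simp: at_layer_def tree_sol_def)

lemma H2_tree_sol:
  assumes j: "j \<in> {1..2 ^ (m + Suc k)}"
  shows "snd (H2 W) (tree_sol W c m p q) (m + Suc k, j) = complex_of_real c * tree_sol W c m p q (m + Suc k, j)"
proof -
  let ?g = "tree_sol W c m p q"
  have g: "at_layer ?g (m + Suc k - 1) = sol W c m p q k" "at_layer ?g (m + Suc k) = sol W c m p q (Suc k)"
    "at_layer ?g (Suc (m + Suc k)) = sol W c m p q (Suc (Suc k))"
    using at_layer_tree_sol[of W c m p q k] at_layer_tree_sol[of W c m p q "Suc k"] at_layer_tree_sol[of W c m p q "Suc (Suc k)"]
    by simp_all
  from j have "j \<ge> 1" by simp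
  have "m + Suc k \<noteq> 0" by simp
  have "snd (H2 W) ?g (m + Suc k, j) = - dup (sol W c m p q k) j
    - (sol W c m p q (Suc (Suc k)) (2 * j - 1) + sol W c m p q (Suc (Suc k)) (2 * j))
    + matvec (m + Suc k) (W (m + Suc k)) (sol W c m p q (Suc k)) j"
    by (simp only: H2_action[OF j] g \<open>m + Suc k \<noteq> 0\<close> if_False)
  also have "\<dots> = complex_of_real c * sol W c m p q (Suc k) j"
    by (simp only: sol.simps dup_child[OF \<open>j \<ge> 1\<close>]) (simp add: field_simps)
  also have "sol W c m p q (Suc k) j = ?g (m + Suc k, j)" using g(2) by (metis at_layer_def)
  finally show ?thesis .
qed

text \<open>The last layer is m + k + 1 because the flux at layer m + k reaches that far.\<close>

definition sol_energy :: "(nat \<Rightarrow> nat \<Rightarrow> nat \<Rightarrow> complex) \<Rightarrow> real \<Rightarrow> nat \<Rightarrow> (nat \<Rightarrow> complex) \<Rightarrow> (nat \<Rightarrow> complex) \<Rightarrow> nat \<Rightarrow> real" where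
  "sol_energy W c m p q k = (\<Sum>i\<le>Suc k. layer_sq (m + i) (sol W c m p q i))"

lemma sol_energy_nonneg: "0 \<le> sol_energy W c m p q k"
  by (simp add: sol_energy_def sum_nonneg layer_sq_nonneg)

text \<open>The two choices of data make the flux at layer m read off the value of phi at
  \<open>x\<close>, respectively the sum over the children of \<open>x\<close>; 1/2 splits that
  value between the children. The factor 16 is that of \<open>flux_bound\<close>.\<close>

definition control :: "(nat \<Rightarrow> nat \<Rightarrow> nat \<Rightarrow> complex) \<Rightarrow> nat \<Rightarrow> nat \<Rightarrow> nat \<Rightarrow> real \<Rightarrow> real" where
  "control W m x k c = 16 / real k * (sol_energy W c m (\<lambda>_. 0) (\<lambda>j. dup (\<lambda>i. if i = x then 1 / 2 else 0) j) k
     + sol_energy W c m (\<lambda>i. if i = x then 1 else 0) (\<lambda>_. 0) k)"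

lemma control_nonneg: "0 \<le> control W m x k c"
  by (simp add: control_def sol_energy_nonneg)

text \<open>Cauchy-Schwarz; the injections \<open>a\<close> and \<open>b\<close> allow for the
  offset of one layer between the two factors of a flux.\<close>

lemma sum_mult_le_sqrt:
  assumes "finite I" "inj_on a I" "inj_on b I" "finite X" "a ` I \<subseteq> X" "finite Y" "b ` I \<subseteq> Y"
    and "\<And>i. 0 \<le> f i" "\<And>i. 0 \<le> g (i::nat)"
  shows "(\<Sum>i\<in>I. sqrt (f (a i)) * sqrt (g (b i))) \<le> sqrt (\<Sum>i\<in>X. f (i::nat)) * sqrt (\<Sum>i\<in>Y. g i)"
proof -
  have "(\<Sum>i\<in>I. sqrt (f (a i)) * sqrt (g (b i))) = (\<Sum>i\<in>I. \<bar>sqrt (f (a i))\<bar> * \<bar>sqrt (g (b i))\<bar>)"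
    using assms by simp
  also have "\<dots> \<le> L2_set (\<lambda>i. sqrt (f (a i))) I * L2_set (\<lambda>i. sqrt (g (b i))) I"
    by (rule L2_set_mult_ineq)
  also have "\<dots> = sqrt (\<Sum>i\<in>a ` I. f i) * sqrt (\<Sum>i\<in>b ` I. g i)"
    using assms by (simp add: L2_set_def sum.reindex)
  also have "\<dots> \<le> sqrt (\<Sum>i\<in>X. f (i::nat)) * sqrt (\<Sum>i\<in>Y. g i)"
    using assms by (intro mult_mono real_sqrt_le_mono sum_mono2) (auto simp: sum_nonneg)
  finally show ?thesis .
qed

section \<open>Flux bounds for the resolvent\<close>

context tree_potential
begin

context
  fixes w :: l2 and c :: real and k m x :: nat
  assumes k: "k > 0" and eq: "A w - c *\<^sub>R w - (1 / real k) *\<^sub>R imul w = unit_vec (m, x)" and x: "x \<in> {1..2 ^ m}"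
begin

lemma H2_resolvent:
  "snd (H2 W) (fn w) v = (complex_of_real c + \<i> / of_nat k) * fn w v + (if v = (m, x) then 1 else 0)"
proof -
  have "(m, x) \<in> G2" using x by (simp add: G2_def)
  then have "fn (A w - c *\<^sub>R w - (1 / real k) *\<^sub>R imul w) v = (if v = (m, x) then 1 else 0)"
    unfolding eq by (rule fn_unit_vec)
  then show ?thesis by (simp add: fn_A algebra_simps)
qed

text \<open>Green's identity for the spectral parameters c + i/k and c: the real parts cancel, and
  only 1/k times the overlap is left.\<close>

lemma flux_step:
  "flux (fn w) (tree_sol W c m p q) (m + Suc i) - flux (fn w) (tree_sol W c m p q) (m + i)
    = \<i> / of_nat k * layer_inner (m + Suc i) (at_layer (fn w) (m + Suc i)) (sol W c m p q (Suc i))"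
proof -
  let ?n = "m + Suc i" and ?f = "fn w" and ?g = "tree_sol W c m p q"
  let ?L = "layer_inner ?n (at_layer ?f ?n) (at_layer ?g ?n)"
  have 1: "layer_inner ?n (at_layer ?f ?n) (at_layer (snd (H2 W) ?g) ?n) = complex_of_real c * ?L"
    unfolding layer_inner_scale_right[symmetric]
    by (intro layer_inner_cong refl) (simp only: at_layer_def H2_tree_sol)
  have "layer_inner ?n (at_layer (snd (H2 W) ?f) ?n) (at_layer ?g ?n)
     = cnj (layer_inner ?n (at_layer ?g ?n) (\<lambda>j. (complex_of_real c + \<i> / of_nat k) * at_layer ?f ?n j))"
    unfolding layer_inner_cnj
    by (intro layer_inner_cong refl) (simp add: at_layer_def H2_resolvent)
  also have "\<dots> = (complex_of_real c - \<i> / of_nat k) * ?L"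
    by (simp add: layer_inner_scale_right layer_inner_cnj)
  finally have 2: "layer_inner ?n (at_layer (snd (H2 W) ?f) ?n) (at_layer ?g ?n) = (complex_of_real c - \<i> / of_nat k) * ?L" .
  have "flux ?f ?g ?n - (if ?n = 0 then 0 else flux ?f ?g (?n - 1)) = \<i> / of_nat k * ?L"
    unfolding green_identity[where W=W and n="?n", OF herm, symmetric] 1 2 by (simp add: left_diff_distrib)
  then show ?thesis using at_layer_tree_sol[of W c m p q "Suc i"] by simp
qed

text \<open>The fluxes at m and m + i differ by at most 1/k times the sum of all overlaps. Summing
  over i = 1..k and Cauchy-Schwarz bound k times the flux at m by (2 sqrt 2 + 1) E \<le> 4 E, where
  E is the root of the energy times \<open>norm w\<close>; 16 is the square of 4.\<close>

lemma flux_bound: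
  "(real k * cmod (flux (fn w) (tree_sol W c m p q) m))\<^sup>2 \<le> 16 * sol_energy W c m p q k * (norm w)\<^sup>2"
proof -
  let ?F = "flux (fn w) (tree_sol W c m p q)"
  let ?f = "\<lambda>n. layer_sq n (at_layer (fn w) n)" and ?g = "\<lambda>i. layer_sq (m + i) (sol W c m p q i)"
  let ?L = "\<lambda>i. layer_inner (m + Suc i) (at_layer (fn w) (m + Suc i)) (sol W c m p q (Suc i))"
  have tele: "?F (m + i) = ?F m + \<i> / of_nat k * (\<Sum>l<i. ?L l)" for i
  proof (induction i)
    case (Suc i)
    have "?F (m + Suc i) = ?F (m + i) + \<i> / of_nat k * ?L i" using flux_step[of p q i] by (simp add: algebra_simps)
    then show ?case using Suc.IH by (simp add: algebra_simps)
  qed simp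
  have nl: "cmod (\<i> / of_nat k * (\<Sum>l<i. ?L l)) \<le> (1 / real k) * (\<Sum>l<k. cmod (?L l))" if "i \<le> k" for i
  proof -
    have "cmod (\<i> / of_nat k * (\<Sum>l<i. ?L l)) = (1 / real k) * cmod (\<Sum>l<i. ?L l)"
      by (simp add: norm_mult norm_divide)
    also have "\<dots> \<le> (1 / real k) * (\<Sum>l<i. cmod (?L l))" by (intro mult_left_mono norm_sum) auto
    also have "\<dots> \<le> (1 / real k) * (\<Sum>l<k. cmod (?L l))" using that by (intro mult_left_mono sum_mono2) auto
    finally show ?thesis .
  qed
  let ?E = "sqrt (sol_energy W c m p q k) * norm w"
  \<comment> \<open>Covers the overlaps and both halves of the fluxes, which differ only in the
    layer shifts \<open>a\<close> and \<open>b\<close>.\<close>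
  have E: "(\<Sum>i\<in>I. sqrt (?g (a i)) * sqrt (?f (b i))) \<le> ?E"
    if "finite I" "inj_on a I" "a ` I \<subseteq> {..Suc k}" "inj_on b I" for I :: "nat set" and a b
  proof -
    have "finite (b ` I)" using that(1) by simp
    then obtain N where "\<forall>n\<in>b ` I. n < N" unfolding finite_nat_set_iff_bounded by blast
    then have N: "b ` I \<subseteq> {..<N}" by auto
    have "(\<Sum>i\<in>I. sqrt (?g (a i)) * sqrt (?f (b i))) \<le> sqrt (\<Sum>i\<le>Suc k. ?g i) * sqrt (\<Sum>n<N. ?f n)"
      using that N by (intro sum_mult_le_sqrt[of I a b "{..Suc k}" "{..<N}" ?g ?f]) (auto simp: layer_sq_nonneg)
    also have "\<dots> \<le> sqrt (\<Sum>i\<le>Suc k. ?g i) * norm w"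
    proof (intro mult_left_mono)
      have "(\<Sum>n<N. ?f n) \<le> (norm w)\<^sup>2" using layer_sums_le[OF fn, of w N] by (simp add: norm_fn)
      then show "sqrt (\<Sum>n<N. ?f n) \<le> norm w" by (simp add: real_le_lsqrt)
      show "0 \<le> sqrt (\<Sum>i\<le>Suc k. ?g i)" by (simp add: sum_nonneg layer_sq_nonneg del: sum.atMost_Suc)
    qed
    finally show ?thesis unfolding sol_energy_def .
  qed
  have sL: "(\<Sum>l<k. cmod (?L l)) \<le> ?E"
  proof -
    have "(\<Sum>l<k. cmod (?L l)) \<le> (\<Sum>l<k. sqrt (?g (Suc l)) * sqrt (?f (m + Suc l)))"
      by (intro sum_mono) (subst mult.commute, rule layer_inner_le)
    also have "\<dots> \<le> ?E" by (rule E) (auto simp: inj_on_def)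
    finally show ?thesis .
  qed
  have sF: "(\<Sum>i\<in>{1..k}. cmod (?F (m + i))) \<le> sqrt 2 * (?E + ?E)"
  proof -
    have "(\<Sum>i\<in>{1..k}. cmod (?F (m + i))) \<le> (\<Sum>i\<in>{1..k}. sqrt 2 * (sqrt (?g i) * sqrt (?f (Suc (m + i))) + sqrt (?g (Suc i)) * sqrt (?f (m + i))))"
    proof (rule sum_mono)
      fix i
      show "cmod (?F (m + i)) \<le> sqrt 2 * (sqrt (?g i) * sqrt (?f (Suc (m + i))) + sqrt (?g (Suc i)) * sqrt (?f (m + i)))"
        using flux_le[of "fn w" "tree_sol W c m p q" "m + i"] at_layer_tree_sol[of W c m p q "Suc i"]
        by (simp add: mult.commute)
    qed
    also have "\<dots> = sqrt 2 * ((\<Sum>i\<in>{1..k}. sqrt (?g i) * sqrt (?f (Suc (m + i)))) + (\<Sum>i\<in>{1..k}. sqrt (?g (Suc i)) * sqrt (?f (m + i))))"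
      by (simp only: sum.distrib sum_distrib_left distrib_left)
    also have "\<dots> \<le> sqrt 2 * (?E + ?E)"
      by (intro mult_left_mono add_mono E) (auto simp: inj_on_def)
    finally show ?thesis .
  qed
  have "real k * cmod (?F m) = (\<Sum>i\<in>{1..k}. cmod (?F m))" by simp
  also have "\<dots> \<le> (\<Sum>i\<in>{1..k}. cmod (?F (m + i)) + (1 / real k) * (\<Sum>l<k. cmod (?L l)))"
  proof (rule sum_mono)
    fix i assume "i \<in> {1..k}"
    then have "i \<le> k" by simp
    have "cmod (?F m) = cmod (?F (m + i) - \<i> / of_nat k * (\<Sum>l<i. ?L l))" using tele[of i] by simp
    also have "\<dots> \<le> cmod (?F (m + i)) + cmod (\<i> / of_nat k * (\<Sum>l<i. ?L l))" by (rule norm_triangle_ineq4)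
    finally show "cmod (?F m) \<le> cmod (?F (m + i)) + (1 / real k) * (\<Sum>l<k. cmod (?L l))"
      using nl[OF \<open>i \<le> k\<close>] by linarith
  qed
  also have "\<dots> = (\<Sum>i\<in>{1..k}. cmod (?F (m + i))) + (\<Sum>l<k. cmod (?L l))"
    using k by (simp add: sum.distrib)
  also have "\<dots> \<le> sqrt 2 * (?E + ?E) + ?E" using sF sL by (rule add_mono)
  also have "\<dots> \<le> 4 * ?E"
  proof -
    have "0 \<le> ?E" by (simp add: sol_energy_nonneg)
    moreover have "sqrt 2 \<le> 3 / 2" by (rule real_le_lsqrt) (auto simp: power2_eq_square)
    ultimately have "sqrt 2 * ?E \<le> 3 / 2 * ?E" by (rule mult_right_mono[rotated])
    then show ?thesis unfolding distrib_left by linarith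
  qed
  finally have "real k * cmod (?F m) \<le> 4 * ?E" .
  then have "(real k * cmod (?F m))\<^sup>2 \<le> (4 * ?E)\<^sup>2" by (intro power_mono) auto
  then show ?thesis by (simp add: power_mult_distrib sol_energy_nonneg)
qed

text \<open>The data vanish at layer m, so only one half of the flux survives, and the two values
  1/2 at the children of \<open>x\<close> add up to 1.\<close>

lemma flux_first: "cmod (flux (fn w) (tree_sol W c m (\<lambda>_. 0) (\<lambda>j. dup (\<lambda>i. if i = x then 1 / 2 else 0) j)) m) = cmod (fn w (m, x))"
proof -
  let ?q = "\<lambda>j. dup (\<lambda>i. if i = x then 1 / 2 else 0 :: complex) j"
  have g: "at_layer (tree_sol W c m (\<lambda>_. 0) ?q) m = (\<lambda>_. 0)" "at_layer (tree_sol W c m (\<lambda>_. 0) ?q) (Suc m) = ?q"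
    using at_layer_tree_sol[of W c m "\<lambda>_. 0" ?q 0] at_layer_tree_sol[of W c m "\<lambda>_. 0" ?q "Suc 0"] by simp_all
  have "layer_inner (Suc m) (dup (at_layer (fn w) m)) ?q
     = (\<Sum>i\<in>{1..2 ^ m}. if i = x then cnj (fn w (m, x)) else 0)"
    unfolding layer_inner_dup
  proof (rule sum.cong[OF refl])
    fix i :: nat assume "i \<in> {1..2 ^ m}"
    then have "i \<ge> 1" by simp
    from dup_child[OF this, of "\<lambda>i. if i = x then 1 / 2 else 0 :: complex"]
    show "cnj (at_layer (fn w) m i) * (?q (2 * i - 1) + ?q (2 * i)) = (if i = x then cnj (fn w (m, x)) else 0)"
      by (simp only:) (simp add: at_layer_def)
  qed
  also have "\<dots> = cnj (fn w (m, x))" using x by simp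
  finally have 2: "layer_inner (Suc m) (dup (at_layer (fn w) m)) ?q = cnj (fn w (m, x))" .
  have "layer_inner (Suc m) (dup (\<lambda>_. 0)) h = 0" for h by (simp add: layer_inner_def dup_def)
  then show ?thesis unfolding flux_def g 2 by simp
qed

lemma flux_second: "cmod (flux (fn w) (tree_sol W c m (\<lambda>i. if i = x then 1 else 0) (\<lambda>_. 0)) m)
   = cmod (fn w (Suc m, 2 * x - 1) + fn w (Suc m, 2 * x))"
proof -
  let ?p = "\<lambda>i. if i = x then 1 else 0 :: complex"
  have g: "at_layer (tree_sol W c m ?p (\<lambda>_. 0)) m = ?p" "at_layer (tree_sol W c m ?p (\<lambda>_. 0)) (Suc m) = (\<lambda>_. 0)"
    using at_layer_tree_sol[of W c m ?p "\<lambda>_. 0" 0] at_layer_tree_sol[of W c m ?p "\<lambda>_. 0" "Suc 0"] by simp_all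
  have "layer_inner (Suc m) (dup ?p) (at_layer (fn w) (Suc m))
     = (\<Sum>i\<in>{1..2 ^ m}. if i = x then fn w (Suc m, 2 * x - 1) + fn w (Suc m, 2 * x) else 0)"
    unfolding layer_inner_dup by (intro sum.cong refl) (simp add: at_layer_def)
  also have "\<dots> = fn w (Suc m, 2 * x - 1) + fn w (Suc m, 2 * x)" using x by simp
  finally have 2: "layer_inner (Suc m) (dup ?p) (at_layer (fn w) (Suc m)) = fn w (Suc m, 2 * x - 1) + fn w (Suc m, 2 * x)" .
  have "layer_inner (Suc m) h (\<lambda>_. 0) = 0" for h by (simp add: layer_inner_def)
  then show ?thesis unfolding flux_def g 2 by (simp del: complex_cnj_add)
qed

text \<open>Imaginary part of the resolvent equation paired with \<open>w\<close>: the self-adjoint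
  part drops out and leaves the squared norm over k.\<close>

lemma resolvent_norm_le: "(norm w)\<^sup>2 / real k \<le> cmod (fn w (m, x))"
proof -
  have G: "(m, x) \<in> G2" using x by (simp add: G2_def)
  have "inner (imul w) (A w) = 0"
  proof -
    have "inner (imul w) (A w) = inner (imul (imul w)) (imul (A w))" by (simp add: inner_imul)
    also have "\<dots> = - inner w (A (imul w))" by (simp add: imul_imul A_imul)
    also have "\<dots> = - inner (imul w) (A w)" by (metis inner_commute inner_A)
    finally show ?thesis by simp
  qed
  moreover have "inner (imul w) w = 0"
  proof -
    have "inner (imul w) w = inner (imul (imul w)) (imul w)" by (simp add: inner_imul)
    also have "\<dots> = - inner (imul w) w" by (simp add: imul_imul inner_commute)
    finally show ?thesis by simp
  qed
  ultimately have "inner (imul w) (A w - c *\<^sub>R w - (1 / real k) *\<^sub>R imul w) = - ((norm w)\<^sup>2 / real k)"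
    by (simp add: inner_diff_right inner_imul power2_norm_eq_inner)
  then have "(norm w)\<^sup>2 / real k = - inner (unit_vec (m, x)) (imul w)" unfolding eq by (simp add: inner_commute)
  also have "\<dots> = - Re (fn (imul w) (m, x))" by (simp only: inner_unit_vec[OF G])
  also have "\<dots> \<le> cmod (fn (imul w) (m, x))" by (metis abs_Re_le_cmod abs_ge_minus_self order_trans)
  also have "\<dots> = cmod (fn w (m, x))" by (simp add: norm_mult)
  finally show ?thesis .
qed

end

text \<open>The bound by the value at the vertex and the flux bound for that value give |w|^4 \<le>
  16 E |w|^2, with E the energy of the first solution; one factor cancels.\<close>

lemma control_upper:
  assumes k: "k > 0" and eq: "A w - c *\<^sub>R w - (1 / real k) *\<^sub>R imul w = unit_vec (m, x)" and x: "x \<in> {1..2 ^ m}"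
  shows "(norm w)\<^sup>2 / real k \<le> control W m x k c"
proof (cases "w = 0")
  case False
  let ?E1 = "sol_energy W c m (\<lambda>_. 0) (\<lambda>j. dup (\<lambda>i. if i = x then 1 / 2 else 0) j) k"
  have "(norm w)\<^sup>2 \<le> real k * cmod (fn w (m, x))" using resolvent_norm_le[OF k eq x] k by (simp add: field_simps)
  then have "((norm w)\<^sup>2)\<^sup>2 \<le> (real k * cmod (fn w (m, x)))\<^sup>2" by (intro power_mono) auto
  also have "\<dots> \<le> 16 * ?E1 * (norm w)\<^sup>2"
    using flux_bound[OF k eq x] flux_first[OF k eq x] by metis
  finally have "(norm w)\<^sup>2 * (norm w)\<^sup>2 \<le> (16 * ?E1) * (norm w)\<^sup>2" by (simp add: power2_eq_square)
  then have "(norm w)\<^sup>2 \<le> 16 * ?E1" by (rule mult_right_le_imp_le) (use False in simp)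
  also have "\<dots> \<le> 16 * (?E1 + sol_energy W c m (\<lambda>i. if i = x then 1 else 0) (\<lambda>_. 0) k)"
    by (simp add: sol_energy_nonneg)
  finally show ?thesis using k by (simp add: control_def divide_right_mono)
qed (simp add: control_nonneg)

text \<open>The resolvent equation at the root writes 1 as a combination of the root value and the
  sum over its children, so these are not both small. Each is a flux, and with \<open>norm w\<close>
  bounded the flux bound forces the energies to be of order k^2.\<close>

lemma control_lower:
  assumes k: "k > 0" and eq: "A w - c *\<^sub>R w - (1 / real k) *\<^sub>R imul w = unit_vec (0, 1)"
    and w: "(norm w)\<^sup>2 \<le> C" and C: "C > 0" and c: "\<bar>c\<bar> \<le> r"
  shows "1 / (2 * (cmod (W 0 1 1) + r + 1)\<^sup>2 * C) * real k \<le> control W 0 1 k c"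
proof -
  have x: "(1::nat) \<in> {1..2 ^ 0}" by simp
  let ?E1 = "sol_energy W c 0 (\<lambda>_. 0) (\<lambda>j. dup (\<lambda>i. if i = 1 then 1 / 2 else 0) j) k"
  let ?E2 = "sol_energy W c 0 (\<lambda>i. if i = 1 then 1 else 0) (\<lambda>_. 0) k"
  define a where "a = cmod (fn w (0, 1))"
  define b where "b = cmod (fn w (Suc 0, 2 * 1 - 1) + fn w (Suc 0, 2 * 1))"
  \<comment> \<open>Bounds the coefficient of the root value; the summand 1 covers 1/k.\<close>
  define B where "B = cmod (W 0 1 1) + r + 1"
  have B: "B \<ge> 1" using c by (simp add: B_def add_nonneg_nonneg)
  have a: "(real k * a)\<^sup>2 \<le> 16 * ?E1 * (norm w)\<^sup>2"
    unfolding a_def using flux_bound[OF k eq x] flux_first[OF k eq x] by metis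
  have b: "(real k * b)\<^sup>2 \<le> 16 * ?E2 * (norm w)\<^sup>2"
    unfolding b_def using flux_bound[OF k eq x] flux_second[OF k eq x] by metis
  have "snd (H2 W) (fn w) (0, 1) = - (fn w (Suc 0, 2 * 1 - 1) + fn w (Suc 0, 2 * 1)) + W 0 1 1 * fn w (0, 1)"
    using H2_action[OF x, of W "fn w"] by (simp add: at_layer_def matvec_def)
  then have "1 = - (fn w (Suc 0, 2 * 1 - 1) + fn w (Suc 0, 2 * 1)) + (W 0 1 1 - complex_of_real c - \<i> / of_nat k) * fn w (0, 1)"
    using H2_resolvent[OF k eq x, of "(0, 1)"] by (simp add: algebra_simps)
  then have "1 \<le> cmod (- (fn w (Suc 0, 2 * 1 - 1) + fn w (Suc 0, 2 * 1)) + (W 0 1 1 - complex_of_real c - \<i> / of_nat k) * fn w (0, 1))"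
    by (metis norm_one order_refl)
  also have "\<dots> \<le> b + cmod (W 0 1 1 - complex_of_real c - \<i> / of_nat k) * a"
    unfolding a_def b_def by (rule order_trans[OF norm_triangle_ineq]) (simp only: norm_minus_cancel norm_mult order_refl)
  also have "\<dots> \<le> B * b + B * a"
  proof (intro add_mono mult_right_mono)
    show "0 \<le> a" by (simp add: a_def)
    show "b \<le> B * b" using B mult_right_mono[of 1 B b] by (simp add: b_def)
    have "cmod (W 0 1 1 - complex_of_real c - \<i> / of_nat k) \<le> cmod (W 0 1 1) + cmod (complex_of_real c) + cmod (\<i> / of_nat k)"
      by (intro order_trans[OF norm_triangle_ineq4] add_right_mono norm_triangle_ineq4)
    also have "\<dots> \<le> B"
    proof -
      have "1 / real k \<le> 1" using k by simp
      then show ?thesis using c by (simp add: B_def norm_divide)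
    qed
    finally show "cmod (W 0 1 1 - complex_of_real c - \<i> / of_nat k) \<le> B" .
  qed
  finally have "1 \<le> B * (a + b)" by (simp add: algebra_simps)
  then have "1\<^sup>2 \<le> (B * (a + b))\<^sup>2" by (rule power_mono) simp
  also have "\<dots> \<le> B\<^sup>2 * (2 * (a\<^sup>2 + b\<^sup>2))"
  proof -
    have "(a + b)\<^sup>2 \<le> 2 * (a\<^sup>2 + b\<^sup>2)" using sum_squares_bound[of a b] by (simp add: power2_sum)
    then show ?thesis by (simp add: power_mult_distrib mult_left_mono)
  qed
  finally have "(real k)\<^sup>2 * 1 \<le> (real k)\<^sup>2 * (B\<^sup>2 * (2 * (a\<^sup>2 + b\<^sup>2)))" by (intro mult_left_mono) auto
  also have "\<dots> = 2 * B\<^sup>2 * ((real k * a)\<^sup>2 + (real k * b)\<^sup>2)" by (simp add: power_mult_distrib algebra_simps)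
  also have "\<dots> \<le> 2 * B\<^sup>2 * (16 * ?E1 * C + 16 * ?E2 * C)"
  proof (intro mult_left_mono add_mono)
    show "(real k * a)\<^sup>2 \<le> 16 * ?E1 * C"
      by (rule order_trans[OF a]) (intro mult_left_mono w, simp add: sol_energy_nonneg)
    show "(real k * b)\<^sup>2 \<le> 16 * ?E2 * C"
      by (rule order_trans[OF b]) (intro mult_left_mono w, simp add: sol_energy_nonneg)
  qed simp
  also have "\<dots> = 2 * B\<^sup>2 * C * (real k * control W 0 1 k c)"
    using k by (simp add: control_def algebra_simps)
  finally have "real k * real k \<le> real k * (2 * B\<^sup>2 * C * control W 0 1 k c)" by (simp add: power2_eq_square mult_ac)
  then have "real k \<le> 2 * B\<^sup>2 * C * control W 0 1 k c" by (rule mult_left_le_imp_le) (use k in simp)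
  moreover have "2 * B\<^sup>2 * C > 0" using B C by simp
  ultimately show ?thesis unfolding B_def[symmetric] by (simp add: field_simps)
qed

lemma poisson_control_control:
  assumes meas: "\<And>k. control W m x k \<in> borel_measurable borel"
    and lim: "liminf (\<lambda>k. \<integral>\<^sup>+c\<in>{- r..r}. ennreal ((control W m x k c)\<^sup>2) \<partial>lborel) < \<infinity>"
    and x: "x \<in> {1..2 ^ m}"
  shows "op.poisson_control r (m, x) (control W m x)"
  unfolding op.poisson_control_def
proof (intro conjI allI impI ballI)
  fix k :: nat and c w assume "0 < k" "A w - c *\<^sub>R w - (1 / real k) *\<^sub>R imul w = unit_vec (m, x)"
  then show "(norm w)\<^sup>2 / real k \<le> control W m x k c" by (rule control_upper[OF _ _ x])
next
  fix C assume mx: "(m, x) = (0, 1)"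
  \<comment> \<open>\<open>max C 1\<close> and \<open>\<bar>r\<bar>\<close> keep the denominator
    positive for every \<open>C\<close> and \<open>r\<close>.\<close>
  define \<kappa> where "\<kappa> = 1 / (2 * (cmod (W 0 1 1) + \<bar>r\<bar> + 1)\<^sup>2 * max C 1)"
  have "cmod (W 0 1 1) + \<bar>r\<bar> + 1 > 0" by (simp add: add_nonneg_pos)
  then have "\<kappa> > 0" by (simp add: \<kappa>_def)
  moreover have "\<forall>\<^sub>F k in sequentially. \<forall>c\<in>{- r..r}. \<forall>w. A w - c *\<^sub>R w - (1 / real k) *\<^sub>R imul w = unit_vec (m, x)
    \<longrightarrow> (norm w)\<^sup>2 \<le> C \<longrightarrow> \<kappa> * real k \<le> control W m x k c"
    using eventually_gt_at_top[of 0]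
  proof eventually_elim
    case (elim k)
    show ?case
    proof (intro ballI allI impI)
      fix c w assume c: "c \<in> {- r..r}" and eq: "A w - c *\<^sub>R w - (1 / real k) *\<^sub>R imul w = unit_vec (m, x)" and w: "(norm w)\<^sup>2 \<le> C"
      have "(norm w)\<^sup>2 \<le> max C 1" using w by simp
      moreover have "\<bar>c\<bar> \<le> \<bar>r\<bar>" using c by auto
      ultimately have "\<kappa> * real k \<le> control W 0 1 k c"
        unfolding \<kappa>_def using eq mx by (intro control_lower[OF elim]) auto
      then show "\<kappa> * real k \<le> control W m x k c" using mx by simp
    qed
  qed
  ultimately show "\<exists>\<kappa>>0. \<forall>\<^sub>F k in sequentially. \<forall>c\<in>{- r..r}. \<forall>w. A w - c *\<^sub>R w - (1 / real k) *\<^sub>R imul w = unit_vec (m, x)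
    \<longrightarrow> (norm w)\<^sup>2 \<le> C \<longrightarrow> \<kappa> * real k \<le> control W m x k c" by blast
qed (use assms control_nonneg in auto)

end

section \<open>Growth of the solutions\<close>

definition sol_sq :: "(nat \<Rightarrow> nat \<Rightarrow> nat \<Rightarrow> complex) \<Rightarrow> real \<Rightarrow> nat \<Rightarrow> (nat \<Rightarrow> complex) \<Rightarrow> (nat \<Rightarrow> complex) \<Rightarrow> nat \<Rightarrow> real" where
  "sol_sq W c m p q i = layer_sq (m + i) (sol W c m p q i) + layer_sq (m + Suc i) (sol W c m p q (Suc i))"

text \<open>For \<open>W = 0\<close> this quadratic form does not depend on \<open>i\<close>; it is positive definite for
  \<open>\<bar>c\<bar> < 2 * sqrt 2\<close>.\<close>

definition sol_form :: "(nat \<Rightarrow> nat \<Rightarrow> nat \<Rightarrow> complex) \<Rightarrow> real \<Rightarrow> nat \<Rightarrow> (nat \<Rightarrow> complex) \<Rightarrow> (nat \<Rightarrow> complex) \<Rightarrow> nat \<Rightarrow> real" where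
  "sol_form W c m p q i = sol_sq W c m p q i
     + c / 2 * Re (layer_inner (m + Suc i) (dup (sol W c m p q i)) (sol W c m p q (Suc i)))"

text \<open>The gradient of the quadratic form: the first-order effect of the next layer of the
  potential on \<open>sol_form\<close> is the inner product of its contribution with this
  vector.\<close>

definition sol_dir :: "(nat \<Rightarrow> nat \<Rightarrow> nat \<Rightarrow> complex) \<Rightarrow> real \<Rightarrow> nat \<Rightarrow> (nat \<Rightarrow> complex) \<Rightarrow> (nat \<Rightarrow> complex) \<Rightarrow> nat \<Rightarrow> nat \<Rightarrow> complex" where
  "sol_dir W c m p q i j = - (dup (sol W c m p q i) j + complex_of_real (c / 2) * sol W c m p q (Suc i) j)"

lemma sol_sq_nonneg: "0 \<le> sol_sq W c m p q i"
  by (simp add: sol_sq_def layer_sq_nonneg)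

lemma layer_sq_half_dup: "layer_sq n f = 1 / 2 * layer_sq (Suc n) (dup f)"
  by (simp add: layer_sq_dup)

text \<open>A pointwise identity on layer \<open>N\<close> in a, g, b and h = -a + b - c g, where
  1/2 h is the new value. The terms without b recombine to the old form, which is the conservation
  law of the free recursion.\<close>

lemma sol_form_Suc:
  fixes W c m p q i
  defines "N \<equiv> m + Suc i"
  defines "b \<equiv> matvec N (W N) (sol W c m p q (Suc i))"
  shows "sol_form W c m p q (Suc i) = sol_form W c m p q i
    + Re (layer_inner N (sol_dir W c m p q i) b) + 1 / 2 * layer_sq N b"
proof -
  define a where "a = dup (sol W c m p q i)"
  define g where "g = sol W c m p q (Suc i)"
  define h where "h j = - a j + b j - complex_of_real c * g j" for j
  have N: "m + Suc i = N" "m + Suc (Suc i) = Suc N" "Suc (m + i) = N" by (simp_all add: N_def)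
  have s2: "sol W c m p q (Suc (Suc i)) = dup (\<lambda>j. 1 / 2 * h j)"
    by (simp add: h_def[abs_def] a_def g_def b_def N_def)
  have q2: "layer_sq (Suc N) (sol W c m p q (Suc (Suc i))) = (\<Sum>j\<in>{1..2 ^ N}. 1 / 2 * (cmod (h j))\<^sup>2)"
    unfolding s2 layer_sq_dup unfolding layer_sq_def
    by (simp add: norm_mult norm_divide power_mult_distrib power_divide sum_distrib_left)
  have i2: "layer_inner (Suc N) (dup g) (sol W c m p q (Suc (Suc i))) = (\<Sum>j\<in>{1..2 ^ N}. cnj (g j) * h j)"
    unfolding layer_inner_dup s2
  proof (rule sum.cong[OF refl])
    fix j :: nat assume "j \<in> {1..2 ^ N}"
    then have "j \<ge> 1" by simp
    from dup_child[OF this, of "\<lambda>j. 1 / 2 * h j"]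
    show "cnj (g j) * (dup (\<lambda>j. 1 / 2 * h j) (2 * j - 1) + dup (\<lambda>j. 1 / 2 * h j) (2 * j)) = cnj (g j) * h j"
      by (simp only:) simp
  qed
  have q0: "layer_sq (m + i) (sol W c m p q i) = (\<Sum>j\<in>{1..2 ^ N}. 1 / 2 * (cmod (a j))\<^sup>2)"
    by (simp only: layer_sq_half_dup[of "m + i"] N(3) a_def[symmetric]) (simp only: layer_sq_def sum_distrib_left)
  have "sol_form W c m p q (Suc i) = (\<Sum>j\<in>{1..2 ^ N}. (cmod (g j))\<^sup>2 + 1 / 2 * (cmod (h j))\<^sup>2 + c / 2 * Re (cnj (g j) * h j))"
    unfolding sol_form_def sol_sq_def N(1,2) q2 g_def[symmetric] i2
    by (simp only: layer_sq_def sum.distrib sum_distrib_left Re_sum)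
  also have "\<dots> = (\<Sum>j\<in>{1..2 ^ N}. 1 / 2 * (cmod (a j))\<^sup>2 + (cmod (g j))\<^sup>2 + c / 2 * Re (cnj (a j) * g j)
     + Re (cnj (- (a j + complex_of_real (c / 2) * g j)) * b j) + 1 / 2 * (cmod (b j))\<^sup>2)"
    by (intro sum.cong refl) (simp only: h_def cmod_power2, simp add: power2_eq_square field_simps)
  also have "\<dots> = sol_form W c m p q i + Re (layer_inner N (sol_dir W c m p q i) b) + 1 / 2 * layer_sq N b"
    unfolding sol_form_def sol_sq_def q0 N(1) g_def[symmetric] a_def[symmetric]
    by (simp only: sol_dir_def[abs_def] a_def[symmetric] g_def[symmetric])
      (simp only: layer_sq_def layer_inner_def sum.distrib sum_distrib_left Re_sum)
  finally show ?thesis .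
qed

text \<open>Origin of 2 * sqrt 2: the coefficient is |c|/2, the lift contributes sqrt 2, and the
  inequality between geometric and arithmetic mean contributes 1/2.\<close>

lemma abs_sol_form_le:
  "\<bar>c / 2 * Re (layer_inner (m + Suc i) (dup (sol W c m p q i)) (sol W c m p q (Suc i)))\<bar> \<le> \<bar>c\<bar> / (2 * sqrt 2) * sol_sq W c m p q i"
proof -
  let ?a = "sqrt (layer_sq (m + i) (sol W c m p q i))" and ?b = "sqrt (layer_sq (m + Suc i) (sol W c m p q (Suc i)))"
  have "\<bar>Re (layer_inner (m + Suc i) (dup (sol W c m p q i)) (sol W c m p q (Suc i)))\<bar>
    \<le> sqrt (layer_sq (Suc (m + i)) (dup (sol W c m p q i))) * ?b"
    using layer_inner_le[of "m + Suc i"] by (simp add: order_trans[OF abs_Re_le_cmod])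
  also have "\<dots> = sqrt 2 * (?a * ?b)" unfolding layer_sq_dup by (simp add: real_sqrt_mult)
  also have "\<dots> \<le> sqrt 2 * ((?a\<^sup>2 + ?b\<^sup>2) / 2)"
    using sum_squares_bound[of ?a ?b] by (intro mult_left_mono) auto
  also have "?a\<^sup>2 + ?b\<^sup>2 = sol_sq W c m p q i" by (simp add: sol_sq_def layer_sq_nonneg)
  finally have 1: "\<bar>Re (layer_inner (m + Suc i) (dup (sol W c m p q i)) (sol W c m p q (Suc i)))\<bar> \<le> sqrt 2 * (sol_sq W c m p q i / 2)" .
  have "\<bar>c / 2 * Re (layer_inner (m + Suc i) (dup (sol W c m p q i)) (sol W c m p q (Suc i)))\<bar>
     = \<bar>c\<bar> / 2 * \<bar>Re (layer_inner (m + Suc i) (dup (sol W c m p q i)) (sol W c m p q (Suc i)))\<bar>"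
    by (simp add: abs_mult)
  also have "\<dots> \<le> \<bar>c\<bar> / 2 * (sqrt 2 * (sol_sq W c m p q i / 2))" using 1 by (intro mult_left_mono) auto
  also have "\<dots> = \<bar>c\<bar> / (2 * sqrt 2) * sol_sq W c m p q i"
    by (simp add: field_simps)
  finally show ?thesis .
qed

lemma sol_form_bounds:
  assumes "\<bar>c\<bar> \<le> r"
  shows "(1 - r / (2 * sqrt 2)) * sol_sq W c m p q i \<le> sol_form W c m p q i"
    "sol_form W c m p q i \<le> (1 + r / (2 * sqrt 2)) * sol_sq W c m p q i"
proof -
  have "\<bar>c\<bar> / (2 * sqrt 2) * sol_sq W c m p q i \<le> r / (2 * sqrt 2) * sol_sq W c m p q i"
    using assms by (intro mult_right_mono divide_right_mono) (auto simp: sol_sq_nonneg)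
  with abs_sol_form_le[of c m i W p q]
  show "(1 - r / (2 * sqrt 2)) * sol_sq W c m p q i \<le> sol_form W c m p q i"
    "sol_form W c m p q i \<le> (1 + r / (2 * sqrt 2)) * sol_sq W c m p q i"
    unfolding sol_form_def left_diff_distrib distrib_right mult_1 abs_le_iff by linarith+
qed

lemma layer_sq_sol_dir:
  assumes c: "\<bar>c\<bar> \<le> 2 * sqrt 2"
  shows "layer_sq (m + Suc i) (sol_dir W c m p q i) \<le> 4 * sol_sq W c m p q i"
proof -
  let ?N = "m + Suc i" and ?g = "sol W c m p q (Suc i)"
  have c2: "c\<^sup>2 \<le> 8"
  proof -
    have "\<bar>c\<bar>\<^sup>2 \<le> (2 * sqrt 2)\<^sup>2" using c by (intro power_mono) auto
    then show ?thesis by (simp add: power_mult_distrib)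
  qed
  have "layer_sq ?N (sol_dir W c m p q i) = layer_sq ?N (\<lambda>j. dup (sol W c m p q i) j + complex_of_real (c / 2) * ?g j)"
    unfolding layer_sq_def sol_dir_def norm_minus_cancel ..
  also have "\<dots> \<le> 2 * layer_sq ?N (dup (sol W c m p q i)) + 2 * layer_sq ?N (\<lambda>j. complex_of_real (c / 2) * ?g j)"
    by (rule layer_sq_add_le)
  also have "layer_sq ?N (dup (sol W c m p q i)) = 2 * layer_sq (m + i) (sol W c m p q i)"
    by (simp add: layer_sq_dup)
  also have "layer_sq ?N (\<lambda>j. complex_of_real (c / 2) * ?g j) = c\<^sup>2 / 4 * layer_sq ?N ?g"
    by (simp add: layer_sq_def norm_mult power_mult_distrib power_divide sum_distrib_left norm_divide)
  also have "c\<^sup>2 / 4 * layer_sq ?N ?g \<le> 2 * layer_sq ?N ?g"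
    using c2 by (intro mult_right_mono) (auto simp: layer_sq_nonneg)
  finally show ?thesis by (simp add: sol_sq_def)
qed

text \<open>\<open>B\<close> is kept apart from \<open>W\<close> so that the bound serves both the
  random layer and its expectation.\<close>

lemma sol_dir_bound:
  assumes c: "\<bar>c\<bar> \<le> 2 * sqrt 2"
  shows "\<bar>Re (layer_inner (m + Suc i) (sol_dir W c m p q i) (matvec (m + Suc i) B (sol W c m p q (Suc i))))\<bar>
    \<le> 2 * mat_op_norm (2 ^ (m + Suc i)) B * sol_sq W c m p q i"
proof -
  let ?N = "m + Suc i" and ?g = "sol W c m p q (Suc i)" and ?v = "mat_op_norm (2 ^ (m + Suc i)) B"
  note d = layer_sq_sol_dir[OF c, of m i W p q]
  have g: "layer_sq ?N ?g \<le> sol_sq W c m p q i" by (simp add: sol_sq_def layer_sq_nonneg)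
  have "\<bar>Re (layer_inner ?N (sol_dir W c m p q i) (matvec ?N B ?g))\<bar>
     \<le> sqrt (layer_sq ?N (sol_dir W c m p q i)) * sqrt (layer_sq ?N (matvec ?N B ?g))"
    using layer_inner_le abs_Re_le_cmod by (rule order_trans[rotated])
  also have "\<dots> \<le> sqrt (4 * sol_sq W c m p q i) * (?v * sqrt (sol_sq W c m p q i))"
  proof (intro mult_mono)
    show "sqrt (layer_sq ?N (matvec ?N B ?g)) \<le> ?v * sqrt (sol_sq W c m p q i)"
      using g by (intro order_trans[OF layer_sq_matvec] mult_left_mono) (auto simp: mat_op_norm_nonneg)
  qed (use d in \<open>auto simp: sol_sq_nonneg layer_sq_nonneg\<close>)
  also have "\<dots> = 2 * ?v * sol_sq W c m p q i"
    using sol_sq_nonneg[of W c m p q i] by (simp add: real_sqrt_mult)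
  finally show ?thesis .
qed

text \<open>The term linear in the potential is kept apart: only its expectation is summable.\<close>

lemma sol_form_Suc_sq:
  fixes W c m p q i
  defines "N \<equiv> m + Suc i"
  defines "v \<equiv> mat_op_norm (2 ^ N) (W N)"
  defines "Y \<equiv> Re (layer_inner N (sol_dir W c m p q i) (matvec N (W N) (sol W c m p q (Suc i))))"
  assumes r: "\<bar>c\<bar> \<le> r" "r < 2 * sqrt 2" and \<kappa>: "\<kappa> = 1 - r / (2 * sqrt 2)"
  shows "(sol_form W c m p q (Suc i))\<^sup>2 \<le> (sol_form W c m p q i)\<^sup>2 + 2 * sol_form W c m p q i * Y
      + 9 / \<kappa>\<^sup>2 * ((v\<^sup>2 + v ^ 4) * (sol_form W c m p q i)\<^sup>2)"
proof -
  let ?Q = "sol_form W c m p q i" and ?R = "sol_sq W c m p q i"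
  let ?b = "layer_sq N (matvec N (W N) (sol W c m p q (Suc i)))"
  have \<kappa>0: "0 < \<kappa>" "\<kappa> \<le> 1" using r by (auto simp: \<kappa> field_simps)
  have v0: "0 \<le> v" by (simp add: v_def mat_op_norm_nonneg)
  have R0: "0 \<le> ?R" by (rule sol_sq_nonneg)
  have RQ: "?R \<le> ?Q / \<kappa>" using sol_form_bounds(1)[OF r(1), of W m p q i] \<kappa>0 by (simp add: \<kappa>[symmetric] field_simps)
  then have Q0: "0 \<le> ?Q" using R0 \<kappa>0 by (smt (verit) divide_neg_pos)
  have cc: "\<bar>c\<bar> \<le> 2 * sqrt 2" using r by linarith
  have Y: "\<bar>Y\<bar> \<le> 2 * v * ?R" unfolding Y_def v_def N_def by (rule sol_dir_bound[OF cc])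
  have b: "?b \<le> v\<^sup>2 * ?R" "0 \<le> ?b"
  proof -
    have "?b \<le> v\<^sup>2 * layer_sq N (sol W c m p q (Suc i))" unfolding v_def by (rule layer_sq_matvec_sq)
    also have "\<dots> \<le> v\<^sup>2 * ?R" by (intro mult_left_mono) (auto simp: sol_sq_def N_def layer_sq_nonneg)
    finally show "?b \<le> v\<^sup>2 * ?R" .
  qed (rule layer_sq_nonneg)
  have step: "sol_form W c m p q (Suc i) = ?Q + Y + 1 / 2 * ?b"
    unfolding Y_def N_def by (rule sol_form_Suc)
  have "(sol_form W c m p q (Suc i))\<^sup>2 = ?Q\<^sup>2 + 2 * ?Q * Y + ?Q * ?b + (Y + 1 / 2 * ?b)\<^sup>2"
    unfolding step by (simp add: power2_eq_square algebra_simps)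
  moreover have "?Q * ?b \<le> v\<^sup>2 * (?Q * ?R)" using b Q0 mult_left_mono[OF b(1) Q0] by (simp add: mult_ac)
  moreover have "?Q * ?R \<le> ?Q\<^sup>2 / \<kappa>\<^sup>2"
  proof -
    have "?Q * ?R \<le> ?Q * (?Q / \<kappa>)" using RQ Q0 by (rule mult_left_mono)
    also have "\<dots> = ?Q\<^sup>2 / \<kappa>" by (simp add: power2_eq_square)
    \<comment> \<open>Possible because \<open>\<kappa> \<le> 1\<close>; all error terms then carry
      the same factor.\<close>
    also have "\<dots> \<le> ?Q\<^sup>2 / \<kappa>\<^sup>2" using \<kappa>0 by (intro divide_left_mono) (auto simp: power2_eq_square mult_left_le_one_le)
    finally show ?thesis .
  qed
  moreover have "(Y + 1 / 2 * ?b)\<^sup>2 \<le> (8 * v\<^sup>2 + v ^ 4) * ?R\<^sup>2"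
  proof -
    have "(Y + 1 / 2 * ?b)\<^sup>2 \<le> 2 * Y\<^sup>2 + 2 * (1 / 2 * ?b)\<^sup>2"
      using sum_squares_bound[of Y "1 / 2 * ?b"] by (simp add: power2_sum)
    also have "\<dots> \<le> 2 * (2 * v * ?R)\<^sup>2 + 2 * (1 / 2 * (v\<^sup>2 * ?R))\<^sup>2"
    proof (intro add_mono mult_left_mono)
      show "Y\<^sup>2 \<le> (2 * v * ?R)\<^sup>2" using Y by (metis abs_ge_zero power2_abs power_mono)
      show "(1 / 2 * ?b)\<^sup>2 \<le> (1 / 2 * (v\<^sup>2 * ?R))\<^sup>2" using b by (intro power_mono) auto
    qed auto
    also have "\<dots> \<le> (8 * v\<^sup>2 + v ^ 4) * ?R\<^sup>2"
    proof -
      have "2 * (2 * v * ?R)\<^sup>2 = 8 * v\<^sup>2 * ?R\<^sup>2" by (simp add: power_mult_distrib)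
      moreover have "2 * (1 / 2 * (v\<^sup>2 * ?R))\<^sup>2 = 1 / 2 * (v ^ 4 * ?R\<^sup>2)"
        by (simp add: power2_eq_square power4_eq_xxxx)
      moreover have "0 \<le> v ^ 4 * ?R\<^sup>2" by simp
      ultimately show ?thesis unfolding distrib_right by linarith
    qed
    finally show ?thesis .
  qed
  moreover have "?R\<^sup>2 \<le> ?Q\<^sup>2 / \<kappa>\<^sup>2"
    using power_mono[OF RQ R0, of 2] by (simp add: power_divide)
  ultimately have "(sol_form W c m p q (Suc i))\<^sup>2 \<le> ?Q\<^sup>2 + 2 * ?Q * Y + v\<^sup>2 * (?Q\<^sup>2 / \<kappa>\<^sup>2) + (8 * v\<^sup>2 + v ^ 4) * (?Q\<^sup>2 / \<kappa>\<^sup>2)"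
    using mult_left_mono[of "?Q * ?R" "?Q\<^sup>2 / \<kappa>\<^sup>2" "v\<^sup>2"] mult_left_mono[of "?R\<^sup>2" "?Q\<^sup>2 / \<kappa>\<^sup>2" "8 * v\<^sup>2 + v ^ 4"] v0
    by simp
  \<comment> \<open>9 = 1 + 8: one \<open>v\<^sup>2\<close> stems from the product with the old
    form, eight from the square of the increment.\<close>
  moreover have "v\<^sup>2 * (?Q\<^sup>2 / \<kappa>\<^sup>2) + (8 * v\<^sup>2 + v ^ 4) * (?Q\<^sup>2 / \<kappa>\<^sup>2) \<le> 9 / \<kappa>\<^sup>2 * ((v\<^sup>2 + v ^ 4) * ?Q\<^sup>2)"
  proof -
    have "v\<^sup>2 * (?Q\<^sup>2 / \<kappa>\<^sup>2) + (8 * v\<^sup>2 + v ^ 4) * (?Q\<^sup>2 / \<kappa>\<^sup>2) = (9 * v\<^sup>2 + v ^ 4) * (?Q\<^sup>2 / \<kappa>\<^sup>2)"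
      by (simp only: distrib_right[symmetric]) simp
    also have "\<dots> \<le> (9 * v\<^sup>2 + 9 * v ^ 4) * (?Q\<^sup>2 / \<kappa>\<^sup>2)"
      using v0 by (intro mult_right_mono) auto
    finally show ?thesis by (simp add: algebra_simps)
  qed
  ultimately show "(sol_form W c m p q (Suc i))\<^sup>2 \<le> ?Q\<^sup>2 + 2 * ?Q * Y + 9 / \<kappa>\<^sup>2 * ((v\<^sup>2 + v ^ 4) * ?Q\<^sup>2)"
    by linarith
qed

section \<open>Random potentials\<close>

lemma dup_index: "(j::nat) \<in> {1..2 ^ Suc n} \<Longrightarrow> (j + 1) div 2 \<in> {1..2 ^ n}"
  by auto

text \<open>The strict inequalities matter: the solution at step \<open>i\<close> depends on layers
  before m + i only, hence is independent of layer m + i of the potential.\<close>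

lemma sol_measurable:
  assumes W: "\<And>n j k. m < n \<Longrightarrow> n < m + i \<Longrightarrow> j \<in> {1..2 ^ n} \<Longrightarrow> k \<in> {1..2 ^ n} \<Longrightarrow> (\<lambda>z. W z n j k) \<in> borel_measurable N"
    and c: "c \<in> borel_measurable N" and j: "j \<in> {1..2 ^ (m + i)}"
  shows "(\<lambda>z. sol (W z) (c z) m p q i j) \<in> borel_measurable N"
  using W j
proof (induction i arbitrary: j rule: less_induct)
  case (less i)
  consider "i = 0" | "i = Suc 0" | k where "i = Suc (Suc k)" by (metis not0_implies_Suc)
  then show ?case
  proof cases
    case (3 k)
    let ?n = "m + Suc k"
    have j: "(j + 1) div 2 \<in> {1..2 ^ ?n}" using dup_index[of j ?n] less.prems(2) by (simp add: 3)
    have j': "((j + 1) div 2 + 1) div 2 \<in> {1..2 ^ (m + k)}" using dup_index[of "(j + 1) div 2" "m + k"] j by simp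
    have s1: "(\<lambda>z. sol (W z) (c z) m p q (Suc k) l) \<in> borel_measurable N" if "l \<in> {1..2 ^ ?n}" for l
      using that less.prems(1) by (intro less.IH) (auto simp: 3)
    have s0: "(\<lambda>z. sol (W z) (c z) m p q k l) \<in> borel_measurable N" if "l \<in> {1..2 ^ (m + k)}" for l
      using that less.prems(1) by (intro less.IH) (auto simp: 3)
    have w: "(\<lambda>z. W z ?n ((j + 1) div 2) l) \<in> borel_measurable N" if "l \<in> {1..2 ^ ?n}" for l
      using that j less.prems(1) by (auto simp: 3)
    have "(\<lambda>z. 1 / 2 * (- sol (W z) (c z) m p q k (((j + 1) div 2 + 1) div 2)
       + (\<Sum>l\<in>{1..2 ^ ?n}. W z ?n ((j + 1) div 2) l * sol (W z) (c z) m p q (Suc k) l)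
       - complex_of_real (c z) * sol (W z) (c z) m p q (Suc k) ((j + 1) div 2))) \<in> borel_measurable N"
      using s0[OF j'] s1[OF j] measurable_compose[OF c borel_measurable_of_real]
      by (intro borel_measurable_times borel_measurable_diff borel_measurable_add borel_measurable_uminus
          borel_measurable_sum borel_measurable_const w s1 j)
    then show ?thesis by (simp add: 3 dup_def matvec_def)
  qed auto
qed

lemma sol_cong:
  assumes W: "\<And>n j k. n < m + i \<Longrightarrow> j \<in> {1..2 ^ n} \<Longrightarrow> k \<in> {1..2 ^ n} \<Longrightarrow> W n j k = W' n j k"
    and j: "j \<in> {1..2 ^ (m + i)}"
  shows "sol W c m p q i j = sol W' c m p q i j"
  using W j
proof (induction i arbitrary: j rule: less_induct)
  case (less i)
  consider "i = 0" | "i = Suc 0" | k where "i = Suc (Suc k)" by (metis not0_implies_Suc)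
  then show ?case
  proof cases
    case (3 k)
    let ?n = "m + Suc k"
    have j: "(j + 1) div 2 \<in> {1..2 ^ ?n}" using dup_index[of j ?n] less.prems(2) by (simp add: 3)
    have j': "((j + 1) div 2 + 1) div 2 \<in> {1..2 ^ (m + k)}" using dup_index[of "(j + 1) div 2" "m + k"] j by simp
    have s1: "sol W c m p q (Suc k) l = sol W' c m p q (Suc k) l" if "l \<in> {1..2 ^ ?n}" for l
      using that less.prems(1) by (intro less.IH) (auto simp: 3)
    have s0: "sol W c m p q k l = sol W' c m p q k l" if "l \<in> {1..2 ^ (m + k)}" for l
      using that less.prems(1) by (intro less.IH) (auto simp: 3)
    have w: "W ?n ((j + 1) div 2) l = W' ?n ((j + 1) div 2) l" if "l \<in> {1..2 ^ ?n}" for l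
      using that j less.prems(1) by (auto simp: 3)
    have "matvec ?n (W ?n) (sol W c m p q (Suc k)) ((j + 1) div 2) = matvec ?n (W' ?n) (sol W' c m p q (Suc k)) ((j + 1) div 2)"
      unfolding matvec_def by (intro sum.cong refl) (simp only: w s1)
    then show ?thesis unfolding 3 sol.simps dup_def using s0[OF j'] s1[OF j] by simp
  qed auto
qed

lemma layer_sq_measurable:
  assumes "\<And>j. j \<in> {1..2 ^ n} \<Longrightarrow> (\<lambda>z. f z j) \<in> borel_measurable N"
  shows "(\<lambda>z. layer_sq n (f z)) \<in> borel_measurable N"
  unfolding layer_sq_def using assms
  by (intro borel_measurable_sum borel_measurable_power measurable_compose[OF _ borel_measurable_norm]) auto

lemma layer_inner_measurable:
  assumes "\<And>j. j \<in> {1..2 ^ n} \<Longrightarrow> (\<lambda>z. f z j) \<in> borel_measurable N"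
    and "\<And>j. j \<in> {1..2 ^ n} \<Longrightarrow> (\<lambda>z. g z j) \<in> borel_measurable N"
  shows "(\<lambda>z. layer_inner n (f z) (g z)) \<in> borel_measurable N"
  unfolding layer_inner_def using assms
  by (intro borel_measurable_sum borel_measurable_times
      borel_measurable_continuous_on[OF continuous_on_cnj[OF continuous_on_id]]) auto

lemma mat_op_norm_cong:
  assumes "\<And>j k. j \<in> {1..N} \<Longrightarrow> k \<in> {1..N} \<Longrightarrow> A j k = B j k"
  shows "mat_op_norm N A = mat_op_norm N B"
proof -
  have "L2_set (\<lambda>i. cmod (\<Sum>j\<in>{1..N}. A i j * u j)) {1..N} = L2_set (\<lambda>i. cmod (\<Sum>j\<in>{1..N}. B i j * u j)) {1..N}" for u
    by (intro L2_set_cong refl arg_cong[where f=cmod] sum.cong) (simp add: assms)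
  then show ?thesis unfolding mat_op_norm_def by simp
qed

lemma mat_op_norm_diff_le:
  "mat_op_norm N A \<le> mat_op_norm N B + (\<Sum>i\<in>{1..N}. \<Sum>j\<in>{1..N}. cmod (A i j - B i j))"
proof -
  let ?L = "\<lambda>A u. L2_set (\<lambda>i. cmod (\<Sum>j\<in>{1..N}. A i j * u j)) {1..N}"
  have "?L A u \<le> mat_op_norm N B + (\<Sum>i\<in>{1..N}. \<Sum>j\<in>{1..N}. cmod (A i j - B i j))"
    if u: "L2_set (\<lambda>j. cmod (u j)) {1..N} \<le> 1" for u
  proof -
    have "?L A u \<le> L2_set (\<lambda>i. cmod (\<Sum>j\<in>{1..N}. B i j * u j) + cmod (\<Sum>j\<in>{1..N}. (A i j - B i j) * u j)) {1..N}"
    proof (rule L2_set_mono)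
      fix i
      have "(\<Sum>j\<in>{1..N}. A i j * u j) = (\<Sum>j\<in>{1..N}. B i j * u j) + (\<Sum>j\<in>{1..N}. (A i j - B i j) * u j)"
        by (simp add: left_diff_distrib sum_subtractf)
      then show "cmod (\<Sum>j\<in>{1..N}. A i j * u j) \<le> cmod (\<Sum>j\<in>{1..N}. B i j * u j) + cmod (\<Sum>j\<in>{1..N}. (A i j - B i j) * u j)"
        by (metis norm_triangle_ineq)
    qed simp
    also have "\<dots> \<le> ?L B u + ?L (\<lambda>i j. A i j - B i j) u" by (rule L2_set_triangle_ineq)
    also have "?L B u \<le> mat_op_norm N B"
      unfolding mat_op_norm_def by (intro cSup_upper[OF _ mat_op_norm_aux(1)] CollectI exI[of _ u] conjI refl u)
    also have "?L (\<lambda>i j. A i j - B i j) u \<le> mat_op_norm N (\<lambda>i j. A i j - B i j)"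
      unfolding mat_op_norm_def by (intro cSup_upper[OF _ mat_op_norm_aux(1)] CollectI exI[of _ u] conjI refl u)
    also have "mat_op_norm N (\<lambda>i j. A i j - B i j) \<le> (\<Sum>i\<in>{1..N}. \<Sum>j\<in>{1..N}. cmod (A i j - B i j))"
      by (rule mat_op_norm_le_sum)
    finally show ?thesis by simp
  qed
  then show ?thesis
    unfolding mat_op_norm_def[of N A] using mat_op_norm_aux(2)[where N=N and A=A] by (intro cSup_least) auto
qed

text \<open>A supremum over uncountably many vectors, measurable because it is continuous in the
  entries. Setting the entries outside the square to 0 allows continuity to be stated on the full
  function space.\<close>

lemma mat_op_norm_measurable:
  "(\<lambda>x. mat_op_norm N (\<lambda>j k. x (j, k))) \<in> borel_measurable (PiM ({1..N} \<times> {1..N}) (\<lambda>_. borel :: complex measure))"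
proof -
  let ?I = "{1..N} \<times> {1..N}"
  define ext where "ext x = (\<lambda>i. if i \<in> ?I then x i else 0)" for x :: "nat \<times> nat \<Rightarrow> complex"
  have "ext \<in> borel_measurable (PiM ?I (\<lambda>_. borel))"
  proof (rule measurable_coordinatewise_then_product)
    show "(\<lambda>x. ext x i) \<in> borel_measurable (PiM ?I (\<lambda>_. borel))" for i
      by (cases "i \<in> ?I") (auto simp: ext_def)
  qed
  moreover have "continuous_on UNIV (\<lambda>x. mat_op_norm N (\<lambda>j k. x (j, k)))"
    unfolding continuous_on_def
  proof (intro ballI)
    fix x :: "nat \<times> nat \<Rightarrow> complex"
    let ?d = "\<lambda>y. \<Sum>i\<in>{1..N}. \<Sum>j\<in>{1..N}. cmod (y (i, j) - x (i, j))"
    have t: "((\<lambda>y. y i) \<longlongrightarrow> x i) (at x within UNIV)" for i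
      using continuous_on_product_coordinates[where i=i] unfolding continuous_on_def by blast
    have "(?d \<longlongrightarrow> (\<Sum>i\<in>{1..N}. \<Sum>j\<in>{1..N}. cmod (x (i, j) - x (i, j)))) (at x within UNIV)"
      by (intro tendsto_intros t)
    then have d0: "(?d \<longlongrightarrow> 0) (at x within UNIV)" by simp
    have "((\<lambda>y. mat_op_norm N (\<lambda>j k. y (j, k)) - mat_op_norm N (\<lambda>j k. x (j, k))) \<longlongrightarrow> 0) (at x within UNIV)"
    proof (rule Lim_null_comparison[OF always_eventually d0], rule allI)
      fix y
      show "norm (mat_op_norm N (\<lambda>j k. y (j, k)) - mat_op_norm N (\<lambda>j k. x (j, k))) \<le> ?d y"
        using mat_op_norm_diff_le[of N "\<lambda>j k. y (j, k)" "\<lambda>j k. x (j, k)"]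
          mat_op_norm_diff_le[of N "\<lambda>j k. x (j, k)" "\<lambda>j k. y (j, k)"]
        by (simp add: norm_minus_commute abs_le_iff)
    qed
    then show "((\<lambda>x. mat_op_norm N (\<lambda>j k. x (j, k))) \<longlongrightarrow> mat_op_norm N (\<lambda>j k. x (j, k))) (at x within UNIV)"
      by (simp add: LIM_zero_iff)
  qed
  ultimately have "(\<lambda>x. mat_op_norm N (\<lambda>j k. ext x (j, k))) \<in> borel_measurable (PiM ?I (\<lambda>_. borel))"
    by (rule borel_measurable_continuous_on[rotated])
  moreover have "mat_op_norm N (\<lambda>j k. ext x (j, k)) = mat_op_norm N (\<lambda>j k. x (j, k))" for x
    by (rule mat_op_norm_cong) (simp add: ext_def)
  ultimately show ?thesis by simp
qed

lemma entry_le_mat_op_norm: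
  assumes "j \<in> {1..N}" "k \<in> {1..N}" shows "cmod (A j k) \<le> mat_op_norm N A"
proof -
  let ?u = "\<lambda>l. if l = k then 1 else 0 :: complex"
  have s: "(\<Sum>l\<in>{1..N}. A i l * ?u l) = A i k" for i
  proof -
    have "(\<Sum>l\<in>{1..N}. A i l * ?u l) = (\<Sum>l\<in>{1..N}. if l = k then A i l else 0)"
      by (intro sum.cong) auto
    then show ?thesis using assms by simp
  qed
  have u: "L2_set (\<lambda>l. cmod (?u l)) {1..N} = 1"
  proof -
    have "(\<Sum>l\<in>{1..N}. (cmod (?u l))\<^sup>2) = (\<Sum>l\<in>{1..N}. if l = k then 1 else 0)"
      by (intro sum.cong) auto
    then show ?thesis using assms by (simp add: L2_set_def)
  qed
  have "cmod (A j k) \<le> L2_set (\<lambda>i. cmod (A i k)) {1..N}"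
    using assms by (intro member_le_L2_set[of "{1..N}" j "\<lambda>i. cmod (A i k)"]) auto
  also have "\<dots> \<le> mat_op_norm N A * L2_set (\<lambda>l. cmod (?u l)) {1..N}"
    using mat_op_norm_bound[where N=N and A=A and u="?u"] unfolding s .
  finally show ?thesis unfolding u by simp
qed

section \<open>The random potential and its moments\<close>

locale random_potential = prob_space M for M :: "'o measure" +
  fixes V :: "nat \<Rightarrow> 'o \<Rightarrow> nat \<Rightarrow> nat \<Rightarrow> complex"
  assumes indep: "indep_vars
           (\<lambda>n. PiM ({1..2 ^ n} \<times> {1..2 ^ n}) (\<lambda>_. borel :: complex measure))
           (\<lambda>n \<omega>. \<lambda>(j, k)\<in>{1..2 ^ n} \<times> {1..2 ^ n}. V n \<omega> j k) UNIV"
    and herm: "\<And>n \<omega>. \<omega> \<in> space M \<Longrightarrow> hermitian_mat (2 ^ n) (V n \<omega>)"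
    and moments: "(\<Sum>i. let n = Suc i in
            ennreal (mat_op_norm (2 ^ n) (\<lambda>j k. \<integral>\<omega>. V n \<omega> j k \<partial>M)) +
            (\<integral>\<^sup>+\<omega>. ennreal (mat_op_norm (2 ^ n) (V n \<omega>) ^ 2 + mat_op_norm (2 ^ n) (V n \<omega>) ^ 4) \<partial>M))
         < \<infinity>"
begin

abbreviation entries :: "nat \<Rightarrow> (nat \<times> nat \<Rightarrow> complex) measure" where
  "entries n \<equiv> PiM ({1..2 ^ n} \<times> {1..2 ^ n}) (\<lambda>_. borel)"

definition X :: "nat \<Rightarrow> 'o \<Rightarrow> nat \<times> nat \<Rightarrow> complex" where
  "X n \<omega> = (\<lambda>(j, k)\<in>{1..2 ^ n} \<times> {1..2 ^ n}. V n \<omega> j k)"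

lemma indep_X: "indep_vars entries X UNIV"
  using indep by (simp add: X_def[abs_def])

lemma X_measurable: "X n \<in> M \<rightarrow>\<^sub>M entries n"
  using indep_X by (simp add: indep_vars_def)

lemma X_entry: "j \<in> {1..2 ^ n} \<Longrightarrow> k \<in> {1..2 ^ n} \<Longrightarrow> X n \<omega> (j, k) = V n \<omega> j k"
  by (simp add: X_def)

lemma V_measurable:
  assumes "j \<in> {1..2 ^ n}" "k \<in> {1..2 ^ n}"
  shows "(\<lambda>\<omega>. V n \<omega> j k) \<in> borel_measurable M"
proof -
  have "(\<lambda>x. x (j, k)) \<in> entries n \<rightarrow>\<^sub>M borel"
    using assms by (intro measurable_component_singleton) auto
  from measurable_compose[OF X_measurable this] show ?thesis using assms by (simp add: X_entry)
qed

definition norm_V :: "nat \<Rightarrow> 'o \<Rightarrow> real" where "norm_V n \<omega> = mat_op_norm (2 ^ n) (V n \<omega>)"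

lemma norm_V_measurable [measurable]: "norm_V n \<in> borel_measurable M"
proof -
  have "(\<lambda>\<omega>. mat_op_norm (2 ^ n) (\<lambda>j k. X n \<omega> (j, k))) \<in> borel_measurable M"
    by (rule measurable_compose[OF X_measurable mat_op_norm_measurable])
  moreover have "mat_op_norm (2 ^ n) (\<lambda>j k. X n \<omega> (j, k)) = norm_V n \<omega>" for \<omega>
    unfolding norm_V_def by (rule mat_op_norm_cong) (rule X_entry)
  ultimately show ?thesis by simp
qed

lemma moments_finite:
  "(\<integral>\<^sup>+\<omega>. ennreal (norm_V (Suc i) \<omega> ^ 2 + norm_V (Suc i) \<omega> ^ 4) \<partial>M) < \<infinity>"
proof -
  have "(\<integral>\<^sup>+\<omega>. ennreal (norm_V (Suc i) \<omega> ^ 2 + norm_V (Suc i) \<omega> ^ 4) \<partial>M)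
    \<le> ennreal (mat_op_norm (2 ^ Suc i) (\<lambda>j k. \<integral>\<omega>. V (Suc i) \<omega> j k \<partial>M)) +
        (\<integral>\<^sup>+\<omega>. ennreal (norm_V (Suc i) \<omega> ^ 2 + norm_V (Suc i) \<omega> ^ 4) \<partial>M)" by simp
  also have "\<dots> \<le> (\<Sum>i. ennreal (mat_op_norm (2 ^ Suc i) (\<lambda>j k. \<integral>\<omega>. V (Suc i) \<omega> j k \<partial>M)) +
        (\<integral>\<^sup>+\<omega>. ennreal (norm_V (Suc i) \<omega> ^ 2 + norm_V (Suc i) \<omega> ^ 4) \<partial>M))"
    using sum_le_suminf[OF summableI, of "{i}" "\<lambda>i. ennreal (mat_op_norm (2 ^ Suc i) (\<lambda>j k. \<integral>\<omega>. V (Suc i) \<omega> j k \<partial>M)) +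
        (\<integral>\<^sup>+\<omega>. ennreal (norm_V (Suc i) \<omega> ^ 2 + norm_V (Suc i) \<omega> ^ 4) \<partial>M)"] by simp
  also have "\<dots> < \<infinity>" using moments unfolding Let_def norm_V_def .
  finally show ?thesis .
qed

text \<open>The hypothesis sums over n \<ge> 1, so layer 0 is excluded. The first moment follows
  from |v| \<le> 1 + v^2.\<close>

lemma integrable_norm_V:
  assumes "n > 0"
  shows "integrable M (\<lambda>\<omega>. norm_V n \<omega> ^ 2)" "integrable M (\<lambda>\<omega>. norm_V n \<omega> ^ 4)" "integrable M (norm_V n)"
proof -
  obtain i where n: "n = Suc i" using assms not0_implies_Suc by blast
  have s: "integrable M (\<lambda>\<omega>. norm_V n \<omega> ^ 2 + norm_V n \<omega> ^ 4)"
    using moments_finite[of i] n by (intro integrableI_nonneg) auto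
  show 2: "integrable M (\<lambda>\<omega>. norm_V n \<omega> ^ 2)" and "integrable M (\<lambda>\<omega>. norm_V n \<omega> ^ 4)"
    by (rule Bochner_Integration.integrable_bound[OF s]; simp)+
  have "integrable M (\<lambda>\<omega>. 1 + norm_V n \<omega> ^ 2)" using 2 by simp
  then show "integrable M (norm_V n)"
  proof (rule Bochner_Integration.integrable_bound)
    have "\<bar>v\<bar> \<le> 1 + v\<^sup>2" for v :: real
    proof -
      have "0 \<le> (\<bar>v\<bar> - 1)\<^sup>2 + v\<^sup>2 + 1" by simp
      then show ?thesis by (simp add: power2_eq_square algebra_simps flip: abs_mult)
    qed
    then show "AE \<omega> in M. norm (norm_V n \<omega>) \<le> norm (1 + norm_V n \<omega> ^ 2)" by (simp add: order_trans[OF _ abs_ge_self])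
  qed simp
qed

lemma integrable_V:
  assumes "n > 0" "j \<in> {1..2 ^ n}" "k \<in> {1..2 ^ n}"
  shows "integrable M (\<lambda>\<omega>. V n \<omega> j k)"
  using integrable_norm_V(3)[OF assms(1)] V_measurable[OF assms(2,3)]
proof (rule Bochner_Integration.integrable_bound)
  show "AE \<omega> in M. norm (V n \<omega> j k) \<le> norm (norm_V n \<omega>)"
    using entry_le_mat_op_norm[OF assms(2,3)] by (simp add: norm_V_def order_trans[OF _ abs_ge_self])
qed

definition expV :: "nat \<Rightarrow> nat \<Rightarrow> nat \<Rightarrow> complex" where
  "expV n j k = (\<integral>\<omega>. V n \<omega> j k \<partial>M)"

text \<open>For n > 0 the n-th term of the moment hypothesis, as a real number. The second moment of
  \<open>sol_form\<close> grows by a factor of 1 plus a multiple of it in each layer.\<close>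

definition deviation :: "nat \<Rightarrow> real" where
  "deviation n = mat_op_norm (2 ^ n) (expV n) + (\<integral>\<omega>. norm_V n \<omega> ^ 2 + norm_V n \<omega> ^ 4 \<partial>M)"

lemma deviation_nonneg: "0 \<le> deviation n"
  unfolding deviation_def by (intro add_nonneg_nonneg mat_op_norm_nonneg integral_nonneg_AE) auto

lemma summable_deviation: "summable (\<lambda>i. deviation (Suc i))"
proof (rule summable_suminf_not_top[OF deviation_nonneg])
  have "ennreal (deviation (Suc i)) = (let n = Suc i in
            ennreal (mat_op_norm (2 ^ n) (\<lambda>j k. \<integral>\<omega>. V n \<omega> j k \<partial>M)) +
            (\<integral>\<^sup>+\<omega>. ennreal (mat_op_norm (2 ^ n) (V n \<omega>) ^ 2 + mat_op_norm (2 ^ n) (V n \<omega>) ^ 4) \<partial>M))" for i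
  proof -
    have "(\<integral>\<^sup>+\<omega>. ennreal (norm_V (Suc i) \<omega> ^ 2 + norm_V (Suc i) \<omega> ^ 4) \<partial>M) = ennreal (\<integral>\<omega>. norm_V (Suc i) \<omega> ^ 2 + norm_V (Suc i) \<omega> ^ 4 \<partial>M)"
      using integrable_norm_V[of "Suc i"] by (intro nn_integral_eq_integral) auto
    moreover have "0 \<le> (\<integral>\<omega>. norm_V (Suc i) \<omega> ^ 2 + norm_V (Suc i) \<omega> ^ 4 \<partial>M)" by (rule integral_nonneg_AE) auto
    ultimately show ?thesis unfolding deviation_def expV_def[abs_def] Let_def norm_V_def
      by (simp only: ennreal_plus mat_op_norm_nonneg)
  qed
  then show "(\<Sum>i. ennreal (deviation (Suc i))) \<noteq> \<top>" using moments by simp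
qed

text \<open>The congruence assumptions say that the functionals see only entries within range. They
  allow \<open>V\<close> to be exchanged for the restricted families, to which independence
  applies.\<close>

lemma indep_past:
  fixes \<Phi> :: "(nat \<Rightarrow> nat \<Rightarrow> nat \<Rightarrow> complex) \<Rightarrow> 'b::topological_space" and \<Psi> :: "(nat \<Rightarrow> nat \<Rightarrow> complex) \<Rightarrow> 'b"
  assumes \<Phi>: "(\<lambda>x. \<Phi> (\<lambda>n j k. x n (j, k))) \<in> borel_measurable (PiM {..<N} entries)"
    and \<Phi>c: "\<And>W W'. (\<And>n j k. n < N \<Longrightarrow> j \<in> {1..2 ^ n} \<Longrightarrow> k \<in> {1..2 ^ n} \<Longrightarrow> W n j k = W' n j k) \<Longrightarrow> \<Phi> W = \<Phi> W'"
    and \<Psi>: "(\<lambda>x. \<Psi> (\<lambda>j k. x (j, k))) \<in> borel_measurable (entries N)"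
    and \<Psi>c: "\<And>B B'. (\<And>j k. j \<in> {1..2 ^ N} \<Longrightarrow> k \<in> {1..2 ^ N} \<Longrightarrow> B j k = B' j k) \<Longrightarrow> \<Psi> B = \<Psi> B'"
  shows "indep_var borel (\<lambda>\<omega>. \<Phi> (\<lambda>n. V n \<omega>)) borel (\<lambda>\<omega>. \<Psi> (V N \<omega>))"
proof -
  have i: "indep_var (PiM {..<N} entries) (\<lambda>\<omega>. restrict (\<lambda>n. X n \<omega>) {..<N}) (PiM {N} entries) (\<lambda>\<omega>. restrict (\<lambda>n. X n \<omega>) {N})"
    by (rule indep_var_restrict[OF indep_X]) auto
  have "(\<lambda>x. \<Psi> (\<lambda>j k. x N (j, k))) \<in> borel_measurable (PiM {N} entries)"
    using measurable_compose[OF measurable_component_singleton[of N "{N}" entries] \<Psi>] by simp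
  from indep_var_compose[OF i \<Phi> this]
  have "indep_var borel ((\<lambda>x. \<Phi> (\<lambda>n j k. x n (j, k))) \<circ> (\<lambda>\<omega>. restrict (\<lambda>n. X n \<omega>) {..<N}))
     borel ((\<lambda>x. \<Psi> (\<lambda>j k. x N (j, k))) \<circ> (\<lambda>\<omega>. restrict (\<lambda>n. X n \<omega>) {N}))" .
  moreover have "(\<lambda>x. \<Phi> (\<lambda>n j k. x n (j, k))) \<circ> (\<lambda>\<omega>. restrict (\<lambda>n. X n \<omega>) {..<N}) = (\<lambda>\<omega>. \<Phi> (\<lambda>n. V n \<omega>))"
    unfolding o_def by (intro ext \<Phi>c) (simp add: X_entry)
  moreover have "(\<lambda>x. \<Psi> (\<lambda>j k. x N (j, k))) \<circ> (\<lambda>\<omega>. restrict (\<lambda>n. X n \<omega>) {N}) = (\<lambda>\<omega>. \<Psi> (V N \<omega>))"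
    unfolding o_def by (intro ext \<Psi>c) (simp add: X_entry)
  ultimately show ?thesis by simp
qed

end

section \<open>Dependence of the solutions on earlier layers\<close>

lemma dup_sol_measurable:
  assumes W: "\<And>n j k. n < m + Suc i \<Longrightarrow> j \<in> {1..2 ^ n} \<Longrightarrow> k \<in> {1..2 ^ n} \<Longrightarrow> (\<lambda>z. W z n j k) \<in> borel_measurable N"
    and c: "c \<in> borel_measurable N" and j: "j \<in> {1..2 ^ (m + Suc i)}"
  shows "(\<lambda>z. dup (sol (W z) (c z) m p q i) j) \<in> borel_measurable N"
  unfolding dup_def using dup_index[of j "m + i"] j W by (intro sol_measurable c) auto

lemma sol_sq_measurable:
  assumes W: "\<And>n j k. n < m + Suc i \<Longrightarrow> j \<in> {1..2 ^ n} \<Longrightarrow> k \<in> {1..2 ^ n} \<Longrightarrow> (\<lambda>z. W z n j k) \<in> borel_measurable N"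
    and c: "c \<in> borel_measurable N"
  shows "(\<lambda>z. sol_sq (W z) (c z) m p q i) \<in> borel_measurable N"
  unfolding sol_sq_def by (intro borel_measurable_add layer_sq_measurable sol_measurable c W) auto

lemma sol_form_measurable:
  assumes W: "\<And>n j k. n < m + Suc i \<Longrightarrow> j \<in> {1..2 ^ n} \<Longrightarrow> k \<in> {1..2 ^ n} \<Longrightarrow> (\<lambda>z. W z n j k) \<in> borel_measurable N"
    and c: "c \<in> borel_measurable N"
  shows "(\<lambda>z. sol_form (W z) (c z) m p q i) \<in> borel_measurable N"
proof -
  have "(\<lambda>z. layer_inner (m + Suc i) (dup (sol (W z) (c z) m p q i)) (sol (W z) (c z) m p q (Suc i))) \<in> borel_measurable N"
    by (intro layer_inner_measurable dup_sol_measurable sol_measurable c W) auto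
  from borel_measurable_Re[THEN measurable_compose[OF this]]
  have "(\<lambda>z. Re (layer_inner (m + Suc i) (dup (sol (W z) (c z) m p q i)) (sol (W z) (c z) m p q (Suc i)))) \<in> borel_measurable N" .
  then show ?thesis unfolding sol_form_def
    by (intro borel_measurable_add borel_measurable_times borel_measurable_divide borel_measurable_const c sol_sq_measurable W)
qed

lemma sol_dir_measurable:
  assumes W: "\<And>n j k. n < m + Suc i \<Longrightarrow> j \<in> {1..2 ^ n} \<Longrightarrow> k \<in> {1..2 ^ n} \<Longrightarrow> (\<lambda>z. W z n j k) \<in> borel_measurable N"
    and c: "c \<in> borel_measurable N" and j: "j \<in> {1..2 ^ (m + Suc i)}"
  shows "(\<lambda>z. sol_dir (W z) (c z) m p q i j) \<in> borel_measurable N"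
proof -
  have "(\<lambda>z. complex_of_real (c z / 2)) \<in> borel_measurable N"
    by (intro measurable_compose[OF _ borel_measurable_of_real] borel_measurable_divide c borel_measurable_const)
  moreover have "(\<lambda>z. sol (W z) (c z) m p q (Suc i) j) \<in> borel_measurable N"
    using j W by (intro sol_measurable c) auto
  ultimately show ?thesis unfolding sol_dir_def
    by (intro borel_measurable_uminus borel_measurable_add borel_measurable_times dup_sol_measurable W c j)
qed

text \<open>Dependence on the layers before m + Suc i alone, in the form that
  \<open>indep_past\<close> asks for.\<close>

lemma sol_parts_cong:
  assumes W: "\<And>n j k. n < m + Suc i \<Longrightarrow> j \<in> {1..2 ^ n} \<Longrightarrow> k \<in> {1..2 ^ n} \<Longrightarrow> W n j k = W' n j k"
  shows "j \<in> {1..2 ^ (m + Suc i)} \<Longrightarrow> sol W c m p q (Suc i) j = sol W' c m p q (Suc i) j"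
    "j \<in> {1..2 ^ (m + Suc i)} \<Longrightarrow> dup (sol W c m p q i) j = dup (sol W' c m p q i) j"
    "j \<in> {1..2 ^ (m + Suc i)} \<Longrightarrow> sol_dir W c m p q i j = sol_dir W' c m p q i j"
    "sol_form W c m p q i = sol_form W' c m p q i"
proof -
  have s0: "sol W c m p q i j = sol W' c m p q i j" if "j \<in> {1..2 ^ (m + i)}" for j
    using that W by (intro sol_cong) auto
  show s1: "sol W c m p q (Suc i) j = sol W' c m p q (Suc i) j" if "j \<in> {1..2 ^ (m + Suc i)}" for j
    using that W by (intro sol_cong) auto
  show d: "dup (sol W c m p q i) j = dup (sol W' c m p q i) j" if "j \<in> {1..2 ^ (m + Suc i)}" for j
    unfolding dup_def using that dup_index[of j "m + i"] by (intro s0) simp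
  show "sol_dir W c m p q i j = sol_dir W' c m p q i j" if "j \<in> {1..2 ^ (m + Suc i)}" for j
    unfolding sol_dir_def using s1[OF that] d[OF that] by simp
  show "sol_form W c m p q i = sol_form W' c m p q i"
    unfolding sol_form_def sol_sq_def
    by (intro arg_cong2[where f="(+)"] arg_cong2[where f="(*)"] arg_cong[where f=Re] refl layer_sq_cong layer_inner_cong s0 s1 d)
qed

section \<open>One step of the recursion in expectation\<close>

context random_potential
begin

lemma PiM_entry_measurable:
  assumes "n < N" "j \<in> {1..2 ^ n}" "k \<in> {1..2 ^ n}"
  shows "(\<lambda>x. x n (j, k)) \<in> borel_measurable (PiM {..<N} entries)"
proof -
  have "(\<lambda>x. x n) \<in> PiM {..<N} entries \<rightarrow>\<^sub>M entries n"
    using assms by (intro measurable_component_singleton) auto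
  moreover have "(\<lambda>x. x (j, k)) \<in> entries n \<rightarrow>\<^sub>M borel"
    using assms by (intro measurable_component_singleton) auto
  ultimately show ?thesis by (rule measurable_compose)
qed

text \<open>Given the potential below layer \<open>m + Suc i\<close>, the linear term of the recursion for
  \<open>sol_form\<close> has as conditional expectation the same term with \<open>expV\<close> in place of \<open>V\<close>.\<close>

lemma sol_form_step:
  fixes m i p q c r
  defines "N \<equiv> m + Suc i"
  defines "Q \<equiv> \<lambda>i \<omega>. sol_form (\<lambda>n. V n \<omega>) c m p q i"
  assumes r: "\<bar>c\<bar> \<le> r" "r < 2 * sqrt 2" and \<kappa>: "\<kappa> = 1 - r / (2 * sqrt 2)"
    and int: "integrable M (\<lambda>\<omega>. (Q i \<omega>)\<^sup>2)"
  shows "integrable M (\<lambda>\<omega>. (Q (Suc i) \<omega>)\<^sup>2)"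
    and "(\<integral>\<omega>. (Q (Suc i) \<omega>)\<^sup>2 \<partial>M) \<le> (1 + 9 / \<kappa>\<^sup>2 * deviation N) * (\<integral>\<omega>. (Q i \<omega>)\<^sup>2 \<partial>M)"
proof -
  have N0: "N > 0" by (simp add: N_def)
  have \<kappa>0: "0 < \<kappa>" "\<kappa> \<le> 1" using r by (auto simp: \<kappa> field_simps)
  have cc: "\<bar>c\<bar> \<le> 2 * sqrt 2" using r by linarith
  let ?V = "\<lambda>\<omega> n. V n \<omega>"
  have Vm: "(\<lambda>\<omega>. ?V \<omega> n j k) \<in> borel_measurable M" if "j \<in> {1..2 ^ n}" "k \<in> {1..2 ^ n}" for n j k
    by (rule V_measurable[OF that])
  have Qm [measurable]: "Q l \<in> borel_measurable M" for l
    unfolding Q_def by (intro sol_form_measurable Vm borel_measurable_const)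
  define d where "d j \<omega> = sol_dir (?V \<omega>) c m p q i j" for j \<omega>
  define g where "g l \<omega> = sol (?V \<omega>) c m p q (Suc i) l" for l \<omega>
  define R where "R \<omega> = sol_sq (?V \<omega>) c m p q i" for \<omega>
  \<comment> \<open>The coefficient of the entry (j,l) of layer \<open>N\<close> in the form times
    the linear term. It involves layers before \<open>N\<close> only, so it is independent of that
    entry.\<close>
  define Z where "Z j l \<omega> = complex_of_real (Q i \<omega>) * cnj (d j \<omega>) * g l \<omega>" for j l \<omega>
  define Y where "Y \<omega> = Re (layer_inner N (sol_dir (?V \<omega>) c m p q i) (matvec N (V N \<omega>) (sol (?V \<omega>) c m p q (Suc i))))" for \<omega>
  have R0: "0 \<le> R \<omega>" for \<omega> by (simp add: R_def sol_sq_nonneg)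
  have RQ: "R \<omega> \<le> Q i \<omega> / \<kappa>" for \<omega>
    using sol_form_bounds(1)[OF r(1), of "?V \<omega>" m p q i] \<kappa>0 by (simp add: \<kappa>[symmetric] R_def Q_def field_simps)
  have Q0: "0 \<le> Q i \<omega>" for \<omega>
    using order_trans[OF R0 RQ, of \<omega>] \<kappa>0 by (simp add: zero_le_divide_iff)
  have QR: "Q i \<omega> * (2 * b * R \<omega>) \<le> 2 / \<kappa> * b * (Q i \<omega>)\<^sup>2" if "b \<ge> 0" for b \<omega>
  proof -
    have "Q i \<omega> * (2 * b * R \<omega>) \<le> Q i \<omega> * (2 * b * (Q i \<omega> / \<kappa>))"
      using RQ Q0 that by (intro mult_left_mono) auto
    then show ?thesis by (simp add: power2_eq_square mult_ac)
  qed
  have dm: "d j \<in> borel_measurable M" if "j \<in> {1..2 ^ N}" for j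
    unfolding d_def using that by (intro sol_dir_measurable Vm borel_measurable_const) (auto simp: N_def)
  have gm: "g j \<in> borel_measurable M" if "j \<in> {1..2 ^ N}" for j
    unfolding g_def using that by (intro sol_measurable Vm borel_measurable_const) (auto simp: N_def)
  have cnjm: "(\<lambda>z. cnj (f z)) \<in> borel_measurable L" if "f \<in> borel_measurable L" for f :: "'x \<Rightarrow> complex" and L
    using that by (intro borel_measurable_continuous_on[OF continuous_on_cnj[OF continuous_on_id]])
  have Zm: "Z j l \<in> borel_measurable M" if "j \<in> {1..2 ^ N}" "l \<in> {1..2 ^ N}" for j l
    unfolding Z_def using dm[OF that(1)] gm[OF that(2)]
    by (intro borel_measurable_times cnjm measurable_compose[OF Qm borel_measurable_of_real])
  have le_layer: "cmod (f j) \<le> sqrt (layer_sq N f)" if "j \<in> {1..2 ^ N}" for f j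
    unfolding layer_sq_def using that by (intro real_le_rsqrt member_le_sum) auto
  have Zb: "cmod (Z j l \<omega>) \<le> 2 / \<kappa> * (Q i \<omega>)\<^sup>2" if "j \<in> {1..2 ^ N}" "l \<in> {1..2 ^ N}" for j l \<omega>
  proof -
    have "cmod (d j \<omega>) \<le> sqrt (4 * R \<omega>)"
      unfolding d_def R_def N_def
      using le_layer[OF that(1), of "sol_dir (?V \<omega>) c m p q i"] layer_sq_sol_dir[OF cc, of m i "?V \<omega>" p q]
      by (auto simp: N_def intro: order_trans)
    moreover have "cmod (g l \<omega>) \<le> sqrt (R \<omega>)"
    proof -
      have "layer_sq N (sol (?V \<omega>) c m p q (Suc i)) \<le> R \<omega>" by (simp add: R_def N_def sol_sq_def layer_sq_nonneg)
      then have "sqrt (layer_sq N (sol (?V \<omega>) c m p q (Suc i))) \<le> sqrt (R \<omega>)" by simp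
      with le_layer[OF that(2), of "sol (?V \<omega>) c m p q (Suc i)"] show ?thesis unfolding g_def by linarith
    qed
    ultimately have "cmod (d j \<omega>) * cmod (g l \<omega>) \<le> sqrt (4 * R \<omega>) * sqrt (R \<omega>)"
      by (intro mult_mono) (auto simp: R0)
    also have "\<dots> = 2 * 1 * R \<omega>" using R0[of \<omega>] by (simp add: real_sqrt_mult)
    finally have "Q i \<omega> * (cmod (d j \<omega>) * cmod (g l \<omega>)) \<le> Q i \<omega> * (2 * 1 * R \<omega>)"
      using Q0 by (intro mult_left_mono)
    also have "\<dots> \<le> 2 / \<kappa> * 1 * (Q i \<omega>)\<^sup>2" by (rule QR) simp
    finally show ?thesis using Q0[of \<omega>] by (simp add: Z_def norm_mult)
  qed
  have Zi: "integrable M (Z j l)" if "j \<in> {1..2 ^ N}" "l \<in> {1..2 ^ N}" for j l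
  proof (rule Bochner_Integration.integrable_bound[OF _ Zm[OF that]])
    show "integrable M (\<lambda>\<omega>. 2 / \<kappa> * (Q i \<omega>)\<^sup>2)" using int by (rule integrable_mult_right)
    show "AE \<omega> in M. norm (Z j l \<omega>) \<le> norm (2 / \<kappa> * (Q i \<omega>)\<^sup>2)"
      using Zb[OF that] \<kappa>0 by (simp add: abs_mult)
  qed
  have Qi: "indep_var borel (\<lambda>\<omega>. (Q i \<omega>)\<^sup>2) borel (\<lambda>\<omega>. \<Psi> (V N \<omega>))"
    if "(\<lambda>x. \<Psi> (\<lambda>j k. x (j, k))) \<in> borel_measurable (entries N)"
      and "\<And>B B'. (\<And>j k. j \<in> {1..2 ^ N} \<Longrightarrow> k \<in> {1..2 ^ N} \<Longrightarrow> B j k = B' j k) \<Longrightarrow> \<Psi> B = \<Psi> B'"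
    for \<Psi> :: "(nat \<Rightarrow> nat \<Rightarrow> complex) \<Rightarrow> real"
    unfolding Q_def
  proof (rule indep_past[where \<Phi>="\<lambda>W. (sol_form W c m p q i)\<^sup>2", OF _ _ that])
    show "(\<lambda>x. (sol_form (\<lambda>n j k. x n (j, k)) c m p q i)\<^sup>2) \<in> borel_measurable (PiM {..<N} entries)"
      unfolding N_def by (intro borel_measurable_power sol_form_measurable PiM_entry_measurable borel_measurable_const)
    show "(sol_form W c m p q i)\<^sup>2 = (sol_form W' c m p q i)\<^sup>2"
      if "\<And>n j k. n < N \<Longrightarrow> j \<in> {1..2 ^ n} \<Longrightarrow> k \<in> {1..2 ^ n} \<Longrightarrow> W n j k = W' n j k" for W W'
      using sol_parts_cong(4)[of m i W W' c p q] that unfolding N_def by simp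
  qed
  have ZV: "indep_var borel (Z j l) borel (\<lambda>\<omega>. V N \<omega> j l)" if jl: "j \<in> {1..2 ^ N}" "l \<in> {1..2 ^ N}" for j l
    unfolding Z_def Q_def d_def g_def
  proof (rule indep_past[where \<Phi>="\<lambda>W. complex_of_real (sol_form W c m p q i) * cnj (sol_dir W c m p q i j) * sol W c m p q (Suc i) l" and \<Psi>="\<lambda>B. B j l"])
    show "(\<lambda>x. complex_of_real (sol_form (\<lambda>n j k. x n (j, k)) c m p q i) * cnj (sol_dir (\<lambda>n j k. x n (j, k)) c m p q i j)
       * sol (\<lambda>n j k. x n (j, k)) c m p q (Suc i) l) \<in> borel_measurable (PiM {..<N} entries)"
    proof (intro borel_measurable_times cnjm measurable_compose[OF _ borel_measurable_of_real])
      show "(\<lambda>x. sol_form (\<lambda>n j k. x n (j, k)) c m p q i) \<in> borel_measurable (PiM {..<N} entries)"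
        unfolding N_def by (intro sol_form_measurable PiM_entry_measurable borel_measurable_const)
      show "(\<lambda>x. sol_dir (\<lambda>n j k. x n (j, k)) c m p q i j) \<in> borel_measurable (PiM {..<N} entries)"
        using jl unfolding N_def by (intro sol_dir_measurable PiM_entry_measurable borel_measurable_const)
      show "(\<lambda>x. sol (\<lambda>n j k. x n (j, k)) c m p q (Suc i) l) \<in> borel_measurable (PiM {..<N} entries)"
        using jl unfolding N_def by (intro sol_measurable PiM_entry_measurable borel_measurable_const) auto
    qed
    show "complex_of_real (sol_form W c m p q i) * cnj (sol_dir W c m p q i j) * sol W c m p q (Suc i) l =
      complex_of_real (sol_form W' c m p q i) * cnj (sol_dir W' c m p q i j) * sol W' c m p q (Suc i) l"
      if "\<And>n j k. n < N \<Longrightarrow> j \<in> {1..2 ^ n} \<Longrightarrow> k \<in> {1..2 ^ n} \<Longrightarrow> W n j k = W' n j k" for W W'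
      using sol_parts_cong[of m i W W'] that jl unfolding N_def by metis
    show "(\<lambda>x. x (j, l)) \<in> borel_measurable (entries N)"
      using jl by (intro measurable_component_singleton) auto
    show "B j l = B' j l" if "\<And>j k. j \<in> {1..2 ^ N} \<Longrightarrow> k \<in> {1..2 ^ N} \<Longrightarrow> B j k = B' j k" for B B' :: "nat \<Rightarrow> nat \<Rightarrow> complex"
      using that jl by blast
  qed
  have Vi: "integrable M (\<lambda>\<omega>. V N \<omega> j l)" if "j \<in> {1..2 ^ N}" "l \<in> {1..2 ^ N}" for j l
    using integrable_V[OF N0 that] .
  note ZVi = indep_var_integrable[OF ZV Zi Vi] and ZVe = indep_var_lebesgue_integral[OF ZV Zi Vi]
  have sum_int: "(\<integral>\<omega>. (\<Sum>j\<in>{1..2 ^ N}. \<Sum>l\<in>{1..2 ^ N}. F j l \<omega>) \<partial>M) = (\<Sum>j\<in>{1..2 ^ N}. \<Sum>l\<in>{1..2 ^ N}. (\<integral>\<omega>. F j l \<omega> \<partial>M))"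
    if F: "\<And>j l. j \<in> {1..2 ^ N} \<Longrightarrow> l \<in> {1..2 ^ N} \<Longrightarrow> integrable M (F j l)" for F :: "nat \<Rightarrow> nat \<Rightarrow> 'o \<Rightarrow> complex"
  proof -
    have "(\<integral>\<omega>. (\<Sum>j\<in>{1..2 ^ N}. \<Sum>l\<in>{1..2 ^ N}. F j l \<omega>) \<partial>M) = (\<Sum>j\<in>{1..2 ^ N}. (\<integral>\<omega>. (\<Sum>l\<in>{1..2 ^ N}. F j l \<omega>) \<partial>M))"
      by (intro Bochner_Integration.integral_sum Bochner_Integration.integrable_sum F)
    also have "\<dots> = (\<Sum>j\<in>{1..2 ^ N}. \<Sum>l\<in>{1..2 ^ N}. (\<integral>\<omega>. F j l \<omega> \<partial>M))"
      by (intro sum.cong refl Bochner_Integration.integral_sum F)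
    finally show ?thesis .
  qed
  have QY: "complex_of_real (Q i \<omega>) * layer_inner N (sol_dir (?V \<omega>) c m p q i) (matvec N B (sol (?V \<omega>) c m p q (Suc i)))
     = (\<Sum>j\<in>{1..2 ^ N}. \<Sum>l\<in>{1..2 ^ N}. Z j l \<omega> * B j l)" for B \<omega>
    unfolding layer_inner_def matvec_def sum_distrib_left Z_def d_def g_def
    by (intro sum.cong refl) (simp only: mult_ac)
  have QYr: "Q i \<omega> * Re (layer_inner N (sol_dir (?V \<omega>) c m p q i) (matvec N B (sol (?V \<omega>) c m p q (Suc i))))
     = Re (\<Sum>j\<in>{1..2 ^ N}. \<Sum>l\<in>{1..2 ^ N}. Z j l \<omega> * B j l)" for B \<omega>
    unfolding QY[symmetric] by simp
  have intY: "integrable M (\<lambda>\<omega>. Q i \<omega> * Y \<omega>)"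
    unfolding Y_def QYr by (intro integrable_Re Bochner_Integration.integrable_sum ZVi)
  \<comment> \<open>Independence, entry by entry, replaces the potential by its mean. The operator
    norm is taken only afterwards, so that the bound contains the norm of the mean and not the mean
    of the norm.\<close>
  have EY: "(\<integral>\<omega>. Q i \<omega> * Y \<omega> \<partial>M) \<le> 2 / \<kappa> * mat_op_norm (2 ^ N) (expV N) * (\<integral>\<omega>. (Q i \<omega>)\<^sup>2 \<partial>M)"
  proof -
    have "(\<integral>\<omega>. Q i \<omega> * Y \<omega> \<partial>M) = Re (\<integral>\<omega>. (\<Sum>j\<in>{1..2 ^ N}. \<Sum>l\<in>{1..2 ^ N}. Z j l \<omega> * V N \<omega> j l) \<partial>M)"
      unfolding Y_def QYr by (intro integral_Re Bochner_Integration.integrable_sum ZVi)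
    also have "(\<integral>\<omega>. (\<Sum>j\<in>{1..2 ^ N}. \<Sum>l\<in>{1..2 ^ N}. Z j l \<omega> * V N \<omega> j l) \<partial>M)
       = (\<Sum>j\<in>{1..2 ^ N}. \<Sum>l\<in>{1..2 ^ N}. (\<integral>\<omega>. Z j l \<omega> \<partial>M) * expV N j l)"
    proof -
      have "(\<integral>\<omega>. (\<Sum>j\<in>{1..2 ^ N}. \<Sum>l\<in>{1..2 ^ N}. Z j l \<omega> * V N \<omega> j l) \<partial>M)
         = (\<Sum>j\<in>{1..2 ^ N}. \<Sum>l\<in>{1..2 ^ N}. (\<integral>\<omega>. Z j l \<omega> * V N \<omega> j l \<partial>M))"
        by (rule sum_int) (rule ZVi)
      also have "\<dots> = (\<Sum>j\<in>{1..2 ^ N}. \<Sum>l\<in>{1..2 ^ N}. (\<integral>\<omega>. Z j l \<omega> \<partial>M) * expV N j l)"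
        unfolding expV_def by (intro sum.cong refl ZVe)
      finally show ?thesis .
    qed
    also have "\<dots> = (\<integral>\<omega>. (\<Sum>j\<in>{1..2 ^ N}. \<Sum>l\<in>{1..2 ^ N}. Z j l \<omega> * expV N j l) \<partial>M)"
    proof -
      have "(\<integral>\<omega>. (\<Sum>j\<in>{1..2 ^ N}. \<Sum>l\<in>{1..2 ^ N}. Z j l \<omega> * expV N j l) \<partial>M)
         = (\<Sum>j\<in>{1..2 ^ N}. \<Sum>l\<in>{1..2 ^ N}. (\<integral>\<omega>. Z j l \<omega> * expV N j l \<partial>M))"
        by (rule sum_int) (intro integrable_mult_left Zi)
      also have "\<dots> = (\<Sum>j\<in>{1..2 ^ N}. \<Sum>l\<in>{1..2 ^ N}. (\<integral>\<omega>. Z j l \<omega> \<partial>M) * expV N j l)"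
        by (intro sum.cong refl integral_mult_left_zero)
      finally show ?thesis ..
    qed
    also have "Re \<dots> = (\<integral>\<omega>. Q i \<omega> * Re (layer_inner N (sol_dir (?V \<omega>) c m p q i) (matvec N (expV N) (sol (?V \<omega>) c m p q (Suc i)))) \<partial>M)"
      unfolding QYr by (intro integral_Re[symmetric] Bochner_Integration.integrable_sum integrable_mult_left Zi)
    also have "\<dots> \<le> (\<integral>\<omega>. 2 / \<kappa> * mat_op_norm (2 ^ N) (expV N) * (Q i \<omega>)\<^sup>2 \<partial>M)"
    proof (rule integral_mono)
      show "integrable M (\<lambda>\<omega>. Q i \<omega> * Re (layer_inner N (sol_dir (?V \<omega>) c m p q i) (matvec N (expV N) (sol (?V \<omega>) c m p q (Suc i)))))"
        unfolding QYr by (intro integrable_Re Bochner_Integration.integrable_sum integrable_mult_left Zi)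
      show "integrable M (\<lambda>\<omega>. 2 / \<kappa> * mat_op_norm (2 ^ N) (expV N) * (Q i \<omega>)\<^sup>2)" using int by (rule integrable_mult_right)
      fix \<omega>
      have "Q i \<omega> * Re (layer_inner N (sol_dir (?V \<omega>) c m p q i) (matvec N (expV N) (sol (?V \<omega>) c m p q (Suc i))))
        \<le> Q i \<omega> * (2 * mat_op_norm (2 ^ N) (expV N) * R \<omega>)"
        using sol_dir_bound[OF cc, of m i "?V \<omega>" p q "expV N"] Q0[of \<omega>]
        by (intro mult_left_mono) (auto simp: R_def N_def)
      also have "\<dots> \<le> 2 / \<kappa> * mat_op_norm (2 ^ N) (expV N) * (Q i \<omega>)\<^sup>2" by (rule QR) (rule mat_op_norm_nonneg)
      finally show "Q i \<omega> * Re (layer_inner N (sol_dir (?V \<omega>) c m p q i) (matvec N (expV N) (sol (?V \<omega>) c m p q (Suc i))))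
        \<le> 2 / \<kappa> * mat_op_norm (2 ^ N) (expV N) * (Q i \<omega>)\<^sup>2" .
    qed
    also have "\<dots> = 2 / \<kappa> * mat_op_norm (2 ^ N) (expV N) * (\<integral>\<omega>. (Q i \<omega>)\<^sup>2 \<partial>M)" by (rule integral_mult_right_zero)
    finally show ?thesis .
  qed
  have iv: "indep_var borel (\<lambda>\<omega>. (Q i \<omega>)\<^sup>2) borel (\<lambda>\<omega>. (norm_V N \<omega>)\<^sup>2 + norm_V N \<omega> ^ 4)"
    unfolding norm_V_def
  proof (rule Qi[of "\<lambda>B. (mat_op_norm (2 ^ N) B)\<^sup>2 + mat_op_norm (2 ^ N) B ^ 4"])
    show "(\<lambda>x. (mat_op_norm (2 ^ N) (\<lambda>j k. x (j, k)))\<^sup>2 + mat_op_norm (2 ^ N) (\<lambda>j k. x (j, k)) ^ 4) \<in> borel_measurable (entries N)"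
      by (intro borel_measurable_add borel_measurable_power mat_op_norm_measurable)
    show "(mat_op_norm (2 ^ N) B)\<^sup>2 + mat_op_norm (2 ^ N) B ^ 4 = (mat_op_norm (2 ^ N) B')\<^sup>2 + mat_op_norm (2 ^ N) B' ^ 4"
      if "\<And>j k. j \<in> {1..2 ^ N} \<Longrightarrow> k \<in> {1..2 ^ N} \<Longrightarrow> B j k = B' j k" for B B'
      using mat_op_norm_cong[of "2 ^ N" B B'] that by simp
  qed
  have vi: "integrable M (\<lambda>\<omega>. (norm_V N \<omega>)\<^sup>2 + norm_V N \<omega> ^ 4)" using integrable_norm_V[OF N0] by simp
  note Qvi = indep_var_integrable[OF iv int vi] and Qve = indep_var_lebesgue_integral[OF iv int vi]
  have step: "(Q (Suc i) \<omega>)\<^sup>2 \<le> (Q i \<omega>)\<^sup>2 + 2 * (Q i \<omega> * Y \<omega>) + 9 / \<kappa>\<^sup>2 * ((Q i \<omega>)\<^sup>2 * ((norm_V N \<omega>)\<^sup>2 + norm_V N \<omega> ^ 4))" for \<omega>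
    using sol_form_Suc_sq[OF r \<kappa>, of "?V \<omega>" m p q i] by (simp add: Q_def Y_def norm_V_def N_def mult_ac)
  have rhs: "integrable M (\<lambda>\<omega>. (Q i \<omega>)\<^sup>2 + 2 * (Q i \<omega> * Y \<omega>) + 9 / \<kappa>\<^sup>2 * ((Q i \<omega>)\<^sup>2 * ((norm_V N \<omega>)\<^sup>2 + norm_V N \<omega> ^ 4)))"
    using int intY Qvi by (intro Bochner_Integration.integrable_add integrable_mult_right)
  show iQ: "integrable M (\<lambda>\<omega>. (Q (Suc i) \<omega>)\<^sup>2)"
  proof (rule Bochner_Integration.integrable_bound[OF rhs])
    show "AE \<omega> in M. norm ((Q (Suc i) \<omega>)\<^sup>2) \<le> norm ((Q i \<omega>)\<^sup>2 + 2 * (Q i \<omega> * Y \<omega>) + 9 / \<kappa>\<^sup>2 * ((Q i \<omega>)\<^sup>2 * ((norm_V N \<omega>)\<^sup>2 + norm_V N \<omega> ^ 4)))"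
      using step by (intro AE_I2) (simp add: order_trans[OF _ abs_ge_self])
  qed measurable
  have "(\<integral>\<omega>. (Q (Suc i) \<omega>)\<^sup>2 \<partial>M) \<le> (\<integral>\<omega>. (Q i \<omega>)\<^sup>2 + 2 * (Q i \<omega> * Y \<omega>) + 9 / \<kappa>\<^sup>2 * ((Q i \<omega>)\<^sup>2 * ((norm_V N \<omega>)\<^sup>2 + norm_V N \<omega> ^ 4)) \<partial>M)"
    by (rule integral_mono[OF iQ rhs step])
  also have "\<dots> = (\<integral>\<omega>. (Q i \<omega>)\<^sup>2 \<partial>M) + 2 * (\<integral>\<omega>. Q i \<omega> * Y \<omega> \<partial>M) + 9 / \<kappa>\<^sup>2 * ((\<integral>\<omega>. (Q i \<omega>)\<^sup>2 \<partial>M) * (\<integral>\<omega>. (norm_V N \<omega>)\<^sup>2 + norm_V N \<omega> ^ 4 \<partial>M))"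
    using int intY Qvi by (simp only: Bochner_Integration.integral_add Bochner_Integration.integrable_add integrable_mult_right integral_mult_right_zero Qve)
  also have "\<dots> \<le> (1 + 9 / \<kappa>\<^sup>2 * deviation N) * (\<integral>\<omega>. (Q i \<omega>)\<^sup>2 \<partial>M)"
  proof -
    let ?E = "\<integral>\<omega>. (Q i \<omega>)\<^sup>2 \<partial>M" and ?a = "mat_op_norm (2 ^ N) (expV N)" and ?b = "\<integral>\<omega>. (norm_V N \<omega>)\<^sup>2 + norm_V N \<omega> ^ 4 \<partial>M"
    have E0: "0 \<le> ?E" by (rule integral_nonneg_AE) auto
    \<comment> \<open>Absorbs the constant 2 * (2 / \<open>\<kappa>\<close>) of the linear term into
      that of the quadratic terms.\<close>
    have k: "4 / \<kappa> \<le> 9 / \<kappa>\<^sup>2" using \<kappa>0 by (intro frac_le) (auto simp: power2_eq_square mult_left_le_one_le)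
    have "2 * (\<integral>\<omega>. Q i \<omega> * Y \<omega> \<partial>M) \<le> 4 / \<kappa> * (?a * ?E)" using EY by (simp add: mult_ac)
    also have "\<dots> \<le> 9 / \<kappa>\<^sup>2 * (?a * ?E)" using k E0 by (intro mult_right_mono) (auto simp: mat_op_norm_nonneg)
    finally have "2 * (\<integral>\<omega>. Q i \<omega> * Y \<omega> \<partial>M) \<le> 9 / \<kappa>\<^sup>2 * (?a * ?E)" .
    moreover have "(1 + 9 / \<kappa>\<^sup>2 * deviation N) * ?E = ?E + 9 / \<kappa>\<^sup>2 * (?a * ?E) + 9 / \<kappa>\<^sup>2 * (?E * ?b)"
      by (simp add: deviation_def algebra_simps)
    ultimately show ?thesis by linarith
  qed
  finally show "(\<integral>\<omega>. (Q (Suc i) \<omega>)\<^sup>2 \<partial>M) \<le> (1 + 9 / \<kappa>\<^sup>2 * deviation N) * (\<integral>\<omega>. (Q i \<omega>)\<^sup>2 \<partial>M)" .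
qed

end

section \<open>Moments of the control function and almost sure bounds\<close>

lemma control_measurable:
  assumes W: "\<And>n j k. j \<in> {1..2 ^ n} \<Longrightarrow> k \<in> {1..2 ^ n} \<Longrightarrow> (\<lambda>z. W z n j k) \<in> borel_measurable N"
    and c: "c \<in> borel_measurable N"
  shows "(\<lambda>z. control (W z) m x k (c z)) \<in> borel_measurable N"
  unfolding control_def sol_energy_def
  by (intro borel_measurable_times borel_measurable_add borel_measurable_sum borel_measurable_const layer_sq_measurable
      sol_measurable W c)

lemma sol_energy_le: "sol_energy W c m p q k \<le> (\<Sum>i\<le>k. sol_sq W c m p q i)"
proof -
  let ?l = "\<lambda>i. layer_sq (m + i) (sol W c m p q i)"
  have "sol_energy W c m p q k = (\<Sum>i\<le>k. ?l i) + ?l (Suc k)"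
    unfolding sol_energy_def by (rule sum.atMost_Suc)
  moreover have "?l (Suc k) \<le> (\<Sum>i\<le>k. ?l (Suc i))"
    by (rule member_le_sum[of k "{..k}" "\<lambda>i. ?l (Suc i)"]) (auto simp: layer_sq_nonneg)
  moreover have "(\<Sum>i\<le>k. sol_sq W c m p q i) = (\<Sum>i\<le>k. ?l i) + (\<Sum>i\<le>k. ?l (Suc i))"
    unfolding sol_sq_def by (rule sum.distrib)
  ultimately show ?thesis by linarith
qed

text \<open>512 = 16^2 * 2, the 2 for the square of the sum of two energies; \<open>Suc k\<close> is
  the number of terms in Cauchy-Schwarz.\<close>

lemma control_sq_le:
  assumes k: "k > 0"
  shows "(control W m x k c)\<^sup>2 \<le> 512 / (real k)\<^sup>2 * real (Suc k) *
    ((\<Sum>i\<le>k. (sol_sq W c m (\<lambda>_. 0) (\<lambda>j. dup (\<lambda>i. if i = x then 1 / 2 else 0) j) i)\<^sup>2)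
     + (\<Sum>i\<le>k. (sol_sq W c m (\<lambda>i. if i = x then 1 else 0) (\<lambda>_. 0) i)\<^sup>2))"
proof -
  have E: "(sol_energy W c m p q k)\<^sup>2 \<le> real (Suc k) * (\<Sum>i\<le>k. (sol_sq W c m p q i)\<^sup>2)" for p q
  proof -
    have "(sol_energy W c m p q k)\<^sup>2 \<le> (\<Sum>i\<le>k. sol_sq W c m p q i)\<^sup>2"
      by (intro power_mono sol_energy_le sol_energy_nonneg)
    also have "\<dots> \<le> (\<Sum>i\<le>k. (sol_sq W c m p q i)\<^sup>2) * card {..k}"
      by (rule sum_squared_le_sum_of_squares)
    finally show ?thesis by (simp add: mult.commute)
  qed
  let ?a = "sol_energy W c m (\<lambda>_. 0) (\<lambda>j. dup (\<lambda>i. if i = x then 1 / 2 else 0) j) k"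
  let ?b = "sol_energy W c m (\<lambda>i. if i = x then 1 else 0) (\<lambda>_. 0) k"
  have "(16 / real k * y)\<^sup>2 = 256 / (real k)\<^sup>2 * y\<^sup>2" for y
    by (simp add: power_mult_distrib power_divide)
  then have "(control W m x k c)\<^sup>2 = 256 / (real k)\<^sup>2 * (?a + ?b)\<^sup>2"
    unfolding control_def .
  also have "\<dots> \<le> 256 / (real k)\<^sup>2 * (2 * (?a\<^sup>2 + ?b\<^sup>2))"
    using sum_squares_bound[of ?a ?b] by (intro mult_left_mono) (auto simp: power2_sum)
  also have "\<dots> \<le> 256 / (real k)\<^sup>2 * (2 * (real (Suc k) * (\<Sum>i\<le>k. (sol_sq W c m (\<lambda>_. 0) (\<lambda>j. dup (\<lambda>i. if i = x then 1 / 2 else 0) j) i)\<^sup>2)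
     + real (Suc k) * (\<Sum>i\<le>k. (sol_sq W c m (\<lambda>i. if i = x then 1 else 0) (\<lambda>_. 0) i)\<^sup>2)))"
    by (intro mult_left_mono add_mono E) auto
  also have "\<dots> = 512 / (real k)\<^sup>2 * real (Suc k) *
    ((\<Sum>i\<le>k. (sol_sq W c m (\<lambda>_. 0) (\<lambda>j. dup (\<lambda>i. if i = x then 1 / 2 else 0) j) i)\<^sup>2)
     + (\<Sum>i\<le>k. (sol_sq W c m (\<lambda>i. if i = x then 1 else 0) (\<lambda>_. 0) i)\<^sup>2))"
    by (simp only: distrib_left)
  finally show ?thesis .
qed

context random_potential
begin

text \<open>Discrete Gronwall: with 1 + x \<le> exp x the step factors multiply to the exponential
  of a convergent sum. The constant depends on \<open>r\<close> and the initial data but not on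
  \<open>c\<close> or \<open>i\<close>, and this uniformity permits integration over
  \<open>c\<close>.\<close>

lemma sol_sq_moment:
  assumes r: "r < 2 * sqrt 2"
  obtains K where "K \<ge> 0" "\<And>c i. \<bar>c\<bar> \<le> r \<Longrightarrow> integrable M (\<lambda>\<omega>. (sol_sq (\<lambda>n. V n \<omega>) c m p q i)\<^sup>2)"
    "\<And>c i. \<bar>c\<bar> \<le> r \<Longrightarrow> (\<integral>\<omega>. (sol_sq (\<lambda>n. V n \<omega>) c m p q i)\<^sup>2 \<partial>M) \<le> K"
proof
  define \<kappa> where "\<kappa> = 1 - r / (2 * sqrt 2)"
  define R0 where "R0 = layer_sq m p + layer_sq (Suc m) q"
  define D where "D = (\<Sum>i. deviation (Suc i))"
  define K where "K = (2 * R0)\<^sup>2 * exp (9 / \<kappa>\<^sup>2 * D) / \<kappa>\<^sup>2"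
  have \<kappa>0: "0 < \<kappa>" using r by (simp add: \<kappa>_def field_simps)
  have R0: "0 \<le> R0" by (simp add: R0_def layer_sq_nonneg)
  show "0 \<le> K" by (simp add: K_def)
  fix c :: real and i :: nat assume c: "\<bar>c\<bar> \<le> r"
  let ?Q = "\<lambda>i \<omega>. sol_form (\<lambda>n. V n \<omega>) c m p q i"
  have q0: "?Q 0 \<omega> = R0 + c / 2 * Re (layer_inner (Suc m) (dup p) q)" for \<omega>
    by (simp add: sol_form_def sol_sq_def R0_def)
  have sq0: "sol_sq (\<lambda>n. V n \<omega>) c m p q 0 = R0" for \<omega> by (simp add: sol_sq_def R0_def)
  have Q0b: "(?Q 0 \<omega>)\<^sup>2 \<le> (2 * R0)\<^sup>2" for \<omega>
  proof (rule power_mono)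
    have "r / (2 * sqrt 2) \<le> 1" using r by (simp add: field_simps)
    then have "(1 + r / (2 * sqrt 2)) * R0 \<le> 2 * R0" using R0 by (intro mult_right_mono) auto
    with sol_form_bounds(2)[OF c, of "\<lambda>n. V n \<omega>" m p q 0] show "?Q 0 \<omega> \<le> 2 * R0" unfolding sq0 by linarith
    have "0 \<le> \<kappa> * R0" using \<kappa>0 R0 by simp
    with sol_form_bounds(1)[OF c, of "\<lambda>n. V n \<omega>" m p q 0] show "0 \<le> ?Q 0 \<omega>" unfolding sq0 \<kappa>_def by linarith
  qed
  have S: "(\<Sum>l<i. deviation (m + Suc l)) \<le> D" for i
  proof -
    have "(\<Sum>l<i. deviation (m + Suc l)) = (\<Sum>l\<in>(\<lambda>l. m + l) ` {..<i}. deviation (Suc l))"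
      by (subst sum.reindex) (auto simp: inj_on_def)
    also have "\<dots> \<le> D" unfolding D_def by (rule sum_le_suminf[OF summable_deviation]) (auto simp: deviation_nonneg)
    finally show ?thesis .
  qed
  have ind: "integrable M (\<lambda>\<omega>. (?Q i \<omega>)\<^sup>2) \<and> (\<integral>\<omega>. (?Q i \<omega>)\<^sup>2 \<partial>M) \<le> (2 * R0)\<^sup>2 * exp (9 / \<kappa>\<^sup>2 * (\<Sum>l<i. deviation (m + Suc l)))" for i
  proof (induction i)
    case 0
    have "(R0 + c / 2 * Re (layer_inner (Suc m) (dup p) q))\<^sup>2 \<le> (2 * R0)\<^sup>2" using Q0b unfolding q0 .
    then show ?case unfolding q0 by (simp add: prob_space)
  next
    case (Suc i)
    note st = sol_form_step[OF c r \<kappa>_def, of m p q i]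
    let ?E = "\<integral>\<omega>. (?Q i \<omega>)\<^sup>2 \<partial>M" and ?s = "\<Sum>l<i. deviation (m + Suc l)"
    have "(\<integral>\<omega>. (?Q (Suc i) \<omega>)\<^sup>2 \<partial>M) \<le> (1 + 9 / \<kappa>\<^sup>2 * deviation (m + Suc i)) * ?E"
      using st(2) Suc.IH by blast
    also have "\<dots> \<le> exp (9 / \<kappa>\<^sup>2 * deviation (m + Suc i)) * ((2 * R0)\<^sup>2 * exp (9 / \<kappa>\<^sup>2 * ?s))"
      using Suc.IH by (intro mult_mono exp_ge_add_one_self) (auto intro!: integral_nonneg_AE)
    also have "\<dots> = (2 * R0)\<^sup>2 * exp (9 / \<kappa>\<^sup>2 * (\<Sum>l<Suc i. deviation (m + Suc l)))"
      by (simp add: distrib_left exp_add mult_ac)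
    finally show ?case using st(1) Suc.IH by blast
  qed
  have RQ: "(sol_sq (\<lambda>n. V n \<omega>) c m p q i)\<^sup>2 \<le> (?Q i \<omega>)\<^sup>2 / \<kappa>\<^sup>2" for \<omega>
  proof -
    have "sol_sq (\<lambda>n. V n \<omega>) c m p q i \<le> ?Q i \<omega> / \<kappa>"
      using sol_form_bounds(1)[OF c, of "\<lambda>n. V n \<omega>" m p q i] \<kappa>0 by (simp add: \<kappa>_def[symmetric] field_simps)
    from power_mono[OF this sol_sq_nonneg, of 2] show ?thesis by (simp add: power_divide)
  qed
  have iQ: "integrable M (\<lambda>\<omega>. (?Q i \<omega>)\<^sup>2 / \<kappa>\<^sup>2)" using ind[of i] by (intro integrable_divide) auto
  show iR: "integrable M (\<lambda>\<omega>. (sol_sq (\<lambda>n. V n \<omega>) c m p q i)\<^sup>2)"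
  proof (rule Bochner_Integration.integrable_bound[OF iQ])
    show "(\<lambda>\<omega>. (sol_sq (\<lambda>n. V n \<omega>) c m p q i)\<^sup>2) \<in> borel_measurable M"
      by (intro borel_measurable_power sol_sq_measurable V_measurable borel_measurable_const)
    show "AE \<omega> in M. norm ((sol_sq (\<lambda>n. V n \<omega>) c m p q i)\<^sup>2) \<le> norm ((?Q i \<omega>)\<^sup>2 / \<kappa>\<^sup>2)"
      using RQ by simp
  qed
  have "(\<integral>\<omega>. (sol_sq (\<lambda>n. V n \<omega>) c m p q i)\<^sup>2 \<partial>M) \<le> (\<integral>\<omega>. (?Q i \<omega>)\<^sup>2 / \<kappa>\<^sup>2 \<partial>M)"
    by (rule integral_mono[OF iR iQ RQ])
  also have "\<dots> = (\<integral>\<omega>. (?Q i \<omega>)\<^sup>2 \<partial>M) / \<kappa>\<^sup>2" by simp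
  also have "\<dots> \<le> K"
    unfolding K_def
  proof (rule divide_right_mono)
    have "(2 * R0)\<^sup>2 * exp (9 / \<kappa>\<^sup>2 * (\<Sum>l<i. deviation (m + Suc l))) \<le> (2 * R0)\<^sup>2 * exp (9 / \<kappa>\<^sup>2 * D)"
      using S[of i] by (intro mult_left_mono) (auto intro!: divide_right_mono)
    with ind[of i] show "(\<integral>\<omega>. (?Q i \<omega>)\<^sup>2 \<partial>M) \<le> (2 * R0)\<^sup>2 * exp (9 / \<kappa>\<^sup>2 * D)" by linarith
  qed simp
  finally show "(\<integral>\<omega>. (sol_sq (\<lambda>n. V n \<omega>) c m p q i)\<^sup>2 \<partial>M) \<le> K" .
qed

text \<open>An energy is a sum over k + 2 layers, so its second moment is of order k^2, which the
  prefactor 1/k^2 in the square of \<open>control\<close> balances.\<close>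

lemma control_moment:
  assumes r: "r < 2 * sqrt 2"
  obtains C where "\<And>c k. k > 0 \<Longrightarrow> \<bar>c\<bar> \<le> r \<Longrightarrow> (\<integral>\<^sup>+\<omega>. ennreal ((control (\<lambda>n. V n \<omega>) m x k c)\<^sup>2) \<partial>M) \<le> ennreal C"
proof -
  let ?R1 = "\<lambda>c i \<omega>. sol_sq (\<lambda>n. V n \<omega>) c m (\<lambda>_. 0) (\<lambda>j. dup (\<lambda>i. if i = x then 1 / 2 else 0) j) i"
  let ?R2 = "\<lambda>c i \<omega>. sol_sq (\<lambda>n. V n \<omega>) c m (\<lambda>i. if i = x then 1 else 0) (\<lambda>_. 0) i"
  obtain K1 where K1: "K1 \<ge> 0" "\<And>c i. \<bar>c\<bar> \<le> r \<Longrightarrow> integrable M (\<lambda>\<omega>. (?R1 c i \<omega>)\<^sup>2)"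
    "\<And>c i. \<bar>c\<bar> \<le> r \<Longrightarrow> (\<integral>\<omega>. (?R1 c i \<omega>)\<^sup>2 \<partial>M) \<le> K1" by (rule sol_sq_moment[OF r]) blast
  obtain K2 where K2: "K2 \<ge> 0" "\<And>c i. \<bar>c\<bar> \<le> r \<Longrightarrow> integrable M (\<lambda>\<omega>. (?R2 c i \<omega>)\<^sup>2)"
    "\<And>c i. \<bar>c\<bar> \<le> r \<Longrightarrow> (\<integral>\<omega>. (?R2 c i \<omega>)\<^sup>2 \<partial>M) \<le> K2" by (rule sol_sq_moment[OF r]) blast
  have "(\<integral>\<^sup>+\<omega>. ennreal ((control (\<lambda>n. V n \<omega>) m x k c)\<^sup>2) \<partial>M) \<le> ennreal (2048 * (K1 + K2))"
    if k: "k > 0" and c: "\<bar>c\<bar> \<le> r" for k c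
  proof -
    let ?G = "\<lambda>\<omega>. 512 / (real k)\<^sup>2 * real (Suc k) * ((\<Sum>i\<le>k. (?R1 c i \<omega>)\<^sup>2) + (\<Sum>i\<le>k. (?R2 c i \<omega>)\<^sup>2))"
    have i1: "integrable M (\<lambda>\<omega>. \<Sum>i\<le>k. (?R1 c i \<omega>)\<^sup>2)" and i2: "integrable M (\<lambda>\<omega>. \<Sum>i\<le>k. (?R2 c i \<omega>)\<^sup>2)"
      by (intro Bochner_Integration.integrable_sum K1(2) K2(2) c)+
    have e1: "(\<integral>\<omega>. (\<Sum>i\<le>k. (?R1 c i \<omega>)\<^sup>2) \<partial>M) \<le> real (Suc k) * K1"
    proof -
      have "(\<integral>\<omega>. (\<Sum>i\<le>k. (?R1 c i \<omega>)\<^sup>2) \<partial>M) = (\<Sum>i\<le>k. \<integral>\<omega>. (?R1 c i \<omega>)\<^sup>2 \<partial>M)"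
        by (intro Bochner_Integration.integral_sum K1(2) c)
      also have "\<dots> \<le> (\<Sum>i\<le>k. K1)" by (intro sum_mono K1(3) c)
      finally show ?thesis by simp
    qed
    have e2: "(\<integral>\<omega>. (\<Sum>i\<le>k. (?R2 c i \<omega>)\<^sup>2) \<partial>M) \<le> real (Suc k) * K2"
    proof -
      have "(\<integral>\<omega>. (\<Sum>i\<le>k. (?R2 c i \<omega>)\<^sup>2) \<partial>M) = (\<Sum>i\<le>k. \<integral>\<omega>. (?R2 c i \<omega>)\<^sup>2 \<partial>M)"
        by (intro Bochner_Integration.integral_sum K2(2) c)
      also have "\<dots> \<le> (\<Sum>i\<le>k. K2)" by (intro sum_mono K2(3) c)
      finally show ?thesis by simp
    qed
    have "(\<integral>\<^sup>+\<omega>. ennreal ((control (\<lambda>n. V n \<omega>) m x k c)\<^sup>2) \<partial>M) \<le> (\<integral>\<^sup>+\<omega>. ennreal (?G \<omega>) \<partial>M)"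
      by (intro nn_integral_mono ennreal_leI control_sq_le k)
    also have "\<dots> = ennreal (\<integral>\<omega>. ?G \<omega> \<partial>M)"
    proof (rule nn_integral_eq_integral)
      show "integrable M ?G" by (intro integrable_mult_right Bochner_Integration.integrable_add i1 i2)
      show "AE \<omega> in M. 0 \<le> ?G \<omega>" by (intro AE_I2 mult_nonneg_nonneg add_nonneg_nonneg sum_nonneg) auto
    qed
    also have "(\<integral>\<omega>. ?G \<omega> \<partial>M) = 512 / (real k)\<^sup>2 * real (Suc k) * ((\<integral>\<omega>. (\<Sum>i\<le>k. (?R1 c i \<omega>)\<^sup>2) \<partial>M) + (\<integral>\<omega>. (\<Sum>i\<le>k. (?R2 c i \<omega>)\<^sup>2) \<partial>M))"
      by (simp only: integral_mult_right_zero Bochner_Integration.integral_add i1 i2)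
    also have "\<dots> \<le> 512 / (real k)\<^sup>2 * real (Suc k) * (real (Suc k) * K1 + real (Suc k) * K2)"
      by (intro mult_left_mono add_mono e1 e2) auto
    also have "\<dots> = 512 * ((real (Suc k))\<^sup>2 / (real k)\<^sup>2) * (K1 + K2)" by (simp add: power2_eq_square algebra_simps)
    \<comment> \<open>k + 1 \<le> 2 k, which is where 2048 = 512 * 4 comes from.\<close>
    also have "\<dots> \<le> 512 * 4 * (K1 + K2)"
    proof (intro mult_right_mono mult_left_mono)
      have "real (Suc k) \<le> 2 * real k" using k by simp
      then have "(real (Suc k))\<^sup>2 \<le> (2 * real k)\<^sup>2" by (intro power_mono) auto
      then show "(real (Suc k))\<^sup>2 / (real k)\<^sup>2 \<le> 4" using k by (simp add: power_mult_distrib divide_simps)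
    qed (use K1(1) K2(1) in auto)
    finally show ?thesis by (simp add: ennreal_leI)
  qed
  then show thesis by (rule that)
qed

text \<open>The expected square integrals over \<open>c\<close> are bounded uniformly in k, so by
  Fatou their lower limit has finite expectation. This is why \<open>poisson_control\<close> is
  stated with a lower limit.\<close>

lemma AE_liminf_control:
  assumes r: "r < 2 * sqrt 2"
  shows "AE \<omega> in M. liminf (\<lambda>k. \<integral>\<^sup>+c\<in>{- r..r}. ennreal ((control (\<lambda>n. V n \<omega>) m x k c)\<^sup>2) \<partial>lborel) < \<infinity>"
proof -
  interpret pair_sigma_finite M lborel ..
  let ?f = "\<lambda>k \<omega> c. ennreal ((control (\<lambda>n. V n \<omega>) m x k c)\<^sup>2) * indicator {- r..r} c"
  have joint: "(\<lambda>(\<omega>, c). ?f k \<omega> c) \<in> borel_measurable (M \<Otimes>\<^sub>M lborel)" for k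
  proof -
    have "(\<lambda>z. control (\<lambda>n. V n (fst z)) m x k (snd z)) \<in> borel_measurable (M \<Otimes>\<^sub>M lborel)"
      by (intro control_measurable measurable_compose[OF measurable_fst V_measurable]) measurable
    then show ?thesis unfolding split_def by measurable
  qed
  obtain C where C: "\<And>c k. k > 0 \<Longrightarrow> \<bar>c\<bar> \<le> r \<Longrightarrow> (\<integral>\<^sup>+\<omega>. ennreal ((control (\<lambda>n. V n \<omega>) m x k c)\<^sup>2) \<partial>M) \<le> ennreal C"
    using control_moment[OF r] by metis
  let ?F = "\<lambda>k \<omega>. \<integral>\<^sup>+c. ?f k \<omega> c \<partial>lborel"
  have Fm: "?F k \<in> borel_measurable M" for k
    using lborel.borel_measurable_nn_integral[OF joint[of k]] .
  have Fb: "(\<integral>\<^sup>+\<omega>. ?F k \<omega> \<partial>M) \<le> ennreal C * emeasure lborel {- r..r}" if "k > 0" for k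
  proof -
    have "(\<integral>\<^sup>+\<omega>. ?F k \<omega> \<partial>M) = (\<integral>\<^sup>+c. (\<integral>\<^sup>+\<omega>. ?f k \<omega> c \<partial>M) \<partial>lborel)"
      using Fubini'[OF joint[of k]] by simp
    also have "\<dots> \<le> (\<integral>\<^sup>+c. ennreal C * indicator {- r..r} c \<partial>lborel)"
    proof (rule nn_integral_mono)
      fix c
      show "(\<integral>\<^sup>+\<omega>. ?f k \<omega> c \<partial>M) \<le> ennreal C * indicator {- r..r} c"
        using C[OF that, of c] by (cases "c \<in> {- r..r}") (auto simp: abs_le_iff)
    qed
    also have "\<dots> = ennreal C * emeasure lborel {- r..r}" by (simp add: nn_integral_cmult)
    finally show ?thesis .
  qed
  have "(\<integral>\<^sup>+\<omega>. liminf (\<lambda>k. ?F k \<omega>) \<partial>M) \<le> liminf (\<lambda>k. \<integral>\<^sup>+\<omega>. ?F k \<omega> \<partial>M)"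
    by (rule nn_integral_liminf[OF Fm])
  also have "\<dots> \<le> ennreal C * emeasure lborel {- r..r}"
  proof (rule frequently_liminf_le)
    have "\<forall>\<^sub>F k in sequentially. (\<integral>\<^sup>+\<omega>. ?F k \<omega> \<partial>M) \<le> ennreal C * emeasure lborel {- r..r}"
      using eventually_gt_at_top[of 0] by eventually_elim (rule Fb)
    then show "\<exists>\<^sub>F k in sequentially. (\<integral>\<^sup>+\<omega>. ?F k \<omega> \<partial>M) \<le> ennreal C * emeasure lborel {- r..r}"
      by (rule eventually_frequently[OF sequentially_bot])
  qed
  also have "\<dots> < \<infinity>"
    using emeasure_bounded_finite[of "{- r..r}"] by (simp add: ennreal_mult_less_top)
  finally have "(\<integral>\<^sup>+\<omega>. liminf (\<lambda>k. ?F k \<omega>) \<partial>M) \<noteq> \<infinity>" by (rule less_imp_neq)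
  moreover have "(\<lambda>\<omega>. liminf (\<lambda>k. ?F k \<omega>)) \<in> borel_measurable M"
    by (intro borel_measurable_liminf Fm)
  ultimately have "AE \<omega> in M. liminf (\<lambda>k. ?F k \<omega>) \<noteq> \<infinity>" by (intro nn_integral_PInf_AE)
  then show ?thesis by eventually_elim (simp add: less_top)
qed

text \<open>The second moments of the norms are summable, so almost surely their squares are
  summable and in particular bounded.\<close>

lemma AE_bounded: "AE \<omega> in M. \<exists>K. \<forall>n. norm_V n \<omega> \<le> K"
proof -
  let ?f = "\<lambda>i \<omega>. ennreal ((norm_V (Suc i) \<omega>)\<^sup>2)"
  have "(\<integral>\<^sup>+\<omega>. (\<Sum>i. ?f i \<omega>) \<partial>M) = (\<Sum>i. \<integral>\<^sup>+\<omega>. ?f i \<omega> \<partial>M)"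
    by (rule nn_integral_suminf) measurable
  also have "\<dots> \<le> (\<Sum>i. ennreal (deviation (Suc i)))"
  proof (intro suminf_le summableI)
    fix i
    have "(\<integral>\<^sup>+\<omega>. ?f i \<omega> \<partial>M) = ennreal (\<integral>\<omega>. (norm_V (Suc i) \<omega>)\<^sup>2 \<partial>M)"
      using integrable_norm_V(1)[of "Suc i"] by (intro nn_integral_eq_integral) auto
    also have "\<dots> \<le> ennreal (deviation (Suc i))"
    proof (rule ennreal_leI)
      have "(\<integral>\<omega>. (norm_V (Suc i) \<omega>)\<^sup>2 \<partial>M) \<le> (\<integral>\<omega>. (norm_V (Suc i) \<omega>)\<^sup>2 + norm_V (Suc i) \<omega> ^ 4 \<partial>M)"
        using integrable_norm_V[of "Suc i"] by (intro integral_mono) auto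
      then show "(\<integral>\<omega>. (norm_V (Suc i) \<omega>)\<^sup>2 \<partial>M) \<le> deviation (Suc i)"
        using mat_op_norm_nonneg[of "2 ^ Suc i" "expV (Suc i)"] unfolding deviation_def by linarith
    qed
    finally show "(\<integral>\<^sup>+\<omega>. ?f i \<omega> \<partial>M) \<le> ennreal (deviation (Suc i))" .
  qed
  also have "\<dots> < \<infinity>" using suminf_ennreal2[OF deviation_nonneg summable_deviation] by simp
  finally have "(\<integral>\<^sup>+\<omega>. (\<Sum>i. ?f i \<omega>) \<partial>M) \<noteq> \<infinity>" by simp
  then have "AE \<omega> in M. (\<Sum>i. ?f i \<omega>) \<noteq> \<infinity>"
    by (intro nn_integral_PInf_AE) measurable
  then show ?thesis
  proof eventually_elim
    case (elim \<omega>)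
    define s where "s = enn2real (\<Sum>i. ?f i \<omega>)"
    have s: "(\<Sum>i. ?f i \<omega>) = ennreal s" using elim by (simp add: s_def less_top)
    have "norm_V (Suc i) \<omega> \<le> sqrt s" for i
    proof (rule real_le_rsqrt)
      have e: "sum g {i} = g i" for g :: "nat \<Rightarrow> ennreal" by simp
      have "sum (\<lambda>i. ?f i \<omega>) {i} \<le> (\<Sum>i. ?f i \<omega>)"
        by (rule sum_le_suminf[OF summableI]) simp_all
      then have "ennreal ((norm_V (Suc i) \<omega>)\<^sup>2) \<le> ennreal s" unfolding s e .
      moreover have "0 \<le> s" by (simp add: s_def)
      ultimately show "(norm_V (Suc i) \<omega>)\<^sup>2 \<le> s" by (simp only: ennreal_le_iff)
    qed
    \<comment> \<open>Layer 0 has no moment bound and enters with its own finite norm.\<close>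
    then have "norm_V n \<omega> \<le> max (norm_V 0 \<omega>) (sqrt s)" for n by (cases n) (auto simp: le_max_iff_disj)
    then show ?case by blast
  qed
qed

end

theorem theorem6:
  fixes M :: "'o measure" and V :: "nat \<Rightarrow> 'o \<Rightarrow> nat \<Rightarrow> nat \<Rightarrow> complex"
  assumes "prob_space M"
    and "prob_space.indep_vars M
           (\<lambda>n. PiM ({1..2 ^ n} \<times> {1..2 ^ n}) (\<lambda>_. borel :: complex measure))
           (\<lambda>n \<omega>. \<lambda>(j, k)\<in>{1..2 ^ n} \<times> {1..2 ^ n}. V n \<omega> j k) UNIV"
    and "\<And>n \<omega>. \<omega> \<in> space M \<Longrightarrow> hermitian_mat (2 ^ n) (V n \<omega>)"
    and "(\<Sum>i. let n = Suc i in
            ennreal (mat_op_norm (2 ^ n) (\<lambda>j k. \<integral>\<omega>. V n \<omega> j k \<partial>M)) +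
            (\<integral>\<^sup>+\<omega>. ennreal (mat_op_norm (2 ^ n) (V n \<omega>) ^ 2 + mat_op_norm (2 ^ n) (V n \<omega>) ^ 4) \<partial>M))
         < \<infinity>"
  shows "AE \<omega> in M.
           complex_of_real ` {-2 * sqrt 2<..<2 * sqrt 2} \<subseteq> spec_ac G2 (H2 (\<lambda>n. V n \<omega>)) \<and>
           spec_pp G2 (H2 (\<lambda>n. V n \<omega>)) \<inter> complex_of_real ` {-2 * sqrt 2<..<2 * sqrt 2} = {} \<and>
           spec_sc G2 (H2 (\<lambda>n. V n \<omega>)) \<inter> complex_of_real ` {-2 * sqrt 2<..<2 * sqrt 2} = {}"
proof -
  interpret random_potential M V
    using assms by (intro random_potential.intro random_potential_axioms.intro)
  \<comment> \<open>The compact intervals from -r i to r i exhaust the open one. There are countably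
    many of them, so the exceptional null sets over i, m and x can be united.\<close>
  define r where "r i = 2 * sqrt 2 - 1 / real (Suc i)" for i
  have r: "r i < 2 * sqrt 2" for i by (simp add: r_def)
  have r_lim: "\<exists>i. t < r i" if t: "t < 2 * sqrt 2" for t
  proof -
    obtain i where "1 / real (Suc i) < 2 * sqrt 2 - t"
      using reals_Archimedean[of "2 * sqrt 2 - t"] t by (auto simp: inverse_eq_divide)
    then show ?thesis by (intro exI[of _ i]) (simp add: r_def)
  qed
  have "AE \<omega> in M. \<forall>i m x. liminf (\<lambda>k. \<integral>\<^sup>+c\<in>{- r i..r i}. ennreal ((control (\<lambda>n. V n \<omega>) m x k c)\<^sup>2) \<partial>lborel) < \<infinity>"
    unfolding AE_all_countable using AE_liminf_control[OF r] by blast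
  with AE_bounded AE_space show ?thesis
  proof eventually_elim
    case (elim \<omega>)
    then obtain K where K: "\<And>n. norm_V n \<omega> \<le> K" by blast
    let ?W = "\<lambda>n. V n \<omega>"
    interpret tree_potential ?W K
      by unfold_locales (use herm elim K in \<open>auto simp: norm_V_def\<close>)
    have "\<exists>g. op.poisson_control (r i) v g" if vG: "v \<in> G2" for i v
    proof -
      obtain m x where mx: "v = (m, x)" by (cases v)
      with vG have v: "v = (m, x)" "x \<in> {1..2 ^ m}" by (auto simp: G2_def)
      have "control ?W m x k \<in> borel_measurable borel" for k
        by (rule control_measurable[of "\<lambda>_. ?W" borel "\<lambda>c. c"]) auto
      then have "op.poisson_control (r i) (m, x) (control ?W m x)"
        using elim v by (intro poisson_control_control) auto
      then show ?thesis using v by blast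
    qed
    from op.spectral_types[of r "2 * sqrt 2", OF r r_lim this] show ?case by simp
  qed
qed

end
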